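(* Let $M$ be the rank one Heisenberg vertex operator algebra (a single free boson), with generating weight one state $a$, $(a,a)=1$. Let $v_1,\dots,v_n$ be Fock states of the form $a[-1]^{e_1}\cdots a[-p]^{e_p}.\mathbf 1$ (non-negative integer exponents), with corresponding labelled set $\Phi$. Then $$F_M(v_1,z_1;\dots;v_n,z_n;q)=\frac{1}{\eta(\tau)}\sum_{\varphi\in F(\Phi)}\Gamma(\varphi).$$
   Context: $M$ is the Fock space of the Heisenberg algebra $[a(m),a(n)]=m\delta_{m,-n}$ with $a(n)\mathbf 1=0$ for $n\ge0$; $Y(a,z)=\sum_na(n)z^{-n-1}$; conformal vector $\frac12a(-1)^2\mathbf 1$, central charge $c=1$. Square-bracket modes: $Y[v,z]=\sum_nv[n]z^{-n-1}=Y(q_z^{L(0)}v,q_z-1)$, $q_z=\exp(z)$. $n$-point function: $\tau$ in the upper half plane, $q=\exp(2\pi i\tau)$, $q_i=\exp(z_i)$, $z_{ij}=z_i-z_j$, and $F_M(u_1,z_1;\dots;u_n,z_n;q)=Tr_M\,Y(q_1^{L(0)}u_1,q_1)\cdots Y(q_n^{L(0)}u_n,q_n)q^{L(0)-c/24}$. The coefficient of each power of $q$ is a rational function of the $q_i$; equivalently the trace converges for $|q_1|>\dots>|q_n|>|q\,q_1|$ and is identified with its meromorphic continuation. Functions. $\eta(\tau)=q^{1/24}\prod_{n\ge1}(1-q^n)$. For even $k\ge2$, $E_k(\tau)=-\frac{B_k}{k!}+\frac{2}{(k-1)!}\sum_{n\ge1}\sigma_{k-1}(n)q^n$ ($B_k$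 Bernoulli numbers, $\sigma_{k-1}(n)=\sum_{d|n}d^{k-1}$); $E_k=0$ for odd $k$. $P_0(z,\tau)=-\log z+\sum_{k\ge2}\frac1kE_k(\tau)z^k$; $P_n(z,\tau)=\frac{(-1)^n}{(n-1)!}\frac{d^n}{dz^n}P_0(z,\tau)$ for $n\ge1$ (extended meromorphically to $\mathbb{C}$). For integers $r,s\ge1$: $C(r,s,\tau)=(-1)^{r+1}\frac{(r+s-1)!}{(r-1)!(s-1)!}E_{r+s}(\tau)$, $D(r,s,z,\tau)=(-1)^{r+1}\frac{(r+s-1)!}{(r-1)!(s-1)!}P_{r+s}(z,\tau)$. Labelled sets. $\Phi_i$ is a finite set with elements labelled by positive integers, with exactly as many elements of label $m$ as the exponent of $a[-m]$ in $v_i$; $\Phi=\Phi_1\cup\dots\cup\Phi_n$ (disjoint union). $F(\Phi)$ is the set of fixed-point-free involutions of the set $\Phi$, i.e. permutations $\varphi$ with $\varphi^2=1$ and no fixed points (for $\Phi=\emptyset$ it consists of the identity; distinct permutations are distinct regardless of labels). $\Gamma(\varphi)=\prod_\Xi\gamma(\Xi)$ over the two-element orbits $\Xi$ of $\varphi$ (empty product is $1$), where for an orbit with labels $r,s$ whose elements lie in $\Phi_i,\Phi_j$ respectively, $\gamma(\Xi)=D(r,s,z_{ij},\tau)$ if $i\ne j$ and $\gamma(\Xi)=C(r,s,\tau)$ if $i=j$. *)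

theory Defs
  imports
    "HOL-Complex_Analysis.Complex_Analysis"
    "HOL-Library.Poly_Mapping"
    "HOL-Library.Multiset"
    "HOL-Combinatorics.Permutations"
begin

section \<open>The Heisenberg Fock space\<close>

text \<open>
  The Fock space is the polynomial ring over the complex numbers in the variables
  \<open>a(-1), a(-2), ...\<close>. A monomial is a multiset of natural numbers, in which an element \<open>j\<close>
  stands for one factor \<open>a(-(j+1))\<close>; the index is shifted by one so that every multiset is a
  monomial. The ring structure of polynomial mappings then is that of the symmetric algebra,
  and \<open>1\<close> is the vacuum.
\<close>

type_synonym fock = "nat multiset \<Rightarrow>\<^sub>0 complex"

definition smul :: "complex \<Rightarrow> fock \<Rightarrow> fock" where
  "smul c v = Poly_Mapping.single 0 c * v"

definition heis :: "int \<Rightarrow> fock \<Rightarrow> fock" where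
  "heis m v =
     (if m < 0 then Poly_Mapping.single {#nat (- m - 1)#} 1 * v
      else if m = 0 then 0
      else (\<Sum>b\<in>Poly_Mapping.keys v.
              Poly_Mapping.single (b - {#nat (m - 1)#})
                (of_int m * of_nat (count b (nat (m - 1))) * Poly_Mapping.lookup v b)))"

definition gen_a :: fock where
  "gen_a = Poly_Mapping.single {#0#} 1"

text \<open>
  \<open>vop_list js N\<close> is the \<open>N\<close>-th mode of the field of the state \<open>a(-j\<^sub>1-1) ... a(-j\<^sub>r-1) 1\<close>, that is,
  of the (right nested) normally ordered product of the fields
  \<open>\<partial>\<^sup>j a(z) / j! = (\<Sum>n. ((-n-1) choose j) a(n) z\<^sup>-\<^sup>n\<^sup>-\<^sup>1\<^sup>-\<^sup>j)\<close>.
  Normal ordering puts \<open>a(n)\<close> with \<open>n < 0\<close> to the left and with \<open>n \<ge> 0\<close> to the right. On every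
  vector only finitely many of the summands are non-zero.
\<close>

primrec vop_list :: "nat list \<Rightarrow> int \<Rightarrow> fock \<Rightarrow> fock" where
  "vop_list [] N w = (if N = -1 then w else 0)"
| "vop_list (j # js) N w =
     Sum_any (\<lambda>n::int.
       smul (of_int (- n - 1) gchoose j)
         (if n < 0 then heis n (vop_list js (N - n - 1 - int j) w)
          else vop_list js (N - n - 1 - int j) (heis n w)))"

text \<open>
  The vertex operator \<open>Y(v,z) = (\<Sum>N. vop v N z\<^sup>-\<^sup>N\<^sup>-\<^sup>1)\<close>.
\<close>

definition vop :: "fock \<Rightarrow> int \<Rightarrow> fock \<Rightarrow> fock" where
  "vop v N w =
     (\<Sum>b\<in>Poly_Mapping.keys v.
        smul (Poly_Mapping.lookup v b) (vop_list (sorted_list_of_multiset b) N w))"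

definition conformal_vector :: fock where
  "conformal_vector = smul (1/2) (heis (-1) (heis (-1) 1))"

definition L0 :: "fock \<Rightarrow> fock" where
  "L0 = vop conformal_vector 1"

definition central_charge :: complex where
  "central_charge = 1"

text \<open>
  The conformal weight of a monomial. It is the eigenvalue of \<^const>\<open>L0\<close> on that monomial,
  see \<open>L0_single\<close> below; hence \<open>pow_L0 x\<close> is the operator \<open>x\<close> to the power \<open>L(0)\<close>.
\<close>

definition wt :: "nat multiset \<Rightarrow> nat" where
  "wt b = (\<Sum>j\<in>#b. Suc j)"

definition pow_L0 :: "complex \<Rightarrow> fock \<Rightarrow> fock" where
  "pow_L0 x v =
     (\<Sum>b\<in>Poly_Mapping.keys v. Poly_Mapping.single b (x ^ wt b * Poly_Mapping.lookup v b))"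

subsection \<open>Consistency of the definitions\<close>

lemma heis_single_pos:
  assumes "m > 0"
  shows "heis m (Poly_Mapping.single b c) =
    Poly_Mapping.single (b - {#nat (m - 1)#}) (of_int m * of_nat (count b (nat (m - 1))) * c)"
  using assms by (cases "c = 0") (auto simp: heis_def)

lemma heis_single_neg:
  assumes "m < 0"
  shows "heis m (Poly_Mapping.single b c) = Poly_Mapping.single (add_mset (nat (- m - 1)) b) c"
  using assms by (simp add: heis_def mult_single)

lemma heis_0_right [simp]: "heis m 0 = 0"
  by (simp add: heis_def)

lemma heis_0_left [simp]: "heis 0 v = 0"
  by (simp add: heis_def)

lemma smul_1 [simp]: "smul 1 v = v" and smul_0 [simp]: "smul c 0 = 0" "smul 0 v = 0"
  by (simp_all add: smul_def)

lemma smul_single: "smul x (Poly_Mapping.single b c) = Poly_Mapping.single b (x * c)"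
  by (simp add: smul_def mult_single)

lemma heis_add: "heis m (v + w) = heis m v + heis m w"
proof -
  have *: "(\<Sum>b\<in>Poly_Mapping.keys v. Poly_Mapping.single (b - {#k#}) (x b * Poly_Mapping.lookup v b))
     = Sum_any (\<lambda>b. Poly_Mapping.single (b - {#k#}) (x b * Poly_Mapping.lookup v b))"
    for v :: fock and k and x :: "nat multiset \<Rightarrow> complex"
    by (rule Sum_any.expand_superset [symmetric]) (auto simp: in_keys_iff)
  have fin: "finite {b. Poly_Mapping.single (b - {#k#}) (x b * Poly_Mapping.lookup v b) \<noteq> 0}"
    for v :: fock and k and x :: "nat multiset \<Rightarrow> complex"
    by (rule finite_subset [OF _ finite_keys [of v]]) (auto simp: in_keys_iff)
  let ?t = "\<lambda>v b. Poly_Mapping.single (b - {#nat (m - 1)#})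
      (of_int m * of_nat (count b (nat (m - 1))) * Poly_Mapping.lookup v b)"
  have "Sum_any (?t (v + w)) = Sum_any (\<lambda>b. ?t v b + ?t w b)"
    by (simp only: lookup_add ring_distribs single_add)
  also have "\<dots> = Sum_any (?t v) + Sum_any (?t w)"
    by (rule Sum_any.distrib [OF fin fin])
  finally show ?thesis
    unfolding heis_def * by (simp add: ring_distribs)
qed

lemma fock_induct [case_names zero add]:
  assumes "P 0" and "\<And>v b c. P v \<Longrightarrow> P (v + Poly_Mapping.single b c)"
  shows "P (v :: fock)"
proof (induction v rule: update_induct)
  case const show ?case by fact
next
  case (update f a b)
  have "Poly_Mapping.update a b f = f + Poly_Mapping.single a b"
    using update(1)
    by (intro poly_mapping_eqI) (auto simp: lookup_update lookup_add lookup_single in_keys_iff when_def)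
  with update assms(2) show ?case by simp
qed

lemma heis_commute_single:
  "heis m (heis n (Poly_Mapping.single b c)) =
     heis n (heis m (Poly_Mapping.single b c)) +
     (if m = - n then smul (of_int m) (Poly_Mapping.single b c) else 0)"
proof -
  have mixed: "heis n (heis m (Poly_Mapping.single b c)) = heis m (heis n (Poly_Mapping.single b c)) +
     (if m = - n then Poly_Mapping.single b (of_int n * c) else 0)" if "m < 0" "0 < n" for m n
  proof (cases "m = - n")
    case True
    have *: "of_int n * of_nat (Suc k) * c = of_int n * of_nat k * c + of_int n * c" for k
      by (simp add: algebra_simps)
    from True that show ?thesis
      by (cases "nat (n - 1) \<in># b")
        (simp_all add: heis_single_neg heis_single_pos not_in_iff * single_add del: of_nat_Suc)
  next
    case False
    with that have ne: "nat (n - 1) \<noteq> nat (- m - 1)" by auto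
    have "add_mset (nat (- m - 1)) b - {#nat (n - 1)#} = add_mset (nat (- m - 1)) (b - {#nat (n - 1)#})"
      using ne by (metis diff_union_swap)
    with ne False that show ?thesis
      by (simp add: heis_single_neg heis_single_pos)
  qed
  consider "m < 0" "n < 0" | "m < 0" "n > 0" | "m > 0" "n < 0" | "m > 0" "n > 0" | "m = 0 \<or> n = 0"
    by linarith
  then show ?thesis
  proof cases
    case 1 then show ?thesis by (simp add: heis_single_neg add_mset_commute)
  next
    case 2 then show ?thesis using mixed [of m n]
      by (auto simp: smul_single single_uminus)
  next
    case 3 then show ?thesis using mixed [of n m] by (auto simp: smul_single)
  next
    case 4 then show ?thesis
      by (cases "m = n") (auto simp: heis_single_pos add_mset_commute mult_ac)
  next
    case 5 then show ?thesis by auto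
  qed
qed

lemma heis_commute:
  "heis m (heis n v) - heis n (heis m v) = (if m = - n then smul (of_int m) v else 0)"
proof -
  have "heis m (heis n v) = heis n (heis m v) + (if m = - n then smul (of_int m) v else 0)"
  proof (induction v rule: fock_induct)
    case zero show ?case by simp
  next
    case (add v b c) then show ?case
      by (auto simp: heis_add heis_commute_single [of m n] smul_def ring_distribs)
  qed
  then show ?thesis by simp
qed

lemma vop_list_0: "vop_list [0] N w = heis N w"
proof -
  have "vop_list [0] N w = Sum_any (\<lambda>n. if n = N then heis n w else 0)"
    unfolding vop_list.simps
    by (rule Sum_any.cong) auto
  then show ?thesis by simp
qed

lemma vop_gen_a: "vop gen_a n = heis n"
  by (rule ext) (simp add: vop_def gen_a_def vop_list_0 del: vop_list.simps)

lemma L0_single: "L0 (Poly_Mapping.single b c) = smul (of_nat (wt b)) (Poly_Mapping.single b c)"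
proof -
  define f where "f n = of_int \<bar>n\<bar> * of_nat (count b (nat (\<bar>n\<bar> - 1))) * c" for n :: int
  have cv: "conformal_vector = Poly_Mapping.single {#0, 0#} (1/2)"
  proof -
    have "heis (-1) (1::fock) = Poly_Mapping.single {#0#} 1"
      by (simp add: heis_def)
    then show ?thesis
      by (simp add: conformal_vector_def heis_single_neg smul_single)
  qed
  have "vop_list [0, 0] 1 (Poly_Mapping.single b c) = Sum_any (\<lambda>n. Poly_Mapping.single b (f n))"
    unfolding vop_list.simps(2) [of 0 "[0]"] vop_list_0
  proof (rule Sum_any.cong)
    fix n :: int
    consider "n < 0" | "n = 0" | "n > 0" by linarith
    then show "smul (of_int (- n - 1) gchoose 0)
         (if n < 0 then heis n (heis (1 - n - 1 - int 0) (Poly_Mapping.single b c))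
          else heis (1 - n - 1 - int 0) (heis n (Poly_Mapping.single b c))) =
      Poly_Mapping.single b (f n)"
    proof cases
      case 1 then show ?thesis
        by (cases "nat (- n - 1) \<in># b")
          (auto simp: f_def heis_single_pos heis_single_neg not_in_iff)
    next
      case 2 then show ?thesis by (simp add: f_def)
    next
      case 3 then show ?thesis
        by (cases "nat (n - 1) \<in># b")
          (auto simp: f_def heis_single_pos heis_single_neg not_in_iff)
    qed
  qed
  also have "\<dots> = (\<Sum>n\<in>(\<lambda>j. int j + 1) ` set_mset b \<union> (\<lambda>j. - int j - 1) ` set_mset b.
                   Poly_Mapping.single b (f n))"
  proof (rule Sum_any.expand_superset)
    show "{n. Poly_Mapping.single b (f n) \<noteq> 0} \<subseteq>
      (\<lambda>j. int j + 1) ` set_mset b \<union> (\<lambda>j. - int j - 1) ` set_mset b"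
    proof
      fix n assume "n \<in> {n. Poly_Mapping.single b (f n) \<noteq> 0}"
      then have n: "f n \<noteq> 0" by auto
      then have "nat (\<bar>n\<bar> - 1) \<in># b" "n \<noteq> 0" 
        unfolding f_def by (auto simp: not_in_iff)
      moreover have "n = int (nat (\<bar>n\<bar> - 1)) + 1 \<or> n = - int (nat (\<bar>n\<bar> - 1)) - 1"
        using \<open>n \<noteq> 0\<close> by linarith
      ultimately show "n \<in> (\<lambda>j. int j + 1) ` set_mset b \<union> (\<lambda>j. - int j - 1) ` set_mset b"
        by blast
    qed
  qed auto
  also have "\<dots> = (\<Sum>j\<in>set_mset b. Poly_Mapping.single b (f (int j + 1))) +
                   (\<Sum>j\<in>set_mset b. Poly_Mapping.single b (f (- int j - 1)))"
    by (subst sum.union_disjoint) (auto simp: sum.reindex inj_on_def)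
  also have "\<dots> = Poly_Mapping.single b (2 * of_nat (wt b) * c)"
  proof -
    have sum_mset_sum_count: "(\<Sum>j\<in>#b. g j) = (\<Sum>j\<in>set_mset b. count b j * g j)" for g :: "nat \<Rightarrow> nat"
    proof -
      have "(\<Sum>j\<in>#b. g j) = (\<Sum>j\<in>A. count b j * g j)" if "finite A" "set_mset b \<subseteq> A" for A
        using that(2)
      proof (induction b)
        case (add x b)
        have "(\<Sum>j\<in>A. count (add_mset x b) j * g j) = (\<Sum>j\<in>A. count b j * g j + (if j = x then g j else 0))"
          by (intro sum.cong) auto
        with add that(1) show ?case by (simp add: sum.distrib)
      qed simp
      then show ?thesis by simp
    qed
    have ss: "(\<Sum>j\<in>A. Poly_Mapping.single b (g j)) = Poly_Mapping.single b (\<Sum>j\<in>A. g j)"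
      if "finite A" for A :: "nat set" and g :: "nat \<Rightarrow> complex"
      using that by (induction A rule: finite_induct) (auto simp: single_add)
    have "(\<Sum>j\<in>set_mset b. of_nat (Suc j) * of_nat (count b j) * c) = of_nat (wt b) * c"
      by (simp add: wt_def sum_mset_sum_count sum_distrib_left algebra_simps)
    moreover have "f (int j + 1) = of_nat (Suc j) * of_nat (count b j) * c"
      "f (- int j - 1) = of_nat (Suc j) * of_nat (count b j) * c" for j
      by (simp_all add: f_def add_ac)
    ultimately show ?thesis
      by (simp add: ss mult_ac flip: single_add)
  qed
  finally show ?thesis
    by (simp add: L0_def vop_def cv smul_single del: vop_list.simps)
qed



section \<open>Square bracket modes\<close>

text \<open>
  For \<open>v\<close> of weight \<open>k\<close> one has \<open>Y[v,z] = (\<Sum>m. v(m) e\<^sup>k\<^sup>z (e\<^sup>z-1)\<^sup>-\<^sup>m\<^sup>-\<^sup>1)\<close>, and \<open>sq_coeff k m n\<close> is the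
  coefficient of \<open>z\<^sup>-\<^sup>n\<^sup>-\<^sup>1\<close> in the factor of \<open>v(m)\<close>. It vanishes for \<open>m < n\<close>.
\<close>

definition sq_coeff :: "nat \<Rightarrow> int \<Rightarrow> int \<Rightarrow> complex" where
  "sq_coeff k m n =
     fls_nth (fps_to_fls (fps_exp (of_nat k)) * fps_to_fls (fps_exp 1 - 1) powi (- m - 1)) (- n - 1)"

definition sqmode :: "fock \<Rightarrow> int \<Rightarrow> fock \<Rightarrow> fock" where
  "sqmode v n w =
     (\<Sum>b\<in>Poly_Mapping.keys v.
        Sum_any (\<lambda>m::int.
          smul (sq_coeff (wt b) m n) (vop (Poly_Mapping.single b (Poly_Mapping.lookup v b)) m w)))"

text \<open>
  \<open>fock_state p e\<close> is \<open>a[-1]\<^sup>e\<^sup>1 ... a[-p]\<^sup>e\<^sup>p 1\<close>, where the exponent of \<open>a[-m]\<close> is \<open>e m\<close>.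
\<close>

definition fock_state :: "nat \<Rightarrow> (nat \<Rightarrow> nat) \<Rightarrow> fock" where
  "fock_state p e = foldr (\<lambda>m. sqmode gen_a (- int m) ^^ e m) [1..<Suc p] 1"


section \<open>n-point functions on the torus\<close>

definition nome :: "complex \<Rightarrow> complex" where
  "nome \<tau> = exp (2 * of_real pi * \<i> * \<tau>)"

text \<open>
  The contribution of the modes \<open>ms\<close> (one for each of the \<open>n\<close> vertex operators) and of the
  basis vector \<open>b\<close> to the trace of
  \<open>Y(q\<^sub>1\<^sup>L\<^sup>(\<^sup>0\<^sup>) u\<^sub>1, q\<^sub>1) ... Y(q\<^sub>n\<^sup>L\<^sup>(\<^sup>0\<^sup>) u\<^sub>n, q\<^sub>n) q\<^sup>L\<^sup>(\<^sup>0\<^sup>)\<^sup>-\<^sup>c\<^sup>/\<^sup>2\<^sup>4\<close> with \<open>q\<^sub>i = exp z\<^sub>i\<close>.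
  The insertions are numbered from \<open>1\<close> to \<open>n\<close>.
\<close>

definition trace_term ::
  "nat \<Rightarrow> (nat \<Rightarrow> fock) \<Rightarrow> complex \<Rightarrow> (nat \<Rightarrow> complex) \<Rightarrow> (nat \<Rightarrow> int) \<Rightarrow> nat multiset \<Rightarrow> complex" where
  "trace_term n u \<tau> z ms b =
     Poly_Mapping.lookup
       (foldr (\<lambda>i. vop (pow_L0 (exp (z i)) (u i)) (ms i)) [1..<Suc n] (Poly_Mapping.single b 1)) b
     * (\<Prod>i=1..n. exp (z i) powi (- ms i - 1))
     * exp (2 * of_real pi * \<i> * \<tau> * (of_nat (wt b) - central_charge / 24))"

definition trace_domain :: "nat \<Rightarrow> complex \<Rightarrow> (nat \<Rightarrow> complex) set" where
  "trace_domain n \<tau> =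
     {z. (\<forall>i. 1 \<le> i \<and> i < n \<longrightarrow> norm (exp (z (Suc i))) < norm (exp (z i))) \<and>
         norm (nome \<tau> * exp (z 1)) < norm (exp (z n))}"

text \<open>
  The points of complex \<open>n\<close>-space that have pairwise distinct images in the torus. This is a
  connected open set that contains \<^const>\<open>trace_domain\<close>, and its complement contains all poles.
\<close>

definition config :: "nat \<Rightarrow> complex \<Rightarrow> (nat \<Rightarrow> complex) set" where
  "config n \<tau> =
     {z. \<forall>i\<in>{1..n}. \<forall>j\<in>{1..n}. i \<noteq> j \<longrightarrow>
           \<not> (\<exists>k l::int. z i - z j = 2 * of_real pi * \<i> * (of_int k + of_int l * \<tau>))}"

text \<open>
  \<open>F\<close> is the trace, where that converges, together with its meromorphic continuation: it is
  holomorphic (continuous, and holomorphic in each variable) on \<^const>\<open>config\<close> and meromorphic in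
  each variable. Its values on \<^const>\<open>config\<close> are determined by those on \<^const>\<open>trace_domain\<close>.
\<close>

definition is_npoint_function ::
  "nat \<Rightarrow> (nat \<Rightarrow> fock) \<Rightarrow> complex \<Rightarrow> ((nat \<Rightarrow> complex) \<Rightarrow> complex) \<Rightarrow> bool" where
  "is_npoint_function n u \<tau> F \<longleftrightarrow>
     (\<forall>z\<in>trace_domain n \<tau>.
        ((\<lambda>(ms, b). trace_term n u \<tau> z ms b) has_sum F z)
          (({1..n} \<rightarrow>\<^sub>E (UNIV :: int set)) \<times> UNIV)) \<and>
     continuous_on (config n \<tau>) F \<and>
     (\<forall>z\<in>config n \<tau>. \<forall>i\<in>{1..n}.
        (\<lambda>w. F (z(i := w))) holomorphic_on {w. z(i := w) \<in> config n \<tau>} \<and>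
        (\<lambda>w. F (z(i := w))) meromorphic_on UNIV)"

definition npoint_function ::
  "nat \<Rightarrow> (nat \<Rightarrow> fock) \<Rightarrow> (nat \<Rightarrow> complex) \<Rightarrow> complex \<Rightarrow> complex" where
  "npoint_function n u z \<tau> = (SOME F. is_npoint_function n u \<tau> F) z"


section \<open>Modular and elliptic functions\<close>

definition dedekind_eta :: "complex \<Rightarrow> complex" where
  "dedekind_eta \<tau> = exp (2 * of_real pi * \<i> * \<tau> / 24) * prodinf (\<lambda>n. 1 - nome \<tau> ^ Suc n)"

definition bernoulli_number :: "nat \<Rightarrow> complex" where
  "bernoulli_number k = fact k * fps_nth (fps_X / (fps_exp 1 - 1)) k"

definition sigma_div :: "nat \<Rightarrow> nat \<Rightarrow> nat" where
  "sigma_div k n = (\<Sum>d | d dvd n. d ^ k)"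

definition eisen :: "nat \<Rightarrow> complex \<Rightarrow> complex" where
  "eisen k \<tau> =
     (if even k then
        - bernoulli_number k / fact k
        + 2 / fact (k - 1) * suminf (\<lambda>n. of_nat (sigma_div (k - 1) (Suc n)) * nome \<tau> ^ Suc n)
      else 0)"

definition ell_P0 :: "complex \<Rightarrow> complex \<Rightarrow> complex" where
  "ell_P0 z \<tau> = - Ln z + suminf (\<lambda>k. 1 / of_nat (k + 2) * eisen (k + 2) \<tau> * z ^ (k + 2))"

text \<open>
  \<open>ell_P n z \<tau>\<close> is meaningful for \<open>n \<ge> 1\<close>. The series for \<^const>\<open>ell_P0\<close> converges near \<open>0\<close>, and its
  derivatives are taken off the branch cut of the logarithm; the function meant is the unique
  meromorphic function on the complex plane (with value \<open>0\<close> at its poles) that extends them.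
\<close>

definition ell_P :: "nat \<Rightarrow> complex \<Rightarrow> complex \<Rightarrow> complex" where
  "ell_P n z \<tau> =
     (THE f. f nicely_meromorphic_on UNIV \<and>
        (\<forall>\<^sub>F w in at 0. w \<notin> \<real>\<^sub>\<le>\<^sub>0 \<longrightarrow>
           f w = (-1) ^ n / fact (n - 1) * (deriv ^^ n) (\<lambda>x. ell_P0 x \<tau>) w)) z"

definition CC :: "nat \<Rightarrow> nat \<Rightarrow> complex \<Rightarrow> complex" where
  "CC r s \<tau> =
     (-1) ^ (r + 1) * (fact (r + s - 1) / (fact (r - 1) * fact (s - 1))) * eisen (r + s) \<tau>"

definition DD :: "nat \<Rightarrow> nat \<Rightarrow> complex \<Rightarrow> complex \<Rightarrow> complex" where
  "DD r s z \<tau> =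
     (-1) ^ (r + 1) * (fact (r + s - 1) / (fact (r - 1) * fact (s - 1))) * ell_P (r + s) z \<tau>"


section \<open>Labelled sets and pairings\<close>

text \<open>
  An element \<open>(i, m, k)\<close> of the labelled set belongs to the \<open>i\<close>-th part and has label \<open>m\<close>; the
  index \<open>k\<close> separates elements with the same part and label.
\<close>

type_synonym labelled = "nat \<times> nat \<times> nat"

definition part :: "labelled \<Rightarrow> nat" where
  "part x = fst x"

definition label :: "labelled \<Rightarrow> nat" where
  "label x = fst (snd x)"

definition labelled_set :: "nat \<Rightarrow> (nat \<Rightarrow> nat) \<Rightarrow> (nat \<Rightarrow> nat \<Rightarrow> nat) \<Rightarrow> labelled set" where
  "labelled_set n p e = {(i, m, k). i \<in> {1..n} \<and> m \<in> {1..p i} \<and> k < e i m}"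

definition fpf_involutions :: "'a set \<Rightarrow> ('a \<Rightarrow> 'a) set" where
  "fpf_involutions A = {\<phi>. \<phi> permutes A \<and> \<phi> \<circ> \<phi> = id \<and> (\<forall>x\<in>A. \<phi> x \<noteq> x)}"

definition gamma_pair :: "(nat \<Rightarrow> complex) \<Rightarrow> complex \<Rightarrow> labelled \<Rightarrow> labelled \<Rightarrow> complex" where
  "gamma_pair z \<tau> x y =
     (if part x = part y then CC (label x) (label y) \<tau>
      else DD (label x) (label y) (z (part x) - z (part y)) \<tau>)"

text \<open>
  \<^const>\<open>gamma_pair\<close> is symmetric in its last two arguments, because \<open>ell_P n\<close> has the parity of \<open>n\<close>
  for \<open>n \<ge> 2\<close> and \<open>eisen\<close> vanishes at odd indices. So the order chosen for an orbit is immaterial.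
\<close>

definition gamma_orbit :: "(nat \<Rightarrow> complex) \<Rightarrow> complex \<Rightarrow> labelled set \<Rightarrow> complex" where
  "gamma_orbit z \<tau> \<Xi> = (case (SOME (x, y). \<Xi> = {x, y}) of (x, y) \<Rightarrow> gamma_pair z \<tau> x y)"

definition Gamma_inv ::
  "labelled set \<Rightarrow> (nat \<Rightarrow> complex) \<Rightarrow> complex \<Rightarrow> (labelled \<Rightarrow> labelled) \<Rightarrow> complex" where
  "Gamma_inv A z \<tau> \<phi> = (\<Prod>\<Xi>\<in>(\<lambda>x. {x, \<phi> x}) ` A. gamma_orbit z \<tau> \<Xi>)"

end

theory Submission
  imports Defs
begin

text \<open>
  Commuting the first letter of a word in the modes \<open>a(n)\<close> to the right and using cyclicity of the trace
  shows that the trace of a word is \<open>1 / \<eta>\<close> times a sum over perfect matchings (a hafnian), a matched pair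
  \<open>a(n), a(-n)\<close> contributing \<open>n / (1 - q\<^sup>n)\<close>, or the normally ordered variant \<open>|n| q\<^sup>|\<^sup>n\<^sup>| / (1 - q\<^sup>|\<^sup>n\<^sup>|)\<close> inside
  one vertex operator. Summation over the modes gives Wick's theorem for arbitrary states.
  The mode \<open>a[-m]\<close> is multiplication by a combination of the \<open>a(-j)\<close>, \<open>j \<le> m\<close>, plus a derivation. The derivation
  adds a constant to the contraction of two factors of the same state, and this constant is the
  Bernoulli term of \<open>E\<^sub>r\<^sub>+\<^sub>s\<close>; the divisor sums come from the trace. For factors of different
  states, the contraction is a derivative of the Lambert series \<open>\<Sum>n. n y\<^sup>n / (1 - q\<^sup>n)\<close> (over all integers
  \<open>n \<noteq> 0\<close>), hence of \<open>\<Sum>l. q\<^sup>l y / (1 - q\<^sup>l y)\<^sup>2\<close>, which is the second derivative of \<open>P\<^sub>0\<close>.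
  The continuation is unique: by the identity theorem on the complement of a discrete set, the
  variables can be released one after the other from a polystrip inside the domain of convergence.
\<close>

subsection \<open>Hafnians\<close>

text \<open>The n-point function asks for unconditional summability over all modes and all basis
  vectors at once, whereas the recursion for traces yields iterated sums only. Positivity closes the
  gap: a word in the modes sends a basis vector to a nonnegative real multiple of a basis vector, so
  the same identity, read with \<open>norm q\<close> and the absolute values of the coefficients,
  sums the norms.

  Square brackets are governed by the substitution y = e^z - 1. Under it the coefficients of a[-m]
  turn the binomial (-n-1 choose j) of the round modes into the pure power (-n)^(m-1) / (m-1)!, so
  that passing to square bracket modes amounts to differentiating one scalar series. The same
  substitution makes the contraction inside one state a derivative of 1/z - 1/(e^z - 1), which is
  where the Bernoulli numbers enter; to such a pair the trace itself adds positive powers of q only.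

  Matchings are taken on lists and not on sets because operators do not commute: weights that agree
  only for letters in word order can be compared there before symmetry permits a reordering.\<close>

text \<open>
  The sum over the perfect matchings of the positions of the list. Removing the first entry equal
  to \<open>y\<close> rather than the entry at a given position is harmless: equal entries contribute equal terms.
\<close>

function hafnian :: "('a \<Rightarrow> 'a \<Rightarrow> 'c::comm_ring_1) \<Rightarrow> 'a list \<Rightarrow> 'c" where
  "hafnian S [] = 1"
| "hafnian S (x # xs) = (\<Sum>y\<leftarrow>xs. S x y * hafnian S (remove1 y xs))"
  by pat_completeness auto
termination
  by (relation "Wellfounded.measure (\<lambda>(S, xs). length xs)") (auto simp: length_remove1)

lemma sorted_wrt_remove1: "sorted_wrt P xs \<Longrightarrow> sorted_wrt P (remove1 x xs)"
  by (induction xs) (use set_remove1_subset in fastforce)+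

text \<open>The recursion evaluates the weight only at an earlier and a later entry, so agreement
  along the list order is enough. This compares weights for words of noncommuting operators, where
  the order of the letters matters.\<close>

lemma hafnian_cong_sorted:
  "sorted_wrt (\<lambda>x y. S x y = T x y) xs \<Longrightarrow> hafnian S xs = hafnian T xs"
proof (induction xs rule: length_induct)
  case (1 xs)
  show ?case
  proof (cases xs)
    case (Cons x ys)
    have "S x y * hafnian S (remove1 y ys) = T x y * hafnian T (remove1 y ys)" if "y \<in> set ys" for y
    proof -
      have "hafnian S (remove1 y ys) = hafnian T (remove1 y ys)"
        using 1 Cons that by (intro 1(1)[rule_format]) (auto simp: length_remove1 sorted_wrt_remove1)
      moreover have "S x y = T x y" using 1(2) Cons that by auto
      ultimately show ?thesis by simp
    qed
    then show ?thesis by (simp add: Cons cong: map_cong)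
  qed simp
qed

lemma hafnian_cong:
  assumes "\<And>x y. x \<in> set xs \<Longrightarrow> y \<in> set xs \<Longrightarrow> S x y = T x y"
  shows "hafnian S xs = hafnian T xs"
proof (rule hafnian_cong_sorted)
  show "sorted_wrt (\<lambda>x y. S x y = T x y) xs"
    using assms by (auto simp: sorted_wrt_iff_nth_less)
qed

text \<open>Each side is a full double sum minus its diagonal, and neither of these changes when the
  arguments are exchanged.\<close>

lemma sum_mset_remove_swap:
  fixes f :: "'a \<Rightarrow> 'a \<Rightarrow> 'c::comm_ring_1"
  shows "(\<Sum>y\<in>#M. \<Sum>z\<in>#M - {#y#}. f y z) = (\<Sum>y\<in>#M. \<Sum>z\<in>#M - {#y#}. f z y)"
proof -
  have *: "(\<Sum>y\<in>#M. \<Sum>z\<in>#M - {#y#}. g y z) = (\<Sum>y\<in>#M. \<Sum>z\<in>#M. g y z) - (\<Sum>y\<in>#M. g y y)"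
    for g :: "'a \<Rightarrow> 'a \<Rightarrow> 'c"
  proof -
    have "(\<Sum>z\<in>#M - {#y#}. g y z) + g y y = (\<Sum>z\<in>#M. g y z)" if "y \<in># M" for y
      using that by (metis add.commute image_mset_add_mset insert_DiffM sum_mset.add_mset)
    then have "(\<Sum>y\<in>#M. (\<Sum>z\<in>#M - {#y#}. g y z) + g y y) = (\<Sum>y\<in>#M. \<Sum>z\<in>#M. g y z)"
      by (intro arg_cong[where f=sum_mset] image_mset_cong)
    then show ?thesis by (simp add: sum_mset.distrib algebra_simps)
  qed
  show ?thesis unfolding * using sum_mset.swap[of f M M] by simp
qed

lemma hafnian_mset_Cons:
  "hafnian S (x # xs) = (\<Sum>y\<in>#mset xs. S x y * hafnian S (remove1 y xs))"
  by (simp flip: sum_mset_sum_list)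

text \<open>Induction on the length reduces the claim to exchanging the two leading entries;
  expanded along both of them, the hafnian is visibly symmetric.\<close>

lemma hafnian_perm:
  assumes sym: "\<And>x y. S x y = S y x"
  shows "mset xs = mset ys \<Longrightarrow> hafnian S xs = hafnian S ys"
proof (induction xs arbitrary: ys rule: length_induct)
  case (1 xs)
  have IH: "hafnian S us = hafnian S vs" if "length us < length xs" "mset us = mset vs" for us vs
    using 1 that by blast
  have tail: "hafnian S (x # us) = hafnian S (x # vs)"
    if "mset us = mset vs" "length us < length xs" for x us vs
  proof -
    have "S x y * hafnian S (remove1 y us) = S x y * hafnian S (remove1 y vs)" if "y \<in># mset us" for y
      using that \<open>mset us = mset vs\<close> \<open>length us < length xs\<close>
      by (intro arg_cong2[where f="(*)"] IH) (auto simp: length_remove1)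
    then have "(\<Sum>y\<in>#mset us. S x y * hafnian S (remove1 y us)) =
        (\<Sum>y\<in>#mset us. S x y * hafnian S (remove1 y vs))"
      by (intro arg_cong[where f=sum_mset] image_mset_cong)
    then show ?thesis unfolding hafnian_mset_Cons using that(1) by simp
  qed
  show ?case
  proof (cases xs)
    case Nil with 1 show ?thesis by simp
  next
    case (Cons x xs')
    with 1(2) obtain y ys' where ys: "ys = y # ys'" by (cases ys) auto
    show ?thesis
    proof (cases "x = y")
      case True
      with 1(2) Cons ys show ?thesis by (auto intro!: tail simp del: hafnian.simps)
    next
      case False
      obtain zs where zs: "mset xs' = add_mset y (mset zs)" "mset ys' = add_mset x (mset zs)"
      proof -
        have "add_mset x (mset xs') = add_mset y (mset ys')" using 1(2) Cons ys by simp
        with False obtain M where "mset xs' = add_mset y M" "mset ys' = add_mset x M"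
          by (auto simp: add_eq_conv_ex)
        then show ?thesis using that ex_mset by metis
      qed
      have len: "length xs' = Suc (length zs)" "length ys' = Suc (length zs)"
        using zs by (metis size_mset size_add_mset)+
      \<comment> \<open>The two leading entries are matched either with each other or with entries u
        and v at different positions of the rest.\<close>
      have two: "hafnian S (a # b # zs) = S a b * hafnian S zs +
          (\<Sum>u\<in>#mset zs. \<Sum>v\<in>#mset zs - {#u#}. S a u * S b v * hafnian S (remove1 v (remove1 u zs)))"
        if "length zs + 2 \<le> length xs" for a b
      proof -
        have "(\<Sum>u\<in>#mset zs. S a u * hafnian S (remove1 u (b # zs))) =
              (\<Sum>u\<in>#mset zs. S a u * hafnian S (b # remove1 u zs))"
        proof (rule arg_cong[where f=sum_mset], rule image_mset_cong)
          fix u assume u: "u \<in># mset zs"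
          have "hafnian S (remove1 u (b # zs)) = hafnian S (b # remove1 u zs)"
            using u that by (intro IH) (auto simp: length_remove1)
          then show "S a u * hafnian S (remove1 u (b # zs)) = S a u * hafnian S (b # remove1 u zs)"
            by simp
        qed
        then show ?thesis
          by (subst hafnian_mset_Cons) (simp add: hafnian_mset_Cons sum_mset_distrib_left mult.assoc del: hafnian.simps)
      qed
      have "hafnian S xs = hafnian S (x # y # zs)"
        unfolding Cons by (rule tail) (use zs Cons in auto)
      also have "\<dots> = hafnian S (y # x # zs)"
      proof -
        have "length zs + 2 \<le> length xs" using Cons len by simp
        have "S x u * S y v * hafnian S (remove1 v (remove1 u zs)) =
              S y v * S x u * hafnian S (remove1 u (remove1 v zs))" for u v
          by (simp add: mult_ac remove1_commute)
        then show ?thesis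
          unfolding two[OF \<open>length zs + 2 \<le> length xs\<close>] sym[of y x]
          by (subst sum_mset_remove_swap) simp
      qed
      also have "\<dots> = hafnian S ys"
        unfolding ys by (rule tail) (use zs Cons len in auto)
      finally show ?thesis .
    qed
  qed
qed

text \<open>\<open>remove1 (f y)\<close> may strike another entry with the same image. The remaining
  list is then the image of \<open>remove1 y ys\<close> only up to order, which symmetry
  forgives.\<close>

lemma hafnian_map:
  assumes sym: "\<And>x y. S x y = S y x"
  shows "hafnian S (map f xs) = hafnian (\<lambda>x y. S (f x) (f y)) xs"
proof (induction xs rule: length_induct)
  case (1 xs)
  show ?case
  proof (cases xs)
    case (Cons x ys)
    have "hafnian S (remove1 (f y) (map f ys)) = hafnian (\<lambda>x y. S (f x) (f y)) (remove1 y ys)"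
      if "y \<in> set ys" for y
    proof -
      have "hafnian S (remove1 (f y) (map f ys)) = hafnian S (map f (remove1 y ys))"
        using that by (intro hafnian_perm[OF sym]) (simp add: image_mset_Diff)
      also have "\<dots> = hafnian (\<lambda>x y. S (f x) (f y)) (remove1 y ys)"
        using 1 Cons that by (auto simp: length_remove1)
      finally show ?thesis .
    qed
    then show ?thesis unfolding Cons by (simp add: o_def cong: map_cong)
  qed simp
qed

subsection \<open>Linear operators on the Fock space\<close>

lemma smul_add: "smul c (v + w) = smul c v + smul c w"
  and add_smul: "smul (c + d) v = smul c v + smul d v"
  and smul_smul: "smul c (smul d v) = smul (c * d) v"
  by (simp_all add: smul_def ring_distribs single_add mult_single flip: mult.assoc)

interpretation fock: vector_space smul
  by unfold_locales (simp_all add: smul_add add_smul smul_smul)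

lemma lookup_smul [simp]: "Poly_Mapping.lookup (smul c v) b = c * Poly_Mapping.lookup v b"
proof (induction v rule: fock_induct)
  case (add v b' d)
  then show ?case by (simp add: smul_add lookup_add smul_single ring_distribs lookup_single when_def)
qed simp

lemma heis_smul: "heis m (smul c v) = smul c (heis m v)"
proof (induction v rule: fock_induct)
  case (add v b d)
  have "heis m (smul c (Poly_Mapping.single b d)) = smul c (heis m (Poly_Mapping.single b d))"
    by (cases m "0::int" rule: linorder_cases)
       (simp_all add: smul_single heis_single_neg heis_single_pos mult_ac)
  with add show ?case by (simp add: smul_add heis_add)
qed simp

lemma module_hom_heis: "module_hom smul smul (heis m)"
  by unfold_locales (simp_all add: heis_add heis_smul)

lemma module_hom_comp: "module_hom s1 s2 f \<Longrightarrow> module_hom s2 s3 g \<Longrightarrow> module_hom s1 s3 (\<lambda>v. g (f v))"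
  using module_hom_compose[of s1 s2 f s3 g] by (simp add: o_def)

lemma heis_sum_list: "heis m (sum_list vs) = (\<Sum>v\<leftarrow>vs. heis m v)"
  by (induction vs) (simp_all add: heis_add)

lemma lookup_heis_neg:
  "Poly_Mapping.lookup (heis (- int j - 1) v) c =
     (if j \<in># c then Poly_Mapping.lookup v (c - {#j#}) else 0)"
proof (induction v rule: fock_induct)
  case (add v b d)
  have "(add_mset j b = c) = (j \<in># c \<and> b = c - {#j#})" by (metis add_mset_remove_trivial insert_DiffM union_single_eq_member)
  with add show ?case
    by (auto simp: heis_add lookup_add heis_single_neg lookup_single when_def)
qed simp

lemma lookup_heis_pos:
  "Poly_Mapping.lookup (heis (int j + 1) v) c =
     of_nat (j + 1) * of_nat (count c j + 1) * Poly_Mapping.lookup v (add_mset j c)"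
proof (induction v rule: fock_induct)
  case (add v b d)
  have "Poly_Mapping.lookup (heis (int j + 1) (Poly_Mapping.single b d)) c =
     of_nat (j + 1) * of_nat (count c j + 1) * Poly_Mapping.lookup (Poly_Mapping.single b d) (add_mset j c)"
  proof (cases "j \<in># b")
    case True
    then have "(b - {#j#} = c) = (b = add_mset j c)" by auto
    then show ?thesis by (auto simp: heis_single_pos lookup_single when_def algebra_simps)
  next
    case False
    then show ?thesis by (auto simp: heis_single_pos lookup_single when_def not_in_iff)
  qed
  with add show ?case by (simp add: heis_add lookup_add ring_distribs)
qed simp

text \<open>The letters are labels, and \<open>\<nu>\<close> gives their modes. Labels keep equal
  modes apart and stay fixed while the modes are summed over.\<close>

definition heis_word :: "('a \<Rightarrow> int) \<Rightarrow> 'a list \<Rightarrow> fock \<Rightarrow> fock" where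
  "heis_word \<nu> L = foldr (\<lambda>x. heis (\<nu> x)) L"

lemma heis_word_Nil [simp]: "heis_word \<nu> [] v = v"
  and heis_word_Cons [simp]: "heis_word \<nu> (x # L) v = heis (\<nu> x) (heis_word \<nu> L v)"
  and heis_word_append: "heis_word \<nu> (L @ L') v = heis_word \<nu> L (heis_word \<nu> L' v)"
  by (simp_all add: heis_word_def)

lemma module_hom_heis_word: "module_hom smul smul (heis_word \<nu> L)"
proof (induction L)
  case Nil show ?case by unfold_locales (simp_all add: smul_add)
next
  case (Cons x L)
  show ?case unfolding heis_word_Cons[abs_def]
    by (rule module_hom_comp[OF Cons module_hom_heis])
qed

text \<open>The commutator with a(n) is a derivation with scalar values on the letters. Distinctness
  makes \<open>remove1 y\<close> delete the very letter that was contracted.\<close>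

lemma heis_word_commute:
  "distinct L \<Longrightarrow> heis n (heis_word \<nu> L v) = heis_word \<nu> L (heis n v) +
     (\<Sum>y\<leftarrow>L. if \<nu> y = - n then smul (of_int n) (heis_word \<nu> (remove1 y L) v) else 0)"
proof (induction L)
  case (Cons x L)
  have "(\<Sum>y\<leftarrow>L. if \<nu> y = - n then smul (of_int n) (heis_word \<nu> (remove1 y (x # L)) v) else 0)
      = (\<Sum>y\<leftarrow>L. heis (\<nu> x) (if \<nu> y = - n then smul (of_int n) (heis_word \<nu> (remove1 y L) v) else 0))"
    using Cons.prems by (intro arg_cong[where f=sum_list] map_cong) (auto simp: heis_smul)
  moreover have "heis n (heis (\<nu> x) w) = heis (\<nu> x) (heis n w) + (if \<nu> x = - n then smul (of_int n) w else 0)" for w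
    using heis_commute[of n "\<nu> x" w] by (auto simp: algebra_simps)
  ultimately show ?case using Cons by (simp add: heis_add heis_sum_list o_def)
qed simp

subsection \<open>The graded dimension\<close>

text \<open>For complex families summability is absolute, which makes the product family summable on
  the product set.\<close>

lemma has_sum_times:
  fixes f :: "'a \<Rightarrow> complex" and g :: "'b \<Rightarrow> complex"
  assumes f: "(f has_sum a) A" and g: "(g has_sum b) B"
  shows "((\<lambda>(x, y). f x * g y) has_sum a * b) (A \<times> B)"
proof (rule has_sum_SigmaI)
  have nf: "(\<lambda>x. norm (f x)) summable_on A" and ng: "(\<lambda>x. norm (g x)) summable_on B"
    using f g has_sum_imp_summable summable_on_iff_abs_summable_on_complex by blast+
  show "((\<lambda>y. case (x, y) of (x, y) \<Rightarrow> f x * g y) has_sum f x * b) B" for x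
    using has_sum_cmult_right[OF g] by simp
  show "((\<lambda>x. f x * b) has_sum a * b) A" using has_sum_cmult_left[OF f] by simp
  have "(\<lambda>z. norm (case z of (x, y) \<Rightarrow> f x * g y)) summable_on A \<times> B"
  proof (rule summable_on_SigmaI)
    show "((\<lambda>y. norm (case (x, y) of (x, y) \<Rightarrow> f x * g y)) has_sum norm (f x) * infsum (\<lambda>y. norm (g y)) B) B" for x
      using has_sum_cmult_right[OF has_sum_infsum[OF ng]] by (simp add: norm_mult)
    show "(\<lambda>x. norm (f x) * infsum (\<lambda>y. norm (g y)) B) summable_on A"
      by (rule summable_on_cmult_left[OF nf])
  qed auto
  then show "(\<lambda>(x, y). f x * g y) summable_on A \<times> B"
    by (rule abs_summable_summable)
qed

lemma infsum_tendsto_exhaust: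
  fixes f :: "'a \<Rightarrow> complex"
  assumes f: "f summable_on UNIV" and mono: "incseq A" and UN: "(\<Union>n. A n) = UNIV"
  shows "(\<lambda>n. infsum f (A n)) \<longlonglongrightarrow> infsum f UNIV"
proof (rule LIMSEQ_I)
  fix e :: real assume e: "e > 0"
  have nf: "(\<lambda>x. norm (f x)) summable_on UNIV"
    using f summable_on_iff_abs_summable_on_complex by blast
  obtain F where F: "finite F" "dist (sum (\<lambda>x. norm (f x)) F) (infsum (\<lambda>x. norm (f x)) UNIV) \<le> e / 2"
    using infsum_finite_approximation[OF nf, of "e/2"] e by auto
  obtain N where N: "F \<subseteq> A N"
  proof -
    have "\<exists>N. F \<subseteq> A N" using F(1)
    proof (induction F rule: finite_induct)
      case (insert x F)
      then obtain N M where "F \<subseteq> A N" "x \<in> A M" using UN by blast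
      then have "insert x F \<subseteq> A (max N M)"
        using incseqD[OF mono, of N "max N M"] incseqD[OF mono, of M "max N M"] by auto
      then show ?case by blast
    qed simp
    then show ?thesis using that by blast
  qed
  show "\<exists>N. \<forall>n\<ge>N. norm (infsum f (A n) - infsum f UNIV) < e"
  proof (intro exI[of _ N] allI impI)
    fix n assume "n \<ge> N"
    then have FA: "F \<subseteq> A n" using N incseqD[OF mono] by blast
    have s: "f summable_on B" "(\<lambda>x. norm (f x)) summable_on B" for B
      using f nf by (meson summable_on_subset_banach subset_UNIV)+
    have "infsum f UNIV = infsum f (A n) + infsum f (- A n)"
      by (subst infsum_Un_disjoint[symmetric]) (use s in \<open>auto simp: Compl_partition\<close>)
    then have "norm (infsum f (A n) - infsum f UNIV) = norm (infsum f (- A n))"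
      by simp
    also have "\<dots> \<le> infsum (\<lambda>x. norm (f x)) (- A n)"
      by (rule norm_infsum_bound) (use s in auto)
    also have "\<dots> \<le> infsum (\<lambda>x. norm (f x)) (- F)"
      by (rule infsum_mono2) (use s FA in auto)
    also have "\<dots> = infsum (\<lambda>x. norm (f x)) UNIV - sum (\<lambda>x. norm (f x)) F"
      using infsum_Un_disjoint[OF s(2)[of F] s(2)[of "- F"]] F(1) by (auto simp: Compl_partition)
    also have "\<dots> < e" using F(2) e unfolding dist_real_def by linarith
    finally show "norm (infsum f (A n) - infsum f UNIV) < e" .
  qed
qed

lemma wt_simps [simp]: "wt {#} = 0" "wt (add_mset j b) = Suc j + wt b" "wt (b + b') = wt b + wt b'"
  by (simp_all add: wt_def)

lemma wt_replicate_mset [simp]: "wt (replicate_mset k j) = k * Suc j"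
  by (induction k) auto

lemma wt_ge_count: "count b j * Suc j \<le> wt b"
proof -
  have "b = replicate_mset (count b j) j + filter_mset (\<lambda>i. i \<noteq> j) b"
    by (rule multiset_eqI) auto
  then have "wt b = count b j * Suc j + wt (filter_mset (\<lambda>i. i \<noteq> j) b)"
    by (metis wt_replicate_mset wt_simps(3))
  then show ?thesis by simp
qed

text \<open>The Euler product for partitions with parts at most \<open>J\<close>: an element
  \<open>j\<close> counts as a part \<open>j + 1\<close>. The induction step separates the copies of
  \<open>J\<close>, which form a geometric series in \<open>q ^ Suc J\<close>.\<close>

lemma has_sum_wt_bounded:
  fixes q :: complex
  assumes q: "norm q < 1"
  shows "((\<lambda>b. q ^ wt b) has_sum (\<Prod>j<J. 1 / (1 - q ^ Suc j))) {b. set_mset b \<subseteq> {..<J}}"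
proof (induction J)
  case 0
  have "{b. set_mset b \<subseteq> {..<0::nat}} = {{#}}" by auto
  then show ?case by (simp add: has_sum_finite_iff)
next
  case (Suc J)
  have "norm (q ^ Suc J) < 1"
    using q by (metis norm_ge_zero norm_power power_less_one_iff zero_less_Suc)
  then have "((\<lambda>k. (q ^ Suc J) ^ k) has_sum (1 / (1 - q ^ Suc J))) UNIV"
    by (intro norm_summable_imp_has_sum)
       (auto simp: norm_power intro!: summable_geometric geometric_sums power_le_one abs_summable_on_comparison_test)
  from has_sum_times[OF Suc this]
  have "((\<lambda>(b, k). q ^ wt b * (q ^ Suc J) ^ k) has_sum (\<Prod>j<Suc J. 1 / (1 - q ^ Suc j)))
    ({b. set_mset b \<subseteq> {..<J}} \<times> UNIV)" by simp
  also have "?this \<longleftrightarrow> ((\<lambda>b. q ^ wt b) has_sum (\<Prod>j<Suc J. 1 / (1 - q ^ Suc j))) {b. set_mset b \<subseteq> {..<Suc J}}"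
  proof (rule has_sum_reindex_bij_witness[where j = "\<lambda>(b, k). b + replicate_mset k J" and
        i = "\<lambda>b. (filter_mset (\<lambda>i. i \<noteq> J) b, count b J)"])
    fix a assume "a \<in> {b. set_mset b \<subseteq> {..<J}} \<times> (UNIV :: nat set)"
    then obtain b k where a: "a = (b, k)" "set_mset b \<subseteq> {..<J}" by auto
    have "J \<notin># b" using a by auto
    then have "filter_mset (\<lambda>i. i \<noteq> J) (b + replicate_mset k J) = b"
      by (intro multiset_eqI) (auto simp: not_in_iff)
    with \<open>J \<notin># b\<close> show "(filter_mset (\<lambda>i. i \<noteq> J) (case a of (b, k) \<Rightarrow> b + replicate_mset k J),
          count (case a of (b, k) \<Rightarrow> b + replicate_mset k J) J) = a"
      by (simp add: a not_in_iff)
    show "(case a of (b, k) \<Rightarrow> b + replicate_mset k J) \<in> {b. set_mset b \<subseteq> {..<Suc J}}"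
      using a by (auto dest: in_replicate_mset[THEN iffD1] simp: less_Suc_eq split: if_splits)
    show "q ^ wt (case a of (b, k) \<Rightarrow> b + replicate_mset k J) = (case a of (b, k) \<Rightarrow> q ^ wt b * (q ^ Suc J) ^ k)"
      by (simp add: a power_add power_mult power_mult_distrib power_commutes flip: power_mult)
         (simp add: power_mult_distrib mult_ac flip: power_mult)
  next
    fix b assume b: "b \<in> {b. set_mset b \<subseteq> {..<Suc J}}"
    show "(case (filter_mset (\<lambda>i. i \<noteq> J) b, count b J) of (b, k) \<Rightarrow> b + replicate_mset k J) = b"
      by (auto intro!: multiset_eqI)
    show "(filter_mset (\<lambda>i. i \<noteq> J) b, count b J) \<in> {b. set_mset b \<subseteq> {..<J}} \<times> UNIV"
      using b by (auto simp: less_Suc_eq)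
  qed simp
  finally show ?case .
qed

lemma convergent_prod_one_minus_power:
  fixes q :: complex
  assumes "norm q < 1"
  shows "convergent_prod (\<lambda>n. 1 - q ^ Suc n)" "prodinf (\<lambda>n. 1 - q ^ Suc n) \<noteq> 0"
proof -
  have nz: "1 - q ^ Suc n \<noteq> 0" for n
    using assms by (metis norm_one norm_power power_less_one_iff less_irrefl norm_ge_zero right_minus_eq zero_less_Suc)
  have "summable (\<lambda>n. norm (- (q ^ Suc n)))"
    using assms by (auto simp: norm_mult norm_power intro!: summable_mult summable_geometric)
  then have "abs_convergent_prod (\<lambda>n. 1 + (- (q ^ Suc n)))"
    by (intro summable_imp_abs_convergent_prod) auto
  then show *: "convergent_prod (\<lambda>n. 1 - q ^ Suc n)"
    using abs_convergent_prod_imp_convergent_prod by fastforce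
  show "prodinf (\<lambda>n. 1 - q ^ Suc n) \<noteq> 0"
    using * nz by (intro prodinf_nonzero) auto
qed

lemma tendsto_prod_one_minus_power:
  fixes q :: complex
  assumes "norm q < 1"
  shows "(\<lambda>J. \<Prod>j<J. 1 / (1 - q ^ Suc j)) \<longlonglongrightarrow> 1 / prodinf (\<lambda>n. 1 - q ^ Suc n)"
proof -
  have "(\<lambda>J. \<Prod>j<Suc J. 1 - q ^ Suc j) \<longlonglongrightarrow> prodinf (\<lambda>n. 1 - q ^ Suc n)"
    using convergent_prod_LIMSEQ[OF convergent_prod_one_minus_power(1)[OF assms]]
    by (simp only: lessThan_Suc_atMost)
  then have "(\<lambda>J. \<Prod>j<J. 1 - q ^ Suc j) \<longlonglongrightarrow> prodinf (\<lambda>n. 1 - q ^ Suc n)"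
    by (rule LIMSEQ_imp_Suc)
  from tendsto_divide[OF tendsto_const this convergent_prod_one_minus_power(2)[OF assms], of 1]
  show ?thesis by (simp add: prod_dividef)
qed

text \<open>The finite Euler products converge, hence are bounded, and as the terms are nonnegative
  they bound every finite partial sum.\<close>

lemma summable_wt_real:
  fixes r :: real
  assumes r: "0 \<le> r" "r < 1"
  shows "(\<lambda>b. r ^ wt b) summable_on UNIV"
proof (rule nonneg_bdd_above_summable_on)
  define c where "c = (\<lambda>J. \<Prod>j<J. 1 / (1 - r ^ Suc j))"
  have c: "((\<lambda>b. r ^ wt b) has_sum c J) {b. set_mset b \<subseteq> {..<J}}" for J
  proof -
    have "((\<lambda>b. complex_of_real (r ^ wt b)) has_sum of_real (c J)) {b. set_mset b \<subseteq> {..<J}}"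
      using has_sum_wt_bounded[of "of_real r" J] r by (simp add: c_def)
    then show ?thesis by (simp only: has_sum_of_real_iff)
  qed
  have "convergent (\<lambda>J. complex_of_real (c J))"
    using tendsto_prod_one_minus_power[of "of_real r"] r unfolding c_def convergent_def
    by auto
  then have "Bseq (\<lambda>J. complex_of_real (c J))" by (rule convergent_imp_Bseq)
  then obtain K where K: "\<And>J. norm (complex_of_real (c J)) \<le> K" by (auto simp: Bseq_def)
  show "bdd_above (sum (\<lambda>b. r ^ wt b) ` {F. F \<subseteq> UNIV \<and> finite F})"
  proof (rule bdd_aboveI)
    fix x assume "x \<in> sum (\<lambda>b. r ^ wt b) ` {F. F \<subseteq> UNIV \<and> finite F}"
    then obtain F where F: "finite F" "x = sum (\<lambda>b. r ^ wt b) F" by auto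
    have "finite (\<Union>b\<in>F. set_mset b)" using F by auto
    then obtain J where "(\<Union>b\<in>F. set_mset b) \<subseteq> {..<J}"
      using finite_nat_bounded by blast
    then have "F \<subseteq> {b. set_mset b \<subseteq> {..<J}}" by auto
    then have "x \<le> c J" unfolding F(2)
      by (intro finite_sum_le_has_sum[OF c]) (use F r in auto)
    also have "\<dots> \<le> K" using K[of J] by simp
    finally show "x \<le> K" .
  qed
qed (use r in auto)

lemma has_sum_wt:
  fixes q :: complex
  assumes q: "norm q < 1"
  shows "((\<lambda>b. q ^ wt b) has_sum 1 / prodinf (\<lambda>n. 1 - q ^ Suc n)) UNIV"
proof -
  have s: "(\<lambda>b. q ^ wt b) summable_on UNIV"
    by (rule abs_summable_summable) (use summable_wt_real[of "norm q"] q in \<open>simp add: norm_power\<close>)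
  have "(\<lambda>J. infsum (\<lambda>b. q ^ wt b) {b. set_mset b \<subseteq> {..<J}}) \<longlonglongrightarrow> infsum (\<lambda>b. q ^ wt b) UNIV"
  proof (rule infsum_tendsto_exhaust[OF s])
    show "incseq (\<lambda>J. {b. set_mset b \<subseteq> {..<J}})" by (auto simp: incseq_def)
    show "(\<Union>J. {b. set_mset b \<subseteq> {..<J}}) = (UNIV :: nat multiset set)"
      using finite_nat_bounded[OF finite_set_mset] by auto
  qed
  moreover have "infsum (\<lambda>b. q ^ wt b) {b. set_mset b \<subseteq> {..<J}} = (\<Prod>j<J. 1 / (1 - q ^ Suc j))" for J
    by (rule infsumI[OF has_sum_wt_bounded[OF q]])
  ultimately have "infsum (\<lambda>b. q ^ wt b) UNIV = 1 / prodinf (\<lambda>n. 1 - q ^ Suc n)"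
    using tendsto_prod_one_minus_power[OF q] LIMSEQ_unique by simp
  with s show ?thesis by (simp add: has_sum_iff)
qed

subsection \<open>Traces of words in the Heisenberg modes\<close>

text \<open>Each letter multiplies by a variable or applies a multiple of a partial derivative, so
  monomials go to multiples of monomials. The sign of the factor later identifies the norms of the
  trace terms; its polynomial growth in the weight gives convergence.\<close>

lemma heis_word_single:
  "\<exists>b' a. heis_word \<nu> L (Poly_Mapping.single b 1) = Poly_Mapping.single b' (of_real a) \<and> 0 \<le> a \<and>
     a \<le> real (wt b + (\<Sum>x\<leftarrow>L. nat \<bar>\<nu> x\<bar>)) ^ length L \<and> wt b' \<le> wt b + (\<Sum>x\<leftarrow>L. nat \<bar>\<nu> x\<bar>)"
proof (induction L)
  case Nil
  show ?case by (intro exI[of _ b] exI[of _ "1::real"]) simp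
next
  case (Cons x L)
  let ?s = "wt b + (\<Sum>x\<leftarrow>L. nat \<bar>\<nu> x\<bar>)" and ?s' = "wt b + (\<Sum>x\<leftarrow>x # L. nat \<bar>\<nu> x\<bar>)"
  from Cons obtain b' a where IH: "heis_word \<nu> L (Poly_Mapping.single b 1) = Poly_Mapping.single b' (of_real a)"
    "0 \<le> a" "a \<le> real ?s ^ length L" "wt b' \<le> ?s" by blast
  have mono: "real ?s ^ length L \<le> real ?s' ^ length L" by (intro power_mono) auto
  consider "\<nu> x < 0" | "\<nu> x = 0" | "\<nu> x > 0" by linarith
  then show ?case
  proof cases
    case 1
    have "real ?s ^ length L \<le> real ?s' ^ length L" by (rule mono)
    also have "\<dots> \<le> real ?s' ^ length (x # L)" using 1 by (intro power_increasing) auto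
    finally show ?thesis using 1 IH
      by (intro exI[of _ "add_mset (nat (- \<nu> x - 1)) b'"] exI[of _ a])
         (auto simp: heis_single_neg)
  next
    case 2
    then show ?thesis by (intro exI[of _ "{#}"] exI[of _ "0::real"]) simp
  next
    case 3
    define j where "j = nat (\<nu> x - 1)"
    have x: "\<nu> x = int j + 1" using 3 by (simp add: j_def)
    have c: "real (j + 1) * real (count b' j) \<le> real ?s'"
    proof -
      have "count b' j * Suc j \<le> ?s" using wt_ge_count[of b' j] IH by linarith
      then have "(j + 1) * count b' j \<le> ?s'" by (simp add: mult.commute)
      then show ?thesis by (metis of_nat_le_iff of_nat_mult)
    qed
    have w: "wt (b' - {#j#}) \<le> wt b'"
      by (cases "j \<in># b'") (metis insert_DiffM le_add2 wt_simps(2), simp)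
    have "real (j + 1) * real (count b' j) * a \<le> real ?s' * real ?s' ^ length L"
      using c IH mono by (intro mult_mono) auto
    then show ?thesis using IH w
      by (intro exI[of _ "b' - {#j#}"] exI[of _ "real (j + 1) * real (count b' j) * a"])
         (auto simp: heis_single_pos x add.commute)
  qed
qed

lemma lookup_heis_word_single:
  obtains a where "Poly_Mapping.lookup (heis_word \<nu> L (Poly_Mapping.single b 1)) c = complex_of_real a"
    "0 \<le> a" "a \<le> real (wt b + (\<Sum>x\<leftarrow>L. nat \<bar>\<nu> x\<bar>)) ^ length L"
proof -
  obtain b' a where *: "heis_word \<nu> L (Poly_Mapping.single b 1) = Poly_Mapping.single b' (of_real a)" "0 \<le> a"
     "a \<le> real (wt b + (\<Sum>x\<leftarrow>L. nat \<bar>\<nu> x\<bar>)) ^ length L" using heis_word_single by blast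
  show ?thesis
  proof (cases "b' = c")
    case True with * show ?thesis using that[of a] by simp
  next
    case False with * show ?thesis using that[of 0] by (simp add: lookup_single)
  qed
qed

lemma tendsto_power_mult_geometric:
  fixes x :: real
  assumes x: "0 \<le> x" "x < 1"
  shows "(\<lambda>n. real (n + s) ^ K * x ^ n) \<longlonglongrightarrow> 0"
proof (cases "K = 0")
  case True
  then show ?thesis using LIMSEQ_realpow_zero[OF x] by simp
next
  case False
  \<comment> \<open>With a K-th root the claim is the K-th power of the limit of (n + s)
    y^n.\<close>
  define y where "y = root K x"
  have y: "0 \<le> y" "y < 1" "x = y ^ K"
    using False x by (simp_all add: y_def real_root_lt_1_iff)
  have "(\<lambda>n. real n * y ^ n + real s * y ^ n) \<longlonglongrightarrow> 0 + real s * 0"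
    using y by (intro tendsto_add tendsto_mult tendsto_const powser_times_n_limit_0 LIMSEQ_realpow_zero) auto
  then have "(\<lambda>n. real (n + s) * y ^ n) \<longlonglongrightarrow> 0" by (simp add: ring_distribs)
  from tendsto_power[OF this, of K] False
  show ?thesis unfolding y(3) by (simp add: power_mult_distrib mult.commute zero_power flip: power_mult)
qed

lemma summable_heis_word:
  fixes q :: complex
  assumes q: "norm q < 1"
  shows "(\<lambda>b. norm (Poly_Mapping.lookup (heis_word \<nu> L (Poly_Mapping.single b 1)) (f b) * q ^ wt b)) summable_on UNIV"
proof -
  \<comment> \<open>A ratio strictly between \<open>norm q\<close> and 1: the factor
    \<open>(norm q / r) ^ wt b\<close> absorbs the polynomial growth, and \<open>r ^ wt b\<close>
    remains summable.\<close>
  define r where "r = (norm q + 1) / 2"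
  have r: "0 < r" "norm q < r" "r < 1" using q norm_ge_zero[of q] by (auto simp: r_def simp del: norm_ge_zero)
  define s K where "s = (\<Sum>x\<leftarrow>L. nat \<bar>\<nu> x\<bar>)" and "K = length L"
  have "(\<lambda>n. real (n + s) ^ K * (norm q / r) ^ n) \<longlonglongrightarrow> 0"
    using r by (intro tendsto_power_mult_geometric) auto
  then have "Bseq (\<lambda>n. real (n + s) ^ K * (norm q / r) ^ n)"
    using convergent_imp_Bseq convergent_def by blast
  then obtain C where C: "\<And>n. norm (real (n + s) ^ K * (norm q / r) ^ n) \<le> C" by (auto simp: Bseq_def)
  show ?thesis
  proof (rule summable_on_comparison_test)
    show "(\<lambda>b. C * r ^ wt b) summable_on UNIV"
      using r by (intro summable_on_cmult_right summable_wt_real) auto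
    fix b
    obtain a where a: "Poly_Mapping.lookup (heis_word \<nu> L (Poly_Mapping.single b 1)) (f b) = complex_of_real a"
      "0 \<le> a" "a \<le> real (wt b + s) ^ K" unfolding s_def K_def by (rule lookup_heis_word_single)
    have "norm (Poly_Mapping.lookup (heis_word \<nu> L (Poly_Mapping.single b 1)) (f b) * q ^ wt b)
        = a * norm q ^ wt b" using a by (simp add: norm_mult norm_power)
    also have "\<dots> \<le> real (wt b + s) ^ K * norm q ^ wt b" using a by (intro mult_right_mono) auto
    also have "\<dots> = (real (wt b + s) ^ K * (norm q / r) ^ wt b) * r ^ wt b"
      using r by (simp add: power_divide)
    also have "\<dots> \<le> C * r ^ wt b" using C[of "wt b"] r by (intro mult_right_mono) auto
    finally show "norm (Poly_Mapping.lookup (heis_word \<nu> L (Poly_Mapping.single b 1)) (f b) * q ^ wt b) \<le> C * r ^ wt b" .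
  qed auto
qed

lemma has_sum_sum_list:
  fixes f :: "'a \<Rightarrow> 'b \<Rightarrow> 'c::{comm_monoid_add, topological_comm_monoid_add}"
  assumes "\<And>y. y \<in> set L \<Longrightarrow> (f y has_sum g y) A"
  shows "((\<lambda>b. \<Sum>y\<leftarrow>L. f y b) has_sum (\<Sum>y\<leftarrow>L. g y)) A"
  using assms by (induction L) (auto intro!: has_sum_add)

lemma lookup_sum_list: "Poly_Mapping.lookup (sum_list vs) b = (\<Sum>v\<leftarrow>vs. Poly_Mapping.lookup v b)"
  by (induction vs) (simp_all add: lookup_add)

lemma power_int_neq_1:
  fixes q :: complex
  assumes "norm q < 1" "n \<noteq> 0"
  shows "q powi n \<noteq> 1"
proof
  assume *: "q powi n = 1"
  then have "norm q powi n = 1" by (metis norm_one norm_power_int)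
  moreover have "norm q ^ nat \<bar>n\<bar> \<noteq> 1"
    using assms by (metis less_irrefl norm_ge_zero power_less_one_iff zero_less_abs_iff zero_less_nat_eq)
  ultimately show False
    using assms by (cases "n \<ge> 0") (auto simp: power_int_def power_inverse)
qed

text \<open>As a(n) lowers the weight by n, it passes q^L(0) at the cost of the factor
  \<open>q powi n\<close>, and the trace is cyclic. In infinite dimension cyclicity has to be seen
  on the basis: the diagonal entries of the two products correspond under the map from b to
  \<open>add_mset j b\<close>.\<close>

lemma has_sum_heis_word_cyclic:
  fixes q :: complex
  assumes q: "q \<noteq> 0" and n: "n \<noteq> 0"
  assumes A: "((\<lambda>b. Poly_Mapping.lookup (heis n (heis_word \<nu> L (Poly_Mapping.single b 1))) b * q ^ wt b) has_sum A) UNIV"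
  shows "((\<lambda>b. Poly_Mapping.lookup (heis_word \<nu> L (heis n (Poly_Mapping.single b 1))) b * q ^ wt b) has_sum q powi n * A) UNIV"
proof -
  interpret W: module_hom smul smul "heis_word \<nu> L" by (rule module_hom_heis_word)
  \<comment> \<open>Adding one copy of \<open>j\<close> maps all monomials bijectively onto those
    that contain \<open>j\<close>. The terms at the others vanish, because a(-j-1) cannot produce
    such monomials and a(j+1) kills them.\<close>
  have reindex: "((\<lambda>b. h (add_mset j b)) has_sum s) UNIV \<longleftrightarrow> (h has_sum s) UNIV"
    if "\<And>b. j \<notin># b \<Longrightarrow> h b = 0" for h :: "nat multiset \<Rightarrow> complex" and j s
  proof -
    have "((\<lambda>b. h (add_mset j b)) has_sum s) UNIV \<longleftrightarrow> (h has_sum s) {b. j \<in># b}"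
      by (rule has_sum_reindex_bij_witness[where j = "add_mset j" and i = "\<lambda>b. b - {#j#}"]) auto
    also have "\<dots> \<longleftrightarrow> (h has_sum s) UNIV"
      by (rule has_sum_cong_neutral) (use that in auto)
    finally show ?thesis .
  qed
  show ?thesis
  proof (cases "n < 0")
    case True
    define j where "j = nat (- n - 1)"
    have nj: "n = - int j - 1" using True by (simp add: j_def)
    have "((\<lambda>b. Poly_Mapping.lookup (heis_word \<nu> L (Poly_Mapping.single (add_mset j b) 1)) b * q ^ (wt b + Suc j)) has_sum A) UNIV"
      using A unfolding nj lookup_heis_neg
      by (subst (asm) reindex[symmetric, of j]) (auto simp: add_ac)
    from has_sum_cmult_right[OF this, of "q powi n"]
    have "((\<lambda>b. q powi n * (Poly_Mapping.lookup (heis_word \<nu> L (Poly_Mapping.single (add_mset j b) 1)) b * q ^ (wt b + Suc j))) has_sum q powi n * A) UNIV" .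
    moreover have "q powi n * q ^ (m + Suc j) = q ^ m" for m
    proof -
      have "q powi n * q powi (int m + int j + 1) = q powi int m"
        using q by (simp add: nj flip: power_int_add)
      then show ?thesis by (metis add.assoc of_nat_Suc of_nat_add plus_1_eq_Suc add.commute power_int_of_nat)
    qed
    ultimately have "((\<lambda>b. Poly_Mapping.lookup (heis_word \<nu> L (Poly_Mapping.single (add_mset j b) 1)) b * q ^ wt b) has_sum q powi n * A) UNIV"
      by (simp only: mult.left_commute[of "q powi n"])
    then show ?thesis using True by (simp add: heis_single_neg flip: j_def)
  next
    case False
    define j where "j = nat (n - 1)"
    have nj: "n = int j + 1" using False n by (simp add: j_def)
    have qn: "q powi n = q ^ Suc j" by (metis nj of_nat_Suc power_int_of_nat add.commute)
    have h: "heis n (Poly_Mapping.single b 1) = smul (of_nat (Suc j) * of_nat (count b j)) (Poly_Mapping.single (b - {#j#}) 1)" for b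
      by (simp add: nj heis_single_pos smul_single add.commute)
    have "((\<lambda>b. q powi n * (of_nat (j + 1) * of_nat (count b j + 1) * Poly_Mapping.lookup (heis_word \<nu> L (Poly_Mapping.single b 1)) (add_mset j b) * q ^ wt b)) has_sum q powi n * A) UNIV"
      using A unfolding nj lookup_heis_pos by (rule has_sum_cmult_right)
    then have "((\<lambda>b. Poly_Mapping.lookup (heis_word \<nu> L (heis n (Poly_Mapping.single (add_mset j b) 1))) (add_mset j b) * q ^ wt (add_mset j b)) has_sum q powi n * A) UNIV"
      unfolding h W.scale lookup_smul by (simp add: qn power_add mult_ac)
    then show ?thesis
      by (subst (asm) reindex) (auto simp: h W.scale not_in_iff)
  qed
qed

text \<open>
  The trace of two modes \<open>a(n) a(-n)\<close> relative to the partition function: \<open>ordered_weight\<close> for the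
  operators in this order, \<open>normal_weight\<close> for their normally ordered product. The junk value at
  \<open>n = 0\<close> is \<open>0\<close> and is the right one, as \<open>a(0) = 0\<close>.
\<close>

definition ordered_weight :: "complex \<Rightarrow> int \<Rightarrow> complex" where
  "ordered_weight q n = of_int n / (1 - q powi n)"

definition normal_weight :: "complex \<Rightarrow> int \<Rightarrow> complex" where
  "normal_weight q n = of_int \<bar>n\<bar> * q ^ nat \<bar>n\<bar> / (1 - q ^ nat \<bar>n\<bar>)"

text \<open>For n < 0 the product a(n) a(-n) is already normally ordered. In formulas, numerator and
  denominator are multiplied by \<open>q ^ nat (- n)\<close>.\<close>

lemma ordered_weight_neg:
  assumes q: "q \<noteq> 0" "norm q < 1" and "n < 0"
  shows "ordered_weight q n = normal_weight q n"
proof -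
  have *: "q ^ nat (- n) \<noteq> 1" "q ^ nat (-n) \<noteq> 0"
    using power_int_neq_1[OF q(2), of "- n"] q \<open>n < 0\<close> by (auto simp: power_int_def)
  have "q powi n = inverse (q ^ nat (- n))" using \<open>n < 0\<close> by (simp add: power_int_def power_inverse)
  moreover have "m / (1 - inverse P) = - m * P / (1 - P)" if "P \<noteq> 0" "P \<noteq> 1" for m P :: complex
  proof -
    have "1 - inverse P = (P - 1) / P" using that by (simp add: field_simps)
    then have "m / (1 - inverse P) = m * P / (P - 1)" by simp
    also have "\<dots> = - m * P / (1 - P)" using that by (simp add: divide_simps) (simp add: algebra_simps)
    finally show ?thesis .
  qed
  ultimately show ?thesis using \<open>n < 0\<close> * by (simp add: ordered_weight_def normal_weight_def)
qed

lemma normal_weight_minus: "normal_weight q (- n) = normal_weight q n"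
  by (simp add: normal_weight_def)

lemma has_sum_trace_heis_word:
  fixes q :: complex
  assumes q: "q \<noteq> 0" "norm q < 1" and "distinct L"
  shows "((\<lambda>b. Poly_Mapping.lookup (heis_word \<nu> L (Poly_Mapping.single b 1)) b * q ^ wt b) has_sum
     1 / prodinf (\<lambda>n. 1 - q ^ Suc n) *
     hafnian (\<lambda>x y. if \<nu> y = - \<nu> x then ordered_weight q (\<nu> x) else 0) L) UNIV"
  using \<open>distinct L\<close>
proof (induction L rule: length_induct)
  case (1 L)
  let ?Z = "1 / prodinf (\<lambda>n. 1 - q ^ Suc n)"
  let ?S = "\<lambda>x y. if \<nu> y = - \<nu> x then ordered_weight q (\<nu> x) else 0"
  show ?case
  proof (cases L)
    case Nil
    then show ?thesis using has_sum_wt[OF q(2)] by simp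
  next
    case (Cons x L')
    define n where "n = \<nu> x"
    show ?thesis
    proof (cases "n = 0")
      case True
      have "hafnian ?S L = (\<Sum>y\<leftarrow>L'. 0)" unfolding Cons hafnian.simps
        by (intro arg_cong[where f=sum_list] map_cong) (use True in \<open>auto simp: n_def ordered_weight_def\<close>)
      then have "hafnian ?S L = 0" by simp
      with True show ?thesis by (simp add: Cons n_def)
    next
      case False
      define T where "T = (\<lambda>L b. Poly_Mapping.lookup (heis_word \<nu> L (Poly_Mapping.single b 1)) b * q ^ wt b)"
      \<comment> \<open>Convergence comes first: cyclicity leads to the equation A = q^n A +
        contractions, which determines the trace only if \<open>A\<close> exists.\<close>
      have "(\<lambda>b. T L b) summable_on UNIV"
        unfolding T_def by (rule abs_summable_summable[OF summable_heis_word[OF q(2)]])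
      then obtain A where A: "((\<lambda>b. T L b) has_sum A) UNIV" by (auto simp: summable_on_def)
      have B: "((\<lambda>b. Poly_Mapping.lookup (heis_word \<nu> L' (heis n (Poly_Mapping.single b 1))) b * q ^ wt b) has_sum q powi n * A) UNIV"
        using A False by (intro has_sum_heis_word_cyclic q) (simp_all add: Cons T_def n_def)
      have "((\<lambda>b. (if \<nu> y = - n then of_int n * T (remove1 y L') b else 0)) has_sum
             (if \<nu> y = - n then of_int n * (?Z * hafnian ?S (remove1 y L')) else 0)) UNIV" if "y \<in> set L'" for y
      proof -
        have "(T (remove1 y L') has_sum (?Z * hafnian ?S (remove1 y L'))) UNIV"
          unfolding T_def using 1 that by (auto simp: Cons length_remove1)
        from has_sum_cmult_right[OF this, of "of_int n"] show ?thesis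
          by (cases "\<nu> y = - n") (simp_all only: if_True if_False simp_thms has_sum_0_simp)
      qed
      then have C: "((\<lambda>b. \<Sum>y\<leftarrow>L'. if \<nu> y = - n then of_int n * T (remove1 y L') b else 0) has_sum
          (\<Sum>y\<leftarrow>L'. if \<nu> y = - n then of_int n * (?Z * hafnian ?S (remove1 y L')) else 0)) UNIV"
        by (rule has_sum_sum_list)
      have "T L b = Poly_Mapping.lookup (heis_word \<nu> L' (heis n (Poly_Mapping.single b 1))) b * q ^ wt b
          + (\<Sum>y\<leftarrow>L'. if \<nu> y = - n then of_int n * T (remove1 y L') b else 0)" for b
      proof -
        have "distinct L'" using 1 Cons by simp
        have "(\<Sum>y\<leftarrow>L'. Poly_Mapping.lookup (if \<nu> y = - n then smul (of_int n) (heis_word \<nu> (remove1 y L') (Poly_Mapping.single b 1)) else 0) b) * q ^ wt b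
           = (\<Sum>y\<leftarrow>L'. if \<nu> y = - n then of_int n * T (remove1 y L') b else 0)"
          unfolding sum_list_mult_const[symmetric]
          by (intro arg_cong[where f=sum_list] map_cong) (auto simp: T_def)
        then show ?thesis
          using heis_word_commute[OF \<open>distinct L'\<close>, of n \<nu> "Poly_Mapping.single b 1"]
          by (simp add: T_def Cons lookup_add lookup_sum_list o_def ring_distribs flip: n_def)
      qed
      then have "((\<lambda>b. T L b) has_sum q powi n * A +
          (\<Sum>y\<leftarrow>L'. if \<nu> y = - n then of_int n * (?Z * hafnian ?S (remove1 y L')) else 0)) UNIV"
        using has_sum_add[OF B C] by simp
      then have "A = q powi n * A + (\<Sum>y\<leftarrow>L'. if \<nu> y = - n then of_int n * (?Z * hafnian ?S (remove1 y L')) else 0)"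
        using A has_sum_unique by blast
      then have "A * (1 - q powi n) = (\<Sum>y\<leftarrow>L'. if \<nu> y = - n then of_int n * (?Z * hafnian ?S (remove1 y L')) else 0)"
        by (simp add: algebra_simps)
      then have "A = (\<Sum>y\<leftarrow>L'. if \<nu> y = - n then of_int n * (?Z * hafnian ?S (remove1 y L')) else 0) * (1 / (1 - q powi n))"
        using power_int_neq_1[OF q(2) False] by (simp add: field_simps)
      also have "\<dots> = ?Z * hafnian ?S L"
        unfolding sum_list_mult_const[symmetric] Cons hafnian.simps sum_list_const_mult[symmetric]
        by (intro arg_cong[where f=sum_list] map_cong) (auto simp: n_def ordered_weight_def)
      finally show ?thesis using A by (simp add: T_def)
    qed
  qed
qed

subsection \<open>Normal ordering\<close>

text \<open>The recursion copies that of \<open>vop_list\<close>, so the letters of nonnegative mode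
  come out in reverse order.\<close>

primrec normal_order :: "('a \<Rightarrow> int) \<Rightarrow> 'a list \<Rightarrow> 'a list" where
  "normal_order \<nu> [] = []"
| "normal_order \<nu> (x # xs) = (if \<nu> x < 0 then x # normal_order \<nu> xs else normal_order \<nu> xs @ [x])"

lemma mset_normal_order [simp]: "mset (normal_order \<nu> xs) = mset xs"
  by (induction xs) auto

lemma set_normal_order [simp]: "set (normal_order \<nu> xs) = set xs"
  by (metis mset_normal_order set_mset_mset)

lemma normal_order_cong: "(\<And>x. x \<in> set xs \<Longrightarrow> \<nu> x = \<nu>' x) \<Longrightarrow> normal_order \<nu> xs = normal_order \<nu>' xs"
  by (induction xs) auto

lemma sorted_wrt_normal_order: "sorted_wrt (\<lambda>x y. \<nu> x < 0 \<or> \<nu> y \<ge> 0) (normal_order \<nu> xs)"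
  by (induction xs) (auto simp: sorted_wrt_append)

text \<open>The weight when \<open>x\<close> carries the mode n and \<open>y\<close> the mode -n. In
  the last case \<open>y\<close> belongs to the operator further left, so the ordered pair is a(-n)
  a(n).\<close>

definition pair_weight :: "complex \<Rightarrow> ('a \<Rightarrow> nat) \<Rightarrow> 'a \<Rightarrow> 'a \<Rightarrow> int \<Rightarrow> complex" where
  "pair_weight q pt x y n =
     (if pt x = pt y then normal_weight q n
      else if pt x < pt y then ordered_weight q n else ordered_weight q (- n))"

lemma pair_weight_sym: "pair_weight q pt x y n = pair_weight q pt y x (- n)"
  by (simp add: pair_weight_def normal_weight_minus)

lemma sorted_wrt_concat_map:
  assumes "\<And>i. i \<in> set is \<Longrightarrow> sorted_wrt P (f i)"
    and "sorted_wrt (\<lambda>i j. \<forall>x\<in>set (f i). \<forall>y\<in>set (f j). P x y) is"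
  shows "sorted_wrt P (concat (map f is))"
  using assms by (induction "is") (auto simp: sorted_wrt_append)

text \<open>The ordered weight and \<open>pair_weight\<close> agree for letters in the order of the
  word. Since \<open>pair_weight\<close> is symmetric, the letters may then return to their original
  order.\<close>

lemma has_sum_trace_normal_order:
  fixes q :: complex and X :: "nat \<Rightarrow> 'a list"
  assumes q: "q \<noteq> 0" "norm q < 1"
    and dist: "distinct (concat (map X is))" and sorted: "sorted_wrt (<) is"
    and pt: "\<And>i x. i \<in> set is \<Longrightarrow> x \<in> set (X i) \<Longrightarrow> pt x = i"
  shows "((\<lambda>b. Poly_Mapping.lookup (heis_word \<nu> (concat (map (\<lambda>i. normal_order \<nu> (X i)) is)) (Poly_Mapping.single b 1)) b * q ^ wt b) has_sum
     1 / prodinf (\<lambda>n. 1 - q ^ Suc n) *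
     hafnian (\<lambda>x y. if \<nu> y = - \<nu> x then pair_weight q pt x y (\<nu> x) else 0) (concat (map X is))) UNIV"
proof -
  let ?L = "concat (map (\<lambda>i. normal_order \<nu> (X i)) is)"
  let ?g = "\<lambda>x y. if \<nu> y = - \<nu> x then pair_weight q pt x y (\<nu> x) else 0"
  let ?S = "\<lambda>x y. if \<nu> y = - \<nu> x then ordered_weight q (\<nu> x) else 0"
  have mset: "mset ?L = mset (concat (map X is))"
    by (induction "is") auto
  have "sorted_wrt (\<lambda>x y. ?S x y = ?g x y) ?L"
  proof (rule sorted_wrt_concat_map)
    fix i assume i: "i \<in> set is"
    show "sorted_wrt (\<lambda>x y. ?S x y = ?g x y) (normal_order \<nu> (X i))"
    proof (rule sorted_wrt_mono_rel[OF _ sorted_wrt_normal_order])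
      fix x y assume "x \<in> set (normal_order \<nu> (X i))" "y \<in> set (normal_order \<nu> (X i))" "\<nu> x < 0 \<or> 0 \<le> \<nu> y"
      \<comment> \<open>Inside a normally ordered block a contracted pair has its creating letter
        first, and there the two weights coincide.\<close>
      moreover from this have "\<nu> y = - \<nu> x \<Longrightarrow> \<nu> x \<noteq> 0 \<Longrightarrow> \<nu> x < 0" by linarith
      ultimately show "?S x y = ?g x y"
        using pt[OF i] ordered_weight_neg[OF q, of "\<nu> x"]
        by (cases "\<nu> x = 0") (auto simp: pair_weight_def ordered_weight_def normal_weight_def)
    qed
  next
    show "sorted_wrt (\<lambda>i j. \<forall>x\<in>set (normal_order \<nu> (X i)). \<forall>y\<in>set (normal_order \<nu> (X j)). ?S x y = ?g x y) is"
      by (rule sorted_wrt_mono_rel[OF _ sorted]) (auto simp: pair_weight_def pt)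
  qed
  then have "hafnian ?S ?L = hafnian ?g ?L" by (rule hafnian_cong_sorted)
  also have "\<dots> = hafnian ?g (concat (map X is))"
  proof (rule hafnian_perm[OF _ mset])
    fix x y show "?g x y = ?g y x" using pair_weight_sym[of q pt x y "\<nu> x"] by auto
  qed
  finally show ?thesis
    using has_sum_trace_heis_word[OF q, of ?L \<nu>] dist mset
    by (metis (no_types, lifting) mset_eq_imp_distinct_iff)
qed

text \<open>Once the partner of the first letter is chosen, the condition
  \<open>\<nu> y = - \<nu> x\<close> leaves one free integer for this pair, independent of the modes
  of the other letters. So each term of the expansion is a single series times a smaller
  instance.\<close>

lemma has_sum_hafnian_modes:
  fixes c :: "'a \<Rightarrow> int \<Rightarrow> complex" and w :: "'a \<Rightarrow> 'a \<Rightarrow> int \<Rightarrow> complex"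
  assumes "distinct L"
    and "\<And>x y. x \<in> set L \<Longrightarrow> y \<in> set L \<Longrightarrow> x \<noteq> y \<Longrightarrow>
           ((\<lambda>n. c x n * c y (- n) * w x y n) has_sum S x y) UNIV"
  shows "((\<lambda>\<nu>. (\<Prod>x\<in>set L. c x (\<nu> x)) * hafnian (\<lambda>x y. if \<nu> y = - \<nu> x then w x y (\<nu> x) else 0) L)
     has_sum hafnian S L) (set L \<rightarrow>\<^sub>E UNIV)"
  using assms
proof (induction L rule: length_induct)
  case (1 L)
  let ?g = "\<lambda>\<nu> x y. if \<nu> y = - \<nu> x then w x y (\<nu> x) else 0"
  show ?case
  proof (cases L)
    case Nil
    then show ?thesis by (simp add: has_sum_finite_iff)
  next
    case (Cons x L')
    have "((\<lambda>\<nu>. (\<Prod>x\<in>set L. c x (\<nu> x)) * (?g \<nu> x y * hafnian (?g \<nu>) (remove1 y L'))) has_sum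
        S x y * hafnian S (remove1 y L')) (set L \<rightarrow>\<^sub>E UNIV)" if y: "y \<in> set L'" for y
    proof -
      define R where "R = remove1 y L'"
      have dist: "distinct L'" "x \<notin> set L'" "x \<noteq> y" using 1 Cons y by auto
      have setL: "set L = insert x (insert y (set R))" and R: "x \<notin> set R" "y \<notin> set R" "distinct R"
        using dist y by (auto simp: R_def Cons)
      have "((\<lambda>\<nu>. (\<Prod>x\<in>set R. c x (\<nu> x)) * hafnian (?g \<nu>) R) has_sum hafnian S R) (set R \<rightarrow>\<^sub>E UNIV)"
      proof (rule 1(1)[rule_format])
        show "length R < length L" using y by (auto simp: R_def Cons length_remove1)
        show "distinct R" by fact
        show "((\<lambda>n. c u n * c v (- n) * w u v n) has_sum S u v) UNIV"
          if "u \<in> set R" "v \<in> set R" "u \<noteq> v" for u v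
          using that 1(3) setL by auto
      qed
      moreover have "((\<lambda>n. c x n * c y (- n) * w x y n) has_sum S x y) UNIV"
        using 1 dist y Cons by auto
      ultimately have "((\<lambda>(n, \<nu>). c x n * c y (- n) * w x y n * ((\<Prod>x\<in>set R. c x (\<nu> x)) * hafnian (?g \<nu>) R))
          has_sum S x y * hafnian S R) (UNIV \<times> (set R \<rightarrow>\<^sub>E UNIV))"
        by (rule has_sum_times[rotated])
      also have "?this \<longleftrightarrow> ((\<lambda>\<nu>. (\<Prod>x\<in>set L. c x (\<nu> x)) * (?g \<nu> x y * hafnian (?g \<nu>) R)) has_sum
        S x y * hafnian S R) {\<nu> \<in> set L \<rightarrow>\<^sub>E UNIV. \<nu> y = - \<nu> x}"
      proof (rule has_sum_reindex_bij_witness[where j = "\<lambda>(n, \<nu>). \<nu>(x := n, y := - n)" and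
            i = "\<lambda>\<nu>. (\<nu> x, restrict \<nu> (set R))"])
        fix a :: "int \<times> ('a \<Rightarrow> int)" assume "a \<in> UNIV \<times> (set R \<rightarrow>\<^sub>E UNIV)"
        then obtain n \<nu> where a: "a = (n, \<nu>)" "\<nu> \<in> set R \<rightarrow>\<^sub>E UNIV" by auto
        show "((case a of (n, \<nu>) \<Rightarrow> \<nu>(x := n, y := - n)) x, restrict (case a of (n, \<nu>) \<Rightarrow> \<nu>(x := n, y := - n)) (set R)) = a"
          using a R \<open>x \<noteq> y\<close> by (auto simp: restrict_def fun_eq_iff PiE_def extensional_def)
        show "(case a of (n, \<nu>) \<Rightarrow> \<nu>(x := n, y := - n)) \<in> {\<nu> \<in> set L \<rightarrow>\<^sub>E UNIV. \<nu> y = - \<nu> x}"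
          using a R \<open>x \<noteq> y\<close> setL by (auto simp: PiE_def extensional_def)
        have p: "(\<Prod>z\<in>set R. c z ((\<nu>(x := n, y := - n)) z)) = (\<Prod>z\<in>set R. c z (\<nu> z))"
          using R by (intro prod.cong) auto
        have h: "hafnian (?g (\<nu>(x := n, y := - n))) R = hafnian (?g \<nu>) R"
          using R by (intro hafnian_cong) auto
        show "(\<Prod>z\<in>set L. c z ((case a of (n, \<nu>) \<Rightarrow> \<nu>(x := n, y := - n)) z)) *
          (?g (case a of (n, \<nu>) \<Rightarrow> \<nu>(x := n, y := - n)) x y * hafnian (?g (case a of (n, \<nu>) \<Rightarrow> \<nu>(x := n, y := - n))) R)
          = (case a of (n, \<nu>) \<Rightarrow> c x n * c y (- n) * w x y n * ((\<Prod>x\<in>set R. c x (\<nu> x)) * hafnian (?g \<nu>) R))"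
          unfolding a(1) prod.case h setL using R \<open>x \<noteq> y\<close> p by (simp add: mult_ac)
      next
        fix \<nu> :: "'a \<Rightarrow> int" assume \<nu>: "\<nu> \<in> {\<nu> \<in> set L \<rightarrow>\<^sub>E UNIV. \<nu> y = - \<nu> x}"
        show "(case (\<nu> x, restrict \<nu> (set R)) of (n, \<nu>) \<Rightarrow> \<nu>(x := n, y := - n)) = \<nu>"
          using \<nu> R setL by (auto simp: fun_eq_iff PiE_def extensional_def restrict_def)
        show "(\<nu> x, restrict \<nu> (set R)) \<in> UNIV \<times> (set R \<rightarrow>\<^sub>E UNIV)" by auto
      qed simp
      also have "\<dots> \<longleftrightarrow> ((\<lambda>\<nu>. (\<Prod>x\<in>set L. c x (\<nu> x)) * (?g \<nu> x y * hafnian (?g \<nu>) R)) has_sum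
        S x y * hafnian S R) (set L \<rightarrow>\<^sub>E UNIV)"
        by (rule has_sum_cong_neutral) auto
      finally show ?thesis by (simp add: R_def)
    qed
    from has_sum_sum_list[of L', OF this]
    show ?thesis by (simp add: Cons sum_list_const_mult mult.assoc)
  qed
qed

subsection \<open>Sums with finite support\<close>

text \<open>
  Finite support is part of the predicate, since \<open>Sum_any\<close> silently is \<open>0\<close> without it.
\<close>

definition finsums :: "('i \<Rightarrow> 'b::comm_monoid_add) \<Rightarrow> 'i set \<Rightarrow> 'b \<Rightarrow> bool" where
  "finsums f I v \<longleftrightarrow> finite {x \<in> I. f x \<noteq> 0} \<and> sum f {x \<in> I. f x \<noteq> 0} = v"

lemma finsums_superset:
  assumes "finite A" "A \<subseteq> I" "\<And>x. x \<in> I - A \<Longrightarrow> f x = 0"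
  shows "finsums f I (sum f A)"
  unfolding finsums_def
proof
  have "{x \<in> I. f x \<noteq> 0} \<subseteq> A" using assms by auto
  then show "finite {x \<in> I. f x \<noteq> 0}" using assms(1) finite_subset by blast
  show "sum f {x \<in> I. f x \<noteq> 0} = sum f A"
    using assms by (intro sum.mono_neutral_left) auto
qed

lemma finsums_unique: "finsums f I v \<Longrightarrow> finsums f I v' \<Longrightarrow> v = v'"
  by (simp add: finsums_def)

lemma finsums_sum_superset:
  assumes "finsums f I v" "finite A" "A \<subseteq> I" "{x \<in> I. f x \<noteq> 0} \<subseteq> A"
  shows "sum f A = v"
proof -
  have "sum f A = sum f {x \<in> I. f x \<noteq> 0}"
    using assms(2-4) by (intro sum.mono_neutral_right) auto
  then show ?thesis using assms(1) by (simp add: finsums_def)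
qed

lemma finsums_add:
  assumes "finsums f I a" "finsums g I b"
  shows "finsums (\<lambda>x. f x + g x) I (a + b)"
proof -
  let ?A = "{x \<in> I. f x \<noteq> 0} \<union> {x \<in> I. g x \<noteq> 0}"
  have fin: "finite ?A" using assms by (simp add: finsums_def)
  have "finsums (\<lambda>x. f x + g x) I (sum (\<lambda>x. f x + g x) ?A)"
    using fin by (intro finsums_superset) auto
  moreover have "sum (\<lambda>x. f x + g x) ?A = a + b"
    unfolding sum.distrib
    using finsums_sum_superset[OF assms(1) fin] finsums_sum_superset[OF assms(2) fin] by auto
  ultimately show ?thesis by simp
qed

lemma finsums_hom:
  assumes "finsums f I v" "h 0 = 0" "\<And>a b. h (a + b) = h a + h b"
  shows "finsums (\<lambda>x. h (f x)) I (h v)"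
proof -
  have h: "h (sum f A) = (\<Sum>x\<in>A. h (f x))" if "finite A" for A
    using that by (induction A rule: finite_induct) (simp_all add: assms)
  show ?thesis
    using assms(1) h finsums_superset[of "{x \<in> I. f x \<noteq> 0}" I "\<lambda>x. h (f x)"] assms(2)
    by (auto simp: finsums_def)
qed

text \<open>Fubini for finite support. Finiteness is assumed on the pairs, because finite inner
  supports say nothing about the outer one.\<close>

lemma finsums_Sigma:
  assumes fin: "finite {p \<in> Sigma I J. f p \<noteq> 0}"
    and inner: "\<And>x. x \<in> I \<Longrightarrow> finsums (\<lambda>y. f (x, y)) (J x) (v x)"
  shows "finite {x \<in> I. v x \<noteq> 0}" "finsums f (Sigma I J) (sum v {x \<in> I. v x \<noteq> 0})"
proof -
  let ?P = "{p \<in> Sigma I J. f p \<noteq> 0}"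
  have sub: "{x \<in> I. v x \<noteq> 0} \<subseteq> fst ` ?P"
  proof
    fix x assume x: "x \<in> {x \<in> I. v x \<noteq> 0}"
    then have "sum (\<lambda>y. f (x, y)) {y \<in> J x. f (x, y) \<noteq> 0} \<noteq> 0"
      using inner[of x] by (auto simp: finsums_def)
    then obtain y where "y \<in> J x" "f (x, y) \<noteq> 0"
      using sum.neutral by (metis (mono_tags, lifting) mem_Collect_eq)
    then show "x \<in> fst ` ?P" using x by force
  qed
  show fv: "finite {x \<in> I. v x \<noteq> 0}" using fin sub finite_subset by blast
  have "?P = Sigma (fst ` ?P) (\<lambda>x. {y \<in> J x. f (x, y) \<noteq> 0})" by force
  then have "sum f ?P = sum f (Sigma (fst ` ?P) (\<lambda>x. {y \<in> J x. f (x, y) \<noteq> 0}))" by simp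
  also have "\<dots> = (\<Sum>x\<in>fst ` ?P. \<Sum>y\<in>{y \<in> J x. f (x, y) \<noteq> 0}. f (x, y))"
    using fin inner by (subst sum.Sigma) (auto simp: finsums_def)
  also have "\<dots> = (\<Sum>x\<in>fst ` ?P. v x)"
    using inner by (intro sum.cong) (auto simp: finsums_def)
  also have "\<dots> = sum v {x \<in> I. v x \<noteq> 0}"
    using fin sub by (intro sum.mono_neutral_right) auto
  finally show "finsums f (Sigma I J) (sum v {x \<in> I. v x \<noteq> 0})"
    using fin by (simp add: finsums_def)
qed

lemma finsums_reindex_bij_witness:
  assumes "\<And>a. a \<in> S \<Longrightarrow> i (j a) = a" "\<And>a. a \<in> S \<Longrightarrow> j a \<in> T"
    "\<And>b. b \<in> T \<Longrightarrow> j (i b) = b" "\<And>b. b \<in> T \<Longrightarrow> i b \<in> S"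
    "\<And>a. a \<in> S \<Longrightarrow> h (j a) = g a"
  shows "finsums g S v \<longleftrightarrow> finsums h T v"
proof -
  have gi: "g (i b) = h b" if "b \<in> T" for b using assms(3,4)[OF that] assms(5)[of "i b"] by simp
  have b: "bij_betw j {x \<in> S. g x \<noteq> 0} {x \<in> T. h x \<noteq> 0}"
    using assms by (intro bij_betw_byWitness[where f' = i]) (auto simp: gi)
  have "sum h {x \<in> T. h x \<noteq> 0} = sum g {x \<in> S. g x \<noteq> 0}"
    by (rule sum.reindex_bij_witness[where i = j and j = i]) (use assms in \<open>auto simp: gi\<close>)
  then show ?thesis using bij_betw_finite[OF b] by (simp add: finsums_def)
qed

lemma finsums_has_sum:
  fixes f :: "'i \<Rightarrow> 'b::{comm_monoid_add, t2_space}"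
  assumes "finsums f I v" shows "(f has_sum v) I"
  using assms unfolding finsums_def
  by (intro has_sum_finite_neutralI[of "{x \<in> I. f x \<noteq> 0}"]) auto

subsection \<open>Expansion of vertex operators into normally ordered words\<close>

text \<open>With the index shift, only the variables a(-1), ..., a(-M) occur in \<open>w\<close>;
  hence a(n) annihilates \<open>w\<close> for n > M.\<close>

definition mode_bound :: "nat \<Rightarrow> fock \<Rightarrow> bool" where
  "mode_bound M w \<longleftrightarrow> (\<forall>b\<in>Poly_Mapping.keys w. set_mset b \<subseteq> {..<M})"

lemma ex_mode_bound: "\<exists>M. mode_bound M w"
proof -
  have "finite (\<Union>b\<in>Poly_Mapping.keys w. set_mset b)" by auto
  then obtain M where "(\<Union>b\<in>Poly_Mapping.keys w. set_mset b) \<subseteq> {..<M}"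
    using finite_nat_bounded by blast
  then have "mode_bound M w" unfolding mode_bound_def by blast
  then show ?thesis ..
qed

lemma mode_bound_heis:
  assumes "mode_bound M w" "n \<ge> 0"
  shows "mode_bound M (heis n w)" "heis n w \<noteq> 0 \<Longrightarrow> n \<le> int M"
proof -
  show "mode_bound M (heis n w)"
  proof (cases "n = 0")
    case False
    define j where "j = nat (n - 1)"
    have n: "n = int j + 1" using False assms by (simp add: j_def)
    have "set_mset b \<subseteq> {..<M}" if "b \<in> Poly_Mapping.keys (heis n w)" for b
    proof -
      have "add_mset j b \<in> Poly_Mapping.keys w"
        using that unfolding n in_keys_iff lookup_heis_pos by (metis mult_zero_right)
      then have "set_mset (add_mset j b) \<subseteq> {..<M}" using assms(1) by (simp only: mode_bound_def)
      then show ?thesis by simp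
    qed
    then show ?thesis unfolding mode_bound_def by blast
  qed (simp add: mode_bound_def)
  show "n \<le> int M" if "heis n w \<noteq> 0"
  proof (rule ccontr)
    assume c: "\<not> n \<le> int M"
    define j where "j = nat (n - 1)"
    have n: "n = int j + 1" "j \<ge> M" using c by (simp_all add: j_def)
    have "Poly_Mapping.lookup w (add_mset j c) = 0" for c
    proof (rule ccontr)
      assume "Poly_Mapping.lookup w (add_mset j c) \<noteq> 0"
      then have "add_mset j c \<in> Poly_Mapping.keys w" by (simp only: in_keys_iff not_False_eq_True)
      then have "set_mset (add_mset j c) \<subseteq> {..<M}"
        using assms(1) by (simp only: mode_bound_def)
      with n(2) show False by simp
    qed
    then have "heis n w = 0"
      by (intro poly_mapping_eqI) (simp only: n(1) lookup_heis_pos mult_zero_right lookup_zero)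
    with that show False by simp
  qed
qed

lemma heis_word_zero [simp]: "heis_word \<nu> L 0 = 0"
  using module_hom.zero[OF module_hom_heis_word] .

text \<open>The letters of nonnegative mode act first and do not raise the bound, so each of them
  meets a vector that every mode above \<open>M\<close> annihilates.\<close>

lemma normal_order_mode_bound:
  "mode_bound M w \<Longrightarrow> heis_word \<nu> (normal_order \<nu> xs) w \<noteq> 0 \<Longrightarrow> x \<in> set xs \<Longrightarrow> \<nu> x \<le> int M"
proof (induction xs arbitrary: w)
  case (Cons y xs)
  show ?case
  proof (cases "\<nu> y < 0")
    case True
    then have "heis_word \<nu> (normal_order \<nu> xs) w \<noteq> 0" using Cons.prems by auto
    then show ?thesis using Cons True by auto
  next
    case False
    have *: "heis_word \<nu> (normal_order \<nu> xs) (heis (\<nu> y) w) \<noteq> 0"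
      using False Cons.prems by (simp add: heis_word_append)
    then have "heis (\<nu> y) w \<noteq> 0" by auto
    with mode_bound_heis[OF Cons.prems(1)] False have "\<nu> y \<le> int M" "mode_bound M (heis (\<nu> y) w)" by auto
    then show ?thesis using Cons.IH[OF _ *] Cons.prems by auto
  qed
qed simp

text \<open>With the total fixed, upper bounds on all values force a lower bound on each.\<close>

lemma finite_PiE_sum_bounded:
  fixes d :: "'a \<Rightarrow> int"
  assumes A: "finite A"
  shows "finite {\<nu> \<in> A \<rightarrow>\<^sub>E UNIV. (\<Sum>x\<in>A. \<nu> x + d x) = N \<and> (\<forall>x\<in>A. \<nu> x \<le> int M)}"
proof -
  define lo where "lo = N - (\<Sum>x\<in>A. d x) - int (card A) * int M"
  have "{\<nu> \<in> A \<rightarrow>\<^sub>E UNIV. (\<Sum>x\<in>A. \<nu> x + d x) = N \<and> (\<forall>x\<in>A. \<nu> x \<le> int M)} \<subseteq> A \<rightarrow>\<^sub>E {lo..int M}"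
  proof
    fix \<nu> assume "\<nu> \<in> {\<nu> \<in> A \<rightarrow>\<^sub>E UNIV. (\<Sum>x\<in>A. \<nu> x + d x) = N \<and> (\<forall>x\<in>A. \<nu> x \<le> int M)}"
    then have \<nu>: "\<nu> \<in> A \<rightarrow>\<^sub>E UNIV" "(\<Sum>x\<in>A. \<nu> x) + (\<Sum>x\<in>A. d x) = N" "\<And>x. x \<in> A \<Longrightarrow> \<nu> x \<le> int M"
      by (auto simp: sum.distrib)
    have "lo \<le> \<nu> x" if x: "x \<in> A" for x
    proof -
      have "(\<Sum>x\<in>A. \<nu> x) = \<nu> x + (\<Sum>x\<in>A - {x}. \<nu> x)" using A x by (rule sum.remove)
      moreover have "(\<Sum>x\<in>A - {x}. \<nu> x) \<le> int (card (A - {x})) * int M"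
        using sum_bounded_above[of "A - {x}" \<nu> "int M"] \<nu>(3) by auto
      moreover have "int (card (A - {x})) * int M \<le> int (card A) * int M"
        using A by (intro mult_right_mono) (auto intro: card_mono)
      ultimately show ?thesis using \<nu>(2) by (simp add: lo_def)
    qed
    then show "\<nu> \<in> A \<rightarrow>\<^sub>E {lo..int M}" using \<nu> by (auto simp: PiE_def)
  qed
  moreover have "finite (A \<rightarrow>\<^sub>E {lo..int M})" using A by (intro finite_PiE) auto
  ultimately show ?thesis by (rule finite_subset)
qed

text \<open>A factor with derivative index j and mode n carries z^(-n-1-j), and the N-th mode of the
  product collects the terms with z^(-N-1).\<close>

definition mode_fun :: "'a set \<Rightarrow> ('a \<Rightarrow> nat) \<Rightarrow> int \<Rightarrow> ('a \<Rightarrow> int) set" where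
  "mode_fun A jf N = {\<nu> \<in> A \<rightarrow>\<^sub>E UNIV. (\<Sum>x\<in>A. \<nu> x + int (jf x) + 1) = N + 1}"

lemma finite_normal_order_support:
  "finite {\<nu> \<in> mode_fun (set xs) jf N. heis_word \<nu> (normal_order \<nu> xs) w \<noteq> 0}"
proof -
  obtain M where M: "mode_bound M w" using ex_mode_bound by blast
  show ?thesis
    by (rule finite_subset[OF _ finite_PiE_sum_bounded[of "set xs" "\<lambda>x. int (jf x) + 1" "N + 1" M]])
       (use normal_order_mode_bound[OF M] in \<open>auto simp: mode_fun_def add.assoc\<close>)
qed

text \<open>The head of the list contributes one integer and the tail a mode assignment; gluing the
  two turns the nested sums of \<open>vop_list\<close> into one sum over assignments.\<close>

lemma finsums_vop_list:
  "distinct xs \<Longrightarrow> finsums (\<lambda>\<nu>. smul (\<Prod>x\<in>set xs. of_int (- \<nu> x - 1) gchoose jf x) (heis_word \<nu> (normal_order \<nu> xs) w))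
     (mode_fun (set xs) jf N) (vop_list (map jf xs) N w)"
proof (induction xs arbitrary: N w)
  case Nil
  have "mode_fun {} jf N = (if N = -1 then {\<lambda>x. undefined} else {})" for jf :: "'a \<Rightarrow> nat"
    by (auto simp: mode_fun_def)
  then show ?case by (cases "w = 0") (auto simp: finsums_def)
next
  case (Cons x xs)
  let ?f = "\<lambda>\<nu>. smul (\<Prod>x\<in>set (x # xs). of_int (- \<nu> x - 1) gchoose jf x) (heis_word \<nu> (normal_order \<nu> (x # xs)) w)"
  let ?J = "\<lambda>n. mode_fun (set xs) jf (N - n - 1 - int (jf x))"
  define v where "v = (\<lambda>n. smul (of_int (- n - 1) gchoose jf x)
     (if n < 0 then heis n (vop_list (map jf xs) (N - n - 1 - int (jf x)) w)
      else vop_list (map jf xs) (N - n - 1 - int (jf x)) (heis n w)))"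
  define h where "h = (\<lambda>(n, \<nu>). ?f (\<nu>(x := n)))"
  have x: "x \<notin> set xs" "distinct xs" using Cons.prems by auto
  have reindex: "finsums h (Sigma UNIV ?J) s \<longleftrightarrow> finsums ?f (mode_fun (set (x # xs)) jf N) s" for s
  proof (rule finsums_reindex_bij_witness[where j = "\<lambda>(n, \<nu>). \<nu>(x := n)" and i = "\<lambda>\<nu>. (\<nu> x, restrict \<nu> (set xs))"])
    fix a assume "a \<in> Sigma UNIV ?J"
    then obtain n \<nu> where a: "a = (n, \<nu>)" "\<nu> \<in> ?J n" by auto
    have e: "(\<nu>(x := n)) u = \<nu> u" if "u \<in> set xs" for u using that x by auto
    show "((case a of (n, \<nu>) \<Rightarrow> \<nu>(x := n)) x, restrict (case a of (n, \<nu>) \<Rightarrow> \<nu>(x := n)) (set xs)) = a"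
      using a x by (auto simp: restrict_def fun_eq_iff mode_fun_def PiE_def extensional_def)
    have "(\<Sum>u\<in>set xs. (\<nu>(x := n)) u + int (jf u) + 1) = (\<Sum>u\<in>set xs. \<nu> u + int (jf u) + 1)"
      using e by (intro sum.cong) auto
    then show "(case a of (n, \<nu>) \<Rightarrow> \<nu>(x := n)) \<in> mode_fun (set (x # xs)) jf N"
      using a x by (auto simp: mode_fun_def PiE_def extensional_def)
    show "?f (case a of (n, \<nu>) \<Rightarrow> \<nu>(x := n)) = h a" by (simp add: a h_def)
  next
    fix \<nu> assume \<nu>: "\<nu> \<in> mode_fun (set (x # xs)) jf N"
    show "(case (\<nu> x, restrict \<nu> (set xs)) of (n, \<nu>) \<Rightarrow> \<nu>(x := n)) = \<nu>"
      using \<nu> x by (auto simp: mode_fun_def fun_eq_iff PiE_def extensional_def restrict_def)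
    show "(\<nu> x, restrict \<nu> (set xs)) \<in> Sigma UNIV ?J"
      using \<nu> x by (auto simp: mode_fun_def)
  qed
  have h: "h (n, \<nu>) = smul (of_int (- n - 1) gchoose jf x)
       (if n < 0 then heis n (smul (\<Prod>x\<in>set xs. of_int (- \<nu> x - 1) gchoose jf x) (heis_word \<nu> (normal_order \<nu> xs) w))
        else smul (\<Prod>x\<in>set xs. of_int (- \<nu> x - 1) gchoose jf x) (heis_word \<nu> (normal_order \<nu> xs) (heis n w)))" for n \<nu>
  proof -
    have no: "normal_order (\<nu>(x := n)) xs = normal_order \<nu> xs" using x by (intro normal_order_cong) auto
    have hw: "heis_word (\<nu>(x := n)) (normal_order \<nu> xs) u = heis_word \<nu> (normal_order \<nu> xs) u" for u
      unfolding heis_word_def using x by (intro foldr_cong) auto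
    have p: "(\<Prod>u\<in>set xs. of_int (- (\<nu>(x := n)) u - 1) gchoose jf u) = (\<Prod>u\<in>set xs. (of_int (- \<nu> u - 1)::complex) gchoose jf u)"
      using x by (intro prod.cong) auto
    have "(\<Prod>u\<in>set (x # xs). (of_int (- (\<nu>(x := n)) u - 1) :: complex) gchoose jf u) =
      (of_int (- n - 1) gchoose jf x) * (\<Prod>u\<in>set xs. of_int (- \<nu> u - 1) gchoose jf u)"
      using x p by simp
    then show ?thesis unfolding h_def prod.case
      using no hw by (simp add: heis_word_append heis_smul smul_smul)
  qed
  have inner: "finsums (\<lambda>\<nu>. h (n, \<nu>)) (?J n) (v n)" for n
  proof (cases "n < 0")
    case True
    have "finsums (\<lambda>\<nu>. smul (of_int (- n - 1) gchoose jf x) (heis n (smul (\<Prod>x\<in>set xs. of_int (- \<nu> x - 1) gchoose jf x) (heis_word \<nu> (normal_order \<nu> xs) w))))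
       (?J n) (smul (of_int (- n - 1) gchoose jf x) (heis n (vop_list (map jf xs) (N - n - 1 - int (jf x)) w)))"
      by (rule finsums_hom[OF Cons.IH[OF x(2)]]) (simp_all add: heis_add smul_add)
    with True show ?thesis by (simp add: h v_def)
  next
    case False
    have "finsums (\<lambda>\<nu>. smul (of_int (- n - 1) gchoose jf x) (smul (\<Prod>x\<in>set xs. of_int (- \<nu> x - 1) gchoose jf x) (heis_word \<nu> (normal_order \<nu> xs) (heis n w))))
       (?J n) (smul (of_int (- n - 1) gchoose jf x) (vop_list (map jf xs) (N - n - 1 - int (jf x)) (heis n w)))"
      by (rule finsums_hom[OF Cons.IH[OF x(2)]]) (simp_all add: smul_add)
    with False show ?thesis by (simp add: h v_def)
  qed
  \<comment> \<open>Finiteness cannot be read off the nested sums. It comes from the glued word: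
    normal ordering bounds every mode from above, and the fixed total does the rest.\<close>
  have fin: "finite {p \<in> Sigma UNIV ?J. h p \<noteq> 0}"
  proof -
    have f: "finite {\<nu> \<in> mode_fun (set (x # xs)) jf N. ?f \<nu> \<noteq> 0}"
      by (rule finite_subset[OF _ finite_normal_order_support[of "x # xs" jf N w]]) auto
    define s where "s = sum ?f {\<nu> \<in> mode_fun (set (x # xs)) jf N. ?f \<nu> \<noteq> 0}"
    have "finsums ?f (mode_fun (set (x # xs)) jf N) s"
      using f unfolding finsums_def s_def by (rule conjI[OF _ refl])
    then show ?thesis unfolding reindex[symmetric] by (simp add: finsums_def)
  qed
  have "vop_list (map jf (x # xs)) N w = Sum_any v"
    by (simp add: v_def)
  also have "\<dots> = sum v {n \<in> UNIV. v n \<noteq> 0}"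
    by (simp add: Sum_any.expand_set)
  finally show ?case
    using finsums_Sigma(2)[of UNIV ?J h v, OF fin inner] reindex by simp
qed

lemma module_hom_vop_list: "module_hom smul smul (vop_list js N)"
proof -
  \<comment> \<open>Positions serve as labels, since the entries of \<open>js\<close> may
    repeat.\<close>
  define xs jf where "xs = [0..<length js]" and "jf = (\<lambda>k. js ! k)"
  have js: "js = map jf xs" "distinct xs" by (simp_all add: xs_def jf_def map_nth)
  interpret H: module_hom smul smul "heis_word \<nu> L" for \<nu> :: "nat \<Rightarrow> int" and L by (rule module_hom_heis_word)
  show ?thesis
  proof unfold_locales
    fix v w c
    note F = finsums_vop_list[OF js(2), of jf _ N, folded js(1)]
    show "vop_list js N (v + w) = vop_list js N v + vop_list js N w"
      by (rule finsums_unique[OF F]) (use finsums_add[OF F[of v] F[of w]] in \<open>simp add: H.add smul_add\<close>)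
    show "vop_list js N (smul c v) = smul c (vop_list js N v)"
      by (rule finsums_unique[OF F]) (use finsums_hom[OF F[of v], of "smul c"] in \<open>simp add: H.scale smul_add smul_smul mult.commute\<close>)
  qed
qed

lemma finsums_vop_chain:
  assumes "distinct (concat (map X is))" "distinct is"
  shows "finsums (\<lambda>\<nu>. smul (\<Prod>x\<in>set (concat (map X is)). of_int (- \<nu> x - 1) gchoose jf x)
       (heis_word \<nu> (concat (map (\<lambda>i. normal_order \<nu> (X i)) is)) w))
     {\<nu> \<in> set (concat (map X is)) \<rightarrow>\<^sub>E UNIV. \<forall>i\<in>set is. (\<Sum>x\<in>set (X i). \<nu> x + int (jf x) + 1) = ms i + 1}
     (foldr (\<lambda>i. vop_list (map jf (X i)) (ms i)) is w)"
  using assms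
proof (induction "is")
  case Nil
  then show ?case by (cases "w = 0") (auto simp: finsums_def)
next
  case (Cons i "is")
  let ?L = "concat (map X is)"
  let ?w = "\<lambda>\<nu>. concat (map (\<lambda>i. normal_order \<nu> (X i)) is)"
  let ?A = "mode_fun (set (X i)) jf (ms i)"
  let ?B = "{\<nu> \<in> set ?L \<rightarrow>\<^sub>E UNIV. \<forall>i\<in>set is. (\<Sum>x\<in>set (X i). \<nu> x + int (jf x) + 1) = ms i + 1}"
  let ?C = "{\<nu> \<in> set (concat (map X (i # is))) \<rightarrow>\<^sub>E UNIV. \<forall>i\<in>set (i # is). (\<Sum>x\<in>set (X i). \<nu> x + int (jf x) + 1) = ms i + 1}"
  let ?c = "\<lambda>\<nu> A. \<Prod>x\<in>A. (of_int (- \<nu> x - 1) :: complex) gchoose jf x"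
  let ?f = "\<lambda>\<nu>. smul (?c \<nu> (set (concat (map X (i # is)))))
       (heis_word \<nu> (concat (map (\<lambda>i. normal_order \<nu> (X i)) (i # is))) w)"
  let ?t = "\<lambda>\<nu>. smul (?c \<nu> (set ?L)) (heis_word \<nu> (?w \<nu>) w)"
  define R where "R = foldr (\<lambda>i. vop_list (map jf (X i)) (ms i)) is w"
  have d: "distinct (X i)" "distinct ?L" "set (X i) \<inter> set ?L = {}" "distinct is" "i \<notin> set is"
    using Cons.prems by auto
  have IH: "finsums ?t ?B R" unfolding R_def using Cons d by blast
  interpret H: module_hom smul smul "heis_word \<nu> L" for \<nu> :: "'a \<Rightarrow> int" and L by (rule module_hom_heis_word)
  define h where "h = (\<lambda>(\<nu>1, \<nu>2). smul (?c \<nu>1 (set (X i))) (heis_word \<nu>1 (normal_order \<nu>1 (X i)) (?t \<nu>2)))"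
  define v where "v = (\<lambda>\<nu>1. smul (?c \<nu>1 (set (X i))) (heis_word \<nu>1 (normal_order \<nu>1 (X i)) R))"
  let ?m = "\<lambda>\<nu>1 \<nu>2 x. if x \<in> set (X i) then \<nu>1 x else \<nu>2 x"
  have reindex: "finsums h (?A \<times> ?B) s \<longleftrightarrow> finsums ?f ?C s" for s
  proof (rule finsums_reindex_bij_witness[where j = "\<lambda>(\<nu>1, \<nu>2). ?m \<nu>1 \<nu>2" and
        i = "\<lambda>\<nu>. (restrict \<nu> (set (X i)), restrict \<nu> (set ?L))"])
    fix a assume "a \<in> ?A \<times> ?B"
    then obtain \<nu>1 \<nu>2 where a: "a = (\<nu>1, \<nu>2)" "\<nu>1 \<in> ?A" "\<nu>2 \<in> ?B" by auto
    have e1: "?m \<nu>1 \<nu>2 u = \<nu>1 u" if "u \<in> set (X i)" for u using that by auto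
    have e2: "?m \<nu>1 \<nu>2 u = \<nu>2 u" if "u \<in> set ?L" for u using that d(3) by auto
    have ext: "\<nu>1 u = undefined" if "u \<notin> set (X i)" for u
      using a that by (auto simp: mode_fun_def PiE_def extensional_def)
    have ext2: "\<nu>2 u = undefined" if "u \<notin> set ?L" for u
      using a that unfolding PiE_def extensional_def by blast
    have r1: "restrict (?m \<nu>1 \<nu>2) (set (X i)) = \<nu>1" and r2: "restrict (?m \<nu>1 \<nu>2) (set ?L) = \<nu>2"
      using e1 e2 ext ext2 by (auto simp: restrict_def fun_eq_iff)
    show "(restrict (case a of (\<nu>1, \<nu>2) \<Rightarrow> ?m \<nu>1 \<nu>2) (set (X i)), restrict (case a of (\<nu>1, \<nu>2) \<Rightarrow> ?m \<nu>1 \<nu>2) (set ?L)) = a"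
      using r1 r2 a(1) by simp
    have s1: "(\<Sum>u\<in>set (X i). ?m \<nu>1 \<nu>2 u + int (jf u) + 1) = ms i + 1"
      using a(2) by (auto simp: mode_fun_def)
    have s2: "(\<Sum>u\<in>set (X k). ?m \<nu>1 \<nu>2 u + int (jf u) + 1) = ms k + 1" if "k \<in> set is" for k
    proof -
      have "(\<Sum>u\<in>set (X k). ?m \<nu>1 \<nu>2 u + int (jf u) + 1) = (\<Sum>u\<in>set (X k). \<nu>2 u + int (jf u) + 1)"
      proof (rule sum.cong[OF refl])
        fix u assume "u \<in> set (X k)"
        then have "u \<in> set ?L" using that by auto
        from e2[OF this] show "?m \<nu>1 \<nu>2 u + int (jf u) + 1 = \<nu>2 u + int (jf u) + 1" by (simp only:)
      qed
      then show ?thesis using a(3) that by auto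
    qed
    have "?m \<nu>1 \<nu>2 \<in> set (concat (map X (i # is))) \<rightarrow>\<^sub>E UNIV"
      using ext2 by (auto simp: PiE_def extensional_def)
    then show "(case a of (\<nu>1, \<nu>2) \<Rightarrow> ?m \<nu>1 \<nu>2) \<in> ?C"
      unfolding a(1) prod.case using s1 s2 by auto
    have n1: "normal_order (?m \<nu>1 \<nu>2) (X i) = normal_order \<nu>1 (X i)"
      using e1 by (rule normal_order_cong)
    have n2: "?w (?m \<nu>1 \<nu>2) = ?w \<nu>2"
      by (intro arg_cong[where f=concat] map_cong refl normal_order_cong e2) auto
    have h1: "heis_word (?m \<nu>1 \<nu>2) (normal_order \<nu>1 (X i)) u = heis_word \<nu>1 (normal_order \<nu>1 (X i)) u" for u
      unfolding heis_word_def using e1 by (intro foldr_cong) auto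
    have h2: "heis_word (?m \<nu>1 \<nu>2) (?w \<nu>2) u = heis_word \<nu>2 (?w \<nu>2) u" for u
      unfolding heis_word_def
    proof (rule foldr_cong[OF refl refl])
      fix y v assume "y \<in> set (?w \<nu>2)"
      then have "y \<in> set ?L" by auto
      from e2[OF this] show "heis (?m \<nu>1 \<nu>2 y) v = heis (\<nu>2 y) v" by (simp only:)
    qed
    have c1: "?c (?m \<nu>1 \<nu>2) (set (X i)) = ?c \<nu>1 (set (X i))" using e1 by (intro prod.cong) auto
    have c2: "?c (?m \<nu>1 \<nu>2) (set ?L) = ?c \<nu>2 (set ?L)" by (intro prod.cong refl) (simp only: e2)
    have "?c (?m \<nu>1 \<nu>2) (set (concat (map X (i # is)))) = ?c \<nu>1 (set (X i)) * ?c \<nu>2 (set ?L)"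
    proof -
      have "set (concat (map X (i # is))) = set (X i) \<union> set ?L" by simp
      then show ?thesis using d(3) c1 c2 by (simp only: prod.union_disjoint[OF finite_set finite_set])
    qed
    then show "?f (case a of (\<nu>1, \<nu>2) \<Rightarrow> ?m \<nu>1 \<nu>2) = h a"
      unfolding a(1) prod.case h_def
      by (simp only: list.map concat.simps heis_word_append n1 n2 h1 h2 H.scale smul_smul)
  next
    fix \<nu> assume \<nu>: "\<nu> \<in> ?C"
    have "\<nu> x = undefined" if "x \<notin> set (X i)" "x \<notin> set ?L" for x
      using \<nu> that by (auto simp: PiE_def extensional_def)
    then show "(case (restrict \<nu> (set (X i)), restrict \<nu> (set ?L)) of (\<nu>1, \<nu>2) \<Rightarrow> ?m \<nu>1 \<nu>2) = \<nu>"
      by (auto simp: fun_eq_iff restrict_def)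
    have "(\<Sum>x\<in>set (X k). restrict \<nu> (set ?L) x + int (jf x) + 1) = ms k + 1" if "k \<in> set is" for k
    proof -
      have "(\<Sum>x\<in>set (X k). restrict \<nu> (set ?L) x + int (jf x) + 1) = (\<Sum>x\<in>set (X k). \<nu> x + int (jf x) + 1)"
        using that by (intro sum.cong) auto
      then show ?thesis using \<nu> that by auto
    qed
    moreover have "restrict \<nu> (set ?L) \<in> set ?L \<rightarrow>\<^sub>E UNIV" by auto
    moreover have "restrict \<nu> (set (X i)) \<in> ?A" using \<nu> by (auto simp: mode_fun_def)
    ultimately show "(restrict \<nu> (set (X i)), restrict \<nu> (set ?L)) \<in> ?A \<times> ?B" by blast
  qed
  have inner: "finsums (\<lambda>\<nu>2. h (\<nu>1, \<nu>2)) ?B (v \<nu>1)" for \<nu>1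
    unfolding h_def v_def prod.case by (rule finsums_hom[OF IH]) (simp_all add: H.add smul_add)
  have outer: "finsums v ?A (vop_list (map jf (X i)) (ms i) R)"
    unfolding v_def by (rule finsums_vop_list[OF d(1)])
  \<comment> \<open>The operators on the right come first: they leave finitely many nonzero vectors,
    and each of these admits finitely many mode assignments of the leftmost operator.\<close>
  have fin: "finite {p \<in> Sigma ?A (\<lambda>_. ?B). h p \<noteq> 0}"
  proof -
    let ?B' = "{\<nu>2 \<in> ?B. ?t \<nu>2 \<noteq> 0}"
    have "finite ?B'" using IH by (simp add: finsums_def)
    moreover have "finite {\<nu>1 \<in> ?A. heis_word \<nu>1 (normal_order \<nu>1 (X i)) (?t \<nu>2) \<noteq> 0}" for \<nu>2
      by (rule finite_normal_order_support)
    ultimately have "finite (Sigma ?B' (\<lambda>\<nu>2. {\<nu>1 \<in> ?A. heis_word \<nu>1 (normal_order \<nu>1 (X i)) (?t \<nu>2) \<noteq> 0}))"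
      by (rule finite_SigmaI)
    then have "finite (prod.swap ` Sigma ?B' (\<lambda>\<nu>2. {\<nu>1 \<in> ?A. heis_word \<nu>1 (normal_order \<nu>1 (X i)) (?t \<nu>2) \<noteq> 0}))"
      by (rule finite_imageI)
    moreover have "p \<in> prod.swap ` Sigma ?B' (\<lambda>\<nu>2. {\<nu>1 \<in> ?A. heis_word \<nu>1 (normal_order \<nu>1 (X i)) (?t \<nu>2) \<noteq> 0})"
      if p: "p \<in> {p \<in> Sigma ?A (\<lambda>_. ?B). h p \<noteq> 0}" for p
    proof -
      obtain \<nu>1 \<nu>2 where e: "p = (\<nu>1, \<nu>2)" "\<nu>1 \<in> ?A" "\<nu>2 \<in> ?B" "h (\<nu>1, \<nu>2) \<noteq> 0" using p by blast
      have ne: "heis_word \<nu>1 (normal_order \<nu>1 (X i)) (?t \<nu>2) \<noteq> 0" using e(4) unfolding h_def by auto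
      then have "?t \<nu>2 \<noteq> 0" by (metis heis_word_zero)
      with e ne show ?thesis by (intro image_eqI[of _ _ "(\<nu>2, \<nu>1)"]) simp_all
    qed
    ultimately show ?thesis by (meson finite_subset subsetI)
  qed
  have "finsums h (?A \<times> ?B) (sum v {x \<in> ?A. v x \<noteq> 0})"
    by (rule finsums_Sigma(2)[OF fin inner])
  also have "sum v {x \<in> ?A. v x \<noteq> 0} = vop_list (map jf (X i)) (ms i) R"
    using outer by (simp only: finsums_def)
  finally show ?case unfolding reindex by (simp add: R_def)
qed

subsection \<open>Absolute convergence of the trace\<close>

text \<open>Iterated summation, first over the basis and then over the modes, is available for any
  coefficients with convergent contraction series. Read with \<open>norm (c x n)\<close> and
  \<open>norm q\<close> it sums the norms of all terms, because the matrix entries are nonnegative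
  reals. This gives joint summability, and the iterated value becomes the joint one.\<close>

lemma has_sum_trace_modes:
  fixes q :: complex and X :: "nat \<Rightarrow> 'a list" and c :: "'a \<Rightarrow> int \<Rightarrow> complex"
  assumes q: "q \<noteq> 0" "norm q < 1"
    and dist: "distinct (concat (map X is))" and sorted: "sorted_wrt (<) is"
    and pt: "\<And>i x. i \<in> set is \<Longrightarrow> x \<in> set (X i) \<Longrightarrow> pt x = i"
    and S: "\<And>x y. x \<in> set (concat (map X is)) \<Longrightarrow> y \<in> set (concat (map X is)) \<Longrightarrow> x \<noteq> y \<Longrightarrow>
       ((\<lambda>n. c x n * c y (- n) * pair_weight q pt x y n) has_sum S x y) UNIV"
    and abs: "\<And>x y. x \<in> set (concat (map X is)) \<Longrightarrow> y \<in> set (concat (map X is)) \<Longrightarrow> x \<noteq> y \<Longrightarrow>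
       (\<lambda>n. of_real (norm (c x n)) * of_real (norm (c y (- n))) * pair_weight (of_real (norm q)) pt x y n) summable_on UNIV"
  shows "((\<lambda>(\<nu>, b). (\<Prod>x\<in>set (concat (map X is)). c x (\<nu> x)) *
      (Poly_Mapping.lookup (heis_word \<nu> (concat (map (\<lambda>i. normal_order \<nu> (X i)) is)) (Poly_Mapping.single b 1)) b * q ^ wt b))
    has_sum 1 / prodinf (\<lambda>n. 1 - q ^ Suc n) * hafnian S (concat (map X is)))
    ((set (concat (map X is)) \<rightarrow>\<^sub>E UNIV) \<times> UNIV)"
proof -
  let ?L = "concat (map X is)"
  let ?M = "\<lambda>\<nu> b. Poly_Mapping.lookup (heis_word \<nu> (concat (map (\<lambda>i. normal_order \<nu> (X i)) is)) (Poly_Mapping.single b 1)) b"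
  have main: "\<exists>g. (\<forall>\<nu>. ((\<lambda>b. (\<Prod>x\<in>set ?L. c x (\<nu> x)) * (?M \<nu> b * q ^ wt b)) has_sum g \<nu>) UNIV) \<and>
     (g has_sum 1 / prodinf (\<lambda>n. 1 - q ^ Suc n) * hafnian S ?L) (set ?L \<rightarrow>\<^sub>E UNIV)"
    if q: "q \<noteq> 0" "norm q < 1" and S: "\<And>x y. x \<in> set ?L \<Longrightarrow> y \<in> set ?L \<Longrightarrow> x \<noteq> y \<Longrightarrow>
       ((\<lambda>n. c x n * c y (- n) * pair_weight q pt x y n) has_sum S x y) UNIV"
    for c :: "'a \<Rightarrow> int \<Rightarrow> complex" and q S
  proof (intro exI conjI allI)
    let ?h = "\<lambda>\<nu>. hafnian (\<lambda>x y. if \<nu> y = - \<nu> x then pair_weight q pt x y (\<nu> x) else 0) ?L"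
    let ?Z = "1 / prodinf (\<lambda>n. 1 - q ^ Suc n)"
    show "((\<lambda>b. (\<Prod>x\<in>set ?L. c x (\<nu> x)) * (?M \<nu> b * q ^ wt b)) has_sum (\<Prod>x\<in>set ?L. c x (\<nu> x)) * (?Z * ?h \<nu>)) UNIV" for \<nu>
      by (rule has_sum_cmult_right[OF has_sum_trace_normal_order[OF q dist sorted pt]])
    have "((\<lambda>\<nu>. ?Z * ((\<Prod>x\<in>set ?L. c x (\<nu> x)) * ?h \<nu>)) has_sum ?Z * hafnian S ?L) (set ?L \<rightarrow>\<^sub>E UNIV)"
      by (intro has_sum_cmult_right has_sum_hafnian_modes dist S)
    then show "((\<lambda>\<nu>. (\<Prod>x\<in>set ?L. c x (\<nu> x)) * (?Z * ?h \<nu>)) has_sum ?Z * hafnian S ?L) (set ?L \<rightarrow>\<^sub>E UNIV)"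
      by (simp only: mult.left_commute)
  qed
  obtain g where g: "\<And>\<nu>. ((\<lambda>b. (\<Prod>x\<in>set ?L. c x (\<nu> x)) * (?M \<nu> b * q ^ wt b)) has_sum g \<nu>) UNIV"
     "(g has_sum 1 / prodinf (\<lambda>n. 1 - q ^ Suc n) * hafnian S ?L) (set ?L \<rightarrow>\<^sub>E UNIV)"
    using main[OF q S] by blast
  let ?c' = "\<lambda>x n. complex_of_real (norm (c x n))" and ?q' = "complex_of_real (norm q)"
  let ?S' = "\<lambda>x y. infsum (\<lambda>n. ?c' x n * ?c' y (- n) * pair_weight ?q' pt x y n) UNIV"
  have "?q' \<noteq> 0" "norm ?q' < 1" using q by auto
  then have "\<exists>g. (\<forall>\<nu>. ((\<lambda>b. (\<Prod>x\<in>set ?L. ?c' x (\<nu> x)) * (?M \<nu> b * ?q' ^ wt b)) has_sum g \<nu>) UNIV) \<and>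
     (g has_sum 1 / prodinf (\<lambda>n. 1 - ?q' ^ Suc n) * hafnian ?S' ?L) (set ?L \<rightarrow>\<^sub>E UNIV)"
    by (rule main) (intro has_sum_infsum abs)
  then obtain g' where g': "\<And>\<nu>. ((\<lambda>b. (\<Prod>x\<in>set ?L. ?c' x (\<nu> x)) * (?M \<nu> b * ?q' ^ wt b)) has_sum g' \<nu>) UNIV"
     "g' summable_on (set ?L \<rightarrow>\<^sub>E UNIV)" by (auto dest: has_sum_imp_summable)
  let ?F = "\<lambda>(\<nu>, b). (\<Prod>x\<in>set ?L. c x (\<nu> x)) * (?M \<nu> b * q ^ wt b)"
  have "(\<lambda>p. norm (?F p)) summable_on ((set ?L \<rightarrow>\<^sub>E UNIV) \<times> UNIV)"
  proof (rule summable_on_SigmaI)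
    fix \<nu> :: "'a \<Rightarrow> int"
    have e: "Re ((\<Prod>x\<in>set ?L. ?c' x (\<nu> x)) * (?M \<nu> b * ?q' ^ wt b)) = norm (?F (\<nu>, b))" for b
    proof -
      obtain a where a: "?M \<nu> b = complex_of_real a" "0 \<le> a" by (rule lookup_heis_word_single)
      have "(\<Prod>x\<in>set ?L. ?c' x (\<nu> x)) * (?M \<nu> b * ?q' ^ wt b) =
          complex_of_real ((\<Prod>x\<in>set ?L. norm (c x (\<nu> x))) * (a * norm q ^ wt b))" using a by simp
      then show ?thesis using a by (simp only: Re_complex_of_real) (simp add: norm_mult norm_power prod_norm)
    qed
    show "((\<lambda>b. norm (?F (\<nu>, b))) has_sum Re (g' \<nu>)) UNIV"
      using has_sum_Re[OF g'(1)[of \<nu>]] unfolding e .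
    show "(\<lambda>\<nu>. Re (g' \<nu>)) summable_on (set ?L \<rightarrow>\<^sub>E UNIV)" by (rule summable_on_Re[OF g'(2)])
  qed auto
  then have "?F summable_on ((set ?L \<rightarrow>\<^sub>E UNIV) \<times> UNIV)" by (rule abs_summable_summable)
  then show ?thesis
    by (intro has_sum_SigmaI[OF _ g(2)]) (use g(1) in simp_all)
qed

text \<open>The second component is a position in the sorted list of factors, so that repeated
  factors of one monomial receive different labels.\<close>

definition mode_labels :: "(nat \<Rightarrow> nat multiset) \<Rightarrow> nat \<Rightarrow> (nat \<times> nat) list" where
  "mode_labels B i = map (Pair i) [0..<size (B i)]"

definition mode_index :: "(nat \<Rightarrow> nat multiset) \<Rightarrow> nat \<times> nat \<Rightarrow> nat" where
  "mode_index B x = sorted_list_of_multiset (B (fst x)) ! snd x"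

lemma length_sorted_list_of_multiset [simp]: "length (sorted_list_of_multiset b) = size b"
  by (metis mset_sorted_list_of_multiset size_mset)

lemma map_mode_index: "map (mode_index B) (mode_labels B i) = sorted_list_of_multiset (B i)"
  by (rule nth_equalityI) (simp_all add: mode_labels_def mode_index_def)

lemma distinct_mode_labels: "distinct is \<Longrightarrow> distinct (concat (map (mode_labels B) is))"
  by (induction "is") (auto simp: mode_labels_def distinct_map inj_on_def)

lemma sum_mode_labels: "(\<Sum>x\<in>set (mode_labels B i). \<nu> x + int (mode_index B x) + 1) = (\<Sum>x\<in>set (mode_labels B i). \<nu> x) + int (wt (B i))"
proof -
  have d: "distinct (mode_labels B i)" using distinct_mode_labels[of "[i]" B] by simp
  have "(\<Sum>x\<in>set (mode_labels B i). Suc (mode_index B x)) = (\<Sum>x\<leftarrow>mode_labels B i. Suc (mode_index B x))"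
    using d by (simp add: sum_list_distinct_conv_sum_set)
  also have "\<dots> = (\<Sum>j\<leftarrow>sorted_list_of_multiset (B i). Suc j)"
    unfolding map_mode_index[symmetric] by (simp add: o_def)
  also have "\<dots> = wt (B i)" unfolding wt_def by (metis mset_map mset_sorted_list_of_multiset sum_mset_sum_list)
  finally have "(\<Sum>x\<in>set (mode_labels B i). int (mode_index B x) + 1) = int (wt (B i))"
    by (metis (mono_tags, lifting) of_nat_Suc of_nat_sum sum.cong add.commute)
  then show ?thesis by (simp add: sum.distrib add.assoc)
qed

lemma prod_power_int: "x \<noteq> 0 \<Longrightarrow> (\<Prod>i\<in>A. x powi f i) = (x :: 'a::field) powi (\<Sum>i\<in>A. f i)"
  by (induction A rule: infinite_finite_induct) (simp_all add: power_int_add)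

text \<open>The coefficient of a(n) in x^(j+1) times the j-th divided derivative of the field at x:
  the power of x belonging to the weight of a monomial is shared out among its factors.\<close>

definition mode_coeff :: "(nat \<Rightarrow> complex) \<Rightarrow> nat \<Rightarrow> nat \<Rightarrow> int \<Rightarrow> complex" where
  "mode_coeff x i j n = (of_int (- n - 1) gchoose j) * x i powi (- n)"

text \<open>The sum over the modes of all single factors is regrouped by the modes \<open>ms\<close>
  of the vertex operators; each fibre is the finite expansion given by
  \<open>finsums_vop_chain\<close>.\<close>

lemma has_sum_trace_monomials:
  fixes q :: complex and x :: "nat \<Rightarrow> complex"
  assumes q: "q \<noteq> 0" "norm q < 1" and sorted: "sorted_wrt (<) is" and x: "\<And>i. i \<in> set is \<Longrightarrow> x i \<noteq> 0"
    and S: "\<And>i j i' j' k k'. i \<in> set is \<Longrightarrow> i' \<in> set is \<Longrightarrow>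
       ((\<lambda>n. mode_coeff x i j n * mode_coeff x i' j' (- n) * pair_weight q fst (i, k :: nat) (i', k' :: nat) n) has_sum S (i, j) (i', j')) UNIV"
    and abs: "\<And>i j i' j' k k'. i \<in> set is \<Longrightarrow> i' \<in> set is \<Longrightarrow>
       (\<lambda>n. of_real (norm (mode_coeff x i j n)) * of_real (norm (mode_coeff x i' j' (- n))) * pair_weight (of_real (norm q)) fst (i, k :: nat) (i', k' :: nat) n) summable_on UNIV"
    and sym: "\<And>y z. S y z = S z y"
  shows "((\<lambda>(ms, b). Poly_Mapping.lookup (foldr (\<lambda>i. vop_list (sorted_list_of_multiset (B i)) (ms i)) is (Poly_Mapping.single b 1)) b
        * (\<Prod>i\<in>set is. x i ^ wt (B i) * x i powi (- ms i - 1)) * q ^ wt b) has_sum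
      1 / prodinf (\<lambda>n. 1 - q ^ Suc n) * hafnian S (concat (map (\<lambda>i. map (Pair i) (sorted_list_of_multiset (B i))) is)))
     ((set is \<rightarrow>\<^sub>E UNIV) \<times> UNIV)"
proof -
  let ?X = "mode_labels B" and ?jf = "mode_index B"
  let ?L = "concat (map ?X is)"
  define c where "c = (\<lambda>y. mode_coeff x (fst y) (?jf y))"
  let ?T = "\<lambda>y y'. S (fst y, ?jf y) (fst y', ?jf y')"
  have dis: "distinct is" using sorted by (simp add: strict_sorted_iff)
  have dist: "distinct ?L" using dis by (rule distinct_mode_labels)
  have fstL: "fst y \<in> set is" if "y \<in> set ?L" for y using that by (auto simp: mode_labels_def)
  define F where "F = (\<lambda>(\<nu>, b). (\<Prod>x\<in>set ?L. c x (\<nu> x)) *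
      (Poly_Mapping.lookup (heis_word \<nu> (concat (map (\<lambda>i. normal_order \<nu> (?X i)) is)) (Poly_Mapping.single b 1)) b * q ^ wt b))"
  have "(F has_sum 1 / prodinf (\<lambda>n. 1 - q ^ Suc n) * hafnian ?T ?L) ((set ?L \<rightarrow>\<^sub>E UNIV) \<times> UNIV)"
    unfolding F_def
  proof (rule has_sum_trace_modes[OF q dist sorted, where pt = fst and c = c and S = ?T])
    show "fst y = i" if "y \<in> set (?X i)" for i y using that by (auto simp: mode_labels_def)
    show "((\<lambda>n. c y n * c y' (- n) * pair_weight q fst y y' n) has_sum ?T y y') UNIV"
      if "y \<in> set ?L" "y' \<in> set ?L" for y y'
      using S[OF fstL[OF that(1)] fstL[OF that(2)], of "?jf y" "?jf y'" "snd y" "snd y'"] unfolding c_def prod.collapse .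
    show "(\<lambda>n. of_real (norm (c y n)) * of_real (norm (c y' (- n))) * pair_weight (of_real (norm q)) fst y y' n) summable_on UNIV"
      if "y \<in> set ?L" "y' \<in> set ?L" for y y'
      using abs[OF fstL[OF that(1)] fstL[OF that(2)], of "?jf y" "?jf y'" "snd y" "snd y'"] unfolding c_def prod.collapse .
  qed
  also have "hafnian ?T ?L = hafnian S (map (\<lambda>y. (fst y, ?jf y)) ?L)"
    by (rule hafnian_map[OF sym, symmetric])
  also have "map (\<lambda>y. (fst y, ?jf y)) ?L = concat (map (\<lambda>i. map (Pair i) (sorted_list_of_multiset (B i))) is)"
    unfolding map_concat map_map o_def
  proof (intro arg_cong[where f = concat] map_cong refl)
    fix i
    show "map (\<lambda>y. (fst y, ?jf y)) (?X i) = map (Pair i) (sorted_list_of_multiset (B i))"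
      unfolding map_mode_index[symmetric] by (auto simp: mode_labels_def)
  qed
  finally have tot: "(F has_sum 1 / prodinf (\<lambda>n. 1 - q ^ Suc n) * hafnian S (concat (map (\<lambda>i. map (Pair i) (sorted_list_of_multiset (B i))) is))) ((set ?L \<rightarrow>\<^sub>E UNIV) \<times> UNIV)" .
  let ?fib = "\<lambda>ms. {\<nu> \<in> set ?L \<rightarrow>\<^sub>E UNIV. \<forall>i\<in>set is. (\<Sum>x\<in>set (?X i). \<nu> x + int (?jf x) + 1) = ms i + 1}"
  let ?ms = "\<lambda>\<nu>. restrict (\<lambda>i. (\<Sum>x\<in>set (?X i). \<nu> x + int (?jf x) + 1) - 1) (set is)"
  have "(F has_sum s) ((set ?L \<rightarrow>\<^sub>E UNIV) \<times> UNIV) \<longleftrightarrow>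
     ((\<lambda>((ms, b), \<nu>). F (\<nu>, b)) has_sum s) (Sigma ((set is \<rightarrow>\<^sub>E UNIV) \<times> UNIV) (\<lambda>(ms, b). ?fib ms))" for s
  proof (rule has_sum_reindex_bij_witness[where j = "\<lambda>(\<nu>, b). ((?ms \<nu>, b), \<nu>)" and i = "\<lambda>((ms, b), \<nu>). (\<nu>, b)"], goal_cases)
    case (3 a)
    then obtain ms b \<nu> where a: "a = ((ms, b), \<nu>)" "ms \<in> set is \<rightarrow>\<^sub>E UNIV" "\<nu> \<in> ?fib ms" by auto
    have "?ms \<nu> i = ms i" for i
      using a(2,3) by (cases "i \<in> set is") (auto simp: PiE_def extensional_def)
    then show ?case by (simp add: a(1) fun_eq_iff)
  qed auto
  with tot have tot': "((\<lambda>((ms, b), \<nu>). F (\<nu>, b)) has_sum 1 / prodinf (\<lambda>n. 1 - q ^ Suc n) * hafnian S (concat (map (\<lambda>i. map (Pair i) (sorted_list_of_multiset (B i))) is)))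
     (Sigma ((set is \<rightarrow>\<^sub>E UNIV) \<times> UNIV) (\<lambda>(ms, b). ?fib ms))" by simp
  show ?thesis
  proof (rule has_sum_SigmaD[OF tot'])
    fix a :: "(nat \<Rightarrow> int) \<times> nat multiset" assume "a \<in> (set is \<rightarrow>\<^sub>E UNIV) \<times> UNIV"
    then obtain ms b where a: "a = (ms, b)" "ms \<in> set is \<rightarrow>\<^sub>E UNIV" by auto
    let ?w = "Poly_Mapping.single b (1 :: complex)"
    let ?P = "\<Prod>i\<in>set is. x i ^ wt (B i) * x i powi (- ms i - 1)"
    have "finsums (\<lambda>\<nu>. smul (\<Prod>x\<in>set ?L. of_int (- \<nu> x - 1) gchoose ?jf x)
         (heis_word \<nu> (concat (map (\<lambda>i. normal_order \<nu> (?X i)) is)) ?w)) (?fib ms)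
       (foldr (\<lambda>i. vop_list (map ?jf (?X i)) (ms i)) is ?w)"
      by (rule finsums_vop_chain[OF dist dis])
    from finsums_hom[OF this, of "\<lambda>v. Poly_Mapping.lookup v b * ?P * q ^ wt b"]
    have "finsums (\<lambda>\<nu>. (\<Prod>x\<in>set ?L. of_int (- \<nu> x - 1) gchoose ?jf x) *
         Poly_Mapping.lookup (heis_word \<nu> (concat (map (\<lambda>i. normal_order \<nu> (?X i)) is)) ?w) b * ?P * q ^ wt b) (?fib ms)
       (Poly_Mapping.lookup (foldr (\<lambda>i. vop_list (sorted_list_of_multiset (B i)) (ms i)) is ?w) b * ?P * q ^ wt b)"
      by (simp add: lookup_add ring_distribs map_mode_index)
    then have "((\<lambda>\<nu>. (\<Prod>x\<in>set ?L. of_int (- \<nu> x - 1) gchoose ?jf x) *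
         Poly_Mapping.lookup (heis_word \<nu> (concat (map (\<lambda>i. normal_order \<nu> (?X i)) is)) ?w) b * ?P * q ^ wt b) has_sum
       (Poly_Mapping.lookup (foldr (\<lambda>i. vop_list (sorted_list_of_multiset (B i)) (ms i)) is ?w) b * ?P * q ^ wt b)) (?fib ms)"
      by (rule finsums_has_sum)
    also have "?this \<longleftrightarrow> ((\<lambda>\<nu>. F (\<nu>, b)) has_sum
       (Poly_Mapping.lookup (foldr (\<lambda>i. vop_list (sorted_list_of_multiset (B i)) (ms i)) is ?w) b * ?P * q ^ wt b)) (?fib ms)"
    proof (rule has_sum_cong)
      fix \<nu> assume \<nu>: "\<nu> \<in> ?fib ms"
      have "(\<Prod>y\<in>set ?L. x (fst y) powi (- \<nu> y)) = (\<Prod>i\<in>set is. \<Prod>y\<in>set (?X i). x (fst y) powi (- \<nu> y))"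
      proof -
        have "set ?L = (\<Union>i\<in>set is. set (?X i))" by auto
        then show ?thesis by (simp only:) (rule prod.UNION_disjoint, auto simp: mode_labels_def)
      qed
      also have "\<dots> = ?P"
      proof (rule prod.cong[OF refl])
        fix i assume i: "i \<in> set is"
        have "(\<Prod>y\<in>set (?X i). x (fst y) powi (- \<nu> y)) = (\<Prod>y\<in>set (?X i). x i powi (- \<nu> y))"
          by (intro prod.cong) (auto simp: mode_labels_def)
        also have "\<dots> = x i powi (- (\<Sum>y\<in>set (?X i). \<nu> y))"
          using x[OF i] by (simp add: prod_power_int sum_negf)
        also have "(\<Sum>y\<in>set (?X i). \<nu> y) = ms i + 1 - int (wt (B i))"
          using \<nu> i sum_mode_labels[of \<nu> B i] by auto
        also have "x i powi (- (ms i + 1 - int (wt (B i)))) = x i powi (int (wt (B i)) + (- ms i - 1))"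
          by (rule arg_cong[where f = "\<lambda>n. x i powi n"]) simp
        also have "\<dots> = x i ^ wt (B i) * x i powi (- ms i - 1)"
          using x[OF i] by (subst power_int_add) auto
        finally show "(\<Prod>y\<in>set (?X i). x (fst y) powi (- \<nu> y)) = x i ^ wt (B i) * x i powi (- ms i - 1)" .
      qed
      finally have "(\<Prod>y\<in>set ?L. x (fst y) powi (- \<nu> y)) = ?P" .
      moreover have "(\<Prod>y\<in>set ?L. c y (\<nu> y)) = (\<Prod>y\<in>set ?L. of_int (- \<nu> y - 1) gchoose ?jf y) * (\<Prod>y\<in>set ?L. x (fst y) powi (- \<nu> y))"
        by (simp add: c_def mode_coeff_def prod.distrib)
      ultimately show "(\<Prod>x\<in>set ?L. of_int (- \<nu> x - 1) gchoose ?jf x) *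
         Poly_Mapping.lookup (heis_word \<nu> (concat (map (\<lambda>i. normal_order \<nu> (?X i)) is)) ?w) b * ?P * q ^ wt b = F (\<nu>, b)"
        by (simp only: F_def prod.case) (simp only: mult_ac)
    qed
    finally show "((\<lambda>\<nu>. case (a, \<nu>) of (x, xa) \<Rightarrow> (case x of (ms, b) \<Rightarrow> \<lambda>\<nu>. F (\<nu>, b)) xa) has_sum
       (case a of (ms, b) \<Rightarrow> Poly_Mapping.lookup (foldr (\<lambda>i. vop_list (sorted_list_of_multiset (B i)) (ms i)) is (Poly_Mapping.single b 1)) b
        * (\<Prod>i\<in>set is. x i ^ wt (B i) * x i powi (- ms i - 1)) * q ^ wt b)) (case a of (ms, b) \<Rightarrow> ?fib ms)"
      by (simp only: a(1) prod.case)
  qed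
qed

section \<open>Estimates for the contraction series\<close>

lemma norm_gbinomial_le: "norm ((of_int a :: complex) gchoose j) \<le> real (nat \<bar>a\<bar> + j) ^ j"
proof -
  have "norm ((of_int a :: complex) gchoose j) = (\<Prod>i = 0..<j. norm (of_int a - of_nat i :: complex)) / fact j"
    by (simp add: gbinomial_prod_rev norm_divide prod_norm)
  also have "\<dots> \<le> (\<Prod>i = 0..<j. norm (of_int a - of_nat i :: complex)) / 1"
    by (intro divide_left_mono prod_nonneg) (auto simp: fact_ge_1)
  also have "\<dots> \<le> (\<Prod>i = 0..<j. real (nat \<bar>a\<bar> + j))"
    unfolding div_by_1
  proof (intro prod_mono conjI norm_ge_zero)
    fix i assume "i \<in> {0..<j}"
    have "norm (of_int a - of_nat i :: complex) \<le> norm (of_int a :: complex) + norm (of_nat i :: complex)"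
      by (rule norm_triangle_ineq4)
    also have "\<dots> \<le> real (nat \<bar>a\<bar> + j)" using \<open>i \<in> {0..<j}\<close> by simp
    finally show "norm (of_int a - of_nat i :: complex) \<le> real (nat \<bar>a\<bar> + j)" .
  qed
  finally show ?thesis by simp
qed

lemma norm_one_minus_power_ge:
  fixes q :: complex
  assumes "norm q < 1" "n > 0"
  shows "1 - norm q \<le> norm (1 - q ^ n)"
proof -
  have "norm q ^ n \<le> norm q ^ 1" using assms by (intro power_decreasing) auto
  then have "1 - norm q \<le> norm (1 :: complex) - norm (q ^ n)" by (simp add: norm_power)
  also have "\<dots> \<le> norm (1 - q ^ n)" by (rule norm_triangle_ineq2)
  finally show ?thesis .
qed

lemma norm_normal_weight_le:
  assumes q: "norm q < 1"
  shows "norm (normal_weight q n) \<le> real (nat \<bar>n\<bar>) / (1 - norm q) * norm q ^ nat \<bar>n\<bar>"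
proof (cases "n = 0")
  case False
  have "norm (normal_weight q n) = real (nat \<bar>n\<bar>) * norm q ^ nat \<bar>n\<bar> / norm (1 - q ^ nat \<bar>n\<bar>)"
    by (simp add: normal_weight_def norm_mult norm_divide norm_power)
  also have "\<dots> \<le> real (nat \<bar>n\<bar>) * norm q ^ nat \<bar>n\<bar> / (1 - norm q)"
    using norm_one_minus_power_ge[OF q, of "nat \<bar>n\<bar>"] False q
    by (intro divide_left_mono mult_pos_pos) auto
  finally show ?thesis by simp
qed (simp add: normal_weight_def)

text \<open>For n > 0 the weight grows at most linearly and t^n decays. For n < 0 the weight decays
  like |q|^|n| up to a linear factor, which beats the growth of t^n because |q| < t.\<close>

lemma norm_ordered_weight_le:
  assumes q: "q \<noteq> 0" "norm q < 1" and t: "norm q < t" "t < 1"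
  shows "norm (ordered_weight q n) * t powi n \<le> real (nat \<bar>n\<bar>) / (1 - norm q) * max t (norm q / t) ^ nat \<bar>n\<bar>"
proof -
  have t0: "t > 0" using t norm_ge_zero[of q] by linarith
  show ?thesis
  proof (cases "n < 0")
    case True
    have "t powi n = (1 / t) ^ nat \<bar>n\<bar>" using True by (simp add: power_int_def power_one_over inverse_eq_divide)
    then have "norm (ordered_weight q n) * t powi n \<le> real (nat \<bar>n\<bar>) / (1 - norm q) * norm q ^ nat \<bar>n\<bar> * (1 / t) ^ nat \<bar>n\<bar>"
      using norm_normal_weight_le[OF q(2), of n] t0 by (simp only: ordered_weight_neg[OF q True]) (intro mult_right_mono, auto)
    also have "\<dots> = real (nat \<bar>n\<bar>) / (1 - norm q) * (norm q / t) ^ nat \<bar>n\<bar>"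
      by (simp add: power_divide power_one_over)
    also have "\<dots> \<le> real (nat \<bar>n\<bar>) / (1 - norm q) * max t (norm q / t) ^ nat \<bar>n\<bar>"
      using q t0 by (intro mult_left_mono power_mono) auto
    finally show ?thesis .
  next
    case False
    show ?thesis
    proof (cases "n = 0")
      case False
      with \<open>\<not> n < 0\<close> have n: "n > 0" by simp
      have e: "q powi n = q ^ nat n" "t powi n = t ^ nat n" using n by (simp_all add: power_int_def)
      have "norm (ordered_weight q n) = real (nat n) / norm (1 - q ^ nat n)"
        using n by (simp add: ordered_weight_def norm_divide e)
      also have "\<dots> \<le> real (nat n) / (1 - norm q)"
        using norm_one_minus_power_ge[OF q(2), of "nat n"] n q
        by (intro divide_left_mono mult_pos_pos) auto
      finally have "norm (ordered_weight q n) * t ^ nat n \<le> real (nat n) / (1 - norm q) * max t (norm q / t) ^ nat n"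
        using q t0 by (intro mult_mono power_mono) auto
      then show ?thesis using n by (simp add: e)
    qed (simp add: ordered_weight_def)
  qed
qed

lemma summable_power_mult_geometric_int:
  fixes \<rho> :: real
  assumes "0 < \<rho>" "\<rho> < 1"
  shows "(\<lambda>n::int. C * (real (nat \<bar>n\<bar> + s) ^ K * \<rho> ^ nat \<bar>n\<bar>)) summable_on UNIV"
proof -
  \<comment> \<open>One square root of the ratio absorbs the polynomial, the other is left for the
    geometric series.\<close>
  define r where "r = sqrt \<rho>"
  have r: "0 < r" "r < 1" "\<rho> = r * r" using assms by (auto simp: r_def)
  have "Bseq (\<lambda>n. real (n + s) ^ K * r ^ n)"
    using tendsto_power_mult_geometric[of r s K] r convergent_imp_Bseq convergent_def by auto
  then obtain D where D: "\<And>n. norm (real (n + s) ^ K * r ^ n) \<le> D" by (auto simp: Bseq_def)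
  have "(\<lambda>n. real (n + s) ^ K * \<rho> ^ n) summable_on UNIV"
  proof (rule summable_on_comparison_test)
    show "(\<lambda>n. D * r ^ n) summable_on UNIV"
      using r by (intro summable_on_cmult_right norm_summable_imp_summable_on) (auto simp: norm_power intro!: summable_geometric)
    fix n
    have "real (n + s) ^ K * \<rho> ^ n = (real (n + s) ^ K * r ^ n) * r ^ n"
      by (simp add: r(3) power_mult_distrib)
    also have "\<dots> \<le> D * r ^ n" using D[of n] r by (intro mult_right_mono) auto
    finally show "real (n + s) ^ K * \<rho> ^ n \<le> D * r ^ n" .
  qed (use assms in auto)
  then have nat: "(\<lambda>n. C * (real (n + s) ^ K * \<rho> ^ n)) summable_on UNIV" by (rule summable_on_cmult_right)
  let ?f = "\<lambda>n::int. C * (real (nat \<bar>n\<bar> + s) ^ K * \<rho> ^ nat \<bar>n\<bar>)"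
  have "?f summable_on range int"
    by (subst summable_on_reindex) (use nat in \<open>auto simp: o_def\<close>)
  moreover have "?f summable_on range (\<lambda>n. - int n)"
    by (subst summable_on_reindex) (use nat in \<open>auto simp: o_def inj_on_def\<close>)
  ultimately have "?f summable_on (range int \<union> range (\<lambda>n. - int n))" by (rule summable_on_union)
  also have "range int \<union> range (\<lambda>n. - int n) = UNIV"
  proof -
    have "n \<in> range int \<union> range (\<lambda>n. - int n)" for n by (cases n rule: int_cases2) auto
    then show ?thesis by blast
  qed
  finally show ?thesis .
qed

text \<open>The quotient t of the absolute values of the two points decides: for different parts, it
  or its inverse lies strictly between \<open>norm q\<close> and 1. The separate \<open>q'\<close>
  makes the estimate serve for \<open>q\<close> and for \<open>norm q\<close> alike.\<close>

lemma summable_pair: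
  fixes q q' :: complex and x :: "nat \<Rightarrow> complex"
  assumes q: "q \<noteq> 0" "norm q < 1" and q': "norm q' = norm q"
    and x: "x i \<noteq> 0" "x i' \<noteq> 0"
    and lt: "i < i' \<Longrightarrow> norm (x i') < norm (x i) \<and> norm q * norm (x i) < norm (x i')"
    and gt: "i' < i \<Longrightarrow> norm (x i) < norm (x i') \<and> norm q * norm (x i') < norm (x i)"
  shows "(\<lambda>n. norm (mode_coeff x i j n) * norm (mode_coeff x i' j' (- n)) * norm (pair_weight q' fst (i, k) (i', k') n)) summable_on UNIV"
proof -
  have q'0: "q' \<noteq> 0" "norm q' < 1" using q q' by auto
  define t where "t = norm (x i') / norm (x i)"
  have t0: "t > 0" using x by (simp add: t_def)
  have "\<exists>\<rho>. 0 < \<rho> \<and> \<rho> < 1 \<and> (\<forall>n. norm (pair_weight q' fst (i, k) (i', k') n) * t powi n \<le> real (nat \<bar>n\<bar>) / (1 - norm q) * \<rho> ^ nat \<bar>n\<bar>)"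
  proof -
    consider "i = i'" | "i < i'" | "i' < i" by linarith
    then show ?thesis
    proof cases
      case 1
      then have "t = 1" using x by (simp add: t_def)
      with 1 show ?thesis using norm_normal_weight_le[OF q'0(2)] q q'
        by (intro exI[of _ "norm q"]) (auto simp: pair_weight_def)
    next
      case 2
      have t: "norm q < t" "t < 1" using lt[OF 2] x by (auto simp: t_def field_simps)
      have "max t (norm q / t) < 1" "max t (norm q / t) > 0" using t t0 q by auto
      then show ?thesis using norm_ordered_weight_le[OF q'0, of t] t 2 q'
        by (intro exI[of _ "max t (norm q / t)"]) (auto simp: pair_weight_def)
    next
      case 3
      have t: "norm q < 1 / t" "1 / t < 1" using gt[OF 3] x by (auto simp: t_def field_simps)
      have m: "max (1 / t) (norm q / (1 / t)) < 1" "max (1 / t) (norm q / (1 / t)) > 0"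
        using t t0 by (auto simp: less_max_iff_disj field_simps)
      have "norm (ordered_weight q' (- n)) * t powi n \<le> real (nat \<bar>n\<bar>) / (1 - norm q) * max (1 / t) (norm q / (1 / t)) ^ nat \<bar>n\<bar>" for n
        using norm_ordered_weight_le[OF q'0, of "1 / t" "- n"] t q' by (simp add: power_int_minus power_int_divide_distrib)
      with m 3 show ?thesis
        by (intro exI[of _ "max (1 / t) (norm q / (1 / t))"]) (auto simp: pair_weight_def)
    qed
  qed
  then obtain \<rho> where \<rho>: "0 < \<rho>" "\<rho> < 1"
    "\<And>n. norm (pair_weight q' fst (i, k) (i', k') n) * t powi n \<le> real (nat \<bar>n\<bar>) / (1 - norm q) * \<rho> ^ nat \<bar>n\<bar>" by blast
  define s where "s = 1 + j + j'"
  show ?thesis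
  proof (rule summable_on_comparison_test)
    show "(\<lambda>n::int. 1 / (1 - norm q) * (real (nat \<bar>n\<bar> + s) ^ (j + j' + 1) * \<rho> ^ nat \<bar>n\<bar>)) summable_on UNIV"
      by (rule summable_power_mult_geometric_int[OF \<rho>(1,2)])
    fix n :: int
    let ?N = "real (nat \<bar>n\<bar> + s)"
    have a: "norm ((of_int (- n - 1) :: complex) gchoose j) \<le> ?N ^ j"
      by (rule order_trans[OF norm_gbinomial_le power_mono]) (auto simp: s_def)
    have b: "norm ((of_int (- (- n) - 1) :: complex) gchoose j') \<le> ?N ^ j'"
      by (rule order_trans[OF norm_gbinomial_le power_mono]) (auto simp: s_def)
    have "norm (x i) powi (- n) * norm (x i') powi n = t powi n"
      using x by (simp add: t_def power_int_minus power_int_divide_distrib field_simps)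
    then have "norm (mode_coeff x i j n) * norm (mode_coeff x i' j' (- n)) * norm (pair_weight q' fst (i, k) (i', k') n)
       = norm ((of_int (- n - 1) :: complex) gchoose j) * norm ((of_int (- (- n) - 1) :: complex) gchoose j') *
         (norm (pair_weight q' fst (i, k) (i', k') n) * t powi n)"
      by (simp add: mode_coeff_def norm_mult norm_power_int mult_ac)
    also have "\<dots> \<le> ?N ^ j * ?N ^ j' * (real (nat \<bar>n\<bar>) / (1 - norm q) * \<rho> ^ nat \<bar>n\<bar>)"
      using t0 by (intro mult_mono a b \<rho>(3)) (auto intro!: mult_nonneg_nonneg)
    also have "\<dots> \<le> ?N ^ j * ?N ^ j' * (?N / (1 - norm q) * \<rho> ^ nat \<bar>n\<bar>)"
      using q \<rho> by (intro mult_left_mono mult_right_mono divide_right_mono) auto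
    finally show "norm (mode_coeff x i j n) * norm (mode_coeff x i' j' (- n)) * norm (pair_weight q' fst (i, k) (i', k') n)
       \<le> 1 / (1 - norm q) * (?N ^ (j + j' + 1) * \<rho> ^ nat \<bar>n\<bar>)"
      by (simp add: power_add mult_ac)
  qed auto
qed

definition propagator :: "complex \<Rightarrow> (nat \<Rightarrow> complex) \<Rightarrow> nat \<times> nat \<Rightarrow> nat \<times> nat \<Rightarrow> complex" where
  "propagator q x y z = infsum (\<lambda>n. mode_coeff x (fst y) (snd y) n * mode_coeff x (fst z) (snd z) (- n) * pair_weight q fst y z n) UNIV"

text \<open>The substitution of -n for n. Both sides are reindexed infinite sums, so convergence
  does not enter.\<close>

lemma propagator_sym: "propagator q x y z = propagator q x z y"
  unfolding propagator_def
  by (rule infsum_reindex_bij_witness[of _ uminus uminus])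
     (auto simp: pair_weight_sym[of q fst y z] mult_ac)

subsection \<open>The trace for general states\<close>

lemma lookup_pow_L0: "Poly_Mapping.lookup (pow_L0 x v) b = x ^ wt b * Poly_Mapping.lookup v b"
proof -
  have "Poly_Mapping.lookup (pow_L0 x v) b =
      (\<Sum>b'\<in>Poly_Mapping.keys v. if b' = b then x ^ wt b' * Poly_Mapping.lookup v b' else 0)"
    unfolding pow_L0_def lookup_sum by (intro sum.cong) (auto simp: lookup_single when_def)
  then show ?thesis by (auto simp: in_keys_iff)
qed

lemma vop_pow_L0:
  assumes "x \<noteq> 0"
  shows "vop (pow_L0 x v) N w = (\<Sum>b\<in>Poly_Mapping.keys v.
     smul (x ^ wt b * Poly_Mapping.lookup v b) (vop_list (sorted_list_of_multiset b) N w))"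
proof -
  have "Poly_Mapping.keys (pow_L0 x v) = Poly_Mapping.keys v"
    using assms by (auto simp: in_keys_iff lookup_pow_L0)
  then show ?thesis by (simp add: vop_def lookup_pow_L0)
qed

lemma sum_PiE_insert:
  assumes "x \<notin> A"
  shows "(\<Sum>B\<in>PiE (insert x A) K. f B) = (\<Sum>b\<in>K x. \<Sum>B\<in>PiE A K. f (B(x := b)))"
proof -
  have "(\<Sum>B\<in>PiE (insert x A) K. f B) = (\<Sum>(b, B)\<in>K x \<times> PiE A K. f (B(x := b)))"
    unfolding PiE_insert_eq sum.reindex[OF inj_combinator[OF assms]] by (simp add: o_def case_prod_unfold)
  then show ?thesis by (simp add: sum.cartesian_product)
qed

lemma foldr_multilinear:
  assumes "distinct is" "\<And>i b. module_hom smul smul (V i b)"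
  shows "foldr (\<lambda>i w. \<Sum>b\<in>K i. smul (a i b) (V i b w)) is w =
     (\<Sum>B\<in>PiE (set is) K. smul (\<Prod>i\<in>set is. a i (B i)) (foldr (\<lambda>i. V i (B i)) is w))"
  using assms(1)
proof (induction "is")
  case (Cons i "is")
  interpret V: module_hom smul smul "V k b" for k b by fact
  have i: "i \<notin> set is" using Cons.prems by simp
  have "foldr (\<lambda>i w. \<Sum>b\<in>K i. smul (a i b) (V i b w)) (i # is) w =
     (\<Sum>b\<in>K i. \<Sum>B\<in>PiE (set is) K. smul (a i b * (\<Prod>i\<in>set is. a i (B i))) (V i b (foldr (\<lambda>i. V i (B i)) is w)))"
    using Cons by (simp add: V.sum V.scale fock.scale_sum_right smul_smul)
  also have "\<dots> = (\<Sum>b\<in>K i. \<Sum>B\<in>PiE (set is) K. smul (\<Prod>k\<in>set (i # is). a k ((B(i := b)) k)) (foldr (\<lambda>k. V k ((B(i := b)) k)) (i # is) w))"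
  proof (intro sum.cong refl)
    fix b B
    have p: "(\<Prod>k\<in>set is. a k ((B(i := b)) k)) = (\<Prod>k\<in>set is. a k (B k))"
      using i by (intro prod.cong) auto
    have f: "foldr (\<lambda>k. V k ((B(i := b)) k)) is w = foldr (\<lambda>k. V k (B k)) is w"
      using i by (intro foldr_cong) auto
    show "smul (a i b * (\<Prod>i\<in>set is. a i (B i))) (V i b (foldr (\<lambda>i. V i (B i)) is w)) =
       smul (\<Prod>k\<in>set (i # is). a k ((B(i := b)) k)) (foldr (\<lambda>k. V k ((B(i := b)) k)) (i # is) w)"
      using i p f by simp
  qed
  finally show ?case using i by (simp add: sum_PiE_insert del: foldr.simps)
qed simp

lemma has_sum_sum:
  fixes f :: "'i \<Rightarrow> 'a \<Rightarrow> complex"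
  assumes "\<And>i. i \<in> I \<Longrightarrow> (f i has_sum s i) A"
  shows "((\<lambda>x. \<Sum>i\<in>I. f i x) has_sum (\<Sum>i\<in>I. s i)) A"
  using assms by (induction I rule: infinite_finite_induct) (auto intro!: has_sum_add)

text \<open>
  The part of the trace that depends on the states, linear in each of them. The variable \<open>(i, j)\<close>
  stands for a factor \<open>a(-j-1)\<close> of the state at the \<open>i\<close>-th insertion.
\<close>

definition wick :: "(nat \<times> nat \<Rightarrow> nat \<times> nat \<Rightarrow> complex) \<Rightarrow> nat list \<Rightarrow> (nat \<Rightarrow> fock) \<Rightarrow> complex" where
  "wick S is u = (\<Sum>B\<in>PiE (set is) (\<lambda>i. Poly_Mapping.keys (u i)). (\<Prod>i\<in>set is. Poly_Mapping.lookup (u i) (B i)) *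
     hafnian S (concat (map (\<lambda>i. map (Pair i) (sorted_list_of_multiset (B i))) is)))"

lemma nome_nz [simp]: "nome \<tau> \<noteq> 0"
  by (simp add: nome_def)

lemma norm_nome: "norm (nome \<tau>) = exp (- 2 * pi * Im \<tau>)"
  by (simp add: nome_def)

lemma norm_nome_less_1: "Im \<tau> > 0 \<Longrightarrow> norm (nome \<tau>) < 1"
  by (simp add: norm_nome)

lemma trace_domain_norms:
  assumes z: "z \<in> trace_domain n \<tau>" and i: "1 \<le> i" "i < i'" "i' \<le> n"
  shows "norm (exp (z i')) < norm (exp (z i))" "norm (nome \<tau>) * norm (exp (z i)) < norm (exp (z i'))"
proof -
  have step: "norm (exp (z (Suc i))) < norm (exp (z i))" if "1 \<le> i" "i < n" for i
    using z that by (auto simp: trace_domain_def)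
  have lt: "norm (exp (z k')) < norm (exp (z k))" if "1 \<le> k" "k < k'" "k' \<le> n" for k k'
    using that(2,3)
  proof (induction k' rule: less_induct)
    case (less k')
    show ?case
    proof (cases "k' = Suc k")
      case True then show ?thesis using step[of k] that less by auto
    next
      case False
      then have "norm (exp (z (k' - 1))) < norm (exp (z k))" using less by auto
      moreover have "norm (exp (z k')) < norm (exp (z (k' - 1)))" using step[of "k' - 1"] less that by auto
      ultimately show ?thesis by linarith
    qed
  qed
  show "norm (exp (z i')) < norm (exp (z i))" using lt i by auto
  have "norm (exp (z i)) \<le> norm (exp (z 1))" using lt[of 1 i] i by (cases "i = 1") auto
  then have "norm (nome \<tau>) * norm (exp (z i)) \<le> norm (nome \<tau>) * norm (exp (z 1))"
    by (intro mult_left_mono) auto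
  also have "\<dots> < norm (exp (z n))" using z by (auto simp: trace_domain_def norm_mult)
  also have "\<dots> \<le> norm (exp (z i'))" using lt[of i' n] i by (cases "i' = n") auto
  finally show "norm (nome \<tau>) * norm (exp (z i)) < norm (exp (z i'))" .
qed

text \<open>Multilinearity expands the states into monomials, and the finite sum over these commutes
  with the infinite one.\<close>

theorem has_sum_trace_term:
  assumes n: "1 \<le> n" and \<tau>: "Im \<tau> > 0" and z: "z \<in> trace_domain n \<tau>"
  shows "((\<lambda>(ms, b). trace_term n u \<tau> z ms b) has_sum
      1 / dedekind_eta \<tau> * wick (propagator (nome \<tau>) (\<lambda>i. exp (z i))) [1..<Suc n] u) (({1..n} \<rightarrow>\<^sub>E UNIV) \<times> UNIV)"
proof -
  let ?q = "nome \<tau>" and ?is = "[1..<Suc n]"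
  define x where "x = (\<lambda>i. exp (z i))"
  \<comment> \<open>The factor q^(-c/24). It is written with \<open>exp\<close>, as in
    \<open>dedekind_eta\<close>, because the nome alone does not determine a 24th root.\<close>
  define E where "E = exp (- (2 * of_real pi * \<i> * \<tau> / 24))"
  let ?Z = "1 / prodinf (\<lambda>n. 1 - ?q ^ Suc n)"
  let ?h = "\<lambda>B. hafnian (propagator ?q x) (concat (map (\<lambda>i. map (Pair i) (sorted_list_of_multiset (B i))) ?is))"
  let ?t = "\<lambda>B ms b. Poly_Mapping.lookup (foldr (\<lambda>i. vop_list (sorted_list_of_multiset (B i)) (ms i)) ?is (Poly_Mapping.single b 1)) b
        * (\<Prod>i\<in>set ?is. x i ^ wt (B i) * x i powi (- ms i - 1)) * ?q ^ wt b"
  note q = nome_nz[of \<tau>] norm_nome_less_1[OF \<tau>]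
  have isn: "set ?is = {1..n}" by auto
  have summable: "(\<lambda>n. norm (mode_coeff x i j n) * norm (mode_coeff x i' j' (- n)) * norm (pair_weight q' fst (i, k) (i', k') n)) summable_on UNIV"
    if "i \<in> set ?is" "i' \<in> set ?is" "norm q' = norm ?q" for i i' j j' and k k' :: nat and q'
    by (rule summable_pair[OF q that(3)]) (use that trace_domain_norms[OF z] in \<open>auto simp: x_def\<close>)
  have mono: "((\<lambda>(ms, b). ?t B ms b) has_sum ?Z * ?h B) ((set ?is \<rightarrow>\<^sub>E UNIV) \<times> UNIV)" for B
  proof (rule has_sum_trace_monomials[OF q])
    show "sorted_wrt (<) ?is" by (rule sorted_wrt_upt)
    show "x i \<noteq> 0" for i by (simp add: x_def)
    fix i j i' j' k k' :: nat assume i: "i \<in> set ?is" "i' \<in> set ?is"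
    have e: "pair_weight ?q fst (i, k) (i', k') = pair_weight ?q fst (i, j) (i', j')"
      by (auto simp: pair_weight_def fun_eq_iff)
    have "(\<lambda>n. mode_coeff x i j n * mode_coeff x i' j' (- n) * pair_weight ?q fst (i, j) (i', j') n) summable_on UNIV"
      by (rule abs_summable_summable) (use summable[OF i refl] in \<open>simp add: norm_mult\<close>)
    then show "((\<lambda>n. mode_coeff x i j n * mode_coeff x i' j' (- n) * pair_weight ?q fst (i, k) (i', k') n) has_sum propagator ?q x (i, j) (i', j')) UNIV"
      unfolding e propagator_def by simp
    show "(\<lambda>n. of_real (norm (mode_coeff x i j n)) * of_real (norm (mode_coeff x i' j' (- n))) * pair_weight (of_real (norm ?q)) fst (i, k) (i', k') n) summable_on UNIV"
      by (rule abs_summable_summable) (use summable[OF i, of "of_real (norm ?q)"] in \<open>simp add: norm_mult\<close>)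
  qed (rule propagator_sym)
  have expand: "trace_term n u \<tau> z ms b = E * (\<Sum>B\<in>PiE (set ?is) (\<lambda>i. Poly_Mapping.keys (u i)). (\<Prod>i\<in>set ?is. Poly_Mapping.lookup (u i) (B i)) * ?t B ms b)" for ms b
  proof -
    have "foldr (\<lambda>i. vop (pow_L0 (exp (z i)) (u i)) (ms i)) ?is (Poly_Mapping.single b 1) =
       foldr (\<lambda>i w. \<Sum>b\<in>Poly_Mapping.keys (u i). smul (x i ^ wt b * Poly_Mapping.lookup (u i) b) (vop_list (sorted_list_of_multiset b) (ms i) w)) ?is (Poly_Mapping.single b 1)"
      by (intro foldr_cong refl) (simp add: vop_pow_L0 x_def)
    also have "\<dots> = (\<Sum>B\<in>PiE (set ?is) (\<lambda>i. Poly_Mapping.keys (u i)). smul (\<Prod>i\<in>set ?is. x i ^ wt (B i) * Poly_Mapping.lookup (u i) (B i)) (foldr (\<lambda>i. vop_list (sorted_list_of_multiset (B i)) (ms i)) ?is (Poly_Mapping.single b 1)))"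
      by (rule foldr_multilinear) (simp_all only: distinct_upt module_hom_vop_list)
    finally have f: "Poly_Mapping.lookup (foldr (\<lambda>i. vop (pow_L0 (exp (z i)) (u i)) (ms i)) ?is (Poly_Mapping.single b 1)) b =
      (\<Sum>B\<in>PiE (set ?is) (\<lambda>i. Poly_Mapping.keys (u i)). (\<Prod>i\<in>set ?is. x i ^ wt (B i) * Poly_Mapping.lookup (u i) (B i)) * Poly_Mapping.lookup (foldr (\<lambda>i. vop_list (sorted_list_of_multiset (B i)) (ms i)) ?is (Poly_Mapping.single b 1)) b)"
      by (simp only: lookup_sum lookup_smul)
    have e: "exp (2 * of_real pi * \<i> * \<tau> * (of_nat (wt b) - central_charge / 24)) = ?q ^ wt b * E"
    proof -
      have "?q ^ wt b * E = exp (of_nat (wt b) * (2 * of_real pi * \<i> * \<tau>) + - (2 * of_real pi * \<i> * \<tau> / 24))"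
        by (simp only: nome_def E_def exp_add exp_of_nat_mult)
      also have "of_nat (wt b) * (2 * of_real pi * \<i> * \<tau>) + - (2 * of_real pi * \<i> * \<tau> / 24) = 2 * of_real pi * \<i> * \<tau> * (of_nat (wt b) - central_charge / 24)"
        by (simp add: central_charge_def algebra_simps)
      finally show ?thesis by (rule sym)
    qed
    show ?thesis
      unfolding trace_term_def f e isn[symmetric] x_def[symmetric] sum_distrib_right sum_distrib_left
      by (intro sum.cong refl) (simp only: prod.distrib x_def mult_ac)
  qed
  have "((\<lambda>p. E * (\<Sum>B\<in>PiE (set ?is) (\<lambda>i. Poly_Mapping.keys (u i)). (\<Prod>i\<in>set ?is. Poly_Mapping.lookup (u i) (B i)) * (case p of (ms, b) \<Rightarrow> ?t B ms b)))
     has_sum E * (\<Sum>B\<in>PiE (set ?is) (\<lambda>i. Poly_Mapping.keys (u i)). (\<Prod>i\<in>set ?is. Poly_Mapping.lookup (u i) (B i)) * (?Z * ?h B)))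
     ((set ?is \<rightarrow>\<^sub>E UNIV) \<times> UNIV)"
    by (intro has_sum_cmult_right has_sum_sum mono)
  also have "E * (\<Sum>B\<in>PiE (set ?is) (\<lambda>i. Poly_Mapping.keys (u i)). (\<Prod>i\<in>set ?is. Poly_Mapping.lookup (u i) (B i)) * (?Z * ?h B)) =
     E * ?Z * wick (propagator ?q x) ?is u"
    unfolding wick_def sum_distrib_left by (intro sum.cong refl) (simp only: mult_ac)
  also have "E * ?Z = 1 / dedekind_eta \<tau>"
    by (simp add: E_def dedekind_eta_def exp_minus field_simps)
  finally show ?thesis
    by (simp only: expand case_prod_unfold x_def isn)
qed

subsection \<open>Wick's theorem for square bracket states\<close>

definition lin_ext :: "(nat multiset \<Rightarrow> complex) \<Rightarrow> fock \<Rightarrow> complex" where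
  "lin_ext R v = (\<Sum>b\<in>Poly_Mapping.keys v. Poly_Mapping.lookup v b * R b)"

lemma lin_ext_superset:
  assumes "finite A" "Poly_Mapping.keys v \<subseteq> A"
  shows "lin_ext R v = (\<Sum>b\<in>A. Poly_Mapping.lookup v b * R b)"
  unfolding lin_ext_def using assms by (intro sum.mono_neutral_left) (auto simp: in_keys_iff)

lemma module_hom_lin_ext: "module_hom smul (*) (lin_ext R)"
proof unfold_locales
  fix v w :: fock and c :: complex
  let ?A = "Poly_Mapping.keys v \<union> Poly_Mapping.keys w \<union> Poly_Mapping.keys (v + w)"
  have *: "finite ?A" by auto
  have "lin_ext R (v + w) = (\<Sum>b\<in>?A. Poly_Mapping.lookup (v + w) b * R b)"
    by (rule lin_ext_superset[OF *]) auto
  also have "\<dots> = (\<Sum>b\<in>?A. Poly_Mapping.lookup v b * R b) + (\<Sum>b\<in>?A. Poly_Mapping.lookup w b * R b)"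
    by (simp add: lookup_add ring_distribs sum.distrib)
  also have "\<dots> = lin_ext R v + lin_ext R w"
  proof -
    have "Poly_Mapping.keys v \<subseteq> ?A" "Poly_Mapping.keys w \<subseteq> ?A" by auto
    then show ?thesis by (simp only: lin_ext_superset[OF *])
  qed
  finally show "lin_ext R (v + w) = lin_ext R v + lin_ext R w" .
  have "Poly_Mapping.keys (smul c v) \<subseteq> Poly_Mapping.keys v" by (auto simp: in_keys_iff)
  then show "lin_ext R (smul c v) = c * lin_ext R v"
    by (subst lin_ext_superset[OF finite_keys[of v]]) (auto simp: lin_ext_def sum_distrib_left mult.assoc)
qed

lemma lin_ext_single [simp]: "lin_ext R (Poly_Mapping.single b c) = c * R b"
  by (subst lin_ext_superset[of "{b}"]) auto

abbreviation part_list :: "nat list \<Rightarrow> (nat \<Rightarrow> nat multiset) \<Rightarrow> (nat \<times> nat) list" where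
  "part_list is B \<equiv> concat (map (\<lambda>i. map (Pair i) (sorted_list_of_multiset (B i))) is)"

lemma wick_coord:
  assumes "distinct is" "i \<in> set is"
  shows "wick S is (u(i := v)) = lin_ext (\<lambda>b. \<Sum>B\<in>PiE (set is - {i}) (\<lambda>k. Poly_Mapping.keys (u k)).
     (\<Prod>k\<in>set is - {i}. Poly_Mapping.lookup (u k) (B k)) * hafnian S (part_list is (B(i := b)))) v"
proof -
  have s: "set is = insert i (set is - {i})" "i \<notin> set is - {i}" using assms by auto
  let ?u = "u(i := v)"
  have "wick S is ?u = (\<Sum>b\<in>Poly_Mapping.keys (?u i). \<Sum>B\<in>PiE (set is - {i}) (\<lambda>k. Poly_Mapping.keys (?u k)).
     (\<Prod>k\<in>set is. Poly_Mapping.lookup (?u k) ((B(i := b)) k)) * hafnian S (part_list is (B(i := b))))"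
    unfolding wick_def by (subst s(1), subst sum_PiE_insert[OF s(2)]) (simp add: s(1)[symmetric] insert_absorb assms)
  also have "\<dots> = (\<Sum>b\<in>Poly_Mapping.keys v. \<Sum>B\<in>PiE (set is - {i}) (\<lambda>k. Poly_Mapping.keys (u k)).
     (Poly_Mapping.lookup v b * (\<Prod>k\<in>set is - {i}. Poly_Mapping.lookup (u k) (B k))) * hafnian S (part_list is (B(i := b))))"
  proof (rule sum.cong)
    fix b assume "b \<in> Poly_Mapping.keys v"
    have P: "PiE (set is - {i}) (\<lambda>k. Poly_Mapping.keys (?u k)) = PiE (set is - {i}) (\<lambda>k. Poly_Mapping.keys (u k))"
      by (intro PiE_cong) auto
    have "(\<Prod>k\<in>set is. Poly_Mapping.lookup (?u k) ((B(i := b)) k)) =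
       Poly_Mapping.lookup v b * (\<Prod>k\<in>set is - {i}. Poly_Mapping.lookup (u k) (B k))" for B
      by (subst prod.remove[of "set is" i]) (use assms in \<open>auto intro!: prod.cong arg_cong2[where f = "(*)"]\<close>)
    then show "(\<Sum>B\<in>PiE (set is - {i}) (\<lambda>k. Poly_Mapping.keys (?u k)).
     (\<Prod>k\<in>set is. Poly_Mapping.lookup (?u k) ((B(i := b)) k)) * hafnian S (part_list is (B(i := b)))) =
     (\<Sum>B\<in>PiE (set is - {i}) (\<lambda>k. Poly_Mapping.keys (u k)).
     (Poly_Mapping.lookup v b * (\<Prod>k\<in>set is - {i}. Poly_Mapping.lookup (u k) (B k))) * hafnian S (part_list is (B(i := b))))"
      unfolding P by (simp only:)
  qed simp
  finally show ?thesis by (simp add: lin_ext_def sum_distrib_left mult.assoc)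
qed

lemma module_hom_wick:
  assumes "distinct is" "i \<in> set is"
  shows "module_hom smul (*) (\<lambda>v. wick S is (u(i := v)))"
  unfolding wick_coord[OF assms] by (rule module_hom_lin_ext)

lemma fock_expand: "v = (\<Sum>b\<in>Poly_Mapping.keys v. smul (Poly_Mapping.lookup v b) (Poly_Mapping.single b 1))"
proof (rule poly_mapping_eqI)
  fix k
  have "(\<Sum>b\<in>Poly_Mapping.keys v. Poly_Mapping.lookup v b * Poly_Mapping.lookup (Poly_Mapping.single b 1) k) =
     (\<Sum>b\<in>Poly_Mapping.keys v. if b = k then Poly_Mapping.lookup v b else 0)"
    by (intro sum.cong) (auto simp: lookup_single)
  then show "Poly_Mapping.lookup v k = Poly_Mapping.lookup (\<Sum>b\<in>Poly_Mapping.keys v. smul (Poly_Mapping.lookup v b) (Poly_Mapping.single b 1)) k"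
    by (simp add: lookup_sum in_keys_iff)
qed

text \<open>Multiplication by a variable and partial derivatives send a monomial to a multiple of a
  monomial; for such operators the action can be carried out inside the sum over monomials.\<close>

lemma wick_op:
  assumes "distinct is" "i \<in> set is" and T: "module_hom smul smul T"
    and Ts: "\<And>b. T (Poly_Mapping.single b 1) = Poly_Mapping.single (f b) (\<kappa> b)"
  shows "wick S is (u(i := T (u i))) = (\<Sum>B\<in>PiE (set is) (\<lambda>k. Poly_Mapping.keys (u k)).
     (\<Prod>k\<in>set is. Poly_Mapping.lookup (u k) (B k)) * (\<kappa> (B i) * hafnian S (part_list is (B(i := f (B i))))))"
proof -
  have s: "set is = insert i (set is - {i})" "i \<notin> set is - {i}" using assms by auto
  let ?R = "\<lambda>b. \<Sum>B\<in>PiE (set is - {i}) (\<lambda>k. Poly_Mapping.keys (u k)).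
     (\<Prod>k\<in>set is - {i}. Poly_Mapping.lookup (u k) (B k)) * hafnian S (part_list is (B(i := b)))"
  interpret T: module_hom smul smul T by fact
  interpret L: module_hom smul "(*)" "lin_ext ?R" by (rule module_hom_lin_ext)
  have "wick S is (u(i := T (u i))) = lin_ext ?R (T (\<Sum>b\<in>Poly_Mapping.keys (u i). smul (Poly_Mapping.lookup (u i) b) (Poly_Mapping.single b 1)))"
    unfolding fock_expand[of "u i", symmetric] by (rule wick_coord[OF assms(1,2)])
  also have "\<dots> = (\<Sum>b\<in>Poly_Mapping.keys (u i). Poly_Mapping.lookup (u i) b * (\<kappa> b * ?R (f b)))"
    by (simp only: T.sum T.scale L.sum L.scale Ts lin_ext_single)
  also have "\<dots> = (\<Sum>b\<in>Poly_Mapping.keys (u i). \<Sum>B\<in>PiE (set is - {i}) (\<lambda>k. Poly_Mapping.keys (u k)).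
     (\<Prod>k\<in>set is. Poly_Mapping.lookup (u k) ((B(i := b)) k)) * (\<kappa> ((B(i := b)) i) * hafnian S (part_list is ((B(i := b))(i := f ((B(i := b)) i))))))"
    unfolding sum_distrib_left
  proof (intro sum.cong refl)
    fix b B
    have "(\<Prod>k\<in>set is. Poly_Mapping.lookup (u k) ((B(i := b)) k)) =
       Poly_Mapping.lookup (u i) b * (\<Prod>k\<in>set is - {i}. Poly_Mapping.lookup (u k) (B k))"
      by (subst prod.remove[of "set is" i]) (use assms in \<open>auto intro!: prod.cong arg_cong2[where f = "(*)"]\<close>)
    then show "Poly_Mapping.lookup (u i) b * (\<kappa> b * ((\<Prod>k\<in>set is - {i}. Poly_Mapping.lookup (u k) (B k)) * hafnian S (part_list is (B(i := f b))))) =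
     (\<Prod>k\<in>set is. Poly_Mapping.lookup (u k) ((B(i := b)) k)) * (\<kappa> ((B(i := b)) i) * hafnian S (part_list is ((B(i := b))(i := f ((B(i := b)) i)))))"
      by (simp only: fun_upd_same fun_upd_upd mult_ac)
  qed
  also have "\<dots> = (\<Sum>B\<in>PiE (insert i (set is - {i})) (\<lambda>k. Poly_Mapping.keys (u k)).
     (\<Prod>k\<in>set is. Poly_Mapping.lookup (u k) (B k)) * (\<kappa> (B i) * hafnian S (part_list is (B(i := f (B i))))))"
    by (rule sum_PiE_insert[OF s(2), symmetric])
  finally show ?thesis unfolding s(1)[symmetric] .
qed

lemma mset_part_list:
  "mset (part_list is B) = (\<Sum>i\<leftarrow>is. image_mset (Pair i) (B i))"
  by (induction "is") auto

text \<open>Up to order the new factor stands at the head of the list, and the hafnian is expanded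
  along it. Removing the partner from the list means removing it from the monomial of its
  insertion.\<close>

lemma hafnian_add_mset:
  fixes S :: "nat \<times> nat \<Rightarrow> nat \<times> nat \<Rightarrow> complex"
  assumes "distinct is" "i \<in> set is" and sym: "\<And>y z. S y z = S z y"
  shows "hafnian S (part_list is (B(i := add_mset j (B i)))) =
    (\<Sum>i'\<in>set is. \<Sum>j'\<in>#B i'. S (i, j) (i', j') * hafnian S (part_list is (B(i' := B i' - {#j'#}))))"
proof -
  have upd: "mset (part_list is (B(k := b))) + image_mset (Pair k) (B k) = mset (part_list is B) + image_mset (Pair k) b"
    if "k \<in> set is" for k b
  proof -
    have "(\<Sum>i\<leftarrow>is. image_mset (Pair i) ((B(k := b)) i)) + image_mset (Pair k) (B k) = (\<Sum>i\<leftarrow>is. image_mset (Pair i) (B i)) + image_mset (Pair k) b"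
      using that assms(1)
    proof (induction "is")
      case (Cons a "is")
      show ?case
      proof (cases "a = k")
        case True
        then have "(\<Sum>i\<leftarrow>is. image_mset (Pair i) ((B(k := b)) i)) = (\<Sum>i\<leftarrow>is. image_mset (Pair i) (B i))"
          using Cons.prems by (intro arg_cong[where f = sum_list] map_cong) auto
        with True show ?thesis by simp
      next
        case False
        with Cons show ?thesis by (simp add: add.assoc)
      qed
    qed simp
    then show ?thesis by (simp only: mset_part_list)
  qed
  have a: "mset (part_list is (B(i := add_mset j (B i)))) = mset ((i, j) # part_list is B)"
  proof -
    have "mset (part_list is (B(i := add_mset j (B i)))) + image_mset (Pair i) (B i) = add_mset (i, j) (mset (part_list is B)) + image_mset (Pair i) (B i)"
      unfolding upd[OF assms(2), of "add_mset j (B i)"]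
      by (simp only: image_mset_add_mset union_mset_add_mset_right union_mset_add_mset_left)
    then show ?thesis by (simp only: add_right_cancel mset.simps)
  qed
  have "hafnian S (part_list is (B(i := add_mset j (B i)))) = hafnian S ((i, j) # part_list is B)"
    by (rule hafnian_perm[OF sym a])
  also have "\<dots> = (\<Sum>y\<in>#mset (part_list is B). S (i, j) y * hafnian S (remove1 y (part_list is B)))"
    by (rule hafnian_mset_Cons)
  also have "\<dots> = (\<Sum>k\<leftarrow>is. \<Sum>j'\<in>#B k. S (i, j) (k, j') * hafnian S (remove1 (k, j') (part_list is B)))"
  proof -
    have "(\<Sum>y\<in>#(\<Sum>k\<leftarrow>xs. image_mset (Pair k) (B k)). g y) = (\<Sum>k\<leftarrow>xs. \<Sum>j'\<in>#B k. g (k, j'))"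
      for g :: "nat \<times> nat \<Rightarrow> complex" and xs
      by (induction xs) (simp_all add: image_mset.compositionality o_def)
    from this[of "\<lambda>y. S (i, j) y * hafnian S (remove1 y (part_list is B))" "is"]
    show ?thesis by (simp only: mset_part_list)
  qed
  also have "\<dots> = (\<Sum>k\<in>set is. \<Sum>j'\<in>#B k. S (i, j) (k, j') * hafnian S (remove1 (k, j') (part_list is B)))"
    using assms(1) by (rule sum_list_distinct_conv_sum_set)
  also have "\<dots> = (\<Sum>i'\<in>set is. \<Sum>j'\<in>#B i'. S (i, j) (i', j') * hafnian S (part_list is (B(i' := B i' - {#j'#}))))"
  proof (intro sum.cong refl arg_cong[where f = sum_mset] image_mset_cong)
    fix k j' assume k: "k \<in> set is" "j' \<in># B k"
    have "image_mset (Pair k) (B k) = add_mset (k, j') (image_mset (Pair k) (B k - {#j'#}))"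
      using k(2) by (metis image_mset_add_mset insert_DiffM)
    then have "mset (part_list is B) = add_mset (k, j') (mset (part_list is (B(k := B k - {#j'#}))))"
      using upd[OF k(1), of "B k - {#j'#}"] by simp
    then have "mset (remove1 (k, j') (part_list is B)) = mset (part_list is (B(k := B k - {#j'#})))"
      by simp
    from hafnian_perm[OF sym this]
    show "S (i, j) (k, j') * hafnian S (remove1 (k, j') (part_list is B)) = S (i, j) (k, j') * hafnian S (part_list is (B(k := B k - {#j'#})))"
      by simp
  qed
  finally show ?thesis .
qed

lemma sum_mset_count:
  fixes g :: "nat \<Rightarrow> complex"
  assumes "set_mset b \<subseteq> {..<J}"
  shows "(\<Sum>j\<in>#b. g j) = (\<Sum>j<J. of_nat (count b j) * g j)"
  using assms
proof (induction b)
  case (add x b)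
  have "(\<Sum>j<J. of_nat (count (add_mset x b) j) * g j) = (\<Sum>j<J. of_nat (count b j) * g j + (if j = x then g j else 0))"
    by (intro sum.cong) (auto simp: ring_distribs)
  with add show ?case by (simp add: sum.distrib)
qed simp

text \<open>The partial derivative in the variable a(-j-1).\<close>

definition fock_deriv :: "nat \<Rightarrow> fock \<Rightarrow> fock" where
  "fock_deriv j v = smul (1 / of_nat (j + 1)) (heis (int j + 1) v)"

lemma module_hom_fock_deriv: "module_hom smul smul (fock_deriv j)"
  by unfold_locales (simp_all add: fock_deriv_def heis_add heis_smul smul_add smul_smul mult.commute)

lemma fock_deriv_single: "fock_deriv j (Poly_Mapping.single b 1) = Poly_Mapping.single (b - {#j#}) (of_nat (count b j))"
proof -
  have "(1 + complex_of_nat j) \<noteq> 0" by (metis of_nat_Suc of_nat_neq_0)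
  then show ?thesis by (simp add: fock_deriv_def heis_single_pos smul_single add.commute)
qed

text \<open>Gaussian integration by parts: the new factor a(-j-1) is contracted with every other
  factor, those of its own state included, and a contraction differentiates the state of the
  partner.\<close>

lemma wick_mult:
  assumes "distinct is" "i \<in> set is" and sym: "\<And>y z. S y z = S z y"
    and J: "\<And>k. k \<in> set is \<Longrightarrow> mode_bound J (u k)"
  shows "wick S is (u(i := heis (- int j - 1) (u i))) =
    (\<Sum>i'\<in>set is. \<Sum>j'<J. S (i, j) (i', j') * wick S is (u(i' := fock_deriv j' (u i'))))"
proof -
  let ?P = "PiE (set is) (\<lambda>k. Poly_Mapping.keys (u k))" and ?p = "\<lambda>B. \<Prod>k\<in>set is. Poly_Mapping.lookup (u k) (B k)"
  have "wick S is (u(i := heis (- int j - 1) (u i))) = (\<Sum>B\<in>?P. ?p B * (1 * hafnian S (part_list is (B(i := add_mset j (B i))))))"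
    by (rule wick_op[OF assms(1,2) module_hom_heis]) (simp add: heis_single_neg)
  also have "\<dots> = (\<Sum>B\<in>?P. ?p B * (\<Sum>i'\<in>set is. \<Sum>j'<J. of_nat (count (B i') j') * (S (i, j) (i', j') * hafnian S (part_list is (B(i' := B i' - {#j'#}))))))"
  proof (intro sum.cong refl arg_cong2[where f = "(*)"])
    fix B assume B: "B \<in> ?P"
    have b: "set_mset (B k) \<subseteq> {..<J}" if "k \<in> set is" for k
      using J[OF that] B that by (auto simp: mode_bound_def PiE_def Pi_def)
    show "1 * hafnian S (part_list is (B(i := add_mset j (B i)))) =
       (\<Sum>i'\<in>set is. \<Sum>j'<J. of_nat (count (B i') j') * (S (i, j) (i', j') * hafnian S (part_list is (B(i' := B i' - {#j'#})))))"
      unfolding mult_1_left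
      by (rule trans[OF hafnian_add_mset[OF assms(1,2) sym]]) (intro sum.cong refl sum_mset_count b)
  qed
  also have "\<dots> = (\<Sum>B\<in>?P. \<Sum>i'\<in>set is. \<Sum>j'<J. S (i, j) (i', j') * (?p B * (of_nat (count (B i') j') * hafnian S (part_list is (B(i' := B i' - {#j'#}))))))"
    unfolding sum_distrib_left by (intro sum.cong refl) (simp only: mult_ac)
  also have "\<dots> = (\<Sum>i'\<in>set is. \<Sum>j'<J. S (i, j) (i', j') * (\<Sum>B\<in>?P. ?p B * (of_nat (count (B i') j') * hafnian S (part_list is (B(i' := B i' - {#j'#}))))))"
    unfolding sum_distrib_left
    by (subst sum.swap, intro sum.cong refl, subst sum.swap, rule refl)
  also have "\<dots> = (\<Sum>i'\<in>set is. \<Sum>j'<J. S (i, j) (i', j') * wick S is (u(i' := fock_deriv j' (u i'))))"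
    by (intro sum.cong refl arg_cong2[where f = "(*)"] wick_op[OF assms(1) _ module_hom_fock_deriv fock_deriv_single, symmetric])
  finally show ?thesis .
qed

section \<open>Square bracket modes of the generating state\<close>

lemma fls_subdegree_exp_minus_1: "fls_subdegree (fps_to_fls (fps_exp 1 - 1 :: complex fps)) = 1"
proof -
  have "subdegree (fps_exp 1 - 1 :: complex fps) = 1"
    by (rule subdegreeI) auto
  then show ?thesis by (simp only: fls_subdegree_fls_to_fps of_nat_1)
qed

text \<open>The exponential factor is a unit and the power of e^z - 1 starts at z^(-k-1).\<close>

lemma sq_coeff_eq_0: "k < n \<Longrightarrow> sq_coeff w k n = 0"
proof -
  assume kn: "k < n"
  define E Y where "E = fps_to_fls (fps_exp (of_nat w) :: complex fps)" and "Y = fps_to_fls (fps_exp 1 - 1 :: complex fps)"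
  have "subdegree (fps_exp (of_nat w) :: complex fps) = 0" by (rule subdegreeI) auto
  then have E: "fls_subdegree E = 0" "E \<noteq> 0" by (simp_all add: E_def fls_subdegree_fls_to_fps fps_to_fls_eq_0_iff fps_exp_neq_0)
  have Y: "fls_subdegree Y = 1" unfolding Y_def by (rule fls_subdegree_exp_minus_1)
  then have "Y \<noteq> 0" by auto
  then have "fls_subdegree (E * Y powi (- k - 1)) = - k - 1"
    by (simp add: E Y fls_subdegree_power_int)
  then show ?thesis
    using kn unfolding sq_coeff_def E_def Y_def by (intro fls_eq0_below_subdegree) simp
qed

text \<open>The lower limit comes from the order of the coefficient series, the upper one from the
  annihilation of \<open>w\<close> by high modes. The index 1 of \<open>sq_coeff\<close> is the
  weight of the state.\<close>

lemma sqmode_gen_a: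
  assumes "mode_bound K w" "int K \<le> int K'"
  shows "sqmode gen_a (- int m) w = (\<Sum>k\<in>{- int m..int K'}. smul (sq_coeff 1 k (- int m)) (heis k w))"
proof -
  have "sqmode gen_a (- int m) w = Sum_any (\<lambda>k. smul (sq_coeff 1 k (- int m)) (heis k w))"
    unfolding sqmode_def gen_a_def by (simp add: vop_gen_a[unfolded gen_a_def])
  also have "\<dots> = (\<Sum>k\<in>{- int m..int K'}. smul (sq_coeff 1 k (- int m)) (heis k w))"
  proof (rule Sum_any.expand_superset)
    show "{k. smul (sq_coeff 1 k (- int m)) (heis k w) \<noteq> 0} \<subseteq> {- int m..int K'}"
    proof
      fix k assume "k \<in> {k. smul (sq_coeff 1 k (- int m)) (heis k w) \<noteq> 0}"
      then have "sq_coeff 1 k (- int m) \<noteq> 0" "heis k w \<noteq> 0" by auto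
      then have "- int m \<le> k" "k \<le> int K'"
        using sq_coeff_eq_0[of k "- int m" 1] mode_bound_heis(2)[OF assms(1), of k] assms(2) by fastforce+
      then show "k \<in> {- int m..int K'}" by simp
    qed
  qed auto
  finally show ?thesis .
qed

lemma mode_bound_mono: "mode_bound K w \<Longrightarrow> K \<le> K' \<Longrightarrow> mode_bound K' w"
  unfolding mode_bound_def by (meson lessThan_subset_iff order_trans)

text \<open>Among the round modes that make up a[-m], only the one of index -n fails to commute with
  a(n).\<close>

lemma heis_sqmode_commute:
  assumes "n \<ge> 0"
  shows "heis n (sqmode gen_a (- int m) w) = sqmode gen_a (- int m) (heis n w) + smul (of_int n * sq_coeff 1 (- n) (- int m)) w"
proof -
  obtain K where K: "mode_bound K w" using ex_mode_bound by blast
  note K' = mode_bound_heis(1)[OF K assms]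
  interpret H: module_hom smul smul "heis n" by (rule module_hom_heis)
  let ?c = "\<lambda>k. sq_coeff 1 k (- int m)"
  have "heis n (heis k w) = heis k (heis n w) + (if k = - n then smul (of_int n) w else 0)" for k
    using heis_commute[of n k w] by (auto simp: algebra_simps)
  then have "heis n (sqmode gen_a (- int m) w) =
     (\<Sum>k\<in>{- int m..int K}. smul (?c k) (heis k (heis n w)) + (if k = - n then smul (of_int n * ?c k) w else 0))"
    unfolding sqmode_gen_a[OF K order_refl] H.sum H.scale
    by (intro sum.cong refl) (auto simp: smul_add smul_smul mult.commute)
  also have "\<dots> = sqmode gen_a (- int m) (heis n w) + (if - n \<in> {- int m..int K} then smul (of_int n * ?c (- n)) w else 0)"
    unfolding sqmode_gen_a[OF K' order_refl] by (simp add: sum.distrib)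
  also have "(if - n \<in> {- int m..int K} then smul (of_int n * ?c (- n)) w else 0) = smul (of_int n * ?c (- n)) w"
    using sq_coeff_eq_0[of "- n" "- int m" 1] assms by auto
  finally show ?thesis .
qed

lemma module_hom_sqmode: "module_hom smul smul (sqmode gen_a (- int m))"
proof unfold_locales
  fix v w :: fock and c
  obtain K1 K2 where "mode_bound K1 v" "mode_bound K2 w" using ex_mode_bound by metis
  then have K: "mode_bound (max K1 K2) v" "mode_bound (max K1 K2) w" by (auto intro: mode_bound_mono)
  have vw: "mode_bound (max K1 K2) (v + w)" "mode_bound (max K1 K2) (smul c v)"
  proof -
    have "Poly_Mapping.keys (v + w) \<subseteq> Poly_Mapping.keys v \<union> Poly_Mapping.keys w" "Poly_Mapping.keys (smul c v) \<subseteq> Poly_Mapping.keys v"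
      by (auto simp: in_keys_iff lookup_add)
    with K show "mode_bound (max K1 K2) (v + w)" "mode_bound (max K1 K2) (smul c v)"
      unfolding mode_bound_def by blast+
  qed
  show "sqmode gen_a (- int m) (v + w) = sqmode gen_a (- int m) v + sqmode gen_a (- int m) w"
    by (simp add: sqmode_gen_a[OF vw(1) order_refl] sqmode_gen_a[OF K(1) order_refl] sqmode_gen_a[OF K(2) order_refl] heis_add smul_add sum.distrib)
  show "sqmode gen_a (- int m) (smul c v) = smul c (sqmode gen_a (- int m) v)"
    by (simp add: sqmode_gen_a[OF vw(2) order_refl] sqmode_gen_a[OF K(1) order_refl] heis_smul fock.scale_sum_right smul_smul mult.commute)
qed

text \<open>In contrast to \<open>fock_state\<close>, this takes any list of labelled letters, so
  that single letters can be deleted in an induction.\<close>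

definition sq_state :: "('a \<Rightarrow> nat) \<Rightarrow> 'a list \<Rightarrow> fock" where
  "sq_state \<mu> ls = foldr (\<lambda>y. sqmode gen_a (- int (\<mu> y))) ls 1"

text \<open>The mode moves past all square bracket letters and finally kills the vacuum; each
  commutator is a scalar and deletes the letter.\<close>

lemma heis_sq_state:
  assumes "n \<ge> 0"
  shows "distinct ls \<Longrightarrow> heis n (sq_state \<mu> ls) =
     (\<Sum>y\<leftarrow>ls. smul (of_int n * sq_coeff 1 (- n) (- int (\<mu> y))) (sq_state \<mu> (remove1 y ls)))"
proof (induction ls)
  case Nil
  have "heis n (1 :: fock) = 0"
  proof (cases "n = 0")
    case False
    with assms show ?thesis using heis_single_pos[of n "{#}" 1] by simp
  qed simp
  then show ?case by (simp add: sq_state_def)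
next
  case (Cons x ls)
  interpret Q: module_hom smul smul "sqmode gen_a (- int m)" for m by (rule module_hom_sqmode)
  have Qs: "sqmode gen_a (- int m) (sum_list vs) = (\<Sum>v\<leftarrow>vs. sqmode gen_a (- int m) v)" for m vs
    by (induction vs) (simp_all add: Q.add)
  have c: "sq_state \<mu> (z # zs) = sqmode gen_a (- int (\<mu> z)) (sq_state \<mu> zs)" for z zs
    by (simp add: sq_state_def)
  have "(\<Sum>y\<leftarrow>ls. sqmode gen_a (- int (\<mu> x)) (smul (of_int n * sq_coeff 1 (- n) (- int (\<mu> y))) (sq_state \<mu> (remove1 y ls)))) =
     (\<Sum>y\<leftarrow>ls. smul (of_int n * sq_coeff 1 (- n) (- int (\<mu> y))) (sq_state \<mu> (remove1 y (x # ls))))"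
    using Cons.prems by (intro arg_cong[where f = sum_list] map_cong refl) (auto simp: Q.scale c)
  then show ?case
    using Cons by (simp add: c heis_sqmode_commute[OF assms] Qs o_def add.commute)
qed

text \<open>
  Contractions of square bracket modes: within one state, from commuting the annihilating part of
  \<open>a[-m]\<close> past the creating part of \<open>a[-r]\<close>, and between factors of the trace.
\<close>

definition sq_contraction :: "nat \<Rightarrow> nat \<Rightarrow> complex" where
  "sq_contraction m r = (\<Sum>k=1..r. sq_coeff 1 (int k) (- int m) * (of_nat k * sq_coeff 1 (- int k) (- int r)))"

definition sq_propagator :: "(nat \<times> nat \<Rightarrow> nat \<times> nat \<Rightarrow> complex) \<Rightarrow> nat \<Rightarrow> nat \<Rightarrow> nat \<Rightarrow> nat \<Rightarrow> complex" where
  "sq_propagator S i m i' m' = (\<Sum>j<m. \<Sum>j'<m'. sq_coeff 1 (- int j - 1) (- int m) * sq_coeff 1 (- int j' - 1) (- int m') * S (i, j) (i', j'))"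

text \<open>Both parts of the leading letter end in terms of the same kind: annihilating modes
  delete a letter of the same state, and creating modes are contracted with derivatives of the
  states, which again delete single letters. The result is the recursion of the hafnian.\<close>

lemma wick_sq_state:
  fixes pt :: "'a \<Rightarrow> nat"
  assumes "distinct is" and sym: "\<And>y z. S y z = S z y"
  shows "distinct ls \<Longrightarrow> pt ` set ls \<subseteq> set is \<Longrightarrow>
    wick S is (\<lambda>i. sq_state \<mu> (filter (\<lambda>y. pt y = i) ls)) =
    hafnian (\<lambda>y y'. (if pt y = pt y' then sq_contraction (\<mu> y) (\<mu> y') else 0) + sq_propagator S (pt y) (\<mu> y) (pt y') (\<mu> y')) ls"
proof (induction ls rule: length_induct)
  case (1 ls)
  let ?u = "\<lambda>ls i. sq_state \<mu> (filter (\<lambda>y. pt y = i) ls)"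
  let ?\<gamma> = "\<lambda>y y'. (if pt y = pt y' then sq_contraction (\<mu> y) (\<mu> y') else 0) + sq_propagator S (pt y) (\<mu> y) (pt y') (\<mu> y')"
  show ?case
  proof (cases ls)
    case Nil
    have k: "Poly_Mapping.keys (1 :: fock) = {{#}}"
      by (metis keys_single one_neq_zero single_one)
    have l: "Poly_Mapping.lookup (1 :: fock) {#} = 1"
      by (metis lookup_single_eq single_one)
    have "PiE (set is) (\<lambda>i. {{#}}) = {restrict (\<lambda>_. {#}) (set is)}"
      by (auto simp: PiE_def extensional_def restrict_def fun_eq_iff)
    moreover have "part_list is (restrict (\<lambda>_. {#}) (set is)) = []" by simp
    ultimately obtain B where B: "PiE (set is) (\<lambda>i. {{#}}) = {B}" "part_list is B = []" "B = restrict (\<lambda>_. {#}) (set is)" by blast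
    have "Poly_Mapping.lookup (1 :: fock) (B i) = 1" if "i \<in> set is" for i using that by (simp add: B(3) l)
    moreover have "(\<lambda>i. sq_state \<mu> (filter (\<lambda>y. pt y = i) [])) = (\<lambda>i. 1)" by (simp add: sq_state_def)
    moreover have "wick S is (\<lambda>i. 1) = (\<Prod>i\<in>set is. Poly_Mapping.lookup 1 (B i)) * hafnian S (part_list is B)"
      unfolding wick_def k B(1) by simp
    ultimately show ?thesis unfolding Nil by (simp only: B(2) hafnian.simps prod.neutral_const mult_1_left cong: prod.cong)
  next
    case (Cons y ls')
    define i m where "i = pt y" and "m = \<mu> y"
    define u where "u = ?u ls'"
    have i: "i \<in> set is" and dist: "distinct ls'" "y \<notin> set ls'" and sub: "pt ` set ls' \<subseteq> set is"
      using 1 Cons by (auto simp: i_def)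
    define w where "w = (\<lambda>y'. wick S is (?u (remove1 y' ls')))"
    have W: "module_hom smul (*) (\<lambda>v. wick S is (u(i' := v)))" if "i' \<in> set is" for i'
      by (rule module_hom_wick[OF assms(1) that])
    have Wl: "wick S is (u(i' := sum_list (map g zs))) = (\<Sum>z\<leftarrow>zs. wick S is (u(i' := g z)))" if "i' \<in> set is" for i' g and zs :: "'a list"
      by (induction zs) (simp_all only: list.map sum_list.Nil sum_list.Cons module_hom.add[OF W[OF that]] module_hom.zero[OF W[OF that]])
    have upd: "u(pt y' := sq_state \<mu> (remove1 y' (filter (\<lambda>z. pt z = pt y') ls'))) = ?u (remove1 y' ls')" if "y' \<in> set ls'" for y'
    proof
      fix k show "(u(pt y' := sq_state \<mu> (remove1 y' (filter (\<lambda>z. pt z = pt y') ls')))) k = ?u (remove1 y' ls') k"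
        by (cases "k = pt y'") (simp_all add: u_def filter_remove1 remove1_idem[of y' "filter (\<lambda>z. pt z = k) ls'"])
    qed
    have heis: "wick S is (u(i' := heis n (u i'))) = (\<Sum>y'\<leftarrow>filter (\<lambda>z. pt z = i') ls'. of_int n * sq_coeff 1 (- n) (- int (\<mu> y')) * w y')"
      if i': "i' \<in> set is" and n: "n \<ge> 0" for i' n
    proof -
      have d: "distinct (filter (\<lambda>z. pt z = i') ls')" using dist by simp
      have "wick S is (u(i' := heis n (u i'))) = (\<Sum>y'\<leftarrow>filter (\<lambda>z. pt z = i') ls'. wick S is (u(i' := smul (of_int n * sq_coeff 1 (- n) (- int (\<mu> y'))) (sq_state \<mu> (remove1 y' (filter (\<lambda>z. pt z = i') ls'))))))"
        unfolding Wl[OF i', symmetric] using heis_sq_state[OF n d] by (simp add: u_def)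
      also have "\<dots> = (\<Sum>y'\<leftarrow>filter (\<lambda>z. pt z = i') ls'. of_int n * sq_coeff 1 (- n) (- int (\<mu> y')) * w y')"
        unfolding module_hom.scale[OF W[OF i']] w_def using upd by (intro arg_cong[where f = sum_list] map_cong refl) auto
      finally show ?thesis .
    qed
    have deriv: "wick S is (u(i' := fock_deriv j' (u i'))) = (\<Sum>y'\<leftarrow>filter (\<lambda>z. pt z = i') ls'. sq_coeff 1 (- int j' - 1) (- int (\<mu> y')) * w y')"
      if i': "i' \<in> set is" for i' j'
    proof -
      have ne: "(of_nat (j' + 1) :: complex) \<noteq> 0" by (metis add.commute of_nat_neq_0 plus_1_eq_Suc)
      have e: "- (int j' + 1) = - int j' - 1" and n0: "0 \<le> int j' + 1" by simp_all
      have c: "(of_int (int j' + 1) :: complex) = of_nat (j' + 1)" by simp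
      have cancel: "1 / N * (N * a * b) = a * b" if "N \<noteq> 0" for N a b :: complex using that by simp
      have "wick S is (u(i' := fock_deriv j' (u i'))) = 1 / of_nat (j' + 1) * wick S is (u(i' := heis (int j' + 1) (u i')))"
        unfolding fock_deriv_def module_hom.scale[OF W[OF i']] ..
      also have "\<dots> = (\<Sum>y'\<leftarrow>filter (\<lambda>z. pt z = i') ls'. 1 / of_nat (j' + 1) * (of_nat (j' + 1) * sq_coeff 1 (- int j' - 1) (- int (\<mu> y')) * w y'))"
        by (simp only: heis[OF i' n0] e c sum_list_const_mult)
      also have "\<dots> = (\<Sum>y'\<leftarrow>filter (\<lambda>z. pt z = i') ls'. sq_coeff 1 (- int j' - 1) (- int (\<mu> y')) * w y')"
        by (intro arg_cong[where f = sum_list] map_cong refl cancel[OF ne])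
      finally show ?thesis .
    qed
    \<comment> \<open>One bound for the variables of all states and for all labels, so that the
      truncated sums below have a common range.\<close>
    obtain J where J: "\<And>k. k \<in> set is \<Longrightarrow> mode_bound J (u k)" "\<And>y'. y' \<in> set ls' \<Longrightarrow> \<mu> y' \<le> J"
    proof -
      have "\<exists>Jf. \<forall>k. mode_bound (Jf k) (u k)" by (intro choice allI ex_mode_bound)
      then obtain Jf where Jf: "\<And>k. mode_bound (Jf k) (u k)" by blast
      define J where "J = Max (insert 0 (Jf ` set is \<union> \<mu> ` set ls'))"
      have "Jf k \<le> J" if "k \<in> set is" for k unfolding J_def using that by (intro Max_ge) auto
      moreover have "\<mu> y' \<le> J" if "y' \<in> set ls'" for y' unfolding J_def using that by (intro Max_ge) auto
      ultimately show ?thesis using Jf mode_bound_mono that by blast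
    qed
    have regroup: "(\<Sum>i'\<in>set is. \<Sum>y'\<leftarrow>filter (\<lambda>z. pt z = i') ls'. G y') = (\<Sum>y'\<leftarrow>ls'. G y')" for G :: "'a \<Rightarrow> complex"
      using sub
    proof (induction ls')
      case (Cons a zs)
      have "(\<Sum>i'\<in>set is. \<Sum>y'\<leftarrow>filter (\<lambda>z. pt z = i') (a # zs). G y') =
        (\<Sum>i'\<in>set is. (if i' = pt a then G a else 0) + (\<Sum>y'\<leftarrow>filter (\<lambda>z. pt z = i') zs. G y'))"
        by (intro sum.cong) auto
      then show ?case using Cons by (simp add: sum.distrib)
    qed simp
    have A: "wick S is (u(i := heis (- int j - 1) (u i))) =
      (\<Sum>y'\<leftarrow>ls'. (\<Sum>j'<\<mu> y'. S (i, j) (pt y', j') * sq_coeff 1 (- int j' - 1) (- int (\<mu> y'))) * w y')" for j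
    proof -
      have "wick S is (u(i := heis (- int j - 1) (u i))) =
        (\<Sum>i'\<in>set is. \<Sum>j'<J. S (i, j) (i', j') * (\<Sum>y'\<leftarrow>filter (\<lambda>z. pt z = i') ls'. sq_coeff 1 (- int j' - 1) (- int (\<mu> y')) * w y'))"
        by (rule trans[OF wick_mult[OF assms(1) i sym J(1)]], assumption) (intro sum.cong refl, simp only: deriv)
      also have "\<dots> = (\<Sum>i'\<in>set is. \<Sum>y'\<leftarrow>filter (\<lambda>z. pt z = i') ls'. (\<Sum>j'<J. S (i, j) (pt y', j') * sq_coeff 1 (- int j' - 1) (- int (\<mu> y'))) * w y')"
      proof (rule sum.cong[OF refl])
        fix i'
        have "(\<Sum>j'<J. a j' * (\<Sum>y'\<leftarrow>zs. c j' y' * w y')) = (\<Sum>y'\<leftarrow>zs. (\<Sum>j'<J. a j' * c j' y') * w y')"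
          for a and c :: "nat \<Rightarrow> 'a \<Rightarrow> complex" and zs
          by (induction zs) (simp_all add: sum.distrib ring_distribs sum_distrib_right mult.assoc)
        then have "(\<Sum>j'<J. S (i, j) (i', j') * (\<Sum>y'\<leftarrow>filter (\<lambda>z. pt z = i') ls'. sq_coeff 1 (- int j' - 1) (- int (\<mu> y')) * w y')) =
          (\<Sum>y'\<leftarrow>filter (\<lambda>z. pt z = i') ls'. (\<Sum>j'<J. S (i, j) (i', j') * sq_coeff 1 (- int j' - 1) (- int (\<mu> y'))) * w y')" .
        also have "\<dots> = (\<Sum>y'\<leftarrow>filter (\<lambda>z. pt z = i') ls'. (\<Sum>j'<J. S (i, j) (pt y', j') * sq_coeff 1 (- int j' - 1) (- int (\<mu> y'))) * w y')"
          by (intro arg_cong[where f = sum_list] map_cong refl) auto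
        finally show "(\<Sum>j'<J. S (i, j) (i', j') * (\<Sum>y'\<leftarrow>filter (\<lambda>z. pt z = i') ls'. sq_coeff 1 (- int j' - 1) (- int (\<mu> y')) * w y')) =
          (\<Sum>y'\<leftarrow>filter (\<lambda>z. pt z = i') ls'. (\<Sum>j'<J. S (i, j) (pt y', j') * sq_coeff 1 (- int j' - 1) (- int (\<mu> y'))) * w y')" .
      qed
      also have "\<dots> = (\<Sum>y'\<leftarrow>ls'. (\<Sum>j'<J. S (i, j) (pt y', j') * sq_coeff 1 (- int j' - 1) (- int (\<mu> y'))) * w y')"
        by (rule regroup)
      also have "\<dots> = (\<Sum>y'\<leftarrow>ls'. (\<Sum>j'<\<mu> y'. S (i, j) (pt y', j') * sq_coeff 1 (- int j' - 1) (- int (\<mu> y'))) * w y')"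
      proof (intro arg_cong[where f = sum_list] map_cong refl arg_cong2[where f = "(*)"])
        fix y' assume "y' \<in> set ls'"
        show "(\<Sum>j'<J. S (i, j) (pt y', j') * sq_coeff 1 (- int j' - 1) (- int (\<mu> y'))) = (\<Sum>j'<\<mu> y'. S (i, j) (pt y', j') * sq_coeff 1 (- int j' - 1) (- int (\<mu> y')))"
          using J(2)[OF \<open>y' \<in> set ls'\<close>] by (intro sum.mono_neutral_right) (auto simp: sq_coeff_eq_0)
      qed
      finally show ?thesis .
    qed
    \<comment> \<open>Creating modes from -m to -1, indexed by j in -j-1, and then annihilating
      ones; the mode 0 drops out since a(0) = 0.\<close>
    have split: "sqmode gen_a (- int m) (u i) = (\<Sum>j<m. smul (sq_coeff 1 (- int j - 1) (- int m)) (heis (- int j - 1) (u i))) +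
        (\<Sum>k=1..J. smul (sq_coeff 1 (int k) (- int m)) (heis (int k) (u i)))"
    proof -
      have "{- int m..int J} = (\<lambda>j. - int j - 1) ` {..<m} \<union> insert 0 (int ` {1..J})" (is "?X = ?Y")
      proof
        show "?X \<subseteq> ?Y"
        proof
          fix k assume k: "k \<in> ?X"
          consider "k < 0" | "k = 0" | "k > 0" by linarith
          then show "k \<in> ?Y"
          proof cases
            case 1
            then have "k = - int (nat (- k - 1)) - 1" "nat (- k - 1) < m" using k by auto
            then show ?thesis by blast
          next
            case 3
            then have "k = int (nat k)" "nat k \<in> {1..J}" using k by auto
            then show ?thesis by blast
          qed simp
        qed
      qed auto
      moreover have "(\<Sum>k\<in>(\<lambda>j. - int j - 1) ` {..<m} \<union> insert 0 (int ` {1..J}). f k) = (\<Sum>j<m. f (- int j - 1)) + (\<Sum>k=1..J. f (int k))"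
        if "f 0 = 0" for f :: "int \<Rightarrow> fock"
      proof (subst sum.union_disjoint)
        have "0 \<notin> int ` {1..J}" by auto
        then show "sum f ((\<lambda>j. - int j - 1) ` {..<m}) + sum f (insert 0 (int ` {1..J})) = (\<Sum>j<m. f (- int j - 1)) + (\<Sum>k=1..J. f (int k))"
          using that by (simp add: sum.reindex inj_on_def)
      qed auto
      ultimately show ?thesis unfolding sqmode_gen_a[OF J(1)[OF i] order_refl] by simp
    qed
    have B: "(\<Sum>k=1..J. sq_coeff 1 (int k) (- int m) * wick S is (u(i := heis (int k) (u i)))) =
      (\<Sum>y'\<leftarrow>ls'. (if i = pt y' then sq_contraction m (\<mu> y') else 0) * w y')"
    proof -
      have "(\<Sum>k=1..J. sq_coeff 1 (int k) (- int m) * wick S is (u(i := heis (int k) (u i)))) =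
         (\<Sum>k=1..J. sq_coeff 1 (int k) (- int m) * (\<Sum>y'\<leftarrow>ls'. (if i = pt y' then of_nat k * sq_coeff 1 (- int k) (- int (\<mu> y')) else 0) * w y'))"
      proof (intro sum.cong refl arg_cong2[where f = "(*)"])
        fix k
        have "(\<Sum>y'\<leftarrow>filter (\<lambda>z. pt z = i) zs. g y') = (\<Sum>y'\<leftarrow>zs. (if i = pt y' then g y' else 0))"
          for zs and g :: "'a \<Rightarrow> complex" by (induction zs) auto
        then show "wick S is (u(i := heis (int k) (u i))) = (\<Sum>y'\<leftarrow>ls'. (if i = pt y' then of_nat k * sq_coeff 1 (- int k) (- int (\<mu> y')) else 0) * w y')"
          unfolding heis[OF i of_nat_0_le_iff] by (simp add: if_distrib[of "\<lambda>c. c * _"] cong: if_cong)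
      qed
      also have "\<dots> = (\<Sum>y'\<leftarrow>ls'. (\<Sum>k=1..J. sq_coeff 1 (int k) (- int m) * (if i = pt y' then of_nat k * sq_coeff 1 (- int k) (- int (\<mu> y')) else 0)) * w y')"
        by (induction ls') (simp_all add: sum.distrib ring_distribs sum_distrib_right mult.assoc)
      also have "\<dots> = (\<Sum>y'\<leftarrow>ls'. (if i = pt y' then sq_contraction m (\<mu> y') else 0) * w y')"
      proof (intro arg_cong[where f = sum_list] map_cong refl arg_cong2[where f = "(*)"])
        fix y' assume "y' \<in> set ls'"
        have "(\<Sum>k=1..J. sq_coeff 1 (int k) (- int m) * (of_nat k * sq_coeff 1 (- int k) (- int (\<mu> y')))) = sq_contraction m (\<mu> y')"
          unfolding sq_contraction_def using J(2)[OF \<open>y' \<in> set ls'\<close>]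
          by (intro sum.mono_neutral_right) (auto simp: sq_coeff_eq_0)
        then show "(\<Sum>k=1..J. sq_coeff 1 (int k) (- int m) * (if i = pt y' then of_nat k * sq_coeff 1 (- int k) (- int (\<mu> y')) else 0)) = (if i = pt y' then sq_contraction m (\<mu> y') else 0)"
          by simp
      qed
      finally show ?thesis .
    qed
    have "?u ls = u(i := sqmode gen_a (- int m) (u i))"
      by (rule ext) (auto simp: Cons u_def sq_state_def i_def m_def)
    then have "wick S is (?u ls) = (\<Sum>j<m. sq_coeff 1 (- int j - 1) (- int m) * wick S is (u(i := heis (- int j - 1) (u i)))) +
        (\<Sum>k=1..J. sq_coeff 1 (int k) (- int m) * wick S is (u(i := heis (int k) (u i))))"
      by (simp only: split module_hom.add[OF W[OF i]] module_hom.sum[OF W[OF i]] module_hom.scale[OF W[OF i]])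
    also have "(\<Sum>j<m. sq_coeff 1 (- int j - 1) (- int m) * wick S is (u(i := heis (- int j - 1) (u i)))) =
      (\<Sum>y'\<leftarrow>ls'. sq_propagator S i m (pt y') (\<mu> y') * w y')"
    proof -
      have "(\<Sum>j<m. c j * (\<Sum>y'\<leftarrow>zs. d j y' * w y')) = (\<Sum>y'\<leftarrow>zs. (\<Sum>j<m. c j * d j y') * w y')"
        for c and d :: "nat \<Rightarrow> 'a \<Rightarrow> complex" and zs
        by (induction zs) (simp_all add: sum.distrib ring_distribs sum_distrib_right mult.assoc)
      then have "(\<Sum>j<m. sq_coeff 1 (- int j - 1) (- int m) * wick S is (u(i := heis (- int j - 1) (u i)))) =
         (\<Sum>y'\<leftarrow>ls'. (\<Sum>j<m. sq_coeff 1 (- int j - 1) (- int m) * (\<Sum>j'<\<mu> y'. S (i, j) (pt y', j') * sq_coeff 1 (- int j' - 1) (- int (\<mu> y')))) * w y')"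
        unfolding A .
      also have "\<dots> = (\<Sum>y'\<leftarrow>ls'. sq_propagator S i m (pt y') (\<mu> y') * w y')"
        unfolding sq_propagator_def sum_distrib_left
        by (rule arg_cong[where f = sum_list], rule map_cong[OF refl], rule arg_cong2[where f = "(*)", OF _ refl],
            intro sum.cong refl, simp only: mult_ac)
      finally show ?thesis .
    qed
    also have "(\<Sum>y'\<leftarrow>ls'. sq_propagator S i m (pt y') (\<mu> y') * w y') + (\<Sum>k=1..J. sq_coeff 1 (int k) (- int m) * wick S is (u(i := heis (int k) (u i)))) =
       (\<Sum>y'\<leftarrow>ls'. ?\<gamma> y y' * w y')"
      unfolding B sum_list_addf[symmetric] by (intro arg_cong[where f = sum_list] map_cong refl) (simp only: i_def m_def ring_distribs add.commute)
    also have "\<dots> = (\<Sum>y'\<leftarrow>ls'. ?\<gamma> y y' * hafnian ?\<gamma> (remove1 y' ls'))"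
    proof (intro arg_cong[where f = sum_list] map_cong refl arg_cong2[where f = "(*)"])
      fix y' assume y': "y' \<in> set ls'"
      show "w y' = hafnian ?\<gamma> (remove1 y' ls')" unfolding w_def
      proof (rule 1(1)[rule_format])
        show "length (remove1 y' ls') < length ls" using y' by (simp add: Cons length_remove1)
        show "distinct (remove1 y' ls')" using dist by simp
        show "pt ` set (remove1 y' ls') \<subseteq> set is" using sub set_remove1_subset[of y' ls'] by blast
      qed
    qed
    finally show ?thesis unfolding Cons hafnian.simps .
  qed
qed

subsection \<open>Square bracket coefficients and Bernoulli numbers\<close>

text \<open>As \<open>b\<close> has no constant term, its j-th power starts at order j or later, so
  one truncation at n serves all coefficients involved.\<close>

lemma fps_mult_compose_nth:
  fixes a b e :: "complex fps"
  assumes "fps_nth b 0 = 0"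
  shows "fps_nth (e * (a oo b)) n = (\<Sum>j\<le>n. fps_nth a j * fps_nth (e * b ^ j) n)"
proof -
  have *: "fps_nth (a oo b) k = (\<Sum>j\<le>n. fps_nth a j * fps_nth (b ^ j) k)" if "k \<le> n" for k
  proof -
    have "fps_nth (a oo b) k = (\<Sum>j\<in>{0..k}. fps_nth a j * fps_nth (b ^ j) k)"
      by (simp add: fps_compose_nth)
    also have "\<dots> = (\<Sum>j\<le>n. fps_nth a j * fps_nth (b ^ j) k)"
      using that assms by (intro sum.mono_neutral_left) (auto simp: startsby_zero_power_prefix)
    finally show ?thesis .
  qed
  have "fps_nth (e * (a oo b)) n = (\<Sum>i=0..n. fps_nth e i * (\<Sum>j\<le>n. fps_nth a j * fps_nth (b ^ j) (n - i)))"
    unfolding fps_mult_nth by (intro sum.cong refl) (simp add: *)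
  also have "\<dots> = (\<Sum>j\<le>n. \<Sum>i=0..n. fps_nth e i * (fps_nth a j * fps_nth (b ^ j) (n - i)))"
    unfolding sum_distrib_left by (rule sum.swap)
  also have "\<dots> = (\<Sum>j\<le>n. fps_nth a j * fps_nth (e * b ^ j) n)"
    unfolding fps_mult_nth sum_distrib_left by (intro sum.cong refl) (simp only: mult_ac)
  finally show ?thesis .
qed

text \<open>Substituting e^z - 1 for X turns the equation (1 + X) B' = c B of the binomial series
  into f' = c f with f(0) = 1.\<close>

lemma fps_binomial_compose_exp: "fps_binomial c oo (fps_exp 1 - 1) = fps_exp (c :: complex)"
proof -
  let ?y = "fps_exp 1 - 1 :: complex fps" and ?B = "fps_binomial c"
  have y0: "fps_nth ?y 0 = 0" by simp
  have "(1 + fps_X) * fps_deriv ?B = fps_const c * ?B"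
  proof (rule fps_ext)
    fix n
    show "fps_nth ((1 + fps_X) * fps_deriv ?B) n = fps_nth (fps_const c * ?B) n"
      using gbinomial_mult_1[of c n]
      by (cases n) (simp_all add: ring_distribs add.commute mult_ac)
  qed
  then have "((1 + fps_X) * fps_deriv ?B) oo ?y = (fps_const c * ?B) oo ?y" by simp
  then have "fps_exp 1 * (fps_deriv ?B oo ?y) = fps_const c * (?B oo ?y)"
    by (simp add: fps_compose_mult_distrib[OF y0] fps_compose_add_distrib)
  then have "fps_deriv (?B oo ?y) = fps_const c * (?B oo ?y)"
    by (simp add: fps_compose_deriv[OF y0] mult.commute)
  then have "?B oo ?y = fps_const (fps_nth (?B oo ?y) 0) * fps_exp c"
    by (simp only: fps_exp_unique_ODE)
  then show ?thesis by simp
qed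

lemma sq_coeff_creation:
  assumes "m \<ge> 1"
  shows "sq_coeff 1 (- int j - 1) (- int m) = fps_nth (fps_exp 1 * (fps_exp 1 - 1) ^ j) (m - 1)"
proof -
  have "sq_coeff 1 (- int j - 1) (- int m) = fls_nth (fps_to_fls (fps_exp 1) * fps_to_fls (fps_exp 1 - 1) ^ j) (int (m - 1))"
    using assms by (simp add: sq_coeff_def of_nat_diff)
  also have "fps_to_fls (fps_exp 1) * fps_to_fls (fps_exp 1 - 1) ^ j = fps_to_fls (fps_exp 1 * (fps_exp 1 - 1) ^ j :: complex fps)"
    by (simp only: fls_times_fps_to_fls fps_to_fls_power)
  finally show ?thesis by simp
qed

text \<open>The coefficient of z^(m-1) in e^z (1 + (e^z - 1))^c = e^((c+1) z). For c = -n-1, the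
  upper argument of the binomial for the mode n, it is the pure power (-n)^(m-1) / (m-1)!.\<close>

lemma sum_sq_coeff_gbinomial:
  assumes "m \<ge> 1"
  shows "(\<Sum>j<m. sq_coeff 1 (- int j - 1) (- int m) * (c gchoose j)) = (c + 1) ^ (m - 1) / fact (m - 1)"
proof -
  have "(\<Sum>j<m. sq_coeff 1 (- int j - 1) (- int m) * (c gchoose j)) =
      (\<Sum>j\<le>m - 1. fps_nth (fps_binomial c) j * fps_nth (fps_exp 1 * (fps_exp 1 - 1) ^ j) (m - 1))"
    using assms by (intro sum.cong) (use assms in \<open>auto simp: sq_coeff_creation[OF assms] mult.commute simp del: One_nat_def\<close>)
  also have "\<dots> = fps_nth (fps_exp 1 * (fps_binomial c oo (fps_exp 1 - 1))) (m - 1)"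
    by (rule fps_mult_compose_nth[symmetric]) simp
  also have "\<dots> = fps_nth (fps_exp (1 + c)) (m - 1)"
    by (simp only: fps_binomial_compose_exp fps_exp_add_mult)
  finally show ?thesis by (simp add: add.commute)
qed

definition bern_fps :: "complex fps" where
  "bern_fps = fps_X / (fps_exp 1 - 1)"

lemma bern_fps_mult: "bern_fps * (fps_exp 1 - 1) = fps_X"
proof -
  have "subdegree (fps_exp 1 - 1 :: complex fps) = 1" by (rule subdegreeI) auto
  then have "(fps_exp 1 - 1 :: complex fps) dvd fps_X"
    by (subst fps_dvd_iff) auto
  then show ?thesis unfolding bern_fps_def by simp
qed

lemma bernoulli_number_eq: "bernoulli_number k = fact k * fps_nth bern_fps k"
  by (simp add: bernoulli_number_def bern_fps_def)

text \<open>The series b = z / (e^z - 1) satisfies b(-z) = z + b(z).\<close>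

lemma bern_fps_odd:
  assumes "odd k" "k \<noteq> 1"
  shows "fps_nth bern_fps k = 0"
proof -
  let ?y = "fps_exp 1 - 1 :: complex fps" and ?n = "- fps_X :: complex fps"
  have n0: "fps_nth ?n 0 = 0" by simp
  have y0: "?y \<noteq> 0" by (metis bern_fps_mult fps_X_neq_zero mult_zero_right)
  have "(bern_fps * ?y) oo ?n = fps_X oo ?n" by (simp only: bern_fps_mult)
  then have "(bern_fps oo ?n) * (fps_exp (- 1) - 1) = - fps_X"
    by (simp add: fps_compose_mult_distrib[OF n0] fps_compose_sub_distrib fps_fps_exp_compose_minus)
  then have "(bern_fps oo ?n) * (fps_exp (- 1) - 1) * fps_exp 1 = - fps_X * fps_exp 1" by simp
  moreover have "(fps_exp (- 1) - 1) * fps_exp 1 = - ?y"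
    by (simp add: ring_distribs flip: fps_exp_add_mult)
  ultimately have "(bern_fps oo ?n) * - ?y = - fps_X * fps_exp 1" by (simp only: mult.assoc)
  then have "- ((bern_fps oo ?n) * ?y) = - (fps_X * fps_exp 1)" by (simp only: mult_minus_left mult_minus_right)
  then have "(bern_fps oo ?n) * ?y = fps_X * fps_exp 1" by (simp only: neg_equal_iff_equal)
  also have "\<dots> = (fps_X + bern_fps) * ?y"
    using bern_fps_mult by (simp add: algebra_simps)
  finally have "bern_fps oo ?n = fps_X + bern_fps" using y0 by simp
  moreover have "fps_nth (bern_fps oo ?n) k = (- 1) ^ k * fps_nth bern_fps k"
    using fps_nth_compose_linear[of bern_fps "- 1" k] by (simp add: fps_const_neg[symmetric] del: fps_const_neg)
  ultimately show ?thesis using assms by simp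
qed

lemma fps_to_fls_sum: "fps_to_fls (\<Sum>i\<in>A. f i) = (\<Sum>i\<in>A. fps_to_fls (f i))"
  by (induction A rule: infinite_finite_induct) simp_all

text \<open>With y = e^z - 1 the series is y' / y^p: for p = 1 the logarithmic derivative of a
  series of order one, for p > 1 an exact derivative.\<close>

lemma fls_residue_exp_inverse_power:
  fixes E V :: "complex fls"
  defines "E \<equiv> fps_to_fls (fps_exp 1)" and "V \<equiv> inverse (fps_to_fls (fps_exp 1 - 1))"
  assumes "p \<ge> 1"
  shows "fls_residue (E * V ^ p) = (if p = 1 then 1 else 0)"
proof -
  define Y where "Y = (fps_to_fls (fps_exp 1 - 1) :: complex fls)"
  have V: "V = inverse Y" by (simp add: V_def Y_def)
  have "subdegree (fps_exp 1 - 1 :: complex fps) = 1" by (rule subdegreeI) auto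
  then have sY: "fls_subdegree Y = 1" unfolding Y_def by (simp only: fls_subdegree_fls_to_fps of_nat_1)
  have dY: "fls_deriv Y = E" unfolding Y_def E_def fls_deriv_fps_to_fls by simp
  show ?thesis
  proof (cases "p = 1")
    case True
    then show ?thesis using fls_residue_deriv_times_inverse_eq_subdegree(1)[of Y] by (simp add: V dY sY)
  next
    case False
    define k where "k = p - 2"
    have p: "p = Suc (Suc k)" using False assms by (simp add: k_def)
    have Y0: "Y \<noteq> 0" using sY by auto
    have dV: "fls_deriv V = - E * V ^ 2"
      using Y0 by (simp add: V fls_inverse_deriv dY power2_eq_square mult_ac)
    have "fls_deriv (V ^ Suc k) = - of_nat (Suc k) * (E * V ^ p)"
      unfolding fls_deriv_power dV by (simp add: p power2_eq_square algebra_simps)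
    then have "fls_residue (- of_nat (Suc k) * (E * V ^ p)) = 0" by (metis fls_residue_deriv)
    moreover have "- of_nat (Suc k) * (E * V ^ p) = of_int (- int (Suc k)) * (E * V ^ p)" by simp
    ultimately have "of_int (- int (Suc k)) * fls_residue (E * V ^ p) = 0"
      by (simp only: fls_residue_of_int_times)
    moreover have "(of_int (- int (Suc k)) :: complex) \<noteq> 0" by (metis of_int_eq_0_iff neg_equal_0_iff_equal of_nat_eq_0_iff nat.distinct(2))
    ultimately show ?thesis using False by simp
  qed
qed

section \<open>The contraction within one state\<close>

lemma sq_coeff_annihilation:
  assumes "m \<ge> 1"
  shows "sq_coeff 1 (int k) (- int m) = fls_nth (fps_to_fls (fps_exp 1) * inverse (fps_to_fls (fps_exp 1 - 1)) ^ Suc k) (int m - 1)"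
proof -
  define Y where "Y = (fps_to_fls (fps_exp 1 - 1) :: complex fls)"
  have e: "- int k - 1 = - int (Suc k)" by simp
  have "Y powi (- int k - 1) = inverse Y ^ Suc k"
    unfolding e power_int_minus power_int_of_nat by (rule power_inverse[symmetric])
  then show ?thesis by (simp add: sq_coeff_def Y_def)
qed

text \<open>The generating function of the annihilating coefficients of a[-m], to be evaluated at
  e^z - 1. The constant term is set to 0 in keeping with a(0) = 0.\<close>

definition contraction_fps :: "nat \<Rightarrow> complex fps" where
  "contraction_fps m = Abs_fps (\<lambda>k. if k = 0 then 0 else sq_coeff 1 (int k) (- int m))"

text \<open>Differentiating e^z / (e^z - 1)^(k+1) raises m by one; the square of e^z that arises is
  reduced by e^z = 1 + (e^z - 1).\<close>

lemma sq_coeff_annihilation_Suc: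
  assumes "m \<ge> 1"
  shows "of_nat m * sq_coeff 1 (int k) (- int (Suc m)) =
     - (of_nat k * sq_coeff 1 (int k) (- int m) + of_nat (Suc k) * sq_coeff 1 (int (Suc k)) (- int m))"
proof -
  define E Y V where "E = (fps_to_fls (fps_exp 1) :: complex fls)" and "Y = (fps_to_fls (fps_exp 1 - 1) :: complex fls)" and "V = inverse Y"
  have dY: "fls_deriv Y = E" and dE: "fls_deriv E = E" unfolding Y_def E_def fls_deriv_fps_to_fls by simp_all
  have "subdegree (fps_exp 1 - 1 :: complex fps) = 1" by (rule subdegreeI) auto
  then have "fls_subdegree Y = 1" unfolding Y_def by (simp only: fls_subdegree_fls_to_fps of_nat_1)
  then have Y0: "Y \<noteq> 0" by auto
  have EY: "E = 1 + Y" by (simp add: E_def Y_def)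
  have dV: "fls_deriv V = - E * V ^ 2"
    using Y0 by (simp add: V_def fls_inverse_deriv dY power2_eq_square mult_ac)
  have "fls_deriv (E * V ^ Suc k) = E * V ^ Suc k - of_nat (Suc k) * (E * E * V ^ Suc (Suc k))"
    unfolding fls_deriv_mult fls_deriv_power dV dE by (simp add: power2_eq_square algebra_simps)
  also have "E * E * V ^ Suc (Suc k) = E * V ^ Suc (Suc k) + E * V ^ Suc k"
  proof -
    have "Y * V = 1" using Y0 by (simp add: V_def)
    have "E * E * V ^ Suc (Suc k) = E * (1 + Y) * V ^ Suc (Suc k)" using EY by simp
    also have "\<dots> = E * V ^ Suc (Suc k) + E * (Y * V) * V ^ Suc k" by (simp add: algebra_simps)
    finally show ?thesis using \<open>Y * V = 1\<close> by simp
  qed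
  finally have "fls_deriv (E * V ^ Suc k) = - (of_nat k * (E * V ^ Suc k) + of_nat (Suc k) * (E * V ^ Suc (Suc k)))"
    by (simp add: algebra_simps)
  then have "fls_nth (fls_deriv (E * V ^ Suc k)) (int m - 1) =
     fls_nth (- (of_nat k * (E * V ^ Suc k) + of_nat (Suc k) * (E * V ^ Suc (Suc k)))) (int m - 1)" by simp
  then have "of_int (int m) * fls_nth (E * V ^ Suc k) (int m) =
     - (of_nat k * fls_nth (E * V ^ Suc k) (int m - 1) + of_nat (Suc k) * fls_nth (E * V ^ Suc (Suc k)) (int m - 1))"
    by (simp only: fls_deriv_nth fls_uminus_nth fls_plus_nth fls_mult_of_nat_nth diff_add_cancel)
  then show ?thesis using assms
    by (simp only: sq_coeff_annihilation E_def[symmetric] Y_def[symmetric] V_def[symmetric] of_int_of_nat_eq)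
       (simp add: sq_coeff_annihilation E_def Y_def V_def)
qed

text \<open>k times the creating coefficient is a coefficient of k e^z (e^z - 1)^(k-1), the
  derivative of (e^z - 1)^k, so the sum over k becomes a composition.\<close>

lemma sq_contraction_eq_deriv:
  assumes "m \<ge> 1" "r \<ge> 1"
  shows "(\<Sum>k=1..r. sq_coeff 1 (int k) (- int m) * (of_nat k * sq_coeff 1 (- int k) (- int r))) =
     fps_nth (fps_deriv (contraction_fps m oo (fps_exp 1 - 1))) (r - 1)"
proof -
  let ?y = "fps_exp 1 - 1 :: complex fps"
  have d: "of_nat k * sq_coeff 1 (- int k) (- int r) = of_nat r * fps_nth (?y ^ k) r" if k: "k \<ge> 1" for k
  proof -
    have e: "- int k = - int (k - 1) - 1" using k by simp
    have "of_nat k * sq_coeff 1 (- int k) (- int r) = fps_nth (of_nat k * (fps_exp 1 * ?y ^ (k - 1))) (r - 1)"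
      unfolding e sq_coeff_creation[OF assms(2)] by (simp only: fps_mult_of_nat_nth)
    also have "of_nat k * (fps_exp 1 * ?y ^ (k - 1)) = fps_deriv (?y ^ k)"
      by (simp add: fps_deriv_power fps_of_nat mult_ac)
    also have "fps_nth (fps_deriv (?y ^ k)) (r - 1) = of_nat r * fps_nth (?y ^ k) r"
      using assms by simp
    finally show ?thesis .
  qed
  have "fps_nth (fps_deriv (contraction_fps m oo ?y)) (r - 1) = of_nat r * fps_nth (contraction_fps m oo ?y) r"
    using assms by simp
  also have "\<dots> = of_nat r * (\<Sum>k\<in>{0..r}. fps_nth (contraction_fps m) k * fps_nth (?y ^ k) r)"
    by (simp add: fps_compose_nth)
  also have "(\<Sum>k\<in>{0..r}. fps_nth (contraction_fps m) k * fps_nth (?y ^ k) r) = (\<Sum>k=1..r. fps_nth (contraction_fps m) k * fps_nth (?y ^ k) r)"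
    by (intro sum.mono_neutral_right) (auto simp: contraction_fps_def)
  also have "of_nat r * \<dots> = (\<Sum>k=1..r. sq_coeff 1 (int k) (- int m) * (of_nat k * sq_coeff 1 (- int k) (- int r)))"
    unfolding sum_distrib_left by (intro sum.cong refl) (auto simp: d contraction_fps_def mult_ac simp del: One_nat_def)
  finally show ?thesis by simp
qed

text \<open>The recursion in m, arranged so that (1 + X) d/dX becomes d/dz under X = e^z - 1. The
  subtracted constant restores the vanishing constant term.\<close>

lemma contraction_fps_Suc:
  assumes "m \<ge> 1"
  shows "fps_const (of_nat m) * contraction_fps (Suc m) =
     - ((1 + fps_X) * fps_deriv (contraction_fps m) - fps_const (fps_nth (contraction_fps m) 1))"
proof (rule fps_ext)
  fix k
  show "fps_nth (fps_const (of_nat m) * contraction_fps (Suc m)) k =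
     fps_nth (- ((1 + fps_X) * fps_deriv (contraction_fps m) - fps_const (fps_nth (contraction_fps m) 1))) k"
  proof (cases k)
    case 0
    then show ?thesis by (simp add: contraction_fps_def)
  next
    case (Suc l)
    have "of_nat m * fps_nth (contraction_fps (Suc m)) k = of_nat m * sq_coeff 1 (int k) (- int (Suc m))"
      by (simp add: contraction_fps_def Suc)
    also have "\<dots> = - (of_nat k * fps_nth (contraction_fps m) k + of_nat (Suc k) * fps_nth (contraction_fps m) (Suc k))"
      unfolding sq_coeff_annihilation_Suc[OF assms] by (simp add: contraction_fps_def Suc)
    finally show ?thesis by (simp add: Suc ring_distribs)
  qed
qed

text \<open>A residue in z becomes one in y = e^z - 1: the annihilating coefficient of a[-1] at k is
  that of y^k in 1 / log(1 + y). Without its terms of degree -1 and 0 this series is the generating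
  function, and putting y = e^z - 1 gives 1/z - 1/(e^z - 1) minus a constant.\<close>

lemma contraction_fps_1_deriv:
  "fps_nth (fps_deriv (contraction_fps 1 oo (fps_exp 1 - 1))) s = - of_nat (s + 1) * fps_nth bern_fps (s + 2)"
proof -
  let ?y = "fps_exp 1 - 1 :: complex fps"
  define E Y V where "E = (fps_to_fls (fps_exp 1) :: complex fls)" and "Y = (fps_to_fls ?y :: complex fls)" and "V = inverse Y"
  have y0: "fps_nth ?y 0 = 0" "fps_nth ?y 1 \<noteq> 0" by simp_all
  have yne: "?y \<noteq> 0" using y0(2) by auto
  have Y0: "Y \<noteq> 0" unfolding Y_def using yne fps_to_fls_nonzeroI by blast
  define L where "L = (fps_ln 1 :: complex fps)"
  have LX: "L oo ?y = fps_X"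
    unfolding L_def by (simp only: fps_ln_fps_exp_inv[OF one_neq_zero] fps_inv[OF y0])
  have "subdegree L = 1" unfolding L_def by (rule subdegreeI) (auto simp: fps_ln_nth)
  then have "L dvd fps_X" by (subst fps_dvd_iff) auto
  \<comment> \<open>\<open>M\<close> is y / log(1 + y); composed with e^z - 1 it is (e^z - 1) /
    z.\<close>
  then obtain M where M: "fps_X = L * M" by (auto elim: dvdE)
  have Mo: "?y = fps_X * (M oo ?y)"
  proof -
    have "fps_X oo ?y = (L oo ?y) * (M oo ?y)" unfolding M by (rule fps_compose_mult_distrib[OF y0(1)])
    then show ?thesis by (simp add: LX)
  qed
  have M0: "fps_nth M 0 = 1"
  proof -
    have "fps_nth ?y 1 = fps_nth (fps_X * (M oo ?y)) 1" using Mo by simp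
    then show ?thesis by simp
  qed
  have c1: "sq_coeff 1 (int k) (- int 1) = fps_nth M (k + 1)" for k
  proof -
    \<comment> \<open>Truncation at this order: the remainder carries the factor y^(k+2), which
      cancels the whole power of \<open>V\<close>, so it has no residue.\<close>
    let ?K = "k + 2"
    define R where "R = (fps_shift ?K M oo ?y)"
    have MR: "M oo ?y = (\<Sum>i<?K. fps_const (fps_nth M i) * ?y ^ i) + ?y ^ ?K * R"
    proof -
      have "M = fps_cutoff ?K M + fps_X ^ ?K * fps_shift ?K M"
        using fps_shift_cutoff[of ?K M] by (simp add: add.commute mult.commute)
      also have "fps_cutoff ?K M = (\<Sum>i<?K. fps_const (fps_nth M i) * fps_X ^ i)"
      proof (rule fps_ext)
        fix n
        have "fps_nth (\<Sum>i<?K. fps_const (fps_nth M i) * fps_X ^ i) n = (\<Sum>i<?K. if i = n then fps_nth M i else 0)"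
          unfolding fps_sum_nth by (intro sum.cong refl) auto
        then show "fps_nth (fps_cutoff ?K M) n = fps_nth (\<Sum>i<?K. fps_const (fps_nth M i) * fps_X ^ i) n"
          by (simp only: sum.delta finite_lessThan lessThan_iff fps_cutoff_nth)
      qed
      finally have "M = (\<Sum>i<?K. fps_const (fps_nth M i) * fps_X ^ i) + fps_X ^ ?K * fps_shift ?K M" .
      then have "M oo ?y = ((\<Sum>i<?K. fps_const (fps_nth M i) * fps_X ^ i) + fps_X ^ ?K * fps_shift ?K M) oo ?y" by simp
      then show ?thesis
        by (simp only: fps_compose_add_distrib fps_compose_mult_distrib[OF y0(1)] fps_compose_sum_distrib R_def
            fps_compose_power[OF y0(1), symmetric] fps_X_fps_compose_startby0[OF y0(1)] fps_const_compose)
    qed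
    have YX: "fps_to_fls (M oo ?y) = Y * inverse fls_X"
    proof -
      have "Y = fls_X * fps_to_fls (M oo ?y)"
        unfolding Y_def by (subst Mo) (simp only: fls_times_fps_to_fls fps_X_to_fls)
      then show ?thesis by simp
    qed
    have VY: "Y ^ i * V ^ ?K = V ^ (?K - i)" if "i \<le> ?K" for i
    proof -
      have "V ^ ?K = V ^ i * V ^ (?K - i)" using that by (simp add: power_add[symmetric])
      then show ?thesis using Y0 by (simp add: V_def power_mult_distrib[symmetric] mult.assoc[symmetric])
    qed
    have "sq_coeff 1 (int k) (- int 1) = fls_nth (E * V ^ Suc k) 0"
      by (subst sq_coeff_annihilation) (simp_all add: E_def Y_def V_def)
    also have "\<dots> = fls_residue (inverse fls_X * (E * V ^ Suc k))"
      by (simp add: fls_residue_def fls_inverse_X fls_X_inv_times_conv_shift)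
    also have "inverse fls_X * (E * V ^ Suc k) = E * (Y * inverse fls_X) * V ^ ?K"
      using VY[of 1] by (simp add: mult_ac)
    also have "\<dots> = (\<Sum>i<?K. fls_const (fps_nth M i) * (E * V ^ (?K - i))) + E * fps_to_fls R"
    proof -
      have "fps_to_fls (M oo ?y) = (\<Sum>i<?K. fls_const (fps_nth M i) * Y ^ i) + Y ^ ?K * fps_to_fls R"
        unfolding MR Y_def
        by (simp only: fps_to_fls_plus fls_times_fps_to_fls fps_to_fls_power fps_to_fls_sum fps_const_to_fls)
      then have "E * (Y * inverse fls_X) * V ^ ?K = E * ((\<Sum>i<?K. fls_const (fps_nth M i) * Y ^ i) + Y ^ ?K * fps_to_fls R) * V ^ ?K"
        unfolding YX[symmetric] by simp
      also have "\<dots> = (\<Sum>i<?K. fls_const (fps_nth M i) * (E * (Y ^ i * V ^ ?K))) + E * fps_to_fls R * (Y ^ ?K * V ^ ?K)"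
        by (simp only: ring_distribs sum_distrib_left sum_distrib_right mult_ac)
      also have "\<dots> = (\<Sum>i<?K. fls_const (fps_nth M i) * (E * V ^ (?K - i))) + E * fps_to_fls R"
      proof -
        have "(\<Sum>i<?K. fls_const (fps_nth M i) * (E * (Y ^ i * V ^ ?K))) = (\<Sum>i<?K. fls_const (fps_nth M i) * (E * V ^ (?K - i)))"
          by (rule sum.cong[OF refl]) (simp only: VY lessThan_iff less_imp_le)
        moreover have "Y ^ ?K * V ^ ?K = 1" by (simp only: VY[OF order_refl] diff_self_eq_0 power_0)
        ultimately show ?thesis by (simp only: mult_1_right)
      qed
      finally show ?thesis .
    qed
    also have "fls_residue \<dots> = (\<Sum>i<?K. fps_nth M i * fls_residue (E * V ^ (?K - i))) + fls_residue (E * fps_to_fls R)"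
    proof -
      have rs: "fls_residue (\<Sum>i\<in>A. g i) = (\<Sum>i\<in>A. fls_residue (g i))" for A and g :: "nat \<Rightarrow> complex fls"
        by (induction A rule: infinite_finite_induct) (simp_all add: fls_residue_add fls_residue_def)
      show ?thesis by (simp only: fls_residue_add rs fls_residue_fls_const_times)
    qed
    also have "fls_residue (E * fps_to_fls R) = 0"
    proof -
      have "E * fps_to_fls R = fps_to_fls (fps_exp 1 * R)" by (simp add: E_def fls_times_fps_to_fls)
      then show ?thesis by (simp add: fls_residue_def)
    qed
    also have "(\<Sum>i<?K. fps_nth M i * fls_residue (E * V ^ (?K - i))) = (\<Sum>i<?K. if i = k + 1 then fps_nth M i else 0)"
      unfolding E_def V_def Y_def
      by (intro sum.cong refl) (subst fls_residue_exp_inverse_power, auto)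
    finally show ?thesis by simp
  qed
  let ?G = "contraction_fps 1"
  have "fps_X * ?G = M - 1 - fps_const (fps_nth M 1) * fps_X"
  proof (rule fps_ext)
    fix k
    show "fps_nth (fps_X * ?G) k = fps_nth (M - 1 - fps_const (fps_nth M 1) * fps_X) k"
      using c1[of "k - 1"] M0
      by (cases "k = 0"; cases "k = 1") (auto simp: contraction_fps_def)
  qed
  then have "(fps_X * ?G) oo ?y = (M - 1 - fps_const (fps_nth M 1) * fps_X) oo ?y" by simp
  then have "?y * (?G oo ?y) = (M oo ?y) - 1 - fps_const (fps_nth M 1) * ?y"
    by (simp add: fps_compose_mult_distrib[OF y0(1)] fps_compose_sub_distrib)
  then have "fps_X * (?y * (?G oo ?y)) = fps_X * ((M oo ?y) - 1 - fps_const (fps_nth M 1) * ?y)" by simp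
  also have "\<dots> = ?y - fps_X - fps_X * fps_const (fps_nth M 1) * ?y"
    using Mo by (simp add: right_diff_distrib mult.assoc)
  also have "\<dots> = ?y * (1 - bern_fps - fps_X * fps_const (fps_nth M 1))"
    using bern_fps_mult by (simp add: algebra_simps)
  finally have "?y * (fps_X * (?G oo ?y)) = ?y * (1 - bern_fps - fps_X * fps_const (fps_nth M 1))"
    by (simp only: mult.left_commute)
  then have "fps_X * (?G oo ?y) = 1 - bern_fps - fps_X * fps_const (fps_nth M 1)" using yne by simp
  then have "fps_nth (fps_X * (?G oo ?y)) (s + 2) = fps_nth (1 - bern_fps - fps_X * fps_const (fps_nth M 1)) (s + 2)" by simp
  then have "fps_nth (?G oo ?y) (s + 1) = - fps_nth bern_fps (s + 2)" by simp
  then show ?thesis by (simp add: algebra_simps)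
qed

text \<open>By the recursion in m each step differentiates once more in z, so this is (-1)^m / m!
  times the m-th derivative of the case m = 0.\<close>

lemma contraction_fps_deriv:
  "fps_nth (fps_deriv (contraction_fps (Suc m) oo (fps_exp 1 - 1))) s =
     (- 1) ^ (m + 1) * fact (s + m + 1) / (fact m * fact s) * fps_nth bern_fps (s + m + 2)"
proof (induction m arbitrary: s)
  case 0
  have "(fact (s + 1) :: complex) / fact s = of_nat (s + 1)" by simp
  then show ?case using contraction_fps_1_deriv[of s] by simp
next
  case (Suc m)
  let ?y = "fps_exp 1 - 1 :: complex fps"
  have y0: "fps_nth ?y 0 = 0" by simp
  let ?M = "Suc m"
  have "(fps_const (of_nat ?M) * contraction_fps (Suc ?M)) oo ?y =
    (- ((1 + fps_X) * fps_deriv (contraction_fps ?M) - fps_const (fps_nth (contraction_fps ?M) 1))) oo ?y"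
    by (subst contraction_fps_Suc) simp_all
  then have "fps_const (of_nat ?M) * (contraction_fps (Suc ?M) oo ?y) =
     - (fps_deriv (contraction_fps ?M oo ?y) - fps_const (fps_nth (contraction_fps ?M) 1))"
    by (simp add: fps_compose_mult_distrib[OF y0] fps_compose_sub_distrib fps_compose_add_distrib fps_compose_uminus
        fps_compose_deriv[OF y0] mult.commute)
  then have "fps_deriv (fps_const (of_nat ?M) * (contraction_fps (Suc ?M) oo ?y)) =
     fps_deriv (- (fps_deriv (contraction_fps ?M oo ?y) - fps_const (fps_nth (contraction_fps ?M) 1)))" by simp
  then have "fps_const (of_nat ?M) * fps_deriv (contraction_fps (Suc ?M) oo ?y) = - fps_deriv (fps_deriv (contraction_fps ?M oo ?y))"
    by simp
  then have "fps_nth (fps_const (of_nat ?M) * fps_deriv (contraction_fps (Suc ?M) oo ?y)) s = fps_nth (- fps_deriv (fps_deriv (contraction_fps ?M oo ?y))) s"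
    by simp
  then have e: "of_nat ?M * fps_nth (fps_deriv (contraction_fps (Suc ?M) oo ?y)) s = - (of_nat (s + 1) * fps_nth (fps_deriv (contraction_fps ?M oo ?y)) (s + 1))"
    by (simp only: fps_mult_left_const_nth fps_neg_nth fps_deriv_nth)
  have "fps_nth (fps_deriv (contraction_fps (Suc ?M) oo ?y)) s = - (of_nat (s + 1) * fps_nth (fps_deriv (contraction_fps ?M oo ?y)) (s + 1)) / of_nat ?M"
    using e by (metis nonzero_mult_div_cancel_left of_nat_neq_0)
  also have "\<dots> = - (of_nat (s + 1) * ((- 1) ^ (m + 1) * fact (s + 1 + m + 1) / (fact m * fact (s + 1)) * fps_nth bern_fps (s + 1 + m + 2))) / of_nat ?M"
    by (simp only: Suc.IH)
  also have "\<dots> = (- 1) ^ (?M + 1) * fact (s + ?M + 1) / (fact ?M * fact s) * fps_nth bern_fps (s + ?M + 2)"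
  proof -
    have f: "(fact (s + 1) :: complex) = of_nat (s + 1) * fact s" "(fact ?M :: complex) = of_nat ?M * fact m" by simp_all
    have e: "s + 1 + m + 1 = s + ?M + 1" "s + 1 + m + 2 = s + ?M + 2" by simp_all
    have "(of_nat (s + 1) :: complex) \<noteq> 0" "(of_nat ?M :: complex) \<noteq> 0" by (metis Suc_eq_plus1 of_nat_neq_0)+
    then show ?thesis unfolding e f by (simp add: divide_simps del: of_nat_Suc of_nat_add)
  qed
  finally show ?case .
qed

subsection \<open>Lambert series\<close>

lemma summable_on_power_mult_geometric:
  fixes x :: real
  assumes "0 \<le> x" "x < 1"
  shows "(\<lambda>n. real n ^ K * x ^ n) summable_on UNIV"
proof (rule summable_on_comparison_test)
  define \<rho> where "\<rho> = (x + 1) / 2"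
  have \<rho>: "0 < \<rho>" "\<rho> < 1" "x \<le> \<rho>" using assms by (auto simp: \<rho>_def)
  have "(\<lambda>n::int. 1 * (real (nat \<bar>n\<bar> + 0) ^ K * \<rho> ^ nat \<bar>n\<bar>)) summable_on range int"
    by (rule summable_on_subset_banach[OF summable_power_mult_geometric_int[OF \<rho>(1,2)]]) auto
  then show "(\<lambda>n. real n ^ K * \<rho> ^ n) summable_on UNIV"
    by (subst (asm) summable_on_reindex) (auto simp: o_def)
  show "real n ^ K * x ^ n \<le> real n ^ K * \<rho> ^ n" for n
    using \<rho> assms by (intro mult_left_mono power_mono) auto
qed (use assms in auto)

lemma has_sum_of_abs_summable_on:
  fixes f :: "nat \<Rightarrow> complex"
  assumes "(\<lambda>n. norm (f n)) summable_on UNIV"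
  shows "(f has_sum suminf f) UNIV" "summable (\<lambda>n. norm (f n))"
proof -
  show *: "summable (\<lambda>n. norm (f n))" using assms by (rule summable_on_imp_summable)
  show "(f has_sum suminf f) UNIV"
    using * summable_norm_cancel[OF *] by (intro norm_summable_imp_has_sum) (simp_all add: summable_sums)
qed

text \<open>The index \<open>k\<close> counts applications of y d/dy. The term n = 0 is 0 / 0 =
  0.\<close>

definition lambert_series :: "complex \<Rightarrow> nat \<Rightarrow> complex \<Rightarrow> complex" where
  "lambert_series q k y = suminf (\<lambda>n. of_nat n ^ (k + 1) / (1 - q ^ n) * y ^ n)"

lemma lambert_term_bound:
  fixes q y :: complex
  assumes "norm q < 1"
  shows "norm (of_nat n ^ (k + 1) / (1 - q ^ n) * y ^ n) \<le> 1 / (1 - norm q) * (real n ^ (k + 1) * norm y ^ n)"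
proof (cases "n = 0")
  case False
  have "norm (of_nat n ^ (k + 1) / (1 - q ^ n) * y ^ n) = real n ^ (k + 1) * norm y ^ n / norm (1 - q ^ n)"
    by (simp add: norm_mult norm_divide norm_power)
  also have "\<dots> \<le> real n ^ (k + 1) * norm y ^ n / (1 - norm q)"
    using norm_one_minus_power_ge[OF assms, of n] False assms
    by (intro divide_left_mono mult_pos_pos) auto
  finally show ?thesis by simp
qed simp

lemma abs_summable_lambert:
  fixes q y :: complex
  assumes "norm q < 1" "norm y < 1"
  shows "(\<lambda>n. norm (of_nat n ^ (k + 1) / (1 - q ^ n) * y ^ n)) summable_on UNIV"
proof (rule summable_on_comparison_test)
  show "(\<lambda>n. 1 / (1 - norm q) * (real n ^ (k + 1) * norm y ^ n)) summable_on UNIV"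
    using assms by (intro summable_on_cmult_right summable_on_power_mult_geometric) auto
qed (use lambert_term_bound[OF assms(1)] in auto)

lemma has_sum_lambert:
  assumes "norm q < 1" "norm y < 1"
  shows "((\<lambda>n. of_nat n ^ (k + 1) / (1 - q ^ n) * y ^ n) has_sum lambert_series q k y) UNIV"
  unfolding lambert_series_def by (rule has_sum_of_abs_summable_on(1)[OF abs_summable_lambert[OF assms]])

text \<open>Termwise differentiation. The derivative is described through y D, so that y = 0 causes
  no division.\<close>

lemma has_field_derivative_lambert:
  assumes q: "norm q < 1" and y: "norm y < 1"
  shows "\<exists>D. (lambert_series q k has_field_derivative D) (at y) \<and> y * D = lambert_series q (k + 1) y"
proof -
  let ?c = "\<lambda>k n. of_nat n ^ (k + 1) / (1 - q ^ n) :: complex"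
  have summable: "summable (\<lambda>n. ?c k n * z ^ n)" if "norm z < 1" for z k
    using has_sum_of_abs_summable_on(2)[OF abs_summable_lambert[OF q that]] by (rule summable_norm_cancel)
  have "((\<lambda>z. suminf (\<lambda>n. ?c k n * z ^ n)) has_field_derivative suminf (\<lambda>n. diffs (?c k) n * y ^ n)) (at y)"
    by (rule termdiffs_strong'[of 1, OF summable y])
  moreover have "y * suminf (\<lambda>n. diffs (?c k) n * y ^ n) = lambert_series q (k + 1) y"
  proof -
    have e: "y * (diffs (?c k) n * y ^ n) = ?c (k + 1) (Suc n) * y ^ Suc n" for n
      by (simp add: diffs_def)
    have "summable (\<lambda>n. diffs (?c k) n * y ^ n)"
      by (rule termdiff_converges[OF y]) (rule summable)
    then have "y * suminf (\<lambda>n. diffs (?c k) n * y ^ n) = suminf (\<lambda>n. ?c (k + 1) (Suc n) * y ^ Suc n)"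
      by (subst suminf_mult[symmetric]) (simp_all only: e)
    also have "\<dots> = suminf (\<lambda>n. ?c (k + 1) n * y ^ n) - ?c (k + 1) 0 * y ^ 0"
      by (rule suminf_split_head[OF summable[OF y]])
    finally show ?thesis by (simp add: lambert_series_def)
  qed
  ultimately show ?thesis unfolding lambert_series_def[abs_def] by blast
qed

lemma has_field_derivative_lambert_exp:
  assumes q: "norm q < 1" and y: "norm (c * exp (s * z)) < 1"
  shows "((\<lambda>z. lambert_series q k (c * exp (s * z))) has_field_derivative s * lambert_series q (k + 1) (c * exp (s * z))) (at z)"
proof -
  obtain D where D: "(lambert_series q k has_field_derivative D) (at (c * exp (s * z)))"
    "c * exp (s * z) * D = lambert_series q (k + 1) (c * exp (s * z))"
    using has_field_derivative_lambert[OF q y] by blast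
  have "((\<lambda>z. c * exp (s * z)) has_field_derivative s * (c * exp (s * z))) (at z)"
    by (auto intro!: derivative_eq_intros)
  from DERIV_chain2[OF D(1) this]
  have "((\<lambda>z. lambert_series q k (c * exp (s * z))) has_field_derivative D * (s * (c * exp (s * z)))) (at z)" .
  also have "D * (s * (c * exp (s * z))) = s * (c * exp (s * z) * D)" by (simp only: mult_ac)
  finally show ?thesis unfolding D(2) .
qed

text \<open>
  \<open>\<Sum>n. n y\<^sup>n\<close> for \<open>|y| < 1\<close>; the invariance under \<open>y \<mapsto> 1 / y\<close> makes the sum \<open>ell_S\<close> over the lattice even.
\<close>

definition geo2 :: "complex \<Rightarrow> complex" where
  "geo2 y = y / (1 - y) ^ 2"

lemma geo2_inverse: "y \<noteq> 0 \<Longrightarrow> geo2 (1 / y) = geo2 y"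
proof (cases "y = 1")
  case False
  assume y: "y \<noteq> 0"
  have "1 - 1 / y = - ((1 - y) / y)" using y by (simp add: field_simps)
  then have "geo2 (1 / y) = (1 / y) / ((1 - y) / y) ^ 2" by (simp add: geo2_def)
  also have "\<dots> = geo2 y" using y False by (simp add: geo2_def power_divide power2_eq_square)
  finally show ?thesis .
qed simp

lemma geo2_exp_minus: "geo2 (exp (- z)) = geo2 (exp z)"
  using geo2_inverse[of "exp z"] by (simp add: exp_minus inverse_eq_divide)

lemma has_sum_geo2:
  assumes "norm y < 1"
  shows "((\<lambda>n. of_nat n * y ^ n) has_sum geo2 y) UNIV"
proof -
  have "(\<lambda>n. norm (of_nat n * y ^ n)) summable_on UNIV"
    using summable_on_power_mult_geometric[of "norm y" 1] assms by (simp add: norm_mult norm_power)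
  from has_sum_of_abs_summable_on(1)[OF this]
  have "((\<lambda>n. of_nat n * y ^ n) has_sum suminf (\<lambda>n. of_nat n * y ^ n)) UNIV" .
  also have "suminf (\<lambda>n. of_nat n * y ^ n) = geo2 y"
  proof -
    have "(\<lambda>n. of_nat (Suc n) * y ^ n * y) sums (1 / (1 - y)\<^sup>2 * y)"
      by (rule sums_mult2[OF geometric_deriv_sums[OF assms]])
    then have "(\<lambda>n. of_nat (Suc n) * y ^ Suc n) sums geo2 y" by (simp add: geo2_def mult_ac)
    then have "(\<lambda>n. of_nat n * y ^ n) sums geo2 y"
      using sums_Suc[of "\<lambda>n. of_nat n * y ^ n" "geo2 y"] by simp
    then show ?thesis by (rule sums_unique[symmetric])
  qed
  finally show ?thesis .
qed

lemma has_sum_geometric: "norm (c :: complex) < 1 \<Longrightarrow> ((\<lambda>l. c ^ l) has_sum 1 / (1 - c)) UNIV"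
  by (intro norm_summable_imp_has_sum geometric_sums) (auto simp: norm_power intro!: summable_geometric)

lemma norm_power_less_1: "norm (q :: complex) < 1 \<Longrightarrow> n > 0 \<Longrightarrow> norm (q ^ n) < 1"
  by (simp add: norm_power power_less_one_iff)

text \<open>The double series of n q^(l n) y^n, summed over l first or over n first. Its absolute
  summability is the same computation with \<open>norm q\<close> and \<open>norm y\<close>.\<close>

lemma has_sum_geo2_lambert:
  assumes q: "norm q < 1" and y: "norm y < 1"
  shows "((\<lambda>l. geo2 (q ^ l * y)) has_sum lambert_series q 0 y) UNIV"
proof -
  define f where "f = (\<lambda>(n, l). of_nat n * (q ^ l * y) ^ n :: complex)"
  have inner: "((\<lambda>l. of_nat n * (q ^ l * y) ^ n) has_sum of_nat n ^ (0 + 1) / (1 - q ^ n) * y ^ n) UNIV"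
    if q: "norm q < 1" for n and q y :: complex
  proof (cases "n = 0")
    case False
    then have "((\<lambda>l. (q ^ n) ^ l) has_sum 1 / (1 - q ^ n)) UNIV"
      using q by (intro has_sum_geometric norm_power_less_1) auto
    from has_sum_cmult_right[OF this, of "of_nat n * y ^ n"]
    show ?thesis by (simp add: power_mult_distrib mult_ac flip: power_mult)
  qed simp
  have "(\<lambda>p. norm (f p)) summable_on UNIV \<times> UNIV"
  proof (rule summable_on_SigmaI)
    fix n :: nat
    let ?q = "complex_of_real (norm q)" and ?y = "complex_of_real (norm y)"
    have "((\<lambda>l. of_nat n * (?q ^ l * ?y) ^ n) has_sum of_nat n ^ (0 + 1) / (1 - ?q ^ n) * ?y ^ n) UNIV"
      using q by (intro inner) auto
    also have "(\<lambda>l. of_nat n * (?q ^ l * ?y) ^ n) = (\<lambda>l. of_real (norm (f (n, l))))"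
      by (simp add: f_def norm_mult norm_power)
    also have "of_nat n ^ (0 + 1) / (1 - ?q ^ n) * ?y ^ n = of_real (real n ^ (0 + 1) / (1 - norm q ^ n) * norm y ^ n)"
      by simp
    finally show "((\<lambda>l. norm (f (n, l))) has_sum (real n ^ (0 + 1) / (1 - norm q ^ n) * norm y ^ n)) UNIV"
      by (simp only: has_sum_of_real_iff)
    have "(\<lambda>n. Re (of_nat n ^ (0 + 1) / (1 - ?q ^ n) * ?y ^ n)) summable_on UNIV"
      using has_sum_lambert[of ?q ?y 0] q y by (intro summable_on_Re has_sum_imp_summable) auto
    also have "(\<lambda>n. Re (of_nat n ^ (0 + 1) / (1 - ?q ^ n) * ?y ^ n)) = (\<lambda>n. real n ^ (0 + 1) / (1 - norm q ^ n) * norm y ^ n)"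
    proof
      fix n
      have "of_nat n ^ (0 + 1) / (1 - ?q ^ n) * ?y ^ n = of_real (real n ^ (0 + 1) / (1 - norm q ^ n) * norm y ^ n)" by simp
      then show "Re (of_nat n ^ (0 + 1) / (1 - ?q ^ n) * ?y ^ n) = real n ^ (0 + 1) / (1 - norm q ^ n) * norm y ^ n"
        by (simp only: Re_complex_of_real)
    qed
    finally show "(\<lambda>n. real n ^ (0 + 1) / (1 - norm q ^ n) * norm y ^ n) summable_on UNIV" .
  qed auto
  then have "f summable_on UNIV \<times> UNIV" by (rule abs_summable_summable)
  then have "(f has_sum lambert_series q 0 y) (UNIV \<times> UNIV)"
    by (intro has_sum_SigmaI[OF _ has_sum_lambert[OF q y]]) (use inner[OF q] in \<open>auto simp: f_def\<close>)
  then have "((\<lambda>(l, n). f (n, l)) has_sum lambert_series q 0 y) (UNIV \<times> UNIV)"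
    by (subst (asm) has_sum_swap) (simp add: case_prod_unfold)
  then show ?thesis
  proof (rule has_sum_SigmaD)
    fix l
    have "norm q ^ l * norm y \<le> 1 * norm y" using q by (intro mult_right_mono power_le_one) auto
    then have "norm (q ^ l * y) < 1" using y by (simp add: norm_mult norm_power)
    from has_sum_geo2[OF this]
    show "((\<lambda>n. case (l, n) of (l, n) \<Rightarrow> f (n, l)) has_sum geo2 (q ^ l * y)) UNIV"
      by (simp add: f_def)
  qed
qed

subsection \<open>The elliptic function of weight two\<close>

text \<open>
  The second derivative of \<open>P\<^sub>0\<close>, summed over the imaginary direction of the lattice. Unlike the
  Lambert series it converges at every \<open>z\<close> off the lattice.
\<close>

definition ell_S :: "complex \<Rightarrow> complex \<Rightarrow> complex" where
  "ell_S q z = suminf (\<lambda>l. geo2 (q ^ l * exp z) + geo2 (q ^ (l + 1) * exp (- z)))"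

definition geo2_sum :: "complex \<Rightarrow> complex \<Rightarrow> complex" where
  "geo2_sum q y = suminf (\<lambda>l. geo2 (q ^ l * y))"

lemma summable_geo2:
  assumes q: "norm q < 1"
  shows "summable (\<lambda>l. geo2 (q ^ l * y))"
proof -
  have "(\<lambda>l. norm (q ^ l * y)) \<longlonglongrightarrow> 0"
    using tendsto_mult_right[OF LIMSEQ_realpow_zero[of "norm q"], of "norm y"] q by (simp add: norm_mult norm_power)
  then have "\<forall>\<^sub>F L in sequentially. norm (q ^ L * y) < 1" by (rule order_tendstoD(2)) simp
  then obtain L where L: "norm (q ^ L * y) < 1" by (auto simp: eventually_sequentially)
  have "summable (\<lambda>l. geo2 (q ^ l * (q ^ L * y)))"
    using has_sum_imp_sums[OF has_sum_geo2_lambert[OF q L]] by (rule sums_summable)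
  then have "summable (\<lambda>l. geo2 (q ^ (l + L) * y))" by (simp add: power_add mult_ac)
  then show ?thesis by (subst (asm) summable_iff_shift)
qed

lemma geo2_sum_rec:
  assumes "norm q < 1"
  shows "geo2_sum q y = geo2 y + geo2_sum q (q * y)"
  using suminf_split_head[OF summable_geo2[OF assms, of y]]
  by (simp add: geo2_sum_def power_commutes mult_ac)

lemma geo2_sum_lambert: "norm q < 1 \<Longrightarrow> norm y < 1 \<Longrightarrow> geo2_sum q y = lambert_series q 0 y"
  unfolding geo2_sum_def using has_sum_imp_sums[OF has_sum_geo2_lambert] sums_unique by metis

lemma ell_S_eq:
  assumes "norm q < 1"
  shows "ell_S q z = geo2_sum q (exp z) + geo2_sum q (q * exp (- z))"
proof -
  have "q ^ (l + 1) * exp (- z) = q ^ l * (q * exp (- z))" for l by simp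
  then show ?thesis
    unfolding ell_S_def geo2_sum_def suminf_add[OF summable_geo2[OF assms] summable_geo2[OF assms]] by (simp only:)
qed

text \<open>The sign change exchanges the two halves up to their terms without a power of q, and
  \<open>geo2\<close> takes equal values at e^z and e^(-z).\<close>

lemma ell_S_minus: "norm q < 1 \<Longrightarrow> ell_S q (- z) = ell_S q z"
  using geo2_sum_rec[of q "exp z"] geo2_sum_rec[of q "exp (- z)"]
  by (simp add: ell_S_eq geo2_exp_minus)

text \<open>In this strip both Lambert series converge; the differences z_i - z_j with i < j lie in
  it when z is in the domain of the trace.\<close>

lemma ell_S_strip:
  assumes q: "norm q < 1" and z: "norm (q * exp z) < 1" "norm (exp (- z)) < 1"
  shows "ell_S q z = lambert_series q 0 (exp (- z)) + lambert_series q 0 (q * exp z)"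
  using geo2_sum_rec[OF q, of "exp z"] geo2_sum_rec[OF q, of "exp (- z)"]
    geo2_sum_lambert[OF q z(1)] geo2_sum_lambert[OF q z(2)]
  by (simp add: ell_S_eq[OF q] geo2_exp_minus)

text \<open>Around 0 the two Lambert series are regular, and \<open>geo2 (exp z)\<close> isolates
  the pole.\<close>

lemma ell_S_near_0:
  assumes q: "norm q < 1" and z: "norm (q * exp z) < 1" "norm (q * exp (- z)) < 1"
  shows "ell_S q z = geo2 (exp z) + (lambert_series q 0 (q * exp z) + lambert_series q 0 (q * exp (- z)))"
  using geo2_sum_rec[OF q, of "exp z"] geo2_sum_lambert[OF q z(1)] geo2_sum_lambert[OF q z(2)]
  by (simp add: ell_S_eq[OF q])

lemma open_strip: "open {z :: complex. norm (q * exp z) < 1 \<and> norm (exp (- z)) < 1}"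
  by (intro open_Collect_conj open_Collect_less continuous_intros)

text \<open>In the variable z each derivative raises the index of a Lambert series by one; the
  argument e^(-z) contributes the sign.\<close>

lemma higher_deriv_ell_S_strip:
  assumes q: "norm q < 1"
  shows "norm (q * exp z) < 1 \<Longrightarrow> norm (exp (- z)) < 1 \<Longrightarrow>
    (deriv ^^ k) (ell_S q) z = (- 1) ^ k * lambert_series q k (exp (- z)) + lambert_series q k (q * exp z)"
proof (induction k arbitrary: z)
  case 0
  then show ?case by (simp add: ell_S_strip[OF q])
next
  case (Suc k)
  let ?U = "{z. norm (q * exp z) < 1 \<and> norm (exp (- z)) < 1}"
  have "((\<lambda>z. (- 1) ^ k * lambert_series q k (1 * exp (- 1 * z)) + lambert_series q k (q * exp (1 * z))) has_field_derivative
     (- 1) ^ k * (- 1 * lambert_series q (k + 1) (1 * exp (- 1 * z))) + 1 * lambert_series q (k + 1) (q * exp (1 * z))) (at z)"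
    using Suc.prems by (intro DERIV_add DERIV_cmult has_field_derivative_lambert_exp q) auto
  then have "((\<lambda>z. (- 1) ^ k * lambert_series q k (exp (- z)) + lambert_series q k (q * exp z)) has_field_derivative
     (- 1) ^ Suc k * lambert_series q (Suc k) (exp (- z)) + lambert_series q (Suc k) (q * exp z)) (at z)"
    by simp
  then have "((deriv ^^ k) (ell_S q) has_field_derivative
     (- 1) ^ Suc k * lambert_series q (Suc k) (exp (- z)) + lambert_series q (Suc k) (q * exp z)) (at z)"
    by (rule has_field_derivative_transform_within_open[OF _ open_strip[of q]]) (use Suc in auto)
  then show ?case by (simp add: DERIV_imp_deriv)
qed

subsection \<open>Eisenstein series\<close>

text \<open>The double series of d^K q^(d m) over d, m \<ge> 1, summed over m first or grouped by n
  = d m.\<close>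

lemma has_sum_lambert_sigma:
  fixes q :: complex
  assumes q: "norm q < 1" and K: "K \<ge> 1"
  shows "((\<lambda>d. of_nat d ^ K / (1 - q ^ d) * q ^ d) has_sum suminf (\<lambda>n. of_nat (sigma_div K (Suc n)) * q ^ Suc n)) UNIV"
proof -
  obtain k where k: "K = k + 1" using K by (cases K) auto
  define f where "f = (\<lambda>(d, m). of_nat d ^ K * q ^ (d * m) :: complex)"
  have inner: "((\<lambda>m. of_nat d ^ K * q ^ (d * m)) has_sum of_nat d ^ (k + 1) / (1 - q ^ d) * q ^ d) {1..}"
    if q: "norm q < 1" and d: "d \<ge> 1" for d :: nat and q :: complex
  proof -
    have "((\<lambda>m. (q ^ d) ^ m) has_sum 1 / (1 - q ^ d)) UNIV"
      using q d by (intro has_sum_geometric norm_power_less_1) auto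
    from has_sum_cmult_right[OF this, of "of_nat d ^ K * q ^ d"]
    have "((\<lambda>m. of_nat d ^ K * q ^ (d * Suc m)) has_sum of_nat d ^ (k + 1) / (1 - q ^ d) * q ^ d) UNIV"
      by (simp add: k power_add mult_ac flip: power_mult)
    also have "?this \<longleftrightarrow> ?thesis"
      by (rule has_sum_reindex_bij_witness[where j = Suc and i = "\<lambda>m. m - 1"]) auto
    finally show ?thesis .
  qed
  have outer: "((\<lambda>d. of_nat d ^ (k + 1) / (1 - q ^ d) * q ^ d) has_sum lambert_series q k q) {1..}"
    if "norm q < 1" for q :: complex
    by (rule has_sum_cong_neutral[THEN iffD1, OF _ _ _ has_sum_lambert[OF that that, of k]]) auto
  have "(\<lambda>p. norm (f p)) summable_on {1..} \<times> {1..}"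
  proof (rule summable_on_SigmaI)
    let ?q = "complex_of_real (norm q)"
    fix d :: nat assume "d \<in> {1..}"
    then have "((\<lambda>m. of_nat d ^ K * ?q ^ (d * m)) has_sum of_nat d ^ (k + 1) / (1 - ?q ^ d) * ?q ^ d) {1..}"
      using q by (intro inner) auto
    also have "(\<lambda>m. of_nat d ^ K * ?q ^ (d * m)) = (\<lambda>m. of_real (norm (f (d, m))))"
      by (simp add: f_def norm_mult norm_power)
    also have "of_nat d ^ (k + 1) / (1 - ?q ^ d) * ?q ^ d = of_real (real d ^ (k + 1) / (1 - norm q ^ d) * norm q ^ d)"
      by simp
    finally show "((\<lambda>m. norm (f (d, m))) has_sum (real d ^ (k + 1) / (1 - norm q ^ d) * norm q ^ d)) {1..}"
      by (simp only: has_sum_of_real_iff)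
  next
    let ?q = "complex_of_real (norm q)"
    have "(\<lambda>d. complex_of_real (real d ^ (k + 1) / (1 - norm q ^ d) * norm q ^ d)) summable_on {1..}"
      using has_sum_imp_summable[OF outer[of ?q]] q by simp
    from summable_on_Re[OF this]
    show "(\<lambda>d. real d ^ (k + 1) / (1 - norm q ^ d) * norm q ^ d) summable_on {1..}"
      by (simp only: Re_complex_of_real)
  qed auto
  then have "f summable_on {1..} \<times> {1..}" by (rule abs_summable_summable)
  then have "(f has_sum lambert_series q k q) ({1..} \<times> {1..})"
    by (intro has_sum_SigmaI[OF _ outer[OF q]]) (use inner[OF q] in \<open>auto simp: f_def\<close>)
  also have "?this \<longleftrightarrow> ((\<lambda>(n, d). of_nat d ^ K * q ^ n) has_sum lambert_series q k q) (Sigma {1..} (\<lambda>n. {d. d dvd n}))"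
    by (rule has_sum_reindex_bij_witness[where j = "\<lambda>(d, m). (d * m, d)" and i = "\<lambda>(n, d). (d, n div d)"])
       (auto simp: f_def Suc_le_eq intro!: Nat.gr0I)
  finally have "((\<lambda>n. of_nat (sigma_div K n) * q ^ n) has_sum lambert_series q k q) {1..}"
  proof (rule has_sum_SigmaD)
    fix n :: nat assume "n \<in> {1..}"
    then have "finite {d. d dvd n}" by auto
    then show "((\<lambda>d. case (n, d) of (n, d) \<Rightarrow> of_nat d ^ K * q ^ n) has_sum of_nat (sigma_div K n) * q ^ n) {d. d dvd n}"
      by (intro has_sum_finiteI) (auto simp: sigma_div_def sum_distrib_right)
  qed
  also have "?this \<longleftrightarrow> ((\<lambda>n. of_nat (sigma_div K (Suc n)) * q ^ Suc n) has_sum lambert_series q k q) UNIV"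
    by (rule has_sum_reindex_bij_witness[where i = Suc and j = "\<lambda>m. m - 1"]) auto
  finally have "suminf (\<lambda>n. of_nat (sigma_div K (Suc n)) * q ^ Suc n) = lambert_series q k q"
    by (rule sums_unique[symmetric, OF has_sum_imp_sums])
  then show ?thesis using has_sum_lambert[OF q q, of k] by (simp add: k)
qed

definition sigma_series :: "complex \<Rightarrow> nat \<Rightarrow> complex" where
  "sigma_series q K = suminf (\<lambda>n. of_nat (sigma_div K (Suc n)) * q ^ Suc n)"

lemma has_sum_exp: "((\<lambda>k. z ^ k / fact k) has_sum exp z) UNIV" for z :: complex
proof -
  have "summable (\<lambda>k. norm (z ^ k / fact k))"
    using summable_norm_exp[of z] by (simp add: norm_power norm_mult divide_inverse mult.commute norm_inverse)
  moreover have "(\<lambda>k. z ^ k / fact k) sums exp z"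
    using exp_converges[of z] by (simp add: scaleR_conv_of_real divide_inverse mult.commute)
  ultimately show ?thesis by (rule norm_summable_imp_has_sum)
qed

text \<open>The exponentials e^(dw) and e^(-dw) are expanded and the sum over d is taken first; the
  two signs cancel the odd powers. The bound on |w| makes the majorant with e^(d|w|)
  summable.\<close>

lemma has_sum_sigma_series:
  assumes q: "norm q < 1" and w: "norm q * exp (norm w) < 1"
  shows "((\<lambda>k. (if even k then 2 / fact k * sigma_series q (k + 1) else 0) * w ^ k) has_sum
     lambert_series q 0 (q * exp w) + lambert_series q 0 (q * exp (- w))) UNIV"
proof -
  define t where "t = (\<lambda>(d, k). of_nat d / (1 - q ^ d) * q ^ d * ((of_nat d * w) ^ k / fact k + (of_nat d * - w) ^ k / fact k) :: complex)"
  have nw: "norm (q * exp w) < 1" "norm (q * exp (- w)) < 1"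
  proof -
    have "norm (exp w) \<le> exp (norm w)" "norm (exp (- w)) \<le> exp (norm w)"
      using norm_exp[of w] norm_exp[of "- w"] by auto
    then have "norm q * norm (exp w) \<le> norm q * exp (norm w)" "norm q * norm (exp (- w)) \<le> norm q * exp (norm w)"
      by (intro mult_left_mono; simp)+
    then show "norm (q * exp w) < 1" "norm (q * exp (- w)) < 1" using w by (simp_all only: norm_mult)
  qed
  have inner: "((\<lambda>k. t (d, k)) has_sum of_nat d ^ (0 + 1) / (1 - q ^ d) * (q * exp w) ^ d + of_nat d ^ (0 + 1) / (1 - q ^ d) * (q * exp (- w)) ^ d) UNIV" for d
  proof -
    have "((\<lambda>k. t (d, k)) has_sum of_nat d / (1 - q ^ d) * q ^ d * (exp (of_nat d * w) + exp (of_nat d * - w))) UNIV"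
      unfolding t_def prod.case by (intro has_sum_cmult_right has_sum_add has_sum_exp)
    then show ?thesis by (simp add: exp_of_nat_mult power_mult_distrib ring_distribs add_divide_distrib mult_ac flip: exp_of_nat_mult)
  qed
  have outer: "((\<lambda>d. of_nat d ^ (0 + 1) / (1 - q ^ d) * (q * exp w) ^ d + of_nat d ^ (0 + 1) / (1 - q ^ d) * (q * exp (- w)) ^ d) has_sum
     lambert_series q 0 (q * exp w) + lambert_series q 0 (q * exp (- w))) UNIV"
    by (intro has_sum_add has_sum_lambert q nw)
  have "(\<lambda>p. norm (t p)) summable_on UNIV \<times> UNIV"
  proof (rule summable_on_comparison_test)
    define g where "g = (\<lambda>(d, k). 2 / (1 - norm q) * (real d * norm q ^ d) * ((real d * norm w) ^ k / fact k))"
    show "g summable_on UNIV \<times> UNIV"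
    proof (rule summable_on_SigmaI)
      fix d
      have "((\<lambda>k. complex_of_real ((real d * norm w) ^ k / fact k)) has_sum of_real (exp (real d * norm w))) UNIV"
        using has_sum_exp[of "of_real (real d * norm w)"] by (simp flip: exp_of_real)
      then have "((\<lambda>k. (real d * norm w) ^ k / fact k) has_sum exp (real d * norm w)) UNIV"
        by (simp only: has_sum_of_real_iff)
      from has_sum_cmult_right[OF this, of "2 / (1 - norm q) * (real d * norm q ^ d)"]
      show "((\<lambda>k. g (d, k)) has_sum 2 / (1 - norm q) * (real d ^ 1 * (norm q * exp (norm w)) ^ d)) UNIV"
        by (simp add: g_def exp_of_nat_mult power_mult_distrib mult_ac)
    next
      show "(\<lambda>d. 2 / (1 - norm q) * (real d ^ 1 * (norm q * exp (norm w)) ^ d)) summable_on UNIV"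
        using w by (intro summable_on_cmult_right summable_on_power_mult_geometric) auto
      show "g p \<ge> 0" for p using q by (auto simp: g_def case_prod_unfold)
    qed
    fix p :: "nat \<times> nat"
    obtain d k where p: "p = (d, k)" by (cases p)
    have a: "norm (of_nat d / (1 - q ^ d) * q ^ d) \<le> 1 / (1 - norm q) * (real d * norm q ^ d)"
      using lambert_term_bound[OF q, of d 0 q] by simp
    have b: "norm ((of_nat d * w) ^ k / fact k + (of_nat d * - w) ^ k / fact k) \<le> 2 * ((real d * norm w) ^ k / fact k)"
      by (rule order_trans[OF norm_triangle_ineq]) (simp add: norm_divide norm_power norm_mult)
    have "norm (t p) = norm (of_nat d / (1 - q ^ d) * q ^ d) * norm ((of_nat d * w) ^ k / fact k + (of_nat d * - w) ^ k / fact k)"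
      by (simp only: p t_def prod.case norm_mult)
    also have "\<dots> \<le> (1 / (1 - norm q) * (real d * norm q ^ d)) * (2 * ((real d * norm w) ^ k / fact k))"
      using q by (intro mult_mono a b) auto
    also have "\<dots> = g p" by (simp add: g_def p)
    finally show "norm (t p) \<le> g p" .
  qed auto
  then have "t summable_on UNIV \<times> UNIV" by (rule abs_summable_summable)
  then have "(t has_sum lambert_series q 0 (q * exp w) + lambert_series q 0 (q * exp (- w))) (UNIV \<times> UNIV)"
    by (rule has_sum_SigmaI[OF inner outer])
  then have "((\<lambda>(k, d). t (d, k)) has_sum lambert_series q 0 (q * exp w) + lambert_series q 0 (q * exp (- w))) (UNIV \<times> UNIV)"
    by (subst (asm) has_sum_swap) (simp add: case_prod_unfold)
  then show ?thesis
  proof (rule has_sum_SigmaD)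
    fix k :: nat
    have e: "t (d, k) = (if even k then 2 / fact k * w ^ k else 0) * (of_nat d ^ (k + 1) / (1 - q ^ d) * q ^ d)" for d
      by (simp add: t_def power_mult_distrib minus_power_mult_self power_minus[of w] power_minus[of "of_nat d * w"] field_simps)
    have "((\<lambda>d. (if even k then 2 / fact k * w ^ k else 0) * (of_nat d ^ (k + 1) / (1 - q ^ d) * q ^ d)) has_sum (if even k then 2 / fact k * w ^ k else 0) * sigma_series q (k + 1)) UNIV"
      unfolding sigma_series_def by (intro has_sum_cmult_right has_sum_lambert_sigma q) simp
    then show "((\<lambda>d. case (k, d) of (k, d) \<Rightarrow> t (d, k)) has_sum (if even k then 2 / fact k * sigma_series q (k + 1) else 0) * w ^ k) UNIV"
      unfolding prod.case e by (cases "even k") (simp_all add: mult_ac)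
  qed
qed

text \<open>One formula for both parities: for odd k at least 3 the Bernoulli coefficient vanishes
  as well.\<close>

lemma eisen_eq:
  assumes "k \<ge> 2"
  shows "eisen k \<tau> = - fps_nth bern_fps k + (if even k then 2 / fact (k - 1) * sigma_series (nome \<tau>) (k - 1) else 0)"
proof -
  have "bernoulli_number k / fact k = fps_nth bern_fps k" by (simp add: bernoulli_number_eq)
  then show ?thesis using bern_fps_odd[of k] assms
    by (auto simp: eisen_def sigma_series_def)
qed

lemma bern_fps_0: "fps_nth bern_fps 0 = 1"
proof -
  have "fps_nth (bern_fps * (fps_exp 1 - 1)) 1 = fps_nth fps_X 1" by (simp only: bern_fps_mult)
  then show ?thesis by (simp add: fps_mult_nth)
qed

text \<open>\<open>bern_fps\<close> is the inverse of (e^z - 1) / z, which converges and has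
  constant term 1.\<close>

lemma bern_fps_conv_radius: "fps_conv_radius bern_fps > 0"
proof -
  define Y where "Y = (fps_exp 1 - 1 :: complex fps)"
  define S where "S = fps_shift 1 Y"
  have S0: "fps_nth S 0 = 1" by (simp add: S_def Y_def)
  have Y: "Y = fps_X * S" by (rule fps_ext) (auto simp: S_def Y_def)
  have "bern_fps * Y = fps_X" unfolding Y_def by (rule bern_fps_mult)
  then have "fps_X * (bern_fps * S) = fps_X * 1" by (simp add: Y mult.left_commute)
  then have "bern_fps * S = 1" by (simp only: mult_cancel_left fps_X_neq_zero simp_thms)
  then have "bern_fps = inverse S" using fps_inverse_unique[of S bern_fps] S0 by (simp add: mult.commute)
  moreover have "fps_conv_radius S > 0"
  proof -
    have "fps_conv_radius Y \<ge> min (fps_conv_radius (fps_exp 1 :: complex fps)) (fps_conv_radius (1 :: complex fps))"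
      unfolding Y_def by (rule fps_conv_radius_diff)
    then show ?thesis by (simp add: S_def)
  qed
  ultimately show ?thesis using S0 fps_conv_radius_inverse_pos[of S] by simp
qed

text \<open>\<open>geo2 (exp w)\<close> is the derivative of -1 / (e^w - 1) = -b(w) / w, that is, (b
  - w b') / w^2 with b the Bernoulli series.\<close>

lemma sums_geo2_exp:
  obtains r where "r > 0" "\<And>w. norm w < r \<Longrightarrow> w \<noteq> 0 \<Longrightarrow>
    (\<lambda>k. - of_nat (k + 1) * fps_nth bern_fps (k + 2) * w ^ k) sums (geo2 (exp w) - 1 / w ^ 2)"
proof -
  obtain r where r: "r > 0" "ereal r < fps_conv_radius bern_fps"
    using bern_fps_conv_radius by (metis ereal_dense2 ereal_less(2) zero_ereal_def less_ereal.simps(1))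
  define G where "G = bern_fps - fps_X * fps_deriv bern_fps"
  have eqG: "G = bern_fps ^ 2 * fps_exp 1"
  proof -
    let ?y = "fps_exp 1 - 1 :: complex fps"
    have "fps_deriv (bern_fps * ?y) = 1" unfolding bern_fps_mult by simp
    then have d: "fps_deriv bern_fps * ?y = 1 - bern_fps * fps_exp 1" by (simp add: algebra_simps)
    have "fps_X * fps_deriv bern_fps = bern_fps * ?y * fps_deriv bern_fps" by (simp only: bern_fps_mult)
    also have "\<dots> = bern_fps * (fps_deriv bern_fps * ?y)" by (simp only: mult_ac)
    finally show ?thesis unfolding d G_def by (simp add: algebra_simps power2_eq_square)
  qed
  have Gn: "fps_nth G k = (1 - of_nat k) * fps_nth bern_fps k" for k
    by (cases k) (simp_all add: G_def algebra_simps)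
  have "(\<lambda>k. - of_nat (k + 1) * fps_nth bern_fps (k + 2) * w ^ k) sums (geo2 (exp w) - 1 / w ^ 2)"
    if w: "norm w < r" "w \<noteq> 0" for w
  proof -
    have rw: "ereal (norm w) < fps_conv_radius bern_fps" using w r by (meson ereal_less_le less_ereal.simps(1) less_imp_le order_less_trans)
    have e: "ereal (norm w) < fps_conv_radius (fps_exp 1 :: complex fps)" by simp
    have rw2: "ereal (norm w) < fps_conv_radius (bern_fps ^ 2)"
      using rw fps_conv_radius_power[of bern_fps 2] by (rule less_le_trans)
    have rG: "ereal (norm w) < fps_conv_radius G"
      unfolding eqG using fps_conv_radius_mult[of "bern_fps ^ 2" "fps_exp 1"] rw2 by simp
    define b where "b = eval_fps bern_fps w"
    have "b * (exp w - 1) = w"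
    proof -
      have ey: "ereal (norm w) < fps_conv_radius (fps_exp 1 - 1 :: complex fps)"
        using fps_conv_radius_diff[of "fps_exp 1 :: complex fps" 1] by simp
      have "eval_fps (bern_fps * (fps_exp 1 - 1)) w = b * eval_fps (fps_exp 1 - 1) w"
        unfolding b_def by (rule eval_fps_mult[OF rw ey])
      also have "eval_fps (fps_exp 1 - 1 :: complex fps) w = exp w - 1"
        by (subst eval_fps_diff) auto
      finally show ?thesis by (simp add: bern_fps_mult)
    qed
    then have ne: "exp w - 1 \<noteq> 0" using w(2) by auto
    with \<open>b * (exp w - 1) = w\<close> have b: "b = w / (exp w - 1)" by (simp only: eq_divide_eq) simp
    have "eval_fps G w = b ^ 2 * exp w"
      unfolding eqG b_def using rw2 e by (simp add: eval_fps_mult eval_fps_power[OF rw])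
    also have "\<dots> = w ^ 2 * geo2 (exp w)"
      unfolding b geo2_def by (simp add: power_divide power2_commute[of "exp w" 1])
    finally have "(\<lambda>k. fps_nth G k * w ^ k) sums (w ^ 2 * geo2 (exp w))"
      using sums_eval_fps[OF rG] by simp
    then have "(\<lambda>k. fps_nth G (k + 2) * w ^ (k + 2)) sums (w ^ 2 * geo2 (exp w) - (\<Sum>k<2. fps_nth G k * w ^ k))"
      by (rule sums_split_initial_segment)
    \<comment> \<open>The coefficient of w vanishes because of the factor 1 - k, so the double pole
      comes without a residue.\<close>
    moreover have "(\<Sum>k<2. fps_nth G k * w ^ k) = 1"
      by (simp add: Gn bern_fps_0 numeral_2_eq_2)
    ultimately have "(\<lambda>k. fps_nth G (k + 2) * w ^ (k + 2) * (1 / w ^ 2)) sums ((w ^ 2 * geo2 (exp w) - 1) * (1 / w ^ 2))"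
      by (intro sums_mult2) simp
    moreover have "fps_nth G (k + 2) * w ^ (k + 2) * (1 / w ^ 2) = - of_nat (k + 1) * fps_nth bern_fps (k + 2) * w ^ k" for k
    proof -
      have "w ^ (k + 2) * (1 / w ^ 2) = w ^ k" using w(2) by (simp add: power_add power2_eq_square)
      moreover have "(1 - of_nat (k + 2) :: complex) = - of_nat (k + 1)" by simp
      ultimately show ?thesis unfolding Gn by (simp only: mult.assoc)
    qed
    moreover have "(w ^ 2 * geo2 (exp w) - 1) * (1 / w ^ 2) = geo2 (exp w) - 1 / w ^ 2"
      using w(2) by (simp add: algebra_simps)
    ultimately show ?thesis by (simp only:)
  qed
  with r that show ?thesis by blast
qed

subsection \<open>The functions \<open>P\<^sub>k\<close>\<close>

definition lattice :: "complex \<Rightarrow> complex set" where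
  "lattice \<tau> = {2 * of_real pi * \<i> * (of_int k + of_int l * \<tau>) | k l. True}"

lemma exp_eq_1_lattice:
  assumes "nome \<tau> powi l * exp z = 1"
  shows "z \<in> lattice \<tau>"
proof -
  have "nome \<tau> powi l = exp (of_int l * (2 * of_real pi * \<i> * \<tau>))"
    unfolding nome_def by (cases l rule: int_cases2)
      (simp_all add: exp_of_nat_mult[symmetric] power_int_minus exp_minus mult_ac del: exp_of_nat_mult exp_of_nat2_mult)
  then have "exp (of_int l * (2 * of_real pi * \<i> * \<tau>) + z) = 1" using assms by (simp add: exp_add)
  then obtain k :: int where "of_int l * (2 * of_real pi * \<i> * \<tau>) + z = of_int (2 * k) * (of_real pi * \<i>)"
    unfolding exp_eq_1 by (auto simp: complex_eq_iff)
  then have "z = 2 * of_real pi * \<i> * (of_int k + of_int (- l) * \<tau>)" by (simp add: algebra_simps)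
  then show ?thesis unfolding lattice_def by blast
qed

lemma lattice_uminus: "z \<in> lattice \<tau> \<Longrightarrow> - z \<in> lattice \<tau>"
proof -
  assume "z \<in> lattice \<tau>"
  then obtain k l :: int where "z = 2 * of_real pi * \<i> * (of_int k + of_int l * \<tau>)" by (auto simp: lattice_def)
  then have "- z = 2 * of_real pi * \<i> * (of_int (- k) + of_int (- l) * \<tau>)" by (simp add: algebra_simps)
  then show ?thesis unfolding lattice_def by blast
qed

lemma analytic_geo2_exp:
  assumes "c * exp (s * z) \<noteq> 1"
  shows "(\<lambda>w. geo2 (c * exp (s * w))) analytic_on {z}"
  unfolding geo2_def using assms by (intro analytic_intros) auto

lemma meromorphic_geo2_exp: "(\<lambda>w. geo2 (c * exp (s * w))) meromorphic_on UNIV"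
  unfolding geo2_def
  by (intro meromorphic_intros analytic_on_imp_meromorphic_on analytic_intros) 

text \<open>The factors \<open>1\<close> and \<open>- 1\<close> are written out so that both
  summands have the form treated in \<open>analytic_geo2_exp\<close>.\<close>

definition ell_term :: "complex \<Rightarrow> nat \<Rightarrow> complex \<Rightarrow> complex" where
  "ell_term q l z = geo2 (q ^ l * exp (1 * z)) + geo2 (q ^ (l + 1) * exp (- 1 * z))"

text \<open>On a bounded disc only finitely many terms can have poles; the others are dominated by a
  geometric series, so their sum is holomorphic.\<close>

lemma ell_S_split:
  assumes q: "norm q < 1"
  obtains L H where "H holomorphic_on ball 0 R" "\<And>z. z \<in> ball 0 R \<Longrightarrow> ell_S q z = (\<Sum>l<L. ell_term q l z) + H z"
proof -
  have sum: "summable (\<lambda>l. ell_term q l z)" for z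
    unfolding ell_term_def using summable_add[OF summable_geo2[OF q, of "exp z"] summable_geo2[OF q, of "q * exp (- z)"]]
    by (simp add: mult_ac power_commutes)
  \<comment> \<open>The bound 1/2 imposed next keeps the arguments of the tail away from the pole of
    \<open>geo2\<close> at 1 and makes \<open>geo2\<close> linearly bounded there.\<close>
  have "(\<lambda>l. norm q ^ l * exp R) \<longlonglongrightarrow> 0"
    using tendsto_mult_right[OF LIMSEQ_realpow_zero[of "norm q"], of "exp R"] q by simp
  then have "\<forall>\<^sub>F l in sequentially. norm q ^ l * exp R < 1 / 2" by (rule order_tendstoD(2)) simp
  then obtain L where L: "\<And>l. l \<ge> L \<Longrightarrow> norm q ^ l * exp R < 1 / 2" by (auto simp: eventually_sequentially)
  define H where "H = (\<lambda>z. suminf (\<lambda>l. ell_term q (l + L) z))"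
  have small: "norm (q ^ l * exp (s * z)) \<le> norm q ^ l * exp R" if "z \<in> ball 0 R" "norm s = 1" for l z and s :: complex
  proof -
    have "norm (exp (s * z)) \<le> exp (norm (s * z))" by (rule norm_exp)
    also have "\<dots> \<le> exp R" using that by (simp add: norm_mult)
    finally show ?thesis by (simp add: norm_mult norm_power mult_left_mono)
  qed
  have geo2_le: "norm (geo2 y) \<le> 4 * norm y" if "norm y \<le> 1 / 2" for y
  proof -
    have "1 / 2 \<le> norm (1 - y)" using that norm_triangle_ineq2[of 1 y] by simp
    then have "(1 / 2) ^ 2 \<le> norm (1 - y) ^ 2" by (intro power_mono) auto
    then have "norm y / norm (1 - y) ^ 2 \<le> norm y / (1 / 2) ^ 2"
      by (intro divide_left_mono mult_pos_pos) (auto intro: less_le_trans[of _ "(1/2)^2"])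
    then show ?thesis by (simp add: geo2_def norm_divide norm_power norm_mult power2_eq_square mult.commute)
  qed
  have term_bound: "norm (ell_term q (l + L) z) \<le> 8 * exp R * norm q ^ l" if z: "z \<in> ball 0 R" for l z
  proof -
    have a: "norm q ^ (l + L + i) * exp R \<le> norm q ^ l * exp R" for i
      using q by (intro mult_right_mono power_decreasing) auto
    have g: "norm (geo2 (q ^ (l + L + i) * exp (s * z))) \<le> 4 * (norm q ^ l * exp R)" if "norm s = 1" for i and s :: complex
    proof -
      have b: "norm (q ^ (l + L + i) * exp (s * z)) \<le> norm q ^ (l + L + i) * exp R" by (rule small[OF z that])
      moreover have "norm q ^ (l + L + i) * exp R < 1 / 2" by (rule L) simp
      ultimately have "norm (geo2 (q ^ (l + L + i) * exp (s * z))) \<le> 4 * norm (q ^ (l + L + i) * exp (s * z))"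
        by (intro geo2_le) linarith
      with b a[of i] show ?thesis by linarith
    qed
    have "norm (ell_term q (l + L) z) \<le> 4 * (norm q ^ l * exp R) + 4 * (norm q ^ l * exp R)"
      unfolding ell_term_def
    proof (rule norm_triangle_le)
      have "norm (geo2 (q ^ (l + L) * exp (1 * z))) \<le> 4 * (norm q ^ l * exp R)" using g[of 1 0] by simp
      moreover have "norm (geo2 (q ^ (l + L + 1) * exp (- 1 * z))) \<le> 4 * (norm q ^ l * exp R)" using g[of "- 1" 1] by simp
      ultimately show "norm (geo2 (q ^ (l + L) * exp (1 * z))) + norm (geo2 (q ^ (l + L + 1) * exp (- 1 * z)))
        \<le> 4 * (norm q ^ l * exp R) + 4 * (norm q ^ l * exp R)" by linarith
    qed
    then show ?thesis by (simp add: mult_ac)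
  qed
  show ?thesis
  proof
    show "H holomorphic_on ball 0 R"
    proof (rule holomorphic_uniform_sequence)
      fix n
      show "(\<lambda>z. \<Sum>l<n. ell_term q (l + L) z) holomorphic_on ball 0 R"
      proof (intro holomorphic_on_sum analytic_imp_holomorphic)
        fix l
        have "(\<lambda>w. ell_term q (l + L) w) analytic_on {z}" if z: "z \<in> ball 0 R" for z
        proof -
          have "q ^ (l + L + i) * exp (s * z) \<noteq> 1" if "norm s = 1" for i and s :: complex
          proof
            assume "q ^ (l + L + i) * exp (s * z) = 1"
            then have "1 \<le> norm q ^ (l + L + i) * exp R" using small[OF z that, of "l + L + i"] by simp
            moreover have "norm q ^ (l + L + i) * exp R < 1 / 2" by (rule L) simp
            ultimately show False by linarith
          qed
          from this[of 1 0] this[of "- 1" 1] show ?thesis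
            unfolding ell_term_def by (intro analytic_on_add analytic_geo2_exp) simp_all
        qed
        then show "ell_term q (l + L) analytic_on ball 0 R" using analytic_on_analytic_at by blast
      qed
    next
      fix x assume "x \<in> ball (0 :: complex) R"
      then obtain d where d: "d > 0" "cball x d \<subseteq> ball 0 R" using open_contains_cball open_ball by blast
      have "uniform_limit (cball x d) (\<lambda>n z. \<Sum>l<n. ell_term q (l + L) z) (\<lambda>z. suminf (\<lambda>l. ell_term q (l + L) z)) sequentially"
      proof (rule Weierstrass_m_test)
        show "norm (ell_term q (l + L) z) \<le> 8 * exp R * norm q ^ l" if "z \<in> cball x d" for l z
          using that d(2) by (intro term_bound) auto
        show "summable (\<lambda>l. 8 * exp R * norm q ^ l)" using q by (intro summable_mult summable_geometric) auto
      qed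
      with d show "\<exists>d>0. cball x d \<subseteq> ball 0 R \<and> uniform_limit (cball x d) (\<lambda>n z. \<Sum>l<n. ell_term q (l + L) z) H sequentially"
        unfolding H_def by blast
    qed simp
    show "ell_S q z = (\<Sum>l<L. ell_term q l z) + H z" for z
    proof -
      have "ell_S q z = suminf (\<lambda>l. ell_term q l z)" by (simp add: ell_S_def ell_term_def)
      also have "\<dots> = H z + (\<Sum>l<L. ell_term q l z)"
        unfolding H_def by (rule suminf_split_initial_segment[OF sum])
      finally show ?thesis by simp
    qed
  qed
qed

lemma meromorphic_ell_S:
  assumes q: "norm q < 1"
  shows "ell_S q meromorphic_on UNIV"
proof -
  have "ell_S q meromorphic_on {z}" for z
  proof -
    obtain L H where LH: "H holomorphic_on ball 0 (norm z + 1)"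
      "\<And>w. w \<in> ball 0 (norm z + 1) \<Longrightarrow> ell_S q w = (\<Sum>l<L. ell_term q l w) + H w"
      using ell_S_split[OF q] by metis
    have z: "z \<in> ball 0 (norm z + 1)" by simp
    have "ell_term q l meromorphic_on {z}" for l
      unfolding ell_term_def
      by (intro meromorphic_on_add meromorphic_on_subset[OF meromorphic_geo2_exp]) auto
    moreover have "H meromorphic_on {z}"
    proof -
      have "H analytic_on {z}" using LH(1) z analytic_at by blast
      then show ?thesis by (rule analytic_on_imp_meromorphic_on)
    qed
    ultimately have "(\<lambda>w. (\<Sum>l<L. ell_term q l w) + H w) meromorphic_on {z}" by (intro meromorphic_intros)
    moreover have "\<forall>\<^sub>F w in nhds z. w \<in> ball 0 (norm z + 1)" using z by (intro eventually_nhds_in_open) auto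
    then have "\<forall>\<^sub>F w in at z. ell_S q w = (\<Sum>l<L. ell_term q l w) + H w"
      unfolding eventually_at_filter by eventually_elim (use LH(2) in auto)
    ultimately show ?thesis
      using meromorphic_on_cong[of "{z}" "ell_S q" "\<lambda>w. (\<Sum>l<L. ell_term q l w) + H w"] by auto
  qed
  then show ?thesis using meromorphic_on_meromorphic_at by blast
qed

lemma analytic_ell_S:
  assumes \<tau>: "Im \<tau> > 0" and z: "z \<notin> lattice \<tau>"
  shows "ell_S (nome \<tau>) analytic_on {z}"
proof -
  let ?q = "nome \<tau>"
  obtain L H where LH: "H holomorphic_on ball 0 (norm z + 1)"
    "\<And>w. w \<in> ball 0 (norm z + 1) \<Longrightarrow> ell_S ?q w = (\<Sum>l<L. ell_term ?q l w) + H w"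
    using ell_S_split[OF norm_nome_less_1[OF \<tau>]] by metis
  have zb: "z \<in> ball 0 (norm z + 1)" by simp
  have "ell_term ?q l analytic_on {z}" for l
  proof -
    have "?q ^ l * exp (1 * z) \<noteq> 1"
      using exp_eq_1_lattice[of \<tau> "int l" z] z by auto
    moreover have "?q ^ (l + 1) * exp (- 1 * z) \<noteq> 1"
      using exp_eq_1_lattice[of \<tau> "int (l + 1)" "- z"] z lattice_uminus[of "- z" \<tau>]
      by (auto simp only: power_int_of_nat mult_minus1 minus_minus)
    ultimately show ?thesis unfolding ell_term_def by (intro analytic_on_add analytic_geo2_exp)
  qed
  moreover have "H analytic_on {z}" using LH(1) zb analytic_at by blast
  ultimately have "(\<lambda>w. (\<Sum>l<L. ell_term ?q l w) + H w) analytic_on {z}" by (intro analytic_intros)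
  moreover have "\<forall>\<^sub>F w in nhds z. w \<in> ball 0 (norm z + 1)" using zb by (intro eventually_nhds_in_open) auto
  then have "\<forall>\<^sub>F w in nhds z. ell_S ?q w = (\<Sum>l<L. ell_term ?q l w) + H w"
    by eventually_elim (use LH(2) in auto)
  ultimately show ?thesis by (subst analytic_at_cong) auto
qed

lemma Re_lattice:
  assumes "z \<in> lattice \<tau>"
  shows "\<exists>k l::int. Re z = - 2 * pi * Im \<tau> * of_int l \<and> Im z = 2 * pi * (of_int k + of_int l * Re \<tau>)"
proof -
  obtain k l :: int where "z = 2 * of_real pi * \<i> * (of_int k + of_int l * \<tau>)" using assms by (auto simp: lattice_def)
  then show ?thesis by (intro exI[of _ k] exI[of _ l]) (auto simp: algebra_simps)
qed

lemma lattice_isolated: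
  assumes \<tau>: "Im \<tau> > 0"
  obtains r where "r > 0" "\<And>z. norm z < r \<Longrightarrow> z \<in> lattice \<tau> \<Longrightarrow> z = 0"
proof
  define r where "r = min (2 * pi * Im \<tau>) (2 * pi)"
  show "r > 0" using \<tau> by (simp add: r_def)
  fix z assume z: "norm z < r" "z \<in> lattice \<tau>"
  obtain k l :: int where kl: "z = 2 * of_real pi * \<i> * (of_int k + of_int l * \<tau>)" using z by (auto simp: lattice_def)
  have re: "Re z = - (2 * pi * Im \<tau>) * of_int l" by (simp add: kl)
  have "\<bar>Re z\<bar> < 2 * pi * Im \<tau>" using z abs_Re_le_cmod[of z] by (simp add: r_def)
  then have "\<bar>of_int l\<bar> * (2 * pi * Im \<tau>) < 1 * (2 * pi * Im \<tau>)" using \<tau> unfolding re abs_mult by (simp add: mult.commute)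
  then have "\<bar>of_int l :: real\<bar> < 1" by (rule mult_right_less_imp_less) (use \<tau> in simp)
  then have l: "l = 0" by linarith
  have im: "Im z = 2 * pi * of_int k" by (simp add: kl l)
  have "\<bar>Im z\<bar> < 2 * pi" using z abs_Im_le_cmod[of z] by (simp add: r_def)
  then have "\<bar>of_int k :: real\<bar> < 1" unfolding im by (simp add: abs_mult)
  then have "k = 0" by linarith
  with l kl show "z = 0" by simp
qed

text \<open>The Taylor coefficients at 0 of \<open>ell_P0\<close> plus the logarithm, which start in
  degree two.\<close>

definition pole_coeffs :: "complex \<Rightarrow> nat \<Rightarrow> complex" where
  "pole_coeffs \<tau> n = (if n < 2 then 0 else eisen n \<tau> / of_nat n)"

lemma diffs_diffs_pole_coeffs:
  "diffs (diffs (pole_coeffs \<tau>)) k = of_nat (k + 1) * eisen (k + 2) \<tau>"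
proof -
  have "(of_nat (k + 2) :: complex) \<noteq> 0" by (metis add_2_eq_Suc' of_nat_neq_0)
  then show ?thesis by (simp add: diffs_def pole_coeffs_def)
qed

lemma ell_P0_near_0:
  assumes \<tau>: "Im \<tau> > 0"
  obtains r where "r > 0"
    "\<And>w. norm w < r \<Longrightarrow> ell_P0 w \<tau> = - Ln w + suminf (\<lambda>n. pole_coeffs \<tau> n * w ^ n)"
    "\<And>w. norm w < r \<Longrightarrow> summable (\<lambda>n. pole_coeffs \<tau> n * w ^ n)"
    "\<And>w. norm w < r \<Longrightarrow> w \<noteq> 0 \<Longrightarrow> (\<lambda>k. of_nat (k + 1) * eisen (k + 2) \<tau> * w ^ k) sums (ell_S (nome \<tau>) w - 1 / w ^ 2)"
proof -
  let ?q = "nome \<tau>"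
  note q = norm_nome_less_1[OF \<tau>]
  obtain r1 where r1: "r1 > 0" "\<And>w. norm w < r1 \<Longrightarrow> w \<noteq> 0 \<Longrightarrow>
    (\<lambda>k. - of_nat (k + 1) * fps_nth bern_fps (k + 2) * w ^ k) sums (geo2 (exp w) - 1 / w ^ 2)"
    using sums_geo2_exp by blast
  \<comment> \<open>The second bound amounts to |q| e^|w| < 1, the range of the expansion in divisor
    sums.\<close>
  define r where "r = min r1 (2 * pi * Im \<tau>)"
  have r: "r > 0" using r1 \<tau> by (simp add: r_def)
  have S: "(\<lambda>k. of_nat (k + 1) * eisen (k + 2) \<tau> * w ^ k) sums (ell_S ?q w - 1 / w ^ 2)"
    if w: "norm w < r" "w \<noteq> 0" for w
  proof -
    have n1: "norm ?q * exp (norm w) < 1"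
    proof -
      have "norm ?q * exp (norm w) = exp (norm w - 2 * pi * Im \<tau>)" by (simp add: norm_nome exp_diff exp_minus field_simps)
      also have "\<dots> < 1" using w by (simp add: r_def)
      finally show ?thesis .
    qed
    have nw: "norm (?q * exp w) < 1" "norm (?q * exp (- w)) < 1"
    proof -
      have "norm (exp w) \<le> exp (norm w)" "norm (exp (- w)) \<le> exp (norm w)"
        using norm_exp[of w] norm_exp[of "- w"] by auto
      then have "norm ?q * norm (exp w) \<le> norm ?q * exp (norm w)" "norm ?q * norm (exp (- w)) \<le> norm ?q * exp (norm w)"
        by (intro mult_left_mono; simp)+
      then show "norm (?q * exp w) < 1" "norm (?q * exp (- w)) < 1" using n1 by (simp_all only: norm_mult)
    qed
    have "(\<lambda>k. - of_nat (k + 1) * fps_nth bern_fps (k + 2) * w ^ k + (if even k then 2 / fact k * sigma_series ?q (k + 1) else 0) * w ^ k)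
      sums (geo2 (exp w) - 1 / w ^ 2 + (lambert_series ?q 0 (?q * exp w) + lambert_series ?q 0 (?q * exp (- w))))"
      using w by (intro sums_add r1(2) has_sum_imp_sums[OF has_sum_sigma_series[OF q n1]]) (auto simp: r_def)
    also have "geo2 (exp w) - 1 / w ^ 2 + (lambert_series ?q 0 (?q * exp w) + lambert_series ?q 0 (?q * exp (- w))) = ell_S ?q w - 1 / w ^ 2"
      by (simp add: ell_S_near_0[OF q nw])
    also have "(\<lambda>k. - of_nat (k + 1) * fps_nth bern_fps (k + 2) * w ^ k + (if even k then 2 / fact k * sigma_series ?q (k + 1) else 0) * w ^ k) =
      (\<lambda>k. of_nat (k + 1) * eisen (k + 2) \<tau> * w ^ k)"
    proof
      fix k :: nat
      have ne: "(of_nat (k + 1) :: complex) \<noteq> 0" by (metis Suc_eq_plus1 of_nat_neq_0)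
      have "(2 :: complex) / fact k = of_nat (k + 1) * (2 / fact (k + 1))"
      proof -
        have "2 / F = N * (2 / (N * F))" if "N \<noteq> 0" for N F :: complex using that by simp
        from this[OF ne, of "fact k"] show ?thesis by simp
      qed
      then show "- of_nat (k + 1) * fps_nth bern_fps (k + 2) * w ^ k + (if even k then 2 / fact k * sigma_series ?q (k + 1) else 0) * w ^ k =
         of_nat (k + 1) * eisen (k + 2) \<tau> * w ^ k"
        by (simp add: eisen_eq algebra_simps add_divide_distrib)
    qed
    finally show ?thesis .
  qed
  \<comment> \<open>Convergence is carried back from the twice differentiated series, whose
    coefficients are at least as large in absolute value.\<close>
  have summ: "summable (\<lambda>n. pole_coeffs \<tau> n * w ^ n)" if w: "norm w < r" for w
  proof -
    obtain t where t: "norm w < t" "t < r" using w dense by blast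
    have t0: "t > 0" using t norm_ge_zero[of w] by linarith
    have "summable (\<lambda>k. of_nat (k + 1) * eisen (k + 2) \<tau> * of_real t ^ k)"
      using S[of "of_real t"] t t0 by (auto intro: sums_summable)
    then have "summable (\<lambda>k. norm (of_nat (k + 1) * eisen (k + 2) \<tau> * w ^ k))"
      by (rule powser_insidea) (use t t0 in simp)
    then have "summable (\<lambda>k. norm w ^ 2 * norm (of_nat (k + 1) * eisen (k + 2) \<tau> * w ^ k))"
      by (rule summable_mult)
    moreover have "norm (pole_coeffs \<tau> (k + 2) * w ^ (k + 2)) \<le> norm w ^ 2 * norm (of_nat (k + 1) * eisen (k + 2) \<tau> * w ^ k)" for k
    proof -
      have "norm (eisen (k + 2) \<tau>) / real (k + 2) \<le> real (k + 1) * norm (eisen (k + 2) \<tau>)"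
      proof -
        have "norm (eisen (k + 2) \<tau>) / real (k + 2) \<le> norm (eisen (k + 2) \<tau>) / 1"
          by (intro divide_left_mono) auto
        also have "\<dots> \<le> real (k + 1) * norm (eisen (k + 2) \<tau>)"
          using mult_right_mono[of 1 "real (k + 1)" "norm (eisen (k + 2) \<tau>)"] by simp
        finally show ?thesis .
      qed
      then have "norm (eisen (k + 2) \<tau>) / real (k + 2) * norm w ^ (k + 2) \<le> real (k + 1) * norm (eisen (k + 2) \<tau>) * norm w ^ (k + 2)"
        by (intro mult_right_mono) auto
      moreover have "norm (pole_coeffs \<tau> (k + 2) * w ^ (k + 2)) = norm (eisen (k + 2) \<tau>) / real (k + 2) * norm w ^ (k + 2)"
      proof -
        have "pole_coeffs \<tau> (k + 2) = eisen (k + 2) \<tau> / of_nat (k + 2)" by (simp add: pole_coeffs_def)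
        then show ?thesis by (simp only: norm_mult norm_divide norm_power norm_of_nat)
      qed
      moreover have "norm w ^ 2 * norm (of_nat (k + 1) * eisen (k + 2) \<tau> * w ^ k) = real (k + 1) * norm (eisen (k + 2) \<tau>) * norm w ^ (k + 2)"
        by (simp only: norm_mult norm_power norm_of_nat power_add mult_ac)
      ultimately show ?thesis by linarith
    qed
    ultimately have "summable (\<lambda>k. pole_coeffs \<tau> (k + 2) * w ^ (k + 2))"
      by (rule summable_comparison_test'[of _ 0])
    then show ?thesis by (subst (asm) summable_iff_shift)
  qed
  have P0: "ell_P0 w \<tau> = - Ln w + suminf (\<lambda>n. pole_coeffs \<tau> n * w ^ n)" if "norm w < r" for w
  proof -
    have "suminf (\<lambda>n. pole_coeffs \<tau> n * w ^ n) = suminf (\<lambda>n. pole_coeffs \<tau> (n + 2) * w ^ (n + 2)) + (\<Sum>n<2. pole_coeffs \<tau> n * w ^ n)"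
      by (rule suminf_split_initial_segment[OF summ[OF that]])
    also have "(\<Sum>n<2. pole_coeffs \<tau> n * w ^ n) = 0" by (simp add: pole_coeffs_def)
    finally show ?thesis by (simp add: ell_P0_def pole_coeffs_def)
  qed
  show ?thesis using that[OF r P0 summ S] by blast
qed

text \<open>
  The candidate for \<open>ell_P n\<close>; \<open>remove_sings\<close> gives it the value \<open>0\<close> at its poles.
\<close>

definition ell_Q :: "nat \<Rightarrow> complex \<Rightarrow> complex \<Rightarrow> complex" where
  "ell_Q n \<tau> = remove_sings (\<lambda>z. (- 1) ^ n / fact (n - 1) * (deriv ^^ (n - 2)) (ell_S (nome \<tau>)) z)"

text \<open>Two termwise differentiations off the cut: the logarithm yields 1 / w^2, exactly the
  pole that was separated from \<open>ell_S\<close>.\<close>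

lemma higher_deriv_ell_P0:
  assumes \<tau>: "Im \<tau> > 0" and n: "n \<ge> 2"
  shows "\<forall>\<^sub>F w in at 0. w \<notin> \<real>\<^sub>\<le>\<^sub>0 \<longrightarrow> (deriv ^^ n) (\<lambda>x. ell_P0 x \<tau>) w = (deriv ^^ (n - 2)) (ell_S (nome \<tau>)) w"
proof -
  obtain r where r: "r > 0"
    "\<And>w. norm w < r \<Longrightarrow> ell_P0 w \<tau> = - Ln w + suminf (\<lambda>n. pole_coeffs \<tau> n * w ^ n)"
    "\<And>w. norm w < r \<Longrightarrow> summable (\<lambda>n. pole_coeffs \<tau> n * w ^ n)"
    "\<And>w. norm w < r \<Longrightarrow> w \<noteq> 0 \<Longrightarrow> (\<lambda>k. of_nat (k + 1) * eisen (k + 2) \<tau> * w ^ k) sums (ell_S (nome \<tau>) w - 1 / w ^ 2)"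
    using ell_P0_near_0[OF \<tau>] by blast
  let ?U = "ball 0 r - \<real>\<^sub>\<le>\<^sub>0 :: complex set"
  have U: "open ?U" by (intro open_Diff closed_nonpos_Reals_complex) simp
  let ?H' = "\<lambda>w. suminf (\<lambda>n. diffs (pole_coeffs \<tau>) n * w ^ n)"
  have s': "summable (\<lambda>n. diffs (pole_coeffs \<tau>) n * w ^ n)" if "norm w < r" for w
    using termdiff_converges[OF that, of "pole_coeffs \<tau>"] r(3) by blast
  have d1: "((\<lambda>x. ell_P0 x \<tau>) has_field_derivative - (1 / w) + ?H' w) (at w)" if w: "w \<in> ?U" for w
  proof -
    have "((\<lambda>w. suminf (\<lambda>n. pole_coeffs \<tau> n * w ^ n)) has_field_derivative ?H' w) (at w)"
      by (rule termdiffs_strong'[of r]) (use r w in auto)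
    moreover have "((\<lambda>w. - Ln w) has_field_derivative - (1 / w)) (at w)"
      using w by (auto intro!: derivative_eq_intros simp: inverse_eq_divide)
    ultimately have "((\<lambda>w. - Ln w + suminf (\<lambda>n. pole_coeffs \<tau> n * w ^ n)) has_field_derivative - (1 / w) + ?H' w) (at w)"
      by (rule DERIV_add[rotated])
    then show ?thesis
      by (rule has_field_derivative_transform_within_open[OF _ U w]) (use r(2) in auto)
  qed
  have d2: "((\<lambda>w. - (1 / w) + ?H' w) has_field_derivative ell_S (nome \<tau>) w) (at w)" if w: "w \<in> ?U" for w
  proof -
    have w0: "w \<noteq> 0" using w by auto
    have "(?H' has_field_derivative suminf (\<lambda>n. diffs (diffs (pole_coeffs \<tau>)) n * w ^ n)) (at w)"
      by (rule termdiffs_strong'[of r]) (use s' w in auto)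
    moreover have "suminf (\<lambda>n. diffs (diffs (pole_coeffs \<tau>)) n * w ^ n) = ell_S (nome \<tau>) w - 1 / w ^ 2"
      unfolding diffs_diffs_pole_coeffs using r(4)[of w] w w0 by (intro sums_unique[symmetric]) auto
    moreover have "((\<lambda>w. - (1 / w)) has_field_derivative 1 / w ^ 2) (at w)"
      using w0 by (auto intro!: derivative_eq_intros simp: power2_eq_square)
    ultimately have "((\<lambda>w. - (1 / w) + ?H' w) has_field_derivative 1 / w ^ 2 + (ell_S (nome \<tau>) w - 1 / w ^ 2)) (at w)"
      using DERIV_add by metis
    then show ?thesis by simp
  qed
  have e1: "deriv (\<lambda>x. ell_P0 x \<tau>) w = - (1 / w) + ?H' w" if "w \<in> ?U" for w
    using d1[OF that] by (rule DERIV_imp_deriv)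
  have e2: "(deriv ^^ 2) (\<lambda>x. ell_P0 x \<tau>) w = ell_S (nome \<tau>) w" if w: "w \<in> ?U" for w
  proof -
    have "(deriv (\<lambda>x. ell_P0 x \<tau>) has_field_derivative ell_S (nome \<tau>) w) (at w)"
      by (rule has_field_derivative_transform_within_open[OF d2[OF w] U w]) (use e1 in auto)
    then show ?thesis by (simp add: numeral_2_eq_2 DERIV_imp_deriv)
  qed
  have e: "(deriv ^^ n) (\<lambda>x. ell_P0 x \<tau>) w = (deriv ^^ (n - 2)) (ell_S (nome \<tau>)) w" if w: "w \<in> ?U" for w
  proof -
    have "n = (n - 2) + 2" using n by simp
    then have "(deriv ^^ n) (\<lambda>x. ell_P0 x \<tau>) = (deriv ^^ (n - 2)) ((deriv ^^ 2) (\<lambda>x. ell_P0 x \<tau>))"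
      by (metis funpow_add comp_apply)
    moreover have "\<forall>\<^sub>F x in nhds w. (deriv ^^ 2) (\<lambda>x. ell_P0 x \<tau>) x = ell_S (nome \<tau>) x"
      using eventually_nhds_in_open[OF U w] by eventually_elim (rule e2)
    then have "(deriv ^^ (n - 2)) ((deriv ^^ 2) (\<lambda>x. ell_P0 x \<tau>)) w = (deriv ^^ (n - 2)) (ell_S (nome \<tau>)) w"
      by (intro higher_deriv_cong_ev refl)
    ultimately show ?thesis by simp
  qed
  have "\<forall>\<^sub>F w in nhds (0::complex). w \<in> ball 0 r" using r by (intro eventually_nhds_in_open) auto
  then show ?thesis unfolding eventually_at_filter by eventually_elim (use e in auto)
qed

lemma meromorphic_ell_Q_aux:
  assumes "Im \<tau> > 0"
  shows "(\<lambda>z. (- 1) ^ n / fact (n - 1) * (deriv ^^ (n - 2)) (ell_S (nome \<tau>)) z) meromorphic_on A"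
  by (intro meromorphic_on_mult meromorphic_on_const meromorphic_on_higher_deriv
      meromorphic_on_subset[OF meromorphic_ell_S[OF norm_nome_less_1[OF assms]]]) auto

lemma ell_Q_eq:
  assumes \<tau>: "Im \<tau> > 0" and z: "z \<notin> lattice \<tau>"
  shows "ell_Q n \<tau> z = (- 1) ^ n / fact (n - 1) * (deriv ^^ (n - 2)) (ell_S (nome \<tau>)) z"
proof -
  have "(\<lambda>z. (- 1) ^ n / fact (n - 1) * (deriv ^^ (n - 2)) (ell_S (nome \<tau>)) z) analytic_on {z}"
    by (intro analytic_intros analytic_higher_deriv analytic_ell_S assms)
  then show ?thesis unfolding ell_Q_def by (rule remove_sings_at_analytic)
qed

text \<open>The positive reals approach 0 off the cut, so a condition imposed only there still
  reaches the identity theorem.\<close>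

lemma frequently_at_0_off_cut:
  assumes "\<forall>\<^sub>F w in at (0::complex). w \<notin> \<real>\<^sub>\<le>\<^sub>0 \<longrightarrow> P w"
  shows "\<exists>\<^sub>F w in at 0. P w"
proof -
  obtain d where d: "d > 0" "\<And>w. w \<noteq> 0 \<Longrightarrow> dist w 0 < d \<Longrightarrow> w \<notin> \<real>\<^sub>\<le>\<^sub>0 \<Longrightarrow> P w"
    using assms unfolding eventually_at by auto
  show ?thesis unfolding frequently_at
  proof (intro allI impI)
    fix e :: real assume "e > 0"
    define t where "t = min d e / 2"
    have "t > 0" "t < d" "t < e" using d \<open>e > 0\<close> by (auto simp: t_def min_def)
    then show "\<exists>w\<in>UNIV. w \<noteq> 0 \<and> dist w 0 < e \<and> P w"
      using d(2)[of "of_real t"] by (intro bexI[of _ "of_real t"]) (auto simp: complex_nonpos_Reals_iff)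
  qed
qed

text \<open>The difference, with its removable singularities removed, vanishes identically. The
  values themselves agree because a nicely meromorphic function is continuous off its poles and 0 at
  them.\<close>

lemma nicely_meromorphic_unique:
  assumes f: "f nicely_meromorphic_on UNIV" and g: "g nicely_meromorphic_on UNIV"
    and eq: "\<exists>\<^sub>F w in at z0. f w = g w"
  shows "f = g"
proof -
  define h where "h = remove_sings (\<lambda>w. f w - g w)"
  have mf: "f meromorphic_on UNIV" and mg: "g meromorphic_on UNIV" using f g by (simp_all add: nicely_meromorphic_on_def)
  have md: "(\<lambda>w. f w - g w) meromorphic_on UNIV" by (intro meromorphic_intros mf mg)
  have nh: "h nicely_meromorphic_on UNIV" unfolding h_def by (rule remove_sings_nicely_meromorphic[OF md])
  have ev: "\<forall>\<^sub>F w in at z. h w = f w - g w" for z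
    unfolding h_def by (intro eventually_remove_sings_eq_at meromorphic_on_isolated_singularity meromorphic_on_subset[OF md]) auto
  have "\<exists>\<^sub>F w in at z0. h w = 0"
    using frequently_eventually_frequently[OF eq ev[of z0]] by (rule frequently_mono[rotated]) auto
  then have h0: "h z = 0" for z
    using frequently_eq_meromorphic_imp_constant[OF _ nh open_UNIV connected_UNIV] by blast
  have evfg: "\<forall>\<^sub>F w in at z. f w = g w" for z using ev[of z] by eventually_elim (simp add: h0)
  show "f = g"
  proof
    fix z
    have fz: "is_pole f z \<and> f z = 0 \<or> f \<midarrow>z\<rightarrow> f z" and gz: "is_pole g z \<and> g z = 0 \<or> g \<midarrow>z\<rightarrow> g z"
      using f g by (auto simp: nicely_meromorphic_on_def)
    have pole: "is_pole f z \<longleftrightarrow> is_pole g z" using evfg by (intro is_pole_cong) auto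
    show "f z = g z"
    proof (cases "is_pole f z")
      case True
      then have "\<not> f \<midarrow>z\<rightarrow> f z" "\<not> g \<midarrow>z\<rightarrow> g z" using pole not_tendsto_and_filterlim_at_infinity[of "at z"]
        by (auto simp: is_pole_def)
      then show ?thesis using fz gz by auto
    next
      case False
      then have "f \<midarrow>z\<rightarrow> f z" "g \<midarrow>z\<rightarrow> g z" using fz gz pole by auto
      moreover have "f \<midarrow>z\<rightarrow> g z" using tendsto_cong[OF evfg] \<open>g \<midarrow>z\<rightarrow> g z\<close> by blast
      ultimately show ?thesis using LIM_unique by blast
    qed
  qed
qed

theorem ell_P_eq_ell_Q:
  assumes \<tau>: "Im \<tau> > 0" and n: "n \<ge> 2"
  shows "ell_P n z \<tau> = ell_Q n \<tau> z"
proof -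
  obtain r where r: "r > 0" "\<And>z. norm z < r \<Longrightarrow> z \<in> lattice \<tau> \<Longrightarrow> z = 0" using lattice_isolated[OF \<tau>] by blast
  let ?ok = "\<lambda>f. f nicely_meromorphic_on UNIV \<and>
        (\<forall>\<^sub>F w in at 0. w \<notin> \<real>\<^sub>\<le>\<^sub>0 \<longrightarrow>
           f w = (-1) ^ n / fact (n - 1) * (deriv ^^ n) (\<lambda>x. ell_P0 x \<tau>) w)"
  have "(THE f. ?ok f) = ell_Q n \<tau>"
  proof (rule the_equality)
    have ev: "\<forall>\<^sub>F w in at 0. w \<notin> lattice \<tau>"
      unfolding eventually_at using r by (intro exI[of _ r]) auto
    have "\<forall>\<^sub>F w in at 0. w \<notin> \<real>\<^sub>\<le>\<^sub>0 \<longrightarrow> ell_Q n \<tau> w = (-1) ^ n / fact (n - 1) * (deriv ^^ n) (\<lambda>x. ell_P0 x \<tau>) w"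
      using ev higher_deriv_ell_P0[OF \<tau> n] by eventually_elim (simp add: ell_Q_eq[OF \<tau>])
    moreover have "ell_Q n \<tau> nicely_meromorphic_on UNIV"
      unfolding ell_Q_def by (rule remove_sings_nicely_meromorphic[OF meromorphic_ell_Q_aux[OF \<tau>]])
    ultimately show ok: "?ok (ell_Q n \<tau>)" by blast
    fix f assume f: "?ok f"
    have "\<forall>\<^sub>F w in at 0. w \<notin> \<real>\<^sub>\<le>\<^sub>0 \<longrightarrow> f w = ell_Q n \<tau> w"
      using conjunct2[OF f] conjunct2[OF ok] by eventually_elim auto
    then show "f = ell_Q n \<tau>"
      using f ok by (intro nicely_meromorphic_unique[OF _ _ frequently_at_0_off_cut]) auto
  qed
  then show ?thesis by (simp add: ell_P_def)
qed

lemma ell_P_eq: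
  assumes "Im \<tau> > 0" "n \<ge> 2" "z \<notin> lattice \<tau>"
  shows "ell_P n z \<tau> = (- 1) ^ n / fact (n - 1) * (deriv ^^ (n - 2)) (ell_S (nome \<tau>)) z"
  using assms by (simp add: ell_P_eq_ell_Q ell_Q_eq)

lemma ell_P_meromorphic:
  assumes \<tau>: "Im \<tau> > 0" and n: "n \<ge> 2"
  shows "(\<lambda>z. ell_P n z \<tau>) meromorphic_on UNIV"
  unfolding ell_P_eq_ell_Q[OF assms] ell_Q_def[abs_def]
  using remove_sings_nicely_meromorphic[OF meromorphic_ell_Q_aux[OF \<tau>, of n UNIV]]
  by (simp only: nicely_meromorphic_on_def)

lemma ell_P_analytic:
  assumes \<tau>: "Im \<tau> > 0" and n: "n \<ge> 2" and z: "z \<notin> lattice \<tau>"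
  shows "(\<lambda>z. ell_P n z \<tau>) analytic_on {z}"
proof -
  have an: "(\<lambda>z. (- 1) ^ n / fact (n - 1) * (deriv ^^ (n - 2)) (ell_S (nome \<tau>)) z) analytic_on {z}"
    by (intro analytic_intros analytic_higher_deriv analytic_ell_S \<tau> z)
  then have "ell_Q n \<tau> analytic_on {z}"
    unfolding ell_Q_def using analytic_at_cong[OF eventually_remove_sings_eq_nhds[OF an] refl] by blast
  then show ?thesis by (simp only: ell_P_eq_ell_Q[OF \<tau> n])
qed

text \<open>\<open>ell_S\<close> is even, and n - 2 derivatives introduce the sign (-1)^n.\<close>

lemma ell_P_minus:
  assumes \<tau>: "Im \<tau> > 0" and n: "n \<ge> 2" and z: "z \<notin> lattice \<tau>"
  shows "ell_P n (- z) \<tau> = (- 1) ^ n * ell_P n z \<tau>"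
proof -
  have "ell_S (nome \<tau>) analytic_on {- z}" using analytic_ell_S[OF \<tau>] z lattice_uminus[of "- z" \<tau>] by auto
  then obtain T where T: "open T" "- z \<in> T" "ell_S (nome \<tau>) holomorphic_on T" using analytic_at by blast
  have "open (uminus ` T)" using T(1) by (rule open_negations)
  have "(deriv ^^ (n - 2)) (\<lambda>w. ell_S (nome \<tau>) (- 1 * w)) z = (- 1) ^ (n - 2) * (deriv ^^ (n - 2)) (ell_S (nome \<tau>)) (- 1 * z)"
    by (rule higher_deriv_compose_linear[OF T(3) \<open>open (uminus ` T)\<close> T(1)]) (use T(2) in \<open>auto intro: image_eqI[of _ _ "- z"]\<close>)
  moreover have "(\<lambda>w. ell_S (nome \<tau>) (- 1 * w)) = ell_S (nome \<tau>)"
    using ell_S_minus[OF norm_nome_less_1[OF \<tau>]] by simp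
  ultimately have e: "(deriv ^^ (n - 2)) (ell_S (nome \<tau>)) z = (- 1) ^ (n - 2) * (deriv ^^ (n - 2)) (ell_S (nome \<tau>)) (- z)" by simp
  have z': "- z \<notin> lattice \<tau>" using z lattice_uminus[of "- z" \<tau>] by auto
  have p: "(- 1 :: complex) ^ n = (- 1) ^ (n - 2)" using n by (metis (no_types, lifting) le_add_diff_inverse2 mult_1_right power2_minus power_add power_one)
  have "(- 1 :: complex) ^ (n - 2) * (- 1) ^ (n - 2) = 1" by (simp flip: power_mult_distrib)
  then show ?thesis
    unfolding ell_P_eq[OF \<tau> n z] ell_P_eq[OF \<tau> n z'] e p by (simp add: mult_ac)
qed

subsection \<open>Pairings\<close>

lemma finite_fpf_involutions: "finite A \<Longrightarrow> finite (fpf_involutions A)"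
  unfolding fpf_involutions_def by (rule finite_subset[OF _ finite_permutations]) auto

lemma fpf_involutions_empty: "fpf_involutions {} = {id}"
  by (auto simp: fpf_involutions_def permutes_def)

lemma fpf_involutionsD:
  assumes "\<phi> \<in> fpf_involutions A"
  shows "\<phi> (\<phi> x) = x" "x \<in> A \<Longrightarrow> \<phi> x \<in> A" "x \<in> A \<Longrightarrow> \<phi> x \<noteq> x" "x \<notin> A \<Longrightarrow> \<phi> x = x"
  using assms by (auto simp: fpf_involutions_def fun_eq_iff permutes_in_image permutes_not_in)

lemma fpf_involutionsI:
  assumes "\<And>x. \<phi> (\<phi> x) = x" "\<And>x. x \<in> A \<Longrightarrow> \<phi> x \<noteq> x" "\<And>x. x \<notin> A \<Longrightarrow> \<phi> x = x"
  shows "\<phi> \<in> fpf_involutions A"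
  unfolding fpf_involutions_def permutes_def using assms by (auto simp: fun_eq_iff) metis+

text \<open>The involution is determined by the partner y of x and by a fixed-point-free involution
  of the remaining elements.\<close>

lemma sum_fpf_involutions_insert:
  fixes G :: "('a \<Rightarrow> 'a) \<Rightarrow> 'c::comm_ring_1"
  assumes A: "finite A" and x: "x \<notin> A"
  shows "(\<Sum>\<phi>\<in>fpf_involutions (insert x A). G \<phi>) = (\<Sum>y\<in>A. \<Sum>\<psi>\<in>fpf_involutions (A - {y}). G (\<psi>(x := y, y := x)))"
proof -
  have "(\<Sum>y\<in>A. \<Sum>\<psi>\<in>fpf_involutions (A - {y}). G (\<psi>(x := y, y := x))) =
     (\<Sum>(y, \<psi>)\<in>Sigma A (\<lambda>y. fpf_involutions (A - {y})). G (\<psi>(x := y, y := x)))"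
    using A by (subst sum.Sigma) (auto intro: finite_fpf_involutions)
  also have "\<dots> = (\<Sum>\<phi>\<in>fpf_involutions (insert x A). G \<phi>)"
  \<comment> \<open>In the inverse direction x and its partner become fixed points, since a
    permutation of a set is the identity off that set.\<close>
  proof (rule sum.reindex_bij_witness[where i = "\<lambda>\<phi>. (\<phi> x, \<phi>(x := x, \<phi> x := \<phi> x))" and j = "\<lambda>(y, \<psi>). \<psi>(x := y, y := x)"], goal_cases)
    case (1 a)
    then obtain y \<psi> where a: "a = (y, \<psi>)" "y \<in> A" and \<psi>: "\<psi> \<in> fpf_involutions (A - {y})" by auto
    have "x \<noteq> y" using a x by auto
    have "\<psi> x = x" "\<psi> y = y" using fpf_involutionsD(4)[OF \<psi>] x by auto
    then show ?case using \<open>x \<noteq> y\<close> by (auto simp: a fun_eq_iff)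
  next
    case (2 a)
    then obtain y \<psi> where a: "a = (y, \<psi>)" "y \<in> A" and \<psi>: "\<psi> \<in> fpf_involutions (A - {y})" by auto
    have xy: "x \<noteq> y" using a x by auto
    note D = fpf_involutionsD[OF \<psi>]
    have fx: "\<psi> x = x" "\<psi> y = y" using D(4) x by auto
    have nx: "\<psi> z \<noteq> x" if "z \<noteq> x" for z using that D(1)[of z] fx by metis
    have ny: "\<psi> z \<noteq> y" if "z \<noteq> y" for z using that D(1)[of z] fx by metis
    show ?case unfolding a(1) prod.case
    proof (rule fpf_involutionsI)
      fix z
      show "(\<psi>(x := y, y := x)) ((\<psi>(x := y, y := x)) z) = z"
        using nx ny xy D(1) by auto
      show "(\<psi>(x := y, y := x)) z \<noteq> z" if "z \<in> insert x A" using that xy D(3) by auto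
      show "(\<psi>(x := y, y := x)) z = z" if "z \<notin> insert x A" using that xy D(4) a by auto
    qed
  next
    case (3 \<phi>)
    note D = fpf_involutionsD[OF 3]
    show ?case using D(1)[of x] D(3)[of x] by (auto simp: fun_eq_iff)
  next
    case (4 \<phi>)
    note D = fpf_involutionsD[OF 4]
    have y: "\<phi> x \<in> A" using D(2)[of x] D(3)[of x] by auto
    have "\<phi>(x := x, \<phi> x := \<phi> x) \<in> fpf_involutions (A - {\<phi> x})"
    proof (rule fpf_involutionsI)
      fix z
      have n: "\<phi> z \<noteq> x" if "z \<noteq> \<phi> x" using that D(1)[of z] by auto
      have n': "\<phi> z \<noteq> \<phi> x" if "z \<noteq> x" using that D(1)[of z] D(1)[of x] by metis
      show "(\<phi>(x := x, \<phi> x := \<phi> x)) ((\<phi>(x := x, \<phi> x := \<phi> x)) z) = z"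
        using n n' D(1) by auto
      show "(\<phi>(x := x, \<phi> x := \<phi> x)) z \<noteq> z" if "z \<in> A - {\<phi> x}" using that x D(3) by auto
      show "(\<phi>(x := x, \<phi> x := \<phi> x)) z = z" if "z \<notin> A - {\<phi> x}" using that D(4)[of z] by auto
    qed
    with y show ?case by simp
  next
    case (5 a)
    then show ?case by (auto simp: case_prod_unfold)
  qed
  finally show ?thesis by simp
qed

text \<open>The orbits of the extended involution are {x, y} and those of the remaining one. The
  ambient set \<open>X\<close> keeps the hypothesis on \<open>O'\<close> unchanged while the list
  shrinks.\<close>

lemma hafnian_fpf_involutions:
  fixes S :: "'a \<Rightarrow> 'a \<Rightarrow> 'c::comm_ring_1" and O' :: "'a set \<Rightarrow> 'c"
  assumes O': "\<And>x y. x \<in> X \<Longrightarrow> y \<in> X \<Longrightarrow> x \<noteq> y \<Longrightarrow> O' {x, y} = S x y"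
  shows "distinct xs \<Longrightarrow> set xs \<subseteq> X \<Longrightarrow>
    (\<Sum>\<phi>\<in>fpf_involutions (set xs). \<Prod>\<Xi>\<in>(\<lambda>x. {x, \<phi> x}) ` set xs. O' \<Xi>) = hafnian S xs"
proof (induction xs rule: length_induct)
  case (1 xs)
  show ?case
  proof (cases xs)
    case Nil
    then show ?thesis by (simp add: fpf_involutions_empty)
  next
    case (Cons x ys)
    have x: "x \<notin> set ys" and dist: "distinct ys" and sub: "x \<in> X" "set ys \<subseteq> X" using 1 Cons by auto
    have step: "(\<Sum>\<psi>\<in>fpf_involutions (set ys - {y}). \<Prod>\<Xi>\<in>(\<lambda>z. {z, (\<psi>(x := y, y := x)) z}) ` set xs. O' \<Xi>) = S x y * hafnian S (remove1 y ys)"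
      if y: "y \<in> set ys" for y
    proof -
      have set: "set (remove1 y ys) = set ys - {y}" using dist by simp
      have xy: "x \<noteq> y" using x y by auto
      have "(\<Prod>\<Xi>\<in>(\<lambda>z. {z, (\<psi>(x := y, y := x)) z}) ` set xs. O' \<Xi>) = S x y * (\<Prod>\<Xi>\<in>(\<lambda>z. {z, \<psi> z}) ` (set ys - {y}). O' \<Xi>)"
        if \<psi>: "\<psi> \<in> fpf_involutions (set ys - {y})" for \<psi>
      proof -
        have "(\<lambda>z. {z, (\<psi>(x := y, y := x)) z}) ` set xs = insert {x, y} ((\<lambda>z. {z, \<psi> z}) ` (set ys - {y}))"
        proof -
          define f where "f = \<psi>(x := y, y := x)"
          have f: "f x = y" "f y = x" using xy by (simp_all add: f_def)
          have "set xs = insert x (insert y (set ys - {y}))" using y by (auto simp: Cons)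
          moreover have "(\<lambda>z. {z, f z}) ` (set ys - {y}) = (\<lambda>z. {z, \<psi> z}) ` (set ys - {y})"
            using x by (intro image_cong refl) (auto simp: f_def)
          moreover have "{y, x} = {x, y}" by blast
          ultimately show ?thesis unfolding f_def[symmetric] by (simp only: image_insert f insert_absorb2)
        qed
        moreover have "{x, y} \<notin> (\<lambda>z. {z, \<psi> z}) ` (set ys - {y})"
        proof
          assume "{x, y} \<in> (\<lambda>z. {z, \<psi> z}) ` (set ys - {y})"
          then obtain z where "z \<in> set ys - {y}" "{x, y} = {z, \<psi> z}" by auto
          then show False using fpf_involutionsD(2)[OF \<psi>, of z] x by (auto simp: doubleton_eq_iff)
        qed
        ultimately show ?thesis using O'[of x y] sub y xy by auto
      qed
      then have "(\<Sum>\<psi>\<in>fpf_involutions (set ys - {y}). \<Prod>\<Xi>\<in>(\<lambda>z. {z, (\<psi>(x := y, y := x)) z}) ` set xs. O' \<Xi>) =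
         S x y * (\<Sum>\<psi>\<in>fpf_involutions (set (remove1 y ys)). \<Prod>\<Xi>\<in>(\<lambda>z. {z, \<psi> z}) ` set (remove1 y ys). O' \<Xi>)"
        unfolding set sum_distrib_left by (rule sum.cong[OF refl])
      also have "(\<Sum>\<psi>\<in>fpf_involutions (set (remove1 y ys)). \<Prod>\<Xi>\<in>(\<lambda>z. {z, \<psi> z}) ` set (remove1 y ys). O' \<Xi>) = hafnian S (remove1 y ys)"
      proof (rule 1(1)[rule_format])
        show "length (remove1 y ys) < length xs" using y by (simp add: Cons length_remove1)
        show "distinct (remove1 y ys)" using dist by simp
        show "set (remove1 y ys) \<subseteq> X" using sub(2) set by auto
      qed
      finally show ?thesis .
    qed
    have "(\<Sum>\<phi>\<in>fpf_involutions (set xs). \<Prod>\<Xi>\<in>(\<lambda>x. {x, \<phi> x}) ` set xs. O' \<Xi>) =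
      (\<Sum>y\<in>set ys. \<Sum>\<psi>\<in>fpf_involutions (set ys - {y}). \<Prod>\<Xi>\<in>(\<lambda>z. {z, (\<psi>(x := y, y := x)) z}) ` set xs. O' \<Xi>)"
      using sum_fpf_involutions_insert[OF _ x, of "\<lambda>\<phi>. \<Prod>\<Xi>\<in>(\<lambda>x. {x, \<phi> x}) ` set xs. O' \<Xi>"] by (simp add: Cons)
    also have "\<dots> = (\<Sum>y\<in>set ys. S x y * hafnian S (remove1 y ys))" by (intro sum.cong refl step)
    also have "\<dots> = hafnian S xs" by (simp add: Cons sum_list_distinct_conv_sum_set[OF dist])
    finally show ?thesis .
  qed
qed

subsection \<open>Uniqueness of the continuation\<close>

lemma config_iff: "z \<in> config n \<tau> \<longleftrightarrow> (\<forall>a\<in>{1..n}. \<forall>b\<in>{1..n}. a \<noteq> b \<longrightarrow> z a - z b \<notin> lattice \<tau>)"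
  unfolding config_def lattice_def by (simp only: mem_Collect_eq simp_thms)

lemma config_slice_eq:
  assumes i: "i \<in> {1..n}" and z: "z \<in> config n \<tau>"
  shows "{w. z(i := w) \<in> config n \<tau>} = - (\<Union>j\<in>{1..n} - {i}. (+) (z j) ` lattice \<tau>)"
proof (intro set_eqI iffI)
  fix w assume "w \<in> {w. z(i := w) \<in> config n \<tau>}"
  then have w: "z(i := w) \<in> config n \<tau>" by simp
  have "w \<notin> (+) (z j) ` lattice \<tau>" if j: "j \<in> {1..n} - {i}" for j
  proof
    assume "w \<in> (+) (z j) ` lattice \<tau>"
    then have "w - z j \<in> lattice \<tau>" by auto
    moreover have "(z(i := w)) i - (z(i := w)) j \<notin> lattice \<tau>"
      by (rule w[unfolded config_iff, rule_format]) (use i j in auto)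
    ultimately show False using j by simp
  qed
  then show "w \<in> - (\<Union>j\<in>{1..n} - {i}. (+) (z j) ` lattice \<tau>)" by blast
next
  fix w assume w: "w \<in> - (\<Union>j\<in>{1..n} - {i}. (+) (z j) ` lattice \<tau>)"
  have wj: "w - z j \<notin> lattice \<tau>" "z j - w \<notin> lattice \<tau>" if j: "j \<in> {1..n}" "j \<noteq> i" for j
  proof -
    show "w - z j \<notin> lattice \<tau>"
    proof
      assume "w - z j \<in> lattice \<tau>"
      then have "w \<in> (+) (z j) ` lattice \<tau>" by (intro image_eqI[of _ _ "w - z j"]) auto
      with w j show False by blast
    qed
    then show "z j - w \<notin> lattice \<tau>" using lattice_uminus[of "z j - w" \<tau>] by auto
  qed
  have "(z(i := w)) a - (z(i := w)) b \<notin> lattice \<tau>"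
    if ab: "a \<in> {1..n}" "b \<in> {1..n}" "a \<noteq> b" for a b
  proof -
    have "z a - z b \<notin> lattice \<tau>" by (rule z[unfolded config_iff, rule_format, OF ab])
    then show ?thesis using wj[of a] wj[of b] ab by (cases "a = i"; cases "b = i") auto
  qed
  then show "w \<in> {w. z(i := w) \<in> config n \<tau>}" by (simp only: config_iff mem_Collect_eq) blast
qed

lemma countable_lattice: "countable (lattice \<tau>)"
proof -
  have "lattice \<tau> = range (\<lambda>(k :: int, l :: int). 2 * of_real pi * \<i> * (of_int k + of_int l * \<tau>))"
    by (auto simp: lattice_def)
  then show ?thesis by simp
qed

lemma finite_lattice_ball:
  assumes \<tau>: "Im \<tau> > 0"
  shows "finite (lattice \<tau> \<inter> cball 0 C)"
proof -
  define Lb where "Lb = \<lceil>C / (2 * pi * Im \<tau>)\<rceil>"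
  define Kb where "Kb = \<lceil>C / (2 * pi) + of_int \<bar>Lb\<bar> * \<bar>Re \<tau>\<bar>\<rceil>"
  have "lattice \<tau> \<inter> cball 0 C \<subseteq> (\<lambda>(k, l). 2 * of_real pi * \<i> * (of_int k + of_int l * \<tau>)) ` ({- Kb..Kb} \<times> {- Lb..Lb})"
  proof
    fix v assume "v \<in> lattice \<tau> \<inter> cball 0 C"
    then have "v \<in> lattice \<tau>" and nv: "norm v \<le> C" by auto
    then obtain k l where v: "v = 2 * of_real pi * \<i> * (of_int k + of_int l * \<tau>)" unfolding lattice_def by blast
    have "Re v = - (2 * pi * Im \<tau>) * of_int l" by (simp add: v)
    then have "\<bar>of_int l\<bar> * (2 * pi * Im \<tau>) \<le> C" using abs_Re_le_cmod[of v] nv \<tau> by (simp add: abs_mult mult.commute)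
    then have "\<bar>of_int l\<bar> \<le> C / (2 * pi * Im \<tau>)" using \<tau> by (simp add: pos_le_divide_eq)
    then have l: "\<bar>l\<bar> \<le> Lb" unfolding Lb_def by linarith
    have "Im v = 2 * pi * (of_int k + of_int l * Re \<tau>)" by (simp add: v)
    then have "\<bar>of_int k + of_int l * Re \<tau>\<bar> * (2 * pi) \<le> C" using abs_Im_le_cmod[of v] nv by (simp add: abs_mult mult.commute)
    then have "\<bar>of_int k + of_int l * Re \<tau>\<bar> \<le> C / (2 * pi)" by (simp add: pos_le_divide_eq)
    moreover have "\<bar>of_int l * Re \<tau>\<bar> \<le> of_int \<bar>Lb\<bar> * \<bar>Re \<tau>\<bar>"
      unfolding abs_mult using l by (intro mult_right_mono) linarith+
    ultimately have "\<bar>of_int k\<bar> \<le> C / (2 * pi) + of_int \<bar>Lb\<bar> * \<bar>Re \<tau>\<bar>" by linarith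
    then have "\<bar>k\<bar> \<le> Kb" unfolding Kb_def by linarith
    with l show "v \<in> (\<lambda>(k, l). 2 * of_real pi * \<i> * (of_int k + of_int l * \<tau>)) ` ({- Kb..Kb} \<times> {- Lb..Lb})"
      unfolding v by (intro image_eqI[of _ _ "(k, l)"]) auto
  qed
  then show ?thesis by (rule finite_subset) auto
qed

text \<open>A limit point of the lattice would be a limit point of its finite part in a bounded
  ball.\<close>

lemma closed_lattice:
  assumes "Im \<tau> > 0"
  shows "closed (lattice \<tau>)"
  unfolding closed_limpt
proof (intro allI impI)
  fix x assume x: "x islimpt lattice \<tau>"
  have "x islimpt (lattice \<tau> \<inter> cball 0 (norm x + 1))"
    unfolding islimpt_approachable
  proof (intro allI impI)
    fix e :: real assume "e > 0"
    then obtain y where y: "y \<in> lattice \<tau>" "y \<noteq> x" "dist y x < min e 1"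
      using x unfolding islimpt_approachable by (metis min_less_iff_conj zero_less_one)
    have "norm y \<le> norm x + 1" using y(3) norm_triangle_ineq2[of y x] by (simp add: dist_norm)
    with y show "\<exists>x'\<in>lattice \<tau> \<inter> cball 0 (norm x + 1). x' \<noteq> x \<and> dist x' x < e" by (intro bexI[of _ y]) auto
  qed
  then show "x \<in> lattice \<tau>" using islimpt_finite[OF finite_lattice_ball[OF assms]] by blast
qed

text \<open>The excluded points form a closed countable set: closed, so the slice is open;
  countable, so the slice is connected and meets every nonempty open set.\<close>

lemma config_slice:
  assumes \<tau>: "Im \<tau> > 0" and i: "i \<in> {1..n}" and z: "z \<in> config n \<tau>"
  shows "open {w. z(i := w) \<in> config n \<tau>}" "connected {w. z(i := w) \<in> config n \<tau>}"
    "\<And>U. open U \<Longrightarrow> U \<noteq> {} \<Longrightarrow> U \<inter> {w. z(i := w) \<in> config n \<tau>} \<noteq> {}"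
proof -
  let ?P = "\<Union>j\<in>{1..n} - {i}. (+) (z j) ` lattice \<tau>"
  note eq = config_slice_eq[OF i z]
  have "closed ?P" by (intro closed_UN ballI) (use closed_translation[OF closed_lattice[OF \<tau>]] in auto)
  then show "open {w. z(i := w) \<in> config n \<tau>}" unfolding eq by (rule open_Compl)
  have c: "countable ?P" using countable_lattice by (intro countable_UN countable_image) auto
  have "connected (UNIV - ?P)"
    by (rule connected_open_diff_countable[OF _ _ _ c]) auto
  then show "connected {w. z(i := w) \<in> config n \<tau>}" unfolding eq Compl_eq_Diff_UNIV .
  fix U :: "complex set" assume U: "open U" "U \<noteq> {}"
  show "U \<inter> {w. z(i := w) \<in> config n \<tau>} \<noteq> {}"
  proof
    assume "U \<inter> {w. z(i := w) \<in> config n \<tau>} = {}"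
    then have "U \<subseteq> ?P" unfolding eq by blast
    then have "countable U" using c by (rule countable_subset)
    moreover obtain x where "x \<in> U" using U by blast
    then obtain e where "e > 0" "ball x e \<subseteq> U" using U(1) open_contains_ball by blast
    ultimately show False using uncountable_ball[of e x] countable_subset by blast
  qed
qed

lemma npoint_function_unique:
  assumes n: "1 \<le> n" and \<tau>: "Im \<tau> > 0"
    and F: "is_npoint_function n u \<tau> F" and G: "is_npoint_function n u \<tau> G"
    and z: "z \<in> config n \<tau>"
  shows "F z = G z"
proof -
  \<comment> \<open>The admissible range of the real parts, of length 2 pi Im \<tau>, is divided
    into n strips \<open>U i\<close> of width \<open>d\<close>, ordered from right to left. Points
    chosen from them satisfy all inequalities of the domain.\<close>
  define d where "d = 2 * pi * Im \<tau> / real n"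
  have d: "d > 0" using \<tau> n by (simp add: d_def)
  define U where "U = (\<lambda>i::nat. {w. - real i * d < Re w \<and> Re w < - (real i - 1) * d})"
  have Uo: "open (U i)" for i
    unfolding U_def by (intro open_Collect_conj open_halfspace_Re_gt open_halfspace_Re_lt)
  have Une: "U i \<noteq> {}" for i
  proof -
    have "of_real (- (real i - 1 / 2) * d) \<in> U i" using d by (simp add: U_def algebra_simps)
    then show ?thesis by blast
  qed
  have dom: "z \<in> trace_domain n \<tau>" if "\<And>i. i \<in> {1..n} \<Longrightarrow> z i \<in> U i" for z
  proof -
    have "norm (exp (z (Suc i))) < norm (exp (z i))" if i: "1 \<le> i" "i < n" for i
    proof -
      have "z (Suc i) \<in> U (Suc i)" "z i \<in> U i" using that(2) i \<open>\<And>i. i \<in> {1..n} \<Longrightarrow> z i \<in> U i\<close> by auto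
      then have "Re (z (Suc i)) < Re (z i)" by (auto simp: U_def)
      then show ?thesis by simp
    qed
    moreover have "norm (nome \<tau> * exp (z 1)) < norm (exp (z n))"
    proof -
      have "z 1 \<in> U 1" "z n \<in> U n" using that n by auto
      then have "Re (z 1) < 0" "- real n * d < Re (z n)" by (auto simp: U_def)
      moreover have "real n * d = 2 * pi * Im \<tau>" using n by (simp add: d_def)
      ultimately have "- 2 * pi * Im \<tau> + Re (z 1) < Re (z n)" by linarith
      then show ?thesis by (simp add: norm_mult norm_nome flip: exp_add)
    qed
    ultimately show ?thesis by (auto simp: trace_domain_def)
  qed
  \<comment> \<open>The first m variables are free already and the others still confined to their
    strips; the step continues analytically in the variable \<open>Suc m\<close>.\<close>
  have "\<forall>z\<in>config n \<tau>. (\<forall>i\<in>{1..n}. i > m \<longrightarrow> z i \<in> U i) \<longrightarrow> F z = G z" if "m \<le> n" for m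
    using that
  proof (induction m)
    case 0
    show ?case
    proof (intro ballI impI)
      fix z assume "z \<in> config n \<tau>" "\<forall>i\<in>{1..n}. 0 < i \<longrightarrow> z i \<in> U i"
      then have "z \<in> trace_domain n \<tau>" by (intro dom) auto
      then show "F z = G z" using F G unfolding is_npoint_function_def by (meson has_sum_unique)
    qed
  next
    case (Suc m)
    show ?case
    proof (intro ballI impI)
      fix z assume z: "z \<in> config n \<tau>" and zU: "\<forall>i\<in>{1..n}. Suc m < i \<longrightarrow> z i \<in> U i"
      let ?i = "Suc m"
      have i: "?i \<in> {1..n}" using Suc.prems by auto
      let ?D = "{w. z(?i := w) \<in> config n \<tau>}"
      note slice = config_slice[OF \<tau> i z]
      have hol: "(\<lambda>w. F (z(?i := w)) - G (z(?i := w))) holomorphic_on ?D"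
        using F G z i unfolding is_npoint_function_def by (intro holomorphic_on_diff) auto
      have zero: "F (z(?i := w)) - G (z(?i := w)) = 0" if w: "w \<in> U ?i \<inter> ?D" for w
      proof -
        have "\<forall>j\<in>{1..n}. m < j \<longrightarrow> (z(?i := w)) j \<in> U j" using w zU by auto
        then show ?thesis using Suc w by auto
      qed
      have ne: "U ?i \<inter> ?D \<noteq> {}" by (rule slice(3)[OF Uo Une])
      then obtain w0 where w0: "w0 \<in> U ?i \<inter> ?D" by blast
      have "z ?i \<in> ?D" using z by simp
      then have "F (z(?i := z ?i)) - G (z(?i := z ?i)) = 0"
        using analytic_continuation_open[of "U ?i \<inter> ?D" ?D "\<lambda>w. F (z(?i := w)) - G (z(?i := w))" "\<lambda>_. 0" "z ?i"]
          slice Uo ne hol zero by auto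
      then show "F z = G z" by simp
    qed
  qed
  from this[of n] show ?thesis using z by auto
qed

lemma npoint_function_eqI:
  assumes "1 \<le> n" "Im \<tau> > 0" "is_npoint_function n u \<tau> F" "z \<in> config n \<tau>"
  shows "npoint_function n u z \<tau> = F z"
proof -
  have "is_npoint_function n u \<tau> (SOME F. is_npoint_function n u \<tau> F)" by (rule someI[of "is_npoint_function n u \<tau>", OF assms(3)])
  from npoint_function_unique[OF assms(1,2) this assms(3,4)] show ?thesis by (simp add: npoint_function_def)
qed

subsection \<open>Evaluation of the propagators\<close>

lemma has_sum_propagator:
  assumes \<tau>: "Im \<tau> > 0" and z: "z \<in> trace_domain n \<tau>" and i: "i \<in> {1..n}" "i' \<in> {1..n}"
  shows "((\<lambda>l. mode_coeff (\<lambda>i. exp (z i)) i j l * mode_coeff (\<lambda>i. exp (z i)) i' j' (- l) * pair_weight (nome \<tau>) fst (i, j) (i', j') l)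
    has_sum propagator (nome \<tau>) (\<lambda>i. exp (z i)) (i, j) (i', j')) UNIV"
proof -
  have "(\<lambda>l. norm (mode_coeff (\<lambda>i. exp (z i)) i j l) * norm (mode_coeff (\<lambda>i. exp (z i)) i' j' (- l)) * norm (pair_weight (nome \<tau>) fst (i, j) (i', j') l)) summable_on UNIV"
  proof (rule summable_pair[OF nome_nz norm_nome_less_1[OF \<tau>] refl])
    show "norm (exp (z i')) < norm (exp (z i)) \<and> norm (nome \<tau>) * norm (exp (z i)) < norm (exp (z i'))" if "i < i'"
      using trace_domain_norms[OF z _ that] i by (simp only: atLeastAtMost_iff)
    show "norm (exp (z i)) < norm (exp (z i')) \<and> norm (nome \<tau>) * norm (exp (z i')) < norm (exp (z i))" if "i' < i"
      using trace_domain_norms[OF z _ that] i by (simp only: atLeastAtMost_iff)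
  qed simp_all
  then have "(\<lambda>l. mode_coeff (\<lambda>i. exp (z i)) i j l * mode_coeff (\<lambda>i. exp (z i)) i' j' (- l) * pair_weight (nome \<tau>) fst (i, j) (i', j') l) summable_on UNIV"
    by - (rule abs_summable_summable, simp add: norm_mult)
  then show ?thesis unfolding propagator_def by simp
qed

text \<open>\<open>sum_sq_coeff_gbinomial\<close> applies to both factors, whose modes are l and -l.
  The weight depends only on the parts, so the sums over j and j' separate.\<close>

lemma has_sum_sq_propagator:
  assumes \<tau>: "Im \<tau> > 0" and z: "z \<in> trace_domain n \<tau>" and i: "i \<in> {1..n}" "i' \<in> {1..n}" and m: "m \<ge> 1" "m' \<ge> 1"
  shows "((\<lambda>l. (of_int (- l) ^ (m - 1) / fact (m - 1) * (of_int l ^ (m' - 1) / fact (m' - 1))) * exp (- (z i - z i')) powi l *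
      pair_weight (nome \<tau>) fst (i, 0 :: nat) (i', 0) l)
    has_sum sq_propagator (propagator (nome \<tau>) (\<lambda>i. exp (z i))) i m i' m') UNIV"
proof -
  let ?x = "\<lambda>i. exp (z i)"
  let ?b = "\<lambda>m j. sq_coeff 1 (- int j - 1) (- int m)"
  have pw: "pair_weight (nome \<tau>) fst (i, j) (i', j') = pair_weight (nome \<tau>) fst (i, 0 :: nat) (i', 0)" for j j' :: nat
    by (auto simp: pair_weight_def fun_eq_iff)
  have "((\<lambda>l. \<Sum>j<m. \<Sum>j'<m'. ?b m j * ?b m' j' * (mode_coeff ?x i j l * mode_coeff ?x i' j' (- l) * pair_weight (nome \<tau>) fst (i, j) (i', j') l))
    has_sum sq_propagator (propagator (nome \<tau>) ?x) i m i' m') UNIV"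
    unfolding sq_propagator_def by (intro has_sum_sum has_sum_cmult_right has_sum_propagator[OF \<tau> z i])
  also have "(\<lambda>l. \<Sum>j<m. \<Sum>j'<m'. ?b m j * ?b m' j' * (mode_coeff ?x i j l * mode_coeff ?x i' j' (- l) * pair_weight (nome \<tau>) fst (i, j) (i', j') l)) =
    (\<lambda>l. (of_int (- l) ^ (m - 1) / fact (m - 1) * (of_int l ^ (m' - 1) / fact (m' - 1))) * exp (- (z i - z i')) powi l *
      pair_weight (nome \<tau>) fst (i, 0 :: nat) (i', 0) l)"
  proof
    fix l
    have A: "(\<Sum>j<m. ?b m j * mode_coeff ?x i j l) = of_int (- l) ^ (m - 1) / fact (m - 1) * ?x i powi (- l)"
      using sum_sq_coeff_gbinomial[OF m(1), of "of_int (- l - 1)"]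
      by (simp add: mode_coeff_def sum_distrib_right[symmetric] mult.assoc[symmetric])
    have B: "(\<Sum>j'<m'. ?b m' j' * mode_coeff ?x i' j' (- l)) = of_int l ^ (m' - 1) / fact (m' - 1) * ?x i' powi l"
      using sum_sq_coeff_gbinomial[OF m(2), of "of_int (l - 1)"]
      by (simp add: mode_coeff_def sum_distrib_right[symmetric] mult.assoc[symmetric])
    have e: "?x i powi (- l) * ?x i' powi l = exp (- (z i - z i')) powi l"
      by (simp only: minus_diff_eq exp_diff power_int_divide_distrib power_int_minus) (simp only: divide_inverse mult.commute)
    have "(\<Sum>j<m. \<Sum>j'<m'. ?b m j * ?b m' j' * (mode_coeff ?x i j l * mode_coeff ?x i' j' (- l) * pair_weight (nome \<tau>) fst (i, j) (i', j') l)) =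
      (\<Sum>j<m. ?b m j * mode_coeff ?x i j l) * (\<Sum>j'<m'. ?b m' j' * mode_coeff ?x i' j' (- l)) * pair_weight (nome \<tau>) fst (i, 0 :: nat) (i', 0) l"
      unfolding sum_product unfolding sum_distrib_right
    proof (intro sum.cong refl)
      fix j j'
      show "?b m j * ?b m' j' * (mode_coeff ?x i j l * mode_coeff ?x i' j' (- l) * pair_weight (nome \<tau>) fst (i, j) (i', j') l) =
        ?b m j * mode_coeff ?x i j l * (?b m' j' * mode_coeff ?x i' j' (- l)) * pair_weight (nome \<tau>) fst (i, 0 :: nat) (i', 0) l"
        unfolding pw[of j j'] by (simp only: mult_ac)
    qed
    also have "\<dots> = (of_int (- l) ^ (m - 1) / fact (m - 1) * (of_int l ^ (m' - 1) / fact (m' - 1))) * (?x i powi (- l) * ?x i' powi l) *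
      pair_weight (nome \<tau>) fst (i, 0 :: nat) (i', 0) l"
      unfolding A B by (simp only: mult_ac)
    finally show "(\<Sum>j<m. \<Sum>j'<m'. ?b m j * ?b m' j' * (mode_coeff ?x i j l * mode_coeff ?x i' j' (- l) * pair_weight (nome \<tau>) fst (i, j) (i', j') l)) =
      (of_int (- l) ^ (m - 1) / fact (m - 1) * (of_int l ^ (m' - 1) / fact (m' - 1))) * exp (- (z i - z i')) powi l *
      pair_weight (nome \<tau>) fst (i, 0 :: nat) (i', 0) l" unfolding e .
  qed
  finally show ?thesis .
qed

lemma has_sum_int_split:
  fixes f :: "int \<Rightarrow> complex"
  assumes "f 0 = 0" and a: "((\<lambda>n. f (int n)) has_sum a) UNIV" and b: "((\<lambda>n. f (- int n)) has_sum b) UNIV"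
  shows "(f has_sum a + b) UNIV"
proof -
  have "(f has_sum a) {0..}"
    by (subst has_sum_reindex_bij_witness[where i = int and j = nat and S = "{0..}" and T = UNIV and h = "\<lambda>n. f (int n)"]) (use a in auto)
  moreover have "(f has_sum b) {..0}"
    by (subst has_sum_reindex_bij_witness[where i = "\<lambda>n. - int n" and j = "\<lambda>n. nat (- n)" and S = "{..0}" and T = UNIV and h = "\<lambda>n. f (- int n)"]) (use b in auto)
  then have "(f has_sum b) {..<0}"
    by (subst (asm) has_sum_cong_neutral[where T = "{..<0}"]) (use assms(1) in auto)
  ultimately have "(f has_sum a + b) ({0..} \<union> {..<0})" by (intro has_sum_Un_disjoint) auto
  moreover have "{0..} \<union> {..<0} = (UNIV :: int set)" by auto
  ultimately show ?thesis by simp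
qed

lemma neg_one_power_pred: "m \<ge> 1 \<Longrightarrow> (- 1 :: complex) ^ (m + 1) = (- 1) ^ (m - 1)"
  by (cases m) simp_all

text \<open>The terms with l > 0 and those with l < 0 each form a Lambert series. Together, up to
  sign and factorials, they are the derivative of order m + m' - 2 of \<open>ell_S\<close> in its
  strip.\<close>

lemma sq_propagator_less:
  assumes \<tau>: "Im \<tau> > 0" and z: "z \<in> trace_domain n \<tau>" and i: "i \<in> {1..n}" "i' \<in> {1..n}" "i < i'" and m: "m \<ge> 1" "m' \<ge> 1"
    and nl: "z i - z i' \<notin> lattice \<tau>"
  shows "sq_propagator (propagator (nome \<tau>) (\<lambda>i. exp (z i))) i m i' m' = DD m m' (z i - z i') \<tau>"
proof -
  let ?q = "nome \<tau>"
  note q = norm_nome_less_1[OF \<tau>]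
  define w where "w = z i - z i'"
  define K where "K = m + m' - 2"
  define C :: complex where "C = (- 1) ^ (m - 1) / (fact (m - 1) * fact (m' - 1))"
  have K: "(m - 1) + (m' - 1) = K" "m + m' = K + 2" using m by (auto simp: K_def)
  have dom: "norm (exp (- w)) < 1" "norm (?q * exp w) < 1"
  proof -
    have "norm (exp (z i')) < norm (exp (z i))" "norm ?q * norm (exp (z i)) < norm (exp (z i'))"
      using trace_domain_norms[OF z, of i i'] i by auto
    then show "norm (exp (- w)) < 1" "norm (?q * exp w) < 1"
      by (simp_all only: w_def minus_diff_eq exp_diff norm_mult norm_divide times_divide_eq_right) (simp_all add: divide_less_eq_1)
  qed
  have "((\<lambda>l. C * (of_int l ^ K * exp (- w) powi l * ordered_weight ?q l)) has_sum C * (lambert_series ?q K (exp (- w)) + (- 1) ^ K * lambert_series ?q K (?q * exp w))) UNIV"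
  proof (intro has_sum_cmult_right has_sum_int_split)
    show "((\<lambda>n. of_int (int n) ^ K * exp (- w) powi int n * ordered_weight ?q (int n)) has_sum lambert_series ?q K (exp (- w))) UNIV"
      using has_sum_lambert[OF q dom(1), of K] by (simp add: ordered_weight_def mult_ac)
    \<comment> \<open>The weight at the mode -n supplies the factor q^n that turns e^w into the
      argument \<open>?q * exp w\<close>.\<close>
    have "of_int (- int n) ^ K * exp (- w) powi (- int n) * ordered_weight ?q (- int n) =
      (- 1) ^ K * (of_nat n ^ (K + 1) / (1 - ?q ^ n) * (?q * exp w) ^ n)" for n
    proof (cases "n = 0")
      case False
      have a: "ordered_weight ?q (- int n) = of_nat n * ?q ^ n / (1 - ?q ^ n)"
        using False by (subst ordered_weight_neg[OF nome_nz q]) (simp_all add: normal_weight_def)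
      have b: "exp (- w) powi (- int n) = exp w ^ n" by (simp add: power_int_minus exp_minus power_inverse)
      have c: "(of_int (- int n) :: complex) ^ K = (- 1) ^ K * of_nat n ^ K" by (simp add: power_minus[of "of_nat n"])
      show ?thesis unfolding a b c by (simp add: power_mult_distrib)
    qed (simp add: ordered_weight_def)
    then show "((\<lambda>n. of_int (- int n) ^ K * exp (- w) powi (- int n) * ordered_weight ?q (- int n)) has_sum (- 1) ^ K * lambert_series ?q K (?q * exp w)) UNIV"
      by (simp only:) (intro has_sum_cmult_right has_sum_lambert q dom)
  qed (simp add: ordered_weight_def)
  also have "(\<lambda>l. C * (of_int l ^ K * exp (- w) powi l * ordered_weight ?q l)) =
    (\<lambda>l. (of_int (- l) ^ (m - 1) / fact (m - 1) * (of_int l ^ (m' - 1) / fact (m' - 1))) * exp (- (z i - z i')) powi l *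
      pair_weight ?q fst (i, 0 :: nat) (i', 0) l)"
  proof
    fix l
    have "(of_int (- l) :: complex) ^ (m - 1) = (- 1) ^ (m - 1) * of_int l ^ (m - 1)" by (simp add: power_minus[of "of_int l"])
    moreover have "(of_int l :: complex) ^ K = of_int l ^ (m - 1) * of_int l ^ (m' - 1)" by (simp only: K(1)[symmetric] power_add)
    ultimately show "C * (of_int l ^ K * exp (- w) powi l * ordered_weight ?q l) =
      (of_int (- l) ^ (m - 1) / fact (m - 1) * (of_int l ^ (m' - 1) / fact (m' - 1))) * exp (- (z i - z i')) powi l *
      pair_weight ?q fst (i, 0 :: nat) (i', 0) l"
      using i(3) by (simp add: C_def w_def pair_weight_def)
  qed
  finally have "sq_propagator (propagator ?q (\<lambda>i. exp (z i))) i m i' m' = C * (lambert_series ?q K (exp (- w)) + (- 1) ^ K * lambert_series ?q K (?q * exp w))"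
    using has_sum_sq_propagator[OF \<tau> z i(1,2) m] has_sum_unique by blast
  also have "\<dots> = DD m m' w \<tau>"
  proof -
    have k: "m + m' - 1 = K + 1" "K + 2 - 1 = K + 1" "K + 2 - 2 = K" using K by auto
    have P: "ell_P (m + m') w \<tau> = (- 1) ^ (K + 2) / fact (K + 1) * ((- 1) ^ K * lambert_series ?q K (exp (- w)) + lambert_series ?q K (?q * exp w))"
      unfolding K(2) using ell_P_eq[OF \<tau> _ nl[folded w_def], of "K + 2"] higher_deriv_ell_S_strip[OF q dom(2,1), of K] by simp
    have s: "(- 1 :: complex) ^ K * (- 1) ^ K = 1" by (simp flip: power_mult_distrib)
    have "(- 1 :: complex) ^ (K + 2) * ((- 1) ^ K * lambert_series ?q K (exp (- w)) + lambert_series ?q K (?q * exp w)) =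
       ((- 1) ^ K * (- 1) ^ K) * lambert_series ?q K (exp (- w)) + (- 1) ^ K * lambert_series ?q K (?q * exp w)"
      by (simp add: ring_distribs)
    then have "ell_P (m + m') w \<tau> = (lambert_series ?q K (exp (- w)) + (- 1) ^ K * lambert_series ?q K (?q * exp w)) / fact (K + 1)"
      unfolding P s by (simp add: ring_distribs add_divide_distrib)
    moreover have "(fact (K + 1) :: complex) \<noteq> 0" by (rule fact_nonzero)
    ultimately show ?thesis
      unfolding DD_def C_def neg_one_power_pred[OF m(1)] k(1) by (simp del: fact_Suc)
  qed
  finally show ?thesis by (simp add: w_def)
qed

lemma sq_propagator_sym:
  assumes "\<And>y z. S y z = S z y"
  shows "sq_propagator S i m i' m' = sq_propagator S i' m' i m"
  unfolding sq_propagator_def by (subst sum.swap) (use assms in \<open>simp add: mult_ac\<close>)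

lemma DD_sym:
  assumes \<tau>: "Im \<tau> > 0" and m: "m \<ge> 1" "m' \<ge> 1" and nl: "w \<notin> lattice \<tau>"
  shows "DD m m' w \<tau> = DD m' m (- w) \<tau>"
proof -
  have "ell_P (m' + m) (- w) \<tau> = (- 1) ^ (m + m') * ell_P (m + m') w \<tau>"
    using ell_P_minus[OF \<tau> _ nl, of "m + m'"] m by (simp add: add.commute)
  moreover have "(- 1 :: complex) ^ (m' + 1) * (- 1) ^ (m + m') = (- 1) ^ (m + 1)"
  proof -
    have "(- 1 :: complex) ^ (m' + 1) * (- 1) ^ (m + m') = (- 1) ^ (m + 1) * ((- 1) ^ m' * (- 1) ^ m')"
      by (simp add: power_add mult_ac)
    also have "(- 1 :: complex) ^ m' * (- 1) ^ m' = 1" by (simp flip: power_mult_distrib)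
    finally show ?thesis by simp
  qed
  ultimately show ?thesis unfolding DD_def by (simp add: add.commute mult.commute mult.left_commute)
qed

text \<open>For equal parts the exponential is 1, and both signs of l give the same divisor sum,
  with the signs (-1)^(m-1) and (-1)^(m'-1): the two double for m + m' even and cancel for m + m'
  odd. \<open>sq_contraction\<close> supplies the Bernoulli term in both cases.\<close>

lemma sq_propagator_same:
  assumes \<tau>: "Im \<tau> > 0" and z: "z \<in> trace_domain n \<tau>" and i: "i \<in> {1..n}" and m: "m \<ge> 1" "m' \<ge> 1"
  shows "sq_contraction m m' + sq_propagator (propagator (nome \<tau>) (\<lambda>i. exp (z i))) i m i m' = CC m m' \<tau>"
proof -
  let ?q = "nome \<tau>"
  note q = norm_nome_less_1[OF \<tau>]
  define K where "K = m + m' - 2"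
  define F :: complex where "F = fact (m - 1) * fact (m' - 1)"
  have K: "(m - 1) + (m' - 1) = K" "m + m' = K + 2" using m by (auto simp: K_def)
  have pw: "(of_int (- l) ^ (m - 1) / fact (m - 1) * (of_int l ^ (m' - 1) / fact (m' - 1))) * exp (- (z i - z i)) powi l *
      pair_weight ?q fst (i, 0 :: nat) (i, 0) l = 1 / F * (of_int (- l) ^ (m - 1) * of_int l ^ (m' - 1) * normal_weight ?q l)" for l
    by (simp add: pair_weight_def F_def)
  have "((\<lambda>l. 1 / F * (of_int (- l) ^ (m - 1) * of_int l ^ (m' - 1) * normal_weight ?q l)) has_sum
     1 / F * ((- 1) ^ (m - 1) * sigma_series ?q (K + 1) + (- 1) ^ (m' - 1) * sigma_series ?q (K + 1))) UNIV"
  proof (intro has_sum_cmult_right has_sum_int_split)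
    have base: "((\<lambda>d. of_nat d ^ (K + 1) / (1 - ?q ^ d) * ?q ^ d) has_sum sigma_series ?q (K + 1)) UNIV"
      unfolding sigma_series_def by (rule has_sum_lambert_sigma[OF q]) simp
    have p: "(of_nat d :: complex) ^ (K + 1) = of_nat d ^ (m - 1) * of_nat d ^ (m' - 1) * of_nat d" for d
      by (simp only: K(1)[symmetric] power_add power_one_right)
    have e1: "of_int (- int d) ^ (m - 1) * of_int (int d) ^ (m' - 1) * normal_weight ?q (int d) =
       (- 1) ^ (m - 1) * (of_nat d ^ (K + 1) / (1 - ?q ^ d) * ?q ^ d)" for d
      unfolding p by (simp add: normal_weight_def power_minus[of "of_nat d"])
    show "((\<lambda>d. of_int (- int d) ^ (m - 1) * of_int (int d) ^ (m' - 1) * normal_weight ?q (int d)) has_sum (- 1) ^ (m - 1) * sigma_series ?q (K + 1)) UNIV"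
      unfolding e1 by (rule has_sum_cmult_right[OF base])
    have e2: "of_int (- (- int d)) ^ (m - 1) * of_int (- int d) ^ (m' - 1) * normal_weight ?q (- int d) =
       (- 1) ^ (m' - 1) * (of_nat d ^ (K + 1) / (1 - ?q ^ d) * ?q ^ d)" for d
      unfolding p by (simp add: normal_weight_def power_minus[of "of_nat d"])
    show "((\<lambda>d. of_int (- (- int d)) ^ (m - 1) * of_int (- int d) ^ (m' - 1) * normal_weight ?q (- int d)) has_sum (- 1) ^ (m' - 1) * sigma_series ?q (K + 1)) UNIV"
      unfolding e2 by (rule has_sum_cmult_right[OF base])
  qed (simp add: normal_weight_def)
  then have same: "sq_propagator (propagator ?q (\<lambda>i. exp (z i))) i m i m' = 1 / F * ((- 1) ^ (m - 1) * sigma_series ?q (K + 1) + (- 1) ^ (m' - 1) * sigma_series ?q (K + 1))"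
    using has_sum_sq_propagator[OF \<tau> z i i m] has_sum_unique unfolding pw by blast
  have contr: "sq_contraction m m' = (- 1) ^ m * fact (K + 1) / F * fps_nth bern_fps (K + 2)"
  proof -
    have m1: "Suc (m - 1) = m" "m - 1 + 1 = m" and e: "m' - 1 + (m - 1) + 1 = K + 1" "m' - 1 + (m - 1) + 2 = K + 2" using m K by auto
    show ?thesis
      unfolding sq_contraction_def sq_contraction_eq_deriv[OF m]
      using contraction_fps_deriv[of "m - 1" "m' - 1"] unfolding m1 e F_def .
  qed
  have k: "m + m' - 1 = K + 1" "K + 2 - 1 = K + 1" using K by auto
  have CC: "CC m m' \<tau> = (- 1) ^ (m - 1) * (fact (K + 1) / F) * (- fps_nth bern_fps (K + 2) + (if even (K + 2) then 2 / fact (K + 1) * sigma_series ?q (K + 1) else 0))"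
  proof -
    have "eisen (K + 2) \<tau> = - fps_nth bern_fps (K + 2) + (if even (K + 2) then 2 / fact (K + 1) * sigma_series ?q (K + 1) else 0)"
      using eisen_eq[of "K + 2" \<tau>] unfolding k(2) by simp
    then show ?thesis by (simp only: CC_def neg_one_power_pred[OF m(1)] K(2) k(2) F_def)
  qed
  have sgn: "(- 1 :: complex) ^ m = - ((- 1) ^ (m - 1))" using m by (cases m) auto
  have f0: "(fact (K + 1) :: complex) \<noteq> 0" by (rule fact_nonzero)
  show ?thesis
  proof (cases "even (K + 2)")
    case True
    then have "even (m - 1) = even (m' - 1)" using K by presburger
    then have "(- 1 :: complex) ^ (m' - 1) = (- 1) ^ (m - 1)" by (cases "even (m - 1)") auto
    then show ?thesis unfolding same contr CC sgn using True f0
      by (simp del: fact_Suc add: algebra_simps)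
  next
    case False
    then have "even (m - 1) \<noteq> even (m' - 1)" using K by presburger
    then have "(- 1 :: complex) ^ (m' - 1) = - ((- 1) ^ (m - 1))" by (cases "even (m - 1)") auto
    then show ?thesis unfolding same contr CC sgn using False
      by (simp del: fact_Suc)
  qed
qed

subsection \<open>Fock states and labelled sets\<close>

definition label_list :: "(nat \<Rightarrow> nat) \<Rightarrow> (nat \<Rightarrow> nat \<Rightarrow> nat) \<Rightarrow> nat \<Rightarrow> labelled list" where
  "label_list p e i = concat (map (\<lambda>m. map (\<lambda>k. (i, m, k)) [0..<e i m]) [1..<Suc (p i)])"

lemma foldr_concat: "foldr f (concat xss) = foldr (\<lambda>xs. foldr f xs) xss"
  by (induction xss) (simp_all add: fun_eq_iff)

lemma foldr_map_fun: "foldr f (map g xs) = foldr (\<lambda>x. f (g x)) xs"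
  by (rule ext) (simp add: foldr_map o_def)

lemma foldr_const: "foldr (\<lambda>_. g) xs = g ^^ length xs"
  by (induction xs) simp_all

lemma sq_state_label_list: "sq_state label (label_list p e i) = fock_state (p i) (e i)"
proof -
  have "foldr (\<lambda>y. sqmode gen_a (- int (label y))) (map (\<lambda>k. (i, m, k)) [0..<e i m]) = sqmode gen_a (- int m) ^^ e i m" for m
    by (simp add: foldr_map_fun o_def label_def foldr_const)
  then have "foldr (\<lambda>y. sqmode gen_a (- int (label y))) (label_list p e i) = foldr (\<lambda>m. sqmode gen_a (- int m) ^^ e i m) [1..<Suc (p i)]"
    unfolding label_list_def foldr_concat foldr_map_fun o_def by (simp only:)
  then show ?thesis by (simp only: sq_state_def fock_state_def)
qed

lemma set_label_list: "set (concat (map (label_list p e) [1..<Suc n])) = labelled_set n p e"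
proof -
  have "set (concat (map (label_list p e) [1..<Suc n])) = (\<Union>i\<in>{1..n}. \<Union>m\<in>{1..p i}. (\<lambda>k. (i, m, k)) ` {0..<e i m})"
    by (simp add: label_list_def atLeastLessThanSuc_atLeastAtMost del: upt_Suc)
  also have "\<dots> = labelled_set n p e" by (auto simp: labelled_set_def image_iff)
  finally show ?thesis .
qed

lemma part_label_list: "y \<in> set (label_list p e i) \<Longrightarrow> part y = i"
  by (auto simp: label_list_def part_def)

lemma distinct_label_list: "distinct (label_list p e i)"
proof -
  have "distinct ms \<Longrightarrow> distinct (concat (map (\<lambda>m. map (\<lambda>k. (i, m, k)) [0..<e i m]) ms))" for ms
    by (induction ms) (auto simp: distinct_map inj_on_def)
  then show ?thesis unfolding label_list_def by (simp only: distinct_upt)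
qed

lemma distinct_label_lists: "distinct is \<Longrightarrow> distinct (concat (map (label_list p e) is))"
  by (induction "is") (auto simp: distinct_label_list dest: part_label_list)

lemma filter_label_lists:
  assumes "distinct is" "i \<in> set is"
  shows "filter (\<lambda>y. part y = i) (concat (map (label_list p e) is)) = label_list p e i"
  using assms
proof (induction "is")
  case (Cons a "is")
  have f: "filter (\<lambda>y. part y = i) (label_list p e b) = (if b = i then label_list p e b else [])" for b
    using part_label_list[of _ p e b] by (auto simp: filter_empty_conv filter_id_conv)
  have "filter (\<lambda>y. part y = i) (concat (map (label_list p e) is)) = []" if "i \<notin> set is"
    using that part_label_list[of _ p e] by (fastforce simp: filter_empty_conv)
  with Cons f show ?case by (cases "a = i") auto
qed simp

lemma wick_cong:
  assumes "\<And>i. i \<in> set is \<Longrightarrow> u i = u' i"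
  shows "wick S is u = wick S is u'"
proof -
  have P: "PiE (set is) (\<lambda>i. Poly_Mapping.keys (u i)) = PiE (set is) (\<lambda>i. Poly_Mapping.keys (u' i))"
    using assms by (intro PiE_cong) auto
  show ?thesis unfolding wick_def P using assms by (intro sum.cong refl arg_cong2[where f = "(*)"] prod.cong) auto
qed

lemma labelled_setD:
  assumes "y \<in> labelled_set n p e"
  shows "part y \<in> {1..n}" "label y \<ge> 1"
  using assms by (auto simp: labelled_set_def part_def label_def)

text \<open>Real parts of lattice points are multiples of 2 pi Im \<tau>, while those of z_a - z_b
  for a < b lie strictly between 0 and this number.\<close>

lemma trace_domain_subset_config:
  assumes \<tau>: "Im \<tau> > 0" and z: "z \<in> trace_domain n \<tau>"
  shows "z \<in> config n \<tau>"
proof -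
  have less: "z a - z b \<notin> lattice \<tau>" if ab: "a \<in> {1..n}" "b \<in> {1..n}" "a < b" for a b
  proof
    assume "z a - z b \<in> lattice \<tau>"
    then obtain l :: int where l: "Re (z a - z b) = - 2 * pi * Im \<tau> * of_int l" using Re_lattice by blast
    have "norm (exp (z b)) < norm (exp (z a))" "norm (nome \<tau>) * norm (exp (z a)) < norm (exp (z b))"
      using trace_domain_norms[OF z, of a b] ab by auto
    then have "Re (z b) < Re (z a)" "- 2 * pi * Im \<tau> + Re (z a) < Re (z b)"
      by (simp_all add: norm_nome flip: exp_add)
    define c where "c = 2 * pi * Im \<tau>"
    have c: "0 < c" unfolding c_def using \<tau> by simp
    have "Re (z a - z b) = c * - of_int l" unfolding l c_def by simp
    moreover have "Re (z a - z b) < c" "0 < Re (z a - z b)"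
      using \<open>Re (z b) < Re (z a)\<close> \<open>- 2 * pi * Im \<tau> + Re (z a) < Re (z b)\<close> unfolding c_def by simp_all
    ultimately have "c * 0 < c * - real_of_int l" "c * - real_of_int l < c * 1" by simp_all
    then have "0 < - real_of_int l" "- real_of_int l < 1"
      unfolding mult_less_cancel_left_pos[OF c] .
    then have "l < 0" "- 1 < l" by simp_all
    then show False by linarith
  qed
  show ?thesis unfolding config_iff
  proof (intro ballI impI)
    fix a b assume ab: "a \<in> {1..n}" "b \<in> {1..n}" "a \<noteq> b"
    show "z a - z b \<notin> lattice \<tau>"
      using less[of a b] less[of b a] lattice_uminus[of "z a - z b" \<tau>] ab by (cases "a < b") auto
  qed
qed

text \<open>Within one part the signs differ only if the sum of the labels is odd, where
  \<open>eisen\<close> vanishes. For different parts the sign is compensated by the parity of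
  \<open>ell_P\<close>.\<close>

lemma gamma_pair_sym:
  assumes \<tau>: "Im \<tau> > 0" and z: "z \<in> config n \<tau>" and xy: "x \<in> labelled_set n p e" "y \<in> labelled_set n p e"
  shows "gamma_pair z \<tau> x y = gamma_pair z \<tau> y x"
proof (cases "part x = part y")
  case True
  have "(- 1 :: complex) ^ (label x + 1) * eisen (label x + label y) \<tau> = (- 1) ^ (label y + 1) * eisen (label x + label y) \<tau>"
  proof (cases "even (label x + label y)")
    case True
    then have "(- 1 :: complex) ^ (label x + 1) = (- 1) ^ (label y + 1)" by (cases "even (label x)") auto
    then show ?thesis by simp
  qed (simp add: eisen_def)
  then have "CC (label x) (label y) \<tau> = CC (label y) (label x) \<tau>"
    unfolding CC_def by (simp add: add.commute mult.commute mult.left_commute)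
  with True show ?thesis by (simp add: gamma_pair_def)
next
  case False
  have "z (part x) - z (part y) \<notin> lattice \<tau>"
    by (rule z[unfolded config_iff, rule_format]) (use labelled_setD[OF xy(1)] labelled_setD[OF xy(2)] False in auto)
  from DD_sym[OF \<tau> _ _ this] labelled_setD[OF xy(1)] labelled_setD[OF xy(2)] False
  show ?thesis by (simp add: gamma_pair_def)
qed

text \<open>The choice depends on the orbit alone, so one pair (a, b) serves for all z at once. This
  gives meromorphy also through points outside \<open>config\<close>, where
  \<open>gamma_pair_sym\<close> does not apply.\<close>

lemma gamma_orbit_choice:
  "\<exists>a b. {x, y} = {a, b} \<and> (\<forall>z \<tau>. gamma_orbit z \<tau> {x, y} = gamma_pair z \<tau> a b)"
proof -
  obtain a b where ab: "(SOME (a, b). {x, y} = {a, b}) = (a, b)" by (metis surj_pair)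
  have "(\<lambda>(a, b). {x, y} = {a, b}) (SOME (a, b). {x, y} = {a, b})" by (rule someI[of _ "(x, y)"]) simp
  then have "{x, y} = {a, b}" unfolding ab by simp
  show ?thesis
  proof (intro exI conjI allI)
    show "{x, y} = {a, b}" by fact
    show "gamma_orbit z \<tau> {x, y} = gamma_pair z \<tau> a b" for z \<tau> by (simp only: gamma_orbit_def ab prod.case)
  qed
qed

lemma gamma_orbit_eq:
  assumes "Im \<tau> > 0" "z \<in> config n \<tau>" "x \<in> labelled_set n p e" "y \<in> labelled_set n p e"
  shows "gamma_orbit z \<tau> {x, y} = gamma_pair z \<tau> x y"
proof -
  obtain a b where "{x, y} = {a, b}" "gamma_orbit z \<tau> {x, y} = gamma_pair z \<tau> a b" using gamma_orbit_choice by metis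
  then show ?thesis using gamma_pair_sym[OF assms] by (auto simp: doubleton_eq_iff)
qed

definition pairing_function :: "nat \<Rightarrow> (nat \<Rightarrow> nat) \<Rightarrow> (nat \<Rightarrow> nat \<Rightarrow> nat) \<Rightarrow> complex \<Rightarrow> (nat \<Rightarrow> complex) \<Rightarrow> complex" where
  "pairing_function n p e \<tau> z = 1 / dedekind_eta \<tau> *
     (\<Sum>\<phi>\<in>fpf_involutions (labelled_set n p e). Gamma_inv (labelled_set n p e) z \<tau> \<phi>)"

lemma wick_fock_states:
  assumes \<tau>: "Im \<tau> > 0" and z: "z \<in> trace_domain n \<tau>"
  shows "wick (propagator (nome \<tau>) (\<lambda>i. exp (z i))) [1..<Suc n] (\<lambda>i. fock_state (p i) (e i)) =
    (\<Sum>\<phi>\<in>fpf_involutions (labelled_set n p e). Gamma_inv (labelled_set n p e) z \<tau> \<phi>)"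
proof -
  let ?is = "[1..<Suc n]" and ?S = "propagator (nome \<tau>) (\<lambda>i. exp (z i))"
  let ?L = "concat (map (label_list p e) ?is)"
  let ?\<gamma> = "\<lambda>y y'. (if part y = part y' then sq_contraction (label y) (label y') else 0) + sq_propagator ?S (part y) (label y) (part y') (label y')"
  note zc = trace_domain_subset_config[OF \<tau> z]
  have dist: "distinct ?L" by (rule distinct_label_lists) simp
  have setL: "set ?L = labelled_set n p e" by (rule set_label_list)
  have "wick ?S ?is (\<lambda>i. fock_state (p i) (e i)) = wick ?S ?is (\<lambda>i. sq_state label (filter (\<lambda>y. part y = i) ?L))"
  proof (rule wick_cong)
    fix i assume "i \<in> set ?is"
    then have "filter (\<lambda>y. part y = i) ?L = label_list p e i" by (intro filter_label_lists) simp_all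
    then show "fock_state (p i) (e i) = sq_state label (filter (\<lambda>y. part y = i) ?L)" by (simp only: sq_state_label_list)
  qed
  also have "\<dots> = hafnian ?\<gamma> ?L"
  proof (rule wick_sq_state[OF distinct_upt propagator_sym dist])
    show "part ` set ?L \<subseteq> set ?is" unfolding setL using labelled_setD(1) by fastforce
  qed
  also have "\<dots> = hafnian (gamma_pair z \<tau>) ?L"
  proof (rule hafnian_cong)
    fix y y' assume "y \<in> set ?L" "y' \<in> set ?L"
    then have y: "y \<in> labelled_set n p e" "y' \<in> labelled_set n p e" by (simp_all only: setL)
    note D = labelled_setD[OF y(1)] labelled_setD[OF y(2)]
    consider "part y = part y'" | "part y < part y'" | "part y' < part y" by linarith
    then show "?\<gamma> y y' = gamma_pair z \<tau> y y'"
    proof cases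
      case 1
      then show ?thesis using sq_propagator_same[OF \<tau> z D(1,2,4)] by (simp add: gamma_pair_def)
    next
      case 2
      have "z (part y) - z (part y') \<notin> lattice \<tau>"
        by (rule zc[unfolded config_iff, rule_format]) (use D 2 in auto)
      then show ?thesis using sq_propagator_less[OF \<tau> z D(1,3) 2 D(2,4)] 2 by (simp add: gamma_pair_def)
    next
      case 3
      \<comment> \<open>\<open>sq_propagator_less\<close> treats increasing parts; the opposite
        order follows from the symmetry of both sides.\<close>
      have nl: "z (part y') - z (part y) \<notin> lattice \<tau>"
        by (rule zc[unfolded config_iff, rule_format]) (use D 3 in auto)
      have "?\<gamma> y y' = sq_propagator ?S (part y') (label y') (part y) (label y)"
        using 3 sq_propagator_sym[OF propagator_sym] by simp
      also have "\<dots> = DD (label y') (label y) (z (part y') - z (part y)) \<tau>"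
        by (rule sq_propagator_less[OF \<tau> z D(3,1) 3 D(4,2) nl])
      also have "\<dots> = gamma_pair z \<tau> y' y" using 3 by (simp add: gamma_pair_def)
      also have "\<dots> = gamma_pair z \<tau> y y'" by (rule gamma_pair_sym[OF \<tau> zc y(2,1)])
      finally show ?thesis .
    qed
  qed
  also have "\<dots> = (\<Sum>\<phi>\<in>fpf_involutions (set ?L). \<Prod>\<Xi>\<in>(\<lambda>x. {x, \<phi> x}) ` set ?L. gamma_orbit z \<tau> \<Xi>)"
    by (rule hafnian_fpf_involutions[symmetric, where X = "labelled_set n p e"])
       (use gamma_orbit_eq[OF \<tau> zc] dist setL in \<open>simp_all only: order_refl\<close>)
  finally show ?thesis unfolding setL Gamma_inv_def .
qed

subsection \<open>Analytic properties of the pairing sum\<close>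

lemma coordinate_analytic: "(\<lambda>w. (z(i := w)) c :: complex) analytic_on A"
  by (cases "c = i") auto

text \<open>In each variable \<open>gamma_pair\<close> is a constant or a multiple of
  \<open>ell_P\<close> at a difference of coordinates, and on \<open>config\<close> this difference
  avoids the lattice.\<close>

lemma gamma_pair_properties:
  assumes \<tau>: "Im \<tau> > 0" and ab: "a \<in> labelled_set n p e" "b \<in> labelled_set n p e"
  shows "continuous_on (config n \<tau>) (\<lambda>z. gamma_pair z \<tau> a b)"
    "\<And>z i. z \<in> config n \<tau> \<Longrightarrow> (\<lambda>w. gamma_pair (z(i := w)) \<tau> a b) holomorphic_on {w. z(i := w) \<in> config n \<tau>}"
    "\<And>z i. (\<lambda>w. gamma_pair (z(i := w)) \<tau> a b) meromorphic_on UNIV"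
proof -
  note D = labelled_setD[OF ab(1)] labelled_setD[OF ab(2)]
  let ?k = "label a + label b"
  have k: "?k \<ge> 2" using D by linarith
  have nl: "z (part a) - z (part b) \<notin> lattice \<tau>" if "z \<in> config n \<tau>" "part a \<noteq> part b" for z
    by (rule that(1)[unfolded config_iff, rule_format]) (use D that in auto)
  have hol: "(\<lambda>w. ell_P ?k w \<tau>) holomorphic_on - lattice \<tau>"
    using ell_P_analytic[OF \<tau> k] by (intro analytic_imp_holomorphic) (use analytic_on_analytic_at in blast)
  show "continuous_on (config n \<tau>) (\<lambda>z. gamma_pair z \<tau> a b)"
  proof (cases "part a = part b")
    case False
    have "continuous_on (config n \<tau>) (\<lambda>z. ell_P ?k (z (part a) - z (part b)) \<tau>)"
    proof (rule continuous_on_compose2[OF holomorphic_on_imp_continuous_on[OF hol]])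
      show "continuous_on (config n \<tau>) (\<lambda>z. z (part a) - z (part b))"
        by (intro continuous_on_diff continuous_on_subset[OF continuous_on_product_coordinates]) auto
    qed (use nl False in auto)
    with False show ?thesis unfolding gamma_pair_def DD_def
      by (simp only: if_False) (intro continuous_on_mult continuous_on_const)
  qed (simp add: gamma_pair_def)
  fix z :: "nat \<Rightarrow> complex" and i
  have an: "(\<lambda>w. (z(i := w)) (part a) - (z(i := w)) (part b)) analytic_on A" for A
    by (intro analytic_on_diff coordinate_analytic)
  show "(\<lambda>w. gamma_pair (z(i := w)) \<tau> a b) meromorphic_on UNIV"
  proof (cases "part a = part b")
    case False
    have "(\<lambda>w. ell_P ?k ((z(i := w)) (part a) - (z(i := w)) (part b)) \<tau>) meromorphic_on UNIV"
      by (rule meromorphic_on_compose[OF ell_P_meromorphic[OF \<tau> k] an]) auto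
    with False show ?thesis unfolding gamma_pair_def DD_def
      by (simp only: if_False) (intro meromorphic_on_mult meromorphic_on_const)
  qed (simp add: gamma_pair_def meromorphic_on_const)
  assume z: "z \<in> config n \<tau>"
  show "(\<lambda>w. gamma_pair (z(i := w)) \<tau> a b) holomorphic_on {w. z(i := w) \<in> config n \<tau>}"
  proof (cases "part a = part b")
    case False
    have "(\<lambda>w. ell_P ?k ((z(i := w)) (part a) - (z(i := w)) (part b)) \<tau>) holomorphic_on {w. z(i := w) \<in> config n \<tau>}"
      by (rule holomorphic_on_compose_gen[OF analytic_imp_holomorphic[OF an] hol, unfolded o_def])
         (use nl False in blast)
    with False show ?thesis unfolding gamma_pair_def DD_def
      by (simp only: if_False) (intro holomorphic_on_mult holomorphic_on_const)
  qed (simp add: gamma_pair_def)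
qed

lemma is_npoint_function_pairing_function:
  assumes n: "1 \<le> n" and \<tau>: "Im \<tau> > 0"
  shows "is_npoint_function n (\<lambda>i. fock_state (p i) (e i)) \<tau> (pairing_function n p e \<tau>)"
proof -
  let ?A = "labelled_set n p e"
  have orbit: "\<exists>a\<in>?A. \<exists>b\<in>?A. \<forall>z. gamma_orbit z \<tau> \<Xi> = gamma_pair z \<tau> a b"
    if "\<phi> \<in> fpf_involutions ?A" "\<Xi> \<in> (\<lambda>x. {x, \<phi> x}) ` ?A" for \<phi> \<Xi>
  proof -
    from that(2) obtain x where x: "x \<in> ?A" "\<Xi> = {x, \<phi> x}" by blast
    have "\<phi> x \<in> ?A" by (rule fpf_involutionsD(2)[OF that(1) x(1)])
    moreover obtain a b where "{x, \<phi> x} = {a, b}" "\<forall>z \<tau>. gamma_orbit z \<tau> {x, \<phi> x} = gamma_pair z \<tau> a b"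
      using gamma_orbit_choice by blast
    ultimately show ?thesis using x by (metis doubleton_eq_iff)
  qed
  have props: "continuous_on (config n \<tau>) (\<lambda>z. gamma_orbit z \<tau> \<Xi>)"
    "\<And>z i. z \<in> config n \<tau> \<Longrightarrow> (\<lambda>w. gamma_orbit (z(i := w)) \<tau> \<Xi>) holomorphic_on {w. z(i := w) \<in> config n \<tau>}"
    "\<And>z i. (\<lambda>w. gamma_orbit (z(i := w)) \<tau> \<Xi>) meromorphic_on UNIV"
    if "\<phi> \<in> fpf_involutions ?A" "\<Xi> \<in> (\<lambda>x. {x, \<phi> x}) ` ?A" for \<phi> \<Xi>
  proof -
    from orbit[OF that] obtain a b where ab: "a \<in> ?A" "b \<in> ?A" "\<And>z. gamma_orbit z \<tau> \<Xi> = gamma_pair z \<tau> a b"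
      by blast
    note P = gamma_pair_properties[OF \<tau> ab(1,2)]
    show "continuous_on (config n \<tau>) (\<lambda>z. gamma_orbit z \<tau> \<Xi>)" unfolding ab(3) by (rule P(1))
    show "(\<lambda>w. gamma_orbit (z(i := w)) \<tau> \<Xi>) holomorphic_on {w. z(i := w) \<in> config n \<tau>}" if "z \<in> config n \<tau>" for z i
      unfolding ab(3) by (rule P(2)[OF that])
    show "(\<lambda>w. gamma_orbit (z(i := w)) \<tau> \<Xi>) meromorphic_on UNIV" for z i
      unfolding ab(3) by (rule P(3))
  qed
  show ?thesis
    unfolding is_npoint_function_def
  proof (intro conjI ballI)
    fix z assume z: "z \<in> trace_domain n \<tau>"
    show "((\<lambda>(ms, b). trace_term n (\<lambda>i. fock_state (p i) (e i)) \<tau> z ms b) has_sum pairing_function n p e \<tau> z) (({1..n} \<rightarrow>\<^sub>E UNIV) \<times> UNIV)"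
      using has_sum_trace_term[OF n \<tau> z, of "\<lambda>i. fock_state (p i) (e i)"]
      unfolding wick_fock_states[OF \<tau> z] pairing_function_def .
  next
    show "continuous_on (config n \<tau>) (pairing_function n p e \<tau>)"
      unfolding pairing_function_def[abs_def] Gamma_inv_def
      by (intro continuous_on_mult continuous_on_const continuous_on_sum continuous_on_prod props(1))
  next
    fix z i assume z: "z \<in> config n \<tau>"
    show "(\<lambda>w. pairing_function n p e \<tau> (z(i := w))) holomorphic_on {w. z(i := w) \<in> config n \<tau>}"
      unfolding pairing_function_def Gamma_inv_def
      by (intro holomorphic_on_mult holomorphic_on_const holomorphic_on_sum holomorphic_on_prod props(2) z)
    show "(\<lambda>w. pairing_function n p e \<tau> (z(i := w))) meromorphic_on UNIV"
      unfolding pairing_function_def Gamma_inv_def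
      by (intro meromorphic_on_mult meromorphic_on_const meromorphic_on_sum meromorphic_on_prod props(3))
  qed
qed

theorem corollary3p4:
  fixes n :: nat and p :: "nat \<Rightarrow> nat" and e :: "nat \<Rightarrow> nat \<Rightarrow> nat"
    and z :: "nat \<Rightarrow> complex" and \<tau> :: complex
  assumes "1 \<le> n" and "Im \<tau> > 0" and "z \<in> config n \<tau>"
  shows "npoint_function n (\<lambda>i. fock_state (p i) (e i)) z \<tau> =
           1 / dedekind_eta \<tau> *
           (\<Sum>\<phi>\<in>fpf_involutions (labelled_set n p e). Gamma_inv (labelled_set n p e) z \<tau> \<phi>)"
  using npoint_function_eqI[OF assms(1,2) is_npoint_function_pairing_function[OF assms(1,2)] assms(3)]
  by (simp add: pairing_function_def)

end
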